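(* Let $k\ge2$ and $\alpha\in[0,1)$, suppose $g\in\mathcal M_{\mathrm{weak}}^{k,\alpha;2}$, and let $\bar g=\rho^2 g$. Then the following are equivalent: (1) $|d\rho|^2_{\bar g}-1-\dfrac{2}{n+1}\rho\,\Delta_{\bar g}\rho\in C^{k-1,\alpha}_2(M)$; (2) $|d\rho|^2_{\bar g}-1-\dfrac{2}{n+1}\rho\,\Delta_{\bar g}\rho=O(\rho^2)$ as $\rho\to0$; (3) $\mathrm R[g]+n(n+1)\in C^{k-2,\alpha}_2(M)$; (4) $\mathrm R[g]+n(n+1)=O(\rho^2)$ as $\rho\to0$.
   Context: Setting. $\bar M$ is a smooth compact $(n+1)$-dimensional manifold with boundary $\partial M$ ($n\ge1$), $M$ is its interior, and $\rho:\bar M\to[0,\infty)$ is a fixed smooth defining function, i.e. $\rho^{-1}(0)=\partial M$ and $d\rho\ne0$ on $\partial M$. $\Delta_{\bar g}=\mathrm{tr}_{\bar g}\mathrm{Hess}_{\bar g}$; $\mathrm R[g]$ is the scalar curvature. Function spaces. Identify a collar neighborhood of $\partial M$ in $\bar M$ with $\partial M\times[0,\rho_* )$ so that $\rho$ is the last coordinate. Fix finitely many charts $(U,\theta)$ covering $\partial M$, each extending smoothly to a chart containing $\bar U$; then $\Theta=(\theta,\rho)$ on $U\times[0,\rho_* )$ are called background coordinates. Let $\mathbb H=\{(x,y)\in\mathbb R^n\times(0,\infty)\}$ with hyperbolic metric $\breve g=y^{-2}(|dx|^2+dy^2)$ and let $B_r$ be the $\breve g$-ball of radius $r$ about $(0,1)$.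 For $p_0\in M$ with background coordinates $(\theta_0,\rho_0)$, the Möbius parametrization $\Phi:B_2\to M$ centered at $p_0$ is $\Phi(x,y)=(\theta_0+\rho_0x,\rho_0y)$. Fix a countable family $\Phi_i:B_2\to M$ consisting of such maps together with finitely many smooth parametrizations covering the (compact) rest of $M$, such that $\{\Phi_i(B_1)\}$ covers $M$ and $\{\Phi_i(B_2)\}$ is uniformly locally finite. For $k\in\mathbb N_0$, $\alpha\in[0,1)$, $\delta\in\mathbb R$, $C^{k,\alpha}(M)$ is the space of tensor fields $u$ with $\|u\|_{C^{k,\alpha}(M)}=\sup_i\|\Phi_i^*u\|_{C^{k,\alpha}(B_2)}<\infty$ (with $C^{k,0}=C^k$), and $C^{k,\alpha}_\delta(M)=\rho^\delta C^{k,\alpha}(M)$ with norm $\|\rho^{-\delta}u\|_{C^{k,\alpha}(M)}$. The class $\mathcal M_{\mathrm{weak}}^{k,\alpha;2}$ is the set of Riemannian metrics $g$ on $M$ such that $\bar g=\rho^2g$ extends continuously to a nondegenerate metric on $\bar M$; $\bar g\in C^{k,\alpha}_2(M)$, $\mathcal L_{X_1}\bar g\in C^{k-1,\alpha}_2(M)$ and $\mathcal L_{X_1}\mathcal L_{X_2}\bar g\in C^{k-2,\alpha}_2(M)$ for all smooth vector fields $X_1,X_2$ on $\bar M$; and the curvature operator $\mathrm{Riem}[g]:\Lambda^2(TM)\to\Lambda^2(TM)$ (with sign such that constant sectional curvature $\kappa$ corresponds to $\kappa\,\mathrm{Id}$) tends to $-\mathrm{Id}$ as $\rho\to0$ (equivalently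 $|d\rho|_{\bar g}=1$ on $\partial M$). *)

theory Defs
  imports "HOL-Analysis.Analysis" "HOL-Library.Landau_Symbols"
begin

section \<open>Differentiability classes in coordinates\<close>

definition partial_deriv :: "'v::euclidean_space \<Rightarrow> ('v \<Rightarrow> 'w::real_normed_vector) \<Rightarrow> 'v \<Rightarrow> 'w" where
  "partial_deriv b f x = frechet_derivative f (at x) b"

fun iter_deriv :: "'v::euclidean_space list \<Rightarrow> ('v \<Rightarrow> 'w::real_normed_vector) \<Rightarrow> 'v \<Rightarrow> 'w" where
  "iter_deriv [] f = f"
| "iter_deriv (b # bs) f = partial_deriv b (iter_deriv bs f)"

text \<open>For open sets only.\<close>

definition Ck_on :: "nat \<Rightarrow> 'v::euclidean_space set \<Rightarrow> ('v \<Rightarrow> 'w::real_normed_vector) \<Rightarrow> bool" where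
  "Ck_on k S f \<longleftrightarrow> (\<forall>bs. set bs \<subseteq> Basis \<longrightarrow>
     (length bs < k \<longrightarrow> iter_deriv bs f differentiable_on S) \<and>
     (length bs \<le> k \<longrightarrow> continuous_on S (iter_deriv bs f)))"

text \<open>Smoothness on an arbitrary set (here: relatively open subsets of a half-space) means
  local extendability to smooth functions on open sets.\<close>

definition smooth_on :: "'v::euclidean_space set \<Rightarrow> ('v \<Rightarrow> 'w::real_normed_vector) \<Rightarrow> bool" where
  "smooth_on S f \<longleftrightarrow> (\<forall>x\<in>S. \<exists>W F. open W \<and> x \<in> W \<and> (\<forall>k. Ck_on k W F) \<and> (\<forall>y\<in>W \<inter> S. F y = f y))"

text \<open>The value is \<open>top\<close> unless \<open>f\<close> is of class \<open>C\<^sup>k\<close>; the case \<open>\<alpha> = 0\<close> is the \<open>C\<^sup>k\<close> norm.\<close>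

definition hoelder_norm ::
  "nat \<Rightarrow> real \<Rightarrow> 'v::euclidean_space set \<Rightarrow> ('v \<Rightarrow> real) \<Rightarrow> ennreal" where
  "hoelder_norm k \<alpha> S f =
     (if Ck_on k S f then
        (SUP bs\<in>{bs. set bs \<subseteq> Basis \<and> length bs \<le> k}. SUP x\<in>S. ennreal \<bar>iter_deriv bs f x\<bar>) +
        (if \<alpha> = 0 then 0 else
          (SUP bs\<in>{bs. set bs \<subseteq> Basis \<and> length bs = k}. SUP x\<in>S. SUP y\<in>S - {x}.
             ennreal (\<bar>iter_deriv bs f x - iter_deriv bs f y\<bar> / dist x y powr \<alpha>)))
      else top)"


section \<open>Smooth manifolds with boundary\<close>

text \<open>A chart is a pair of its domain and a map, the latter being irrelevant off the domain.
  The set \<open>H\<close> is the model space: a closed half-space or \<open>UNIV\<close>.\<close>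

type_synonym ('m, 'v) chart = "'m set \<times> ('m \<Rightarrow> 'v)"

definition halfspace :: "('e::euclidean_space \<times> real) set" where
  "halfspace = {z. snd z \<ge> 0}"

definition chart_inv :: "('m, 'v) chart \<Rightarrow> 'v \<Rightarrow> 'm" where
  "chart_inv c = inv_into (fst c) (snd c)"

definition chart_image :: "('m, 'v) chart \<Rightarrow> 'v set" where
  "chart_image c = snd c ` fst c"

definition is_chart :: "'m topology \<Rightarrow> 'v::euclidean_space set \<Rightarrow> ('m, 'v) chart \<Rightarrow> bool" where
  "is_chart T H c \<longleftrightarrow> openin T (fst c) \<and> openin (top_of_set H) (chart_image c) \<and>
     homeomorphic_map (subtopology T (fst c)) (top_of_set (chart_image c)) (snd c)"

definition overlap :: "('m, 'v) chart \<Rightarrow> ('m, 'v) chart \<Rightarrow> 'v set" where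
  "overlap c d = snd c ` (fst c \<inter> fst d)"

definition transition :: "('m, 'v) chart \<Rightarrow> ('m, 'v) chart \<Rightarrow> 'v \<Rightarrow> 'v" where
  "transition c d = snd d \<circ> chart_inv c"

definition compatible :: "('m, 'v::euclidean_space) chart \<Rightarrow> ('m, 'v) chart \<Rightarrow> bool" where
  "compatible c d \<longleftrightarrow> smooth_on (overlap c d) (transition c d) \<and> smooth_on (overlap d c) (transition d c)"

text \<open>\<open>\<A>\<close> is a maximal smooth atlas.\<close>

definition smooth_structure ::
  "'m topology \<Rightarrow> 'v::euclidean_space set \<Rightarrow> ('m, 'v) chart set \<Rightarrow> bool" where
  "smooth_structure T H \<A> \<longleftrightarrow>
     (\<Union>c\<in>\<A>. fst c) = topspace T \<and>
     (\<forall>c\<in>\<A>. is_chart T H c) \<and>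
     (\<forall>c\<in>\<A>. \<forall>d\<in>\<A>. compatible c d) \<and>
     (\<forall>c. is_chart T H c \<longrightarrow> (\<forall>d\<in>\<A>. compatible c d) \<longrightarrow> c \<in> \<A>)"

definition bdry :: "('m, 'e::euclidean_space \<times> real) chart set \<Rightarrow> 'm set" where
  "bdry \<A> = {p. \<exists>c\<in>\<A>. p \<in> fst c \<and> snd (snd c p) = 0}"

definition minterior :: "'m topology \<Rightarrow> ('m, 'e::euclidean_space \<times> real) chart set \<Rightarrow> 'm set" where
  "minterior T \<A> = topspace T - bdry \<A>"

text \<open>The maximal atlas of the boundary.\<close>

definition bdry_charts ::
  "'m topology \<Rightarrow> ('m, 'e::euclidean_space \<times> real) chart set \<Rightarrow> ('m, 'e) chart set" where
  "bdry_charts T \<A> = {b. is_chart (subtopology T (bdry \<A>)) UNIV b \<and>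
     (\<forall>c\<in>\<A>. compatible b (fst c \<inter> bdry \<A>, fst \<circ> snd c))}"

definition transition_deriv ::
  "('m, 'v::euclidean_space) chart \<Rightarrow> ('m, 'v) chart \<Rightarrow> 'm \<Rightarrow> 'v \<Rightarrow> 'v" where
  "transition_deriv c d p = frechet_derivative (transition c d) (at (snd c p) within overlap c d)"

definition chart_at :: "('m, 'v) chart set \<Rightarrow> 'm \<Rightarrow> ('m, 'v) chart" where
  "chart_at \<A> p = (SOME c. c \<in> \<A> \<and> p \<in> fst c)"

definition defining_function ::
  "'m topology \<Rightarrow> ('m, 'e::euclidean_space \<times> real) chart set \<Rightarrow> ('m \<Rightarrow> real) \<Rightarrow> bool" where
  "defining_function T \<A> \<rho> \<longleftrightarrow>
     (\<forall>p\<in>topspace T. \<rho> p \<ge> 0) \<and>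
     (\<forall>c\<in>\<A>. smooth_on (chart_image c) (\<rho> \<circ> chart_inv c)) \<and>
     {p\<in>topspace T. \<rho> p = 0} = bdry \<A> \<and>
     (\<forall>p\<in>bdry \<A>. \<forall>c\<in>\<A>. p \<in> fst c \<longrightarrow>
        frechet_derivative (\<rho> \<circ> chart_inv c) (at (snd c p) within chart_image c) \<noteq> (\<lambda>_. 0))"


section \<open>Tensor fields\<close>

text \<open>Vector fields and covariant 2-tensor fields are families of coordinate representations,
  one for each chart of the maximal atlas, subject to the usual transformation law.\<close>

type_synonym ('m, 'v) vfield = "('m, 'v) chart \<Rightarrow> 'm \<Rightarrow> 'v"
type_synonym ('m, 'v) tensor2 = "('m, 'v) chart \<Rightarrow> 'm \<Rightarrow> 'v \<Rightarrow> 'v \<Rightarrow> real"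

definition smooth_vfield :: "('m, 'v::euclidean_space) chart set \<Rightarrow> ('m, 'v) vfield \<Rightarrow> bool" where
  "smooth_vfield \<A> X \<longleftrightarrow>
     (\<forall>c\<in>\<A>. smooth_on (chart_image c) (\<lambda>x. X c (chart_inv c x))) \<and>
     (\<forall>c\<in>\<A>. \<forall>d\<in>\<A>. \<forall>p\<in>fst c \<inter> fst d. X d p = transition_deriv c d p (X c p))"

definition tensor2_field ::
  "('m, 'v::euclidean_space) chart set \<Rightarrow> 'm set \<Rightarrow> ('m, 'v) tensor2 \<Rightarrow> bool" where
  "tensor2_field \<A> S h \<longleftrightarrow>
     (\<forall>c\<in>\<A>. \<forall>p\<in>fst c \<inter> S. bilinear (h c p)) \<and>
     (\<forall>c\<in>\<A>. \<forall>d\<in>\<A>. \<forall>p\<in>fst c \<inter> fst d \<inter> S. \<forall>u v.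
        h c p u v = h d p (transition_deriv c d p u) (transition_deriv c d p v))"

definition riemannian_metric ::
  "('m, 'v::euclidean_space) chart set \<Rightarrow> 'm set \<Rightarrow> ('m, 'v) tensor2 \<Rightarrow> bool" where
  "riemannian_metric \<A> S g \<longleftrightarrow> tensor2_field \<A> S g \<and>
     (\<forall>c\<in>\<A>. \<forall>p\<in>fst c \<inter> S. (\<forall>u v. g c p u v = g c p v u) \<and> (\<forall>u. u \<noteq> 0 \<longrightarrow> g c p u u > 0))"

definition continuous_tensor2 ::
  "('m, 'v::euclidean_space) chart set \<Rightarrow> ('m, 'v) tensor2 \<Rightarrow> bool" where
  "continuous_tensor2 \<A> h \<longleftrightarrow>
     (\<forall>c\<in>\<A>. \<forall>u v. continuous_on (chart_image c) (\<lambda>x. h c (chart_inv c x) u v))"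

definition scale_tensor2 :: "('m \<Rightarrow> real) \<Rightarrow> ('m, 'v) tensor2 \<Rightarrow> ('m, 'v) tensor2" where
  "scale_tensor2 f h = (\<lambda>c p u v. f p * h c p u v)"

definition in_coords :: "('m, 'v) chart \<Rightarrow> ('m, 'v) tensor2 \<Rightarrow> 'v \<Rightarrow> 'v \<Rightarrow> 'v \<Rightarrow> real" where
  "in_coords c h x = h c (chart_inv c x)"

text \<open>In coordinates, \<open>(\<L>\<^sub>X h)\<^sub>i\<^sub>j = X\<^sup>k \<partial>\<^sub>k h\<^sub>i\<^sub>j + h\<^sub>k\<^sub>j \<partial>\<^sub>i X\<^sup>k + h\<^sub>i\<^sub>k \<partial>\<^sub>j X\<^sup>k\<close>
  (only meaningful in the interior).\<close>

definition lie_deriv :: "('m, 'v::euclidean_space) vfield \<Rightarrow> ('m, 'v) tensor2 \<Rightarrow> ('m, 'v) tensor2" where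
  "lie_deriv X h = (\<lambda>c p u v.
     (let DX = frechet_derivative (\<lambda>x. X c (chart_inv c x)) (at (snd c p)) in
        frechet_derivative (\<lambda>x. in_coords c h x u v) (at (snd c p)) (X c p) +
        h c p (DX u) v + h c p u (DX v)))"


section \<open>Riemannian geometry in coordinates\<close>

text \<open>\<open>G x u v\<close> is the metric at the point \<open>x\<close> of coordinate space.\<close>

type_synonym 'v lmetric = "'v \<Rightarrow> 'v \<Rightarrow> 'v \<Rightarrow> real"

definition sharp :: "('v::euclidean_space \<Rightarrow> 'v \<Rightarrow> real) \<Rightarrow> ('v \<Rightarrow> real) \<Rightarrow> 'v" where
  "sharp B l = (THE w. \<forall>v. B w v = l v)"

definition metric_trace ::
  "('v::euclidean_space \<Rightarrow> 'v \<Rightarrow> real) \<Rightarrow> ('v \<Rightarrow> 'v \<Rightarrow> real) \<Rightarrow> real" where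
  "metric_trace B h = (\<Sum>b\<in>Basis. b \<bullet> sharp B (h b))"

definition metric_deriv :: "('v::euclidean_space) lmetric \<Rightarrow> 'v \<Rightarrow> 'v \<Rightarrow> 'v \<Rightarrow> 'v \<Rightarrow> real" where
  "metric_deriv G x w u v = frechet_derivative (\<lambda>y. G y u v) (at x) w"

text \<open>\<open>u\<^sup>i v\<^sup>j \<Gamma>\<^sup>k\<^sub>i\<^sub>j\<close> as a vector.\<close>

definition christoffel :: "('v::euclidean_space) lmetric \<Rightarrow> 'v \<Rightarrow> 'v \<Rightarrow> 'v \<Rightarrow> 'v" where
  "christoffel G x u v = sharp (G x)
     (\<lambda>w. (metric_deriv G x u v w + metric_deriv G x v u w - metric_deriv G x w u v) / 2)"

text \<open>\<open>R(u,v)w = \<nabla>\<^sub>u\<nabla>\<^sub>v w - \<nabla>\<^sub>v\<nabla>\<^sub>u w\<close> for constant coordinate fields; for constant sectional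
  curvature \<open>\<kappa>\<close> this is \<open>\<kappa>(\<langle>v,w\<rangle>u - \<langle>u,w\<rangle>v)\<close>.\<close>

definition curvature :: "('v::euclidean_space) lmetric \<Rightarrow> 'v \<Rightarrow> 'v \<Rightarrow> 'v \<Rightarrow> 'v \<Rightarrow> 'v" where
  "curvature G x u v w =
     frechet_derivative (\<lambda>y. christoffel G y v w) (at x) u -
     frechet_derivative (\<lambda>y. christoffel G y u w) (at x) v +
     christoffel G x u (christoffel G x v w) - christoffel G x v (christoffel G x u w)"

definition ricci :: "('v::euclidean_space) lmetric \<Rightarrow> 'v \<Rightarrow> 'v \<Rightarrow> 'v \<Rightarrow> real" where
  "ricci G x v w = (\<Sum>b\<in>Basis. b \<bullet> curvature G x b v w)"

definition scalar_loc :: "('v::euclidean_space) lmetric \<Rightarrow> 'v \<Rightarrow> real" where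
  "scalar_loc G x = metric_trace (G x) (ricci G x)"

text \<open>A bivector \<open>\<omega> = (1/2) \<omega>\<^sup>i\<^sup>j \<partial>\<^sub>i \<and> \<partial>\<^sub>j\<close> is given by its antisymmetric components
  \<open>\<omega> i j\<close> with \<open>i\<close>, \<open>j\<close> in the standard basis.\<close>

definition bivector :: "('v::euclidean_space \<Rightarrow> 'v \<Rightarrow> real) \<Rightarrow> bool" where
  "bivector \<omega> \<longleftrightarrow> (\<forall>i\<in>Basis. \<forall>j\<in>Basis. \<omega> i j = - \<omega> j i)"

definition bivector_norm ::
  "('v::euclidean_space \<Rightarrow> 'v \<Rightarrow> real) \<Rightarrow> ('v \<Rightarrow> 'v \<Rightarrow> real) \<Rightarrow> real" where
  "bivector_norm B \<omega> = sqrt ((\<Sum>i\<in>Basis. \<Sum>j\<in>Basis. \<Sum>k\<in>Basis. \<Sum>l\<in>Basis.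
     \<omega> i j * \<omega> k l * B i k * B j l) / 2)"

text \<open>\<open>(Riem \<omega>)\<^sup>i\<^sup>j = (1/2) R\<^sup>i\<^sup>j\<^sub>k\<^sub>l \<omega>\<^sup>k\<^sup>l\<close>, where \<open>R\<^sup>i\<^sup>j\<^sub>k\<^sub>l\<close> is the \<open>i\<close>-th component of
  \<open>R(\<partial>\<^sub>k,\<partial>\<^sub>l)\<close> applied to the vector dual to \<open>dx\<^sup>j\<close>; it equals
  \<open>\<kappa>(\<delta>\<^sup>i\<^sub>k \<delta>\<^sup>j\<^sub>l - \<delta>\<^sup>i\<^sub>l \<delta>\<^sup>j\<^sub>k)\<close> for constant sectional curvature \<open>\<kappa>\<close>.\<close>

definition curvature_operator ::
  "('v::euclidean_space) lmetric \<Rightarrow> 'v \<Rightarrow> ('v \<Rightarrow> 'v \<Rightarrow> real) \<Rightarrow> 'v \<Rightarrow> 'v \<Rightarrow> real" where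
  "curvature_operator G x \<omega> i j = (\<Sum>k\<in>Basis. \<Sum>l\<in>Basis.
     \<omega> k l * (i \<bullet> curvature G x k l (sharp (G x) (\<lambda>v. j \<bullet> v)))) / 2"

definition hessian :: "('v::euclidean_space) lmetric \<Rightarrow> ('v \<Rightarrow> real) \<Rightarrow> 'v \<Rightarrow> 'v \<Rightarrow> 'v \<Rightarrow> real" where
  "hessian G f x u v =
     frechet_derivative (\<lambda>y. frechet_derivative f (at y) v) (at x) u -
     frechet_derivative f (at x) (christoffel G x u v)"


section \<open>Riemannian geometry on the interior\<close>

definition scalar_curvature ::
  "('m, 'v::euclidean_space) chart set \<Rightarrow> ('m, 'v) tensor2 \<Rightarrow> 'm \<Rightarrow> real" where
  "scalar_curvature \<A> g p = (let c = chart_at \<A> p in scalar_loc (in_coords c g) (snd c p))"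

definition laplacian ::
  "('m, 'v::euclidean_space) chart set \<Rightarrow> ('m, 'v) tensor2 \<Rightarrow> ('m \<Rightarrow> real) \<Rightarrow> 'm \<Rightarrow> real" where
  "laplacian \<A> g f p = (let c = chart_at \<A> p in
     metric_trace (g c p) (hessian (in_coords c g) (f \<circ> chart_inv c) (snd c p)))"

text \<open>\<open>|df|\<^sup>2\<close> with respect to \<open>g\<close>.\<close>

definition diff_norm_sq ::
  "('m, 'v::euclidean_space) chart set \<Rightarrow> ('m, 'v) tensor2 \<Rightarrow> ('m \<Rightarrow> real) \<Rightarrow> 'm \<Rightarrow> real" where
  "diff_norm_sq \<A> g f p = (let c = chart_at \<A> p;
       df = frechet_derivative (f \<circ> chart_inv c) (at (snd c p)) in df (sharp (g c p) df))"

text \<open>The filter \<open>\<rho> \<rightarrow> 0\<close> on the interior.\<close>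

definition bdry_filter ::
  "'m topology \<Rightarrow> ('m, 'e::euclidean_space \<times> real) chart set \<Rightarrow> ('m \<Rightarrow> real) \<Rightarrow> 'm filter" where
  "bdry_filter T \<A> \<rho> = inf (filtercomap \<rho> (nhds 0)) (principal (minterior T \<A>))"

text \<open>Convergence of the curvature operator to \<open>-Id\<close>, in the operator norm on bivectors
  induced by \<open>g\<close> (which is the one induced by \<open>\<rho>\<^sup>2 g\<close>).\<close>

definition curvature_tends_minus_id ::
  "'m topology \<Rightarrow> ('m, 'e::euclidean_space \<times> real) chart set \<Rightarrow> ('m \<Rightarrow> real) \<Rightarrow>
   ('m, 'e \<times> real) tensor2 \<Rightarrow> bool" where
  "curvature_tends_minus_id T \<A> \<rho> g \<longleftrightarrow> (\<forall>\<epsilon>>0. \<forall>\<^sub>F p in bdry_filter T \<A> \<rho>.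
     \<forall>c\<in>\<A>. p \<in> fst c \<longrightarrow> (\<forall>\<omega>. bivector \<omega> \<longrightarrow>
       bivector_norm (g c p) (\<lambda>i j. curvature_operator (in_coords c g) (snd c p) \<omega> i j + \<omega> i j)
         \<le> \<epsilon> * bivector_norm (g c p) \<omega>))"


section \<open>Moebius parametrizations\<close>

text \<open>The ball about \<open>(0,1)\<close> in the upper half-space, by the formula
  \<open>cosh d((x,y),(x',y')) = 1 + (|x-x'|\<^sup>2 + (y-y')\<^sup>2) / (2 y y')\<close> for hyperbolic distance.\<close>

definition hyp_ball :: "real \<Rightarrow> ('e::euclidean_space \<times> real) set" where
  "hyp_ball r = {(x, y). y > 0 \<and> arcosh (1 + ((norm x)\<^sup>2 + (y - 1)\<^sup>2) / (2 * y)) < r}"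

text \<open>\<open>\<psi> q t\<close> is the point of the collar identified with \<open>(q,t) \<in> \<partial>M \<times> [0,s)\<close>.
  The background chart of a boundary chart \<open>(V,\<theta>)\<close> has domain \<open>V \<times> [0,s)\<close> and map \<open>(\<theta>,\<rho>)\<close>.\<close>

definition background_chart ::
  "('m, 'e::euclidean_space \<times> real) chart set \<Rightarrow> ('m \<Rightarrow> real) \<Rightarrow> ('m \<Rightarrow> real \<Rightarrow> 'm) \<Rightarrow> real \<Rightarrow>
   ('m, 'e) chart \<Rightarrow> ('m, 'e \<times> real) chart" where
  "background_chart \<A> \<rho> \<psi> s b =
     ((\<lambda>(q, t). \<psi> q t) ` (fst b \<times> {0..<s}),
      \<lambda>p. (snd b (fst (inv_into (bdry \<A> \<times> {0..<s}) (\<lambda>(q, t). \<psi> q t) p)), \<rho> p))"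

text \<open>That \<open>\<psi>\<close> is a diffeomorphism onto an open set is expressed by the last conjunct.\<close>

definition collar ::
  "'m topology \<Rightarrow> ('m, 'e::euclidean_space \<times> real) chart set \<Rightarrow> ('m \<Rightarrow> real) \<Rightarrow>
   ('m \<Rightarrow> real \<Rightarrow> 'm) \<Rightarrow> real \<Rightarrow> bool" where
  "collar T \<A> \<rho> \<psi> s \<longleftrightarrow> 0 < s \<and>
     inj_on (\<lambda>(q, t). \<psi> q t) (bdry \<A> \<times> {0..<s}) \<and>
     (\<forall>q\<in>bdry \<A>. \<psi> q 0 = q \<and> (\<forall>t\<in>{0..<s}. \<psi> q t \<in> topspace T \<and> \<rho> (\<psi> q t) = t)) \<and>
     (\<forall>b\<in>bdry_charts T \<A>. background_chart \<A> \<rho> \<psi> s b \<in> \<A>)"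

definition background_cover ::
  "'m topology \<Rightarrow> ('m, 'e::euclidean_space \<times> real) chart set \<Rightarrow> ('m, 'e) chart set \<Rightarrow> bool" where
  "background_cover T \<A> \<B> \<longleftrightarrow> finite \<B> \<and> \<B> \<subseteq> bdry_charts T \<A> \<and> (\<Union>b\<in>\<B>. fst b) = bdry \<A> \<and>
     (\<forall>b\<in>\<B>. \<exists>b'\<in>bdry_charts T \<A>. T closure_of (fst b) \<subseteq> fst b' \<and> (\<forall>q\<in>fst b. snd b' q = snd b q))"

text \<open>Parametrizations are only relevant on \<open>hyp_ball 2\<close>. The centre of the Moebius
  parametrization is \<open>p\<^sub>0 = \<psi> q t\<close>, with background coordinates \<open>(\<theta>\<^sub>0, \<rho>\<^sub>0) = (snd b q, t)\<close>.\<close>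

definition moebius_param ::
  "('m \<Rightarrow> real \<Rightarrow> 'm) \<Rightarrow> real \<Rightarrow> ('m, 'e::euclidean_space) chart set \<Rightarrow> ('e \<times> real \<Rightarrow> 'm) \<Rightarrow> bool" where
  "moebius_param \<psi> s \<B> \<Phi> \<longleftrightarrow> (\<exists>b\<in>\<B>. \<exists>q\<in>fst b. \<exists>t. 0 < t \<and> t < s \<and>
     (\<forall>(x, y)\<in>hyp_ball 2. snd b q + t *\<^sub>R x \<in> chart_image b \<and> t * y < s \<and>
        \<Phi> (x, y) = \<psi> (chart_inv b (snd b q + t *\<^sub>R x)) (t * y)))"

text \<open>A smooth parametrization of a relatively compact part of the interior is required to
  extend to a diffeomorphism defined near the closed ball, i.e. to the inverse of a chart.\<close>

definition interior_param ::
  "'m topology \<Rightarrow> ('m, 'e::euclidean_space \<times> real) chart set \<Rightarrow> ('e \<times> real \<Rightarrow> 'm) \<Rightarrow> bool" where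
  "interior_param T \<A> \<Phi> \<longleftrightarrow> (\<exists>W \<Psi>. open W \<and> closure (hyp_ball 2) \<subseteq> W \<and> W \<subseteq> {z. snd z > 0} \<and>
     inj_on \<Psi> W \<and> \<Psi> ` W \<subseteq> minterior T \<A> \<and> (\<Psi> ` W, inv_into W \<Psi>) \<in> \<A> \<and>
     (\<forall>z\<in>hyp_ball 2. \<Phi> z = \<Psi> z))"

definition moebius_cover ::
  "'m topology \<Rightarrow> ('m, 'e::euclidean_space \<times> real) chart set \<Rightarrow> ('m \<Rightarrow> real \<Rightarrow> 'm) \<Rightarrow> real \<Rightarrow>
   ('m, 'e) chart set \<Rightarrow> nat set \<Rightarrow> (nat \<Rightarrow> 'e \<times> real \<Rightarrow> 'm) \<Rightarrow> bool" where
  "moebius_cover T \<A> \<psi> s \<B> I \<Phi> \<longleftrightarrow>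
     (\<exists>J\<subseteq>I. finite J \<and> (\<forall>i\<in>I - J. moebius_param \<psi> s \<B> (\<Phi> i)) \<and> (\<forall>i\<in>J. interior_param T \<A> (\<Phi> i))) \<and>
     (\<Union>i\<in>I. \<Phi> i ` hyp_ball 1) = minterior T \<A> \<and>
     (\<exists>N. \<forall>p\<in>minterior T \<A>. \<exists>W. openin T W \<and> p \<in> W \<and>
        finite {i\<in>I. \<Phi> i ` hyp_ball 2 \<inter> W \<noteq> {}} \<and> card {i\<in>I. \<Phi> i ` hyp_ball 2 \<inter> W \<noteq> {}} \<le> N)"


section \<open>Weighted Hoelder spaces\<close>

text \<open>The components of \<open>\<Phi>\<^sup>* h\<close> on \<open>hyp_ball 2\<close> are those of \<open>h\<close> in the chart \<open>\<Phi>\<^sup>-\<^sup>1\<close>.\<close>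

definition pullback2 ::
  "('e::euclidean_space \<times> real \<Rightarrow> 'm) \<Rightarrow> ('m, 'e \<times> real) tensor2 \<Rightarrow> 'e \<times> real \<Rightarrow>
   'e \<times> real \<Rightarrow> 'e \<times> real \<Rightarrow> real" where
  "pullback2 \<Phi> h z = h (\<Phi> ` hyp_ball 2, inv_into (hyp_ball 2) \<Phi>) (\<Phi> z)"

definition function_norm ::
  "nat set \<Rightarrow> (nat \<Rightarrow> 'e::euclidean_space \<times> real \<Rightarrow> 'm) \<Rightarrow> nat \<Rightarrow> real \<Rightarrow> ('m \<Rightarrow> real) \<Rightarrow> ennreal" where
  "function_norm I \<Phi> k \<alpha> u = (SUP i\<in>I. hoelder_norm k \<alpha> (hyp_ball 2) (u \<circ> \<Phi> i))"

definition tensor2_norm ::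
  "nat set \<Rightarrow> (nat \<Rightarrow> 'e::euclidean_space \<times> real \<Rightarrow> 'm) \<Rightarrow> nat \<Rightarrow> real \<Rightarrow>
   ('m, 'e \<times> real) tensor2 \<Rightarrow> ennreal" where
  "tensor2_norm I \<Phi> k \<alpha> h = (SUP i\<in>I. SUP u\<in>Basis. SUP v\<in>Basis.
     hoelder_norm k \<alpha> (hyp_ball 2) (\<lambda>z. pullback2 (\<Phi> i) h z u v))"

definition hoelder_functions ::
  "('m \<Rightarrow> real) \<Rightarrow> nat set \<Rightarrow> (nat \<Rightarrow> 'e::euclidean_space \<times> real \<Rightarrow> 'm) \<Rightarrow> nat \<Rightarrow> real \<Rightarrow> real \<Rightarrow>
   ('m \<Rightarrow> real) set" where
  "hoelder_functions \<rho> I \<Phi> k \<alpha> \<delta> = {u. function_norm I \<Phi> k \<alpha> (\<lambda>p. \<rho> p powr (- \<delta>) * u p) < top}"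

definition hoelder_tensors2 ::
  "('m \<Rightarrow> real) \<Rightarrow> nat set \<Rightarrow> (nat \<Rightarrow> 'e::euclidean_space \<times> real \<Rightarrow> 'm) \<Rightarrow> nat \<Rightarrow> real \<Rightarrow> real \<Rightarrow>
   ('m, 'e \<times> real) tensor2 set" where
  "hoelder_tensors2 \<rho> I \<Phi> k \<alpha> \<delta> =
     {h. tensor2_norm I \<Phi> k \<alpha> (scale_tensor2 (\<lambda>p. \<rho> p powr (- \<delta>)) h) < top}"

text \<open>The class \<open>\<M>\<close> of weakly asymptotically hyperbolic metrics with parameters \<open>k, \<alpha>; 2\<close>.\<close>

definition M_weak2 ::
  "'m topology \<Rightarrow> ('m, 'e::euclidean_space \<times> real) chart set \<Rightarrow> ('m \<Rightarrow> real) \<Rightarrow> nat set \<Rightarrow>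
   (nat \<Rightarrow> 'e \<times> real \<Rightarrow> 'm) \<Rightarrow> nat \<Rightarrow> real \<Rightarrow> ('m, 'e \<times> real) tensor2 set" where
  "M_weak2 T \<A> \<rho> I \<Phi> k \<alpha> = {g.
     (let gbar = scale_tensor2 (\<lambda>p. (\<rho> p)\<^sup>2) g in
        riemannian_metric \<A> (minterior T \<A>) g \<and>
        (\<exists>ghat. riemannian_metric \<A> (topspace T) ghat \<and> continuous_tensor2 \<A> ghat \<and>
           (\<forall>c\<in>\<A>. \<forall>p\<in>fst c \<inter> minterior T \<A>. ghat c p = gbar c p)) \<and>
        gbar \<in> hoelder_tensors2 \<rho> I \<Phi> k \<alpha> 2 \<and>
        (\<forall>X1. smooth_vfield \<A> X1 \<longrightarrow> lie_deriv X1 gbar \<in> hoelder_tensors2 \<rho> I \<Phi> (k - 1) \<alpha> 2) \<and>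
        (\<forall>X1 X2. smooth_vfield \<A> X1 \<longrightarrow> smooth_vfield \<A> X2 \<longrightarrow>
           lie_deriv X1 (lie_deriv X2 gbar) \<in> hoelder_tensors2 \<rho> I \<Phi> (k - 2) \<alpha> 2) \<and>
        curvature_tends_minus_id T \<A> \<rho> g)}"

end

theory Submission
  imports Defs
begin

text \<open>Write \<open>f\<close> for the function in (1) and (2). The conformal transformation law of the scalar curvature gives
  \<open>R[g] + n(n+1) = \<rho>\<^sup>2 R[gbar] - n(n+1) f\<close>, and \<open>R[gbar]\<close> is bounded in \<open>C\<^sup>k\<^sup>-\<^sup>2\<^sup>,\<^sup>\<alpha>\<close>. So everything
  reduces to showing that \<open>f = O(\<rho>\<^sup>2)\<close> bounds \<open>\<rho>\<^sup>-\<^sup>2 f\<close> in \<open>C\<^sup>k\<^sup>-\<^sup>1\<^sup>,\<^sup>\<alpha>\<close>.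

  In a Moebius ball centred at height \<open>t\<close>, cut-offs of the coordinate fields of the background chart are
  \<open>1/t\<close> times the coordinate fields of the ball. The hypotheses on the Lie derivatives therefore
  say that the first and second derivatives of the components of \<open>t\<^sup>-\<^sup>2 \<Phi>\<^sup>* gbar\<close> are of order \<open>t\<close> and
  \<open>t\<^sup>2\<close>. Consequently the derivative of \<open>t\<^sup>-\<^sup>2 f\<close> is a sum \<open>G + H\<close> with \<open>dG\<close> and \<open>H\<close> bounded in
  \<open>C\<^sup>k\<^sup>-\<^sup>2\<^sup>,\<^sup>\<alpha>\<close>. A bounded \<open>t\<^sup>-\<^sup>2 f\<close> then forces \<open>G\<close> to be bounded by the mean value theorem, since \<open>G\<close>
  is almost constant along segments, and this bounds the full norm of \<open>t\<^sup>-\<^sup>2 f\<close>.\<close>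

text \<open>The obstacle is uniformity over infinitely many balls. Every regularity statement is
  therefore about an indexed family with one constant, and the classes are generated from an
  abstract predicate \<open>P\<close> closed under sums and products, so that the same algebra
  serves plain C^k calculus and uniform Hoelder bounds. Powers of t are counted by
  \<open>wreg\<close>: |d rho|^2 contains the metric undifferentiated and keeps two derivatives that
  each gain a factor t, whereas the Laplacian has already spent one of them. The part G of the
  derivative is exactly what falls short by one power of t.

  Lower bounds for the metric come from compactness in one chart. The index set is therefore cut
  into finitely many families, one for each boundary chart and a singleton with t = 1 for each
  interior parametrization.

  The norms see all of M, while the big-O conditions see only a neighbourhood of the boundary. The
  two meet because f is bounded on M.\<close>

lemma has_derivative_cong_open:
  assumes "open S" "x \<in> S" "\<And>y. y \<in> S \<Longrightarrow> f y = g y"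
  shows "(f has_derivative f') (at x) \<longleftrightarrow> (g has_derivative f') (at x)"
  using assms by (metis has_derivative_transform_within_open)

lemma frechet_derivative_cong_open:
  assumes "open S" "x \<in> S" "\<And>y. y \<in> S \<Longrightarrow> f y = g y"
  shows "frechet_derivative f (at x) = frechet_derivative g (at x)"
  unfolding frechet_derivative_def using has_derivative_cong_open[OF assms] by simp

lemma partial_deriv_cong_open:
  assumes "open S" "x \<in> S" "\<And>y. y \<in> S \<Longrightarrow> f y = g y"
  shows "partial_deriv b f x = partial_deriv b g x"
  unfolding partial_deriv_def using frechet_derivative_cong_open[OF assms] by simp

lemma partial_deriv_eq: "(f has_derivative f') (at x) \<Longrightarrow> partial_deriv b f x = f' b"
  unfolding partial_deriv_def by (simp add: frechet_derivative_at[symmetric])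

lemma differentiable_on_openD:
  "f differentiable_on S \<Longrightarrow> open S \<Longrightarrow> x \<in> S \<Longrightarrow> f differentiable (at x)"
  by (simp add: differentiable_on_eq_differentiable_at)

lemma has_derivative_openD:
  "f differentiable_on S \<Longrightarrow> open S \<Longrightarrow> x \<in> S \<Longrightarrow> (f has_derivative frechet_derivative f (at x)) (at x)"
  using differentiable_on_openD frechet_derivative_works by blast

lemma differentiable_on_cong:
  assumes "\<And>x. x \<in> S \<Longrightarrow> f x = g x"
  shows "f differentiable_on S \<longleftrightarrow> g differentiable_on S"
  unfolding differentiable_on_def using assms differentiable_transform_within[of _ _ _ 1]
  by (metis zero_less_one)

lemma frechet_derivative_eq_sum:
  fixes f :: "'v::euclidean_space \<Rightarrow> 'w::real_normed_vector"
  assumes "f differentiable (at x)"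
  shows "frechet_derivative f (at x) v = (\<Sum>b\<in>Basis. (v \<bullet> b) *\<^sub>R partial_deriv b f x)"
proof -
  have "linear (frechet_derivative f (at x))"
    using assms by (rule linear_frechet_derivative)
  then have "frechet_derivative f (at x) (\<Sum>b\<in>Basis. (v \<bullet> b) *\<^sub>R b) =
      (\<Sum>b\<in>Basis. (v \<bullet> b) *\<^sub>R frechet_derivative f (at x) b)"
    by (simp add: linear_sum linear_cmul)
  then show ?thesis by (simp add: euclidean_representation partial_deriv_def)
qed

section \<open>Iterated partial derivatives and the class C^k\<close>

lemma iter_deriv_snoc: "iter_deriv (bs @ [b]) f = iter_deriv bs (partial_deriv b f)"
  by (induction bs) auto

lemma iter_deriv_cong_open:
  assumes "open S" "\<And>y. y \<in> S \<Longrightarrow> f y = g y" "x \<in> S"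
  shows "iter_deriv bs f x = iter_deriv bs g x"
  using assms(3)
proof (induction bs arbitrary: x)
  case (Cons b bs)
  then show ?case by (simp, intro partial_deriv_cong_open[OF assms(1)]) auto
qed (use assms in auto)

lemma Ck_on_cong:
  assumes "open S" "\<And>y. y \<in> S \<Longrightarrow> f y = g y"
  shows "Ck_on k S f \<longleftrightarrow> Ck_on k S g"
proof -
  have "iter_deriv bs f differentiable_on S \<longleftrightarrow> iter_deriv bs g differentiable_on S" for bs
    by (intro differentiable_on_cong iter_deriv_cong_open[OF assms])
  moreover have "continuous_on S (iter_deriv bs f) \<longleftrightarrow> continuous_on S (iter_deriv bs g)" for bs
    by (intro continuous_on_cong refl iter_deriv_cong_open[OF assms])
  ultimately show ?thesis unfolding Ck_on_def by simp
qed

lemma Ck_on_0 [simp]: "Ck_on 0 S f \<longleftrightarrow> continuous_on S f"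
  by (auto simp: Ck_on_def)

text \<open>\<open>iter_deriv\<close> takes the derivative at the end of the list first. Splitting
  off this innermost derivative lets an induction on \<open>k\<close> pass from a function to its
  partial derivatives.\<close>

lemma Ck_on_Suc:
  "Ck_on (Suc k) S f \<longleftrightarrow> f differentiable_on S \<and> (\<forall>b\<in>Basis. Ck_on k S (partial_deriv b f))"
    (is "?L \<longleftrightarrow> ?R")
proof
  assume L: ?L
  have "f differentiable_on S" using L[unfolded Ck_on_def, rule_format, of "[]"] by simp
  moreover have "Ck_on k S (partial_deriv b f)" if "b \<in> Basis" for b
    unfolding Ck_on_def
  proof (intro allI impI)
    fix bs :: "'a list" assume bs: "set bs \<subseteq> Basis"
    show "(length bs < k \<longrightarrow> iter_deriv bs (partial_deriv b f) differentiable_on S) \<and>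
     (length bs \<le> k \<longrightarrow> continuous_on S (iter_deriv bs (partial_deriv b f)))"
      using L[unfolded Ck_on_def, rule_format, of "bs @ [b]"] bs that by (simp add: iter_deriv_snoc)
  qed
  ultimately show ?R by blast
next
  assume R: ?R
  show ?L unfolding Ck_on_def
  proof (intro allI impI)
    fix bs :: "'a list" assume bs: "set bs \<subseteq> Basis"
    show "(length bs < Suc k \<longrightarrow> iter_deriv bs f differentiable_on S) \<and>
     (length bs \<le> Suc k \<longrightarrow> continuous_on S (iter_deriv bs f))"
    proof (cases bs rule: rev_cases)
      case Nil
      then show ?thesis using R differentiable_imp_continuous_on by auto
    next
      case (snoc cs b)
      then have "Ck_on k S (partial_deriv b f)" "set cs \<subseteq> Basis" using R bs by auto
      then show ?thesis unfolding Ck_on_def snoc by (simp add: iter_deriv_snoc)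
    qed
  qed
qed

lemma Ck_on_continuous: "Ck_on k S f \<Longrightarrow> continuous_on S f"
  by (cases k) (auto simp: Ck_on_Suc differentiable_imp_continuous_on)

lemma Ck_on_mono: "Ck_on k S f \<Longrightarrow> j \<le> k \<Longrightarrow> Ck_on j S f"
  unfolding Ck_on_def by force

lemma Ck_on_differentiable: "Ck_on k S f \<Longrightarrow> 0 < k \<Longrightarrow> f differentiable_on S"
  by (cases k) (auto simp: Ck_on_Suc)

lemma Ck_on_subset:
  assumes "Ck_on k S f" "T \<subseteq> S"
  shows "Ck_on k T f"
  using assms(1) unfolding Ck_on_def
  by (meson assms(2) continuous_on_subset differentiable_on_subset)

lemma partial_deriv_inner:
  assumes "f differentiable (at x)"
  shows "partial_deriv b (\<lambda>x. f x \<bullet> a) x = partial_deriv b f x \<bullet> a"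
proof -
  have "((\<lambda>x. f x \<bullet> a) has_derivative (\<lambda>h. frechet_derivative f (at x) h \<bullet> a)) (at x)"
    using assms frechet_derivative_works by (auto intro!: derivative_eq_intros)
  then show ?thesis by (simp add: partial_deriv_eq) (simp add: partial_deriv_def)
qed

text \<open>Reduces vector-valued functions to real-valued ones, the only kind that the algebra of
  families below handles.\<close>

lemma Ck_on_componentwise:
  fixes f :: "'v::euclidean_space \<Rightarrow> 'w::euclidean_space"
  assumes "open S"
  shows "Ck_on k S f \<longleftrightarrow> (\<forall>a\<in>Basis. Ck_on k S (\<lambda>x. f x \<bullet> a))"
proof (induction k arbitrary: f)
  case 0
  show ?case using continuous_on_componentwise[of S f] by simp
next
  case (Suc k)
  have d: "f differentiable_on S \<longleftrightarrow> (\<forall>a\<in>Basis. (\<lambda>x. f x \<bullet> a) differentiable_on S)"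
    unfolding differentiable_on_def using differentiable_componentwise_within[of f _ S] by auto
  have p: "Ck_on k S (\<lambda>x. partial_deriv b f x \<bullet> a) \<longleftrightarrow> Ck_on k S (partial_deriv b (\<lambda>x. f x \<bullet> a))"
    if "f differentiable_on S" for a b
    using that by (intro Ck_on_cong[OF assms])
      (simp add: partial_deriv_inner differentiable_on_openD[OF _ assms])
  show ?case
  proof (cases "f differentiable_on S")
    case True
    then show ?thesis using d p[OF True] Suc by (simp add: Ck_on_Suc) blast
  next
    case False
    then show ?thesis using d by (auto simp: Ck_on_Suc)
  qed
qed


section \<open>Regularity of families of functions\<close>

text \<open>With \<open>P\<close> expressing continuity this is the class \<open>C\<^sup>k\<close>, with \<open>P\<close> expressing a uniform
  Hoelder bound it is uniform boundedness in \<open>C\<^sup>k\<^sup>,\<^sup>\<alpha>\<close>.\<close>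

primrec reg :: "(('i \<Rightarrow> 'v::euclidean_space \<Rightarrow> real) \<Rightarrow> bool) \<Rightarrow> 'i set \<Rightarrow> 'v set \<Rightarrow> nat \<Rightarrow>
    ('i \<Rightarrow> 'v \<Rightarrow> real) \<Rightarrow> bool" where
  "reg P I S 0 F \<longleftrightarrow> P F"
| "reg P I S (Suc k) F \<longleftrightarrow> P F \<and> (\<forall>i\<in>I. F i differentiable_on S) \<and>
     (\<forall>b\<in>Basis. reg P I S k (\<lambda>i. partial_deriv b (F i)))"

text \<open>The predicate \<open>P\<close> makes families an algebra of continuous functions that
  contains the constants. Closure under inverses is left out: it needs a lower bound that is uniform
  in the index, and it enters later as the hypothesis that \<open>P\<close> holds for the
  inverse.\<close>

locale regularity =
  fixes P :: "('i \<Rightarrow> 'v::euclidean_space \<Rightarrow> real) \<Rightarrow> bool" and I :: "'i set" and S :: "'v set"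
  assumes open_S: "open S"
    and P_cong: "P F \<Longrightarrow> (\<And>i x. i \<in> I \<Longrightarrow> x \<in> S \<Longrightarrow> F i x = G i x) \<Longrightarrow> P G"
    and P_continuous: "P F \<Longrightarrow> i \<in> I \<Longrightarrow> continuous_on S (F i)"
    and P_const: "P (\<lambda>_ _. c)"
    and P_add: "P F \<Longrightarrow> P G \<Longrightarrow> P (\<lambda>i x. F i x + G i x)"
    and P_mult: "P F \<Longrightarrow> P G \<Longrightarrow> P (\<lambda>i x. F i x * G i x)"
begin

abbreviation "rg \<equiv> reg P I S"

lemma reg_P: "rg k F \<Longrightarrow> P F"
  by (cases k) auto

lemma reg_pred: "rg (Suc k) F \<Longrightarrow> rg k F"
proof (induction k arbitrary: F)
  case (Suc k)
  have "rg k (\<lambda>i. partial_deriv b (F i))" if "b \<in> Basis" for b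
    using Suc.prems that by (intro Suc.IH) simp
  then show ?case using Suc.prems by simp
qed simp

lemma reg_mono: "rg k F \<Longrightarrow> j \<le> k \<Longrightarrow> rg j F"
proof (induction k)
  case (Suc k)
  then show ?case using reg_pred[of k F] by (cases "j = Suc k") (auto simp del: reg.simps(2))
qed simp

lemma reg_differentiable:
  "rg k F \<Longrightarrow> 0 < k \<Longrightarrow> i \<in> I \<Longrightarrow> x \<in> S \<Longrightarrow> F i differentiable (at x)"
  using differentiable_on_openD[OF _ open_S] by (cases k) auto

lemma reg_cong:
  assumes "rg k F" "\<And>i x. i \<in> I \<Longrightarrow> x \<in> S \<Longrightarrow> F i x = G i x"
  shows "rg k G"
  using assms
proof (induction k arbitrary: F G)
  case (Suc k)
  have "rg k (\<lambda>i. partial_deriv b (G i))" if "b \<in> Basis" for b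
  proof (rule Suc.IH[of "\<lambda>i. partial_deriv b (F i)"])
    show "rg k (\<lambda>i. partial_deriv b (F i))" using Suc.prems(1) that by simp
    show "partial_deriv b (F i) x = partial_deriv b (G i) x" if "i \<in> I" "x \<in> S" for i x
      using Suc.prems(2)[OF that(1)] by (rule partial_deriv_cong_open[OF open_S that(2)])
  qed
  moreover have "P G" using Suc.prems by (intro P_cong[of F G]) auto
  moreover have "G i differentiable_on S" if "i \<in> I" for i
    using Suc.prems(1) differentiable_on_cong[of S "F i" "G i", OF Suc.prems(2)[OF that]] that by simp
  ultimately show ?case by simp
next
  case 0
  then show ?case using P_cong[of F G] by simp
qed

text \<open>\<open>P_const\<close> covers constants that do not depend on the index. For constants
  \<open>c i\<close>, such as the scales \<open>t i\<close> of the balls, a uniform bound has to be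
  supplied through \<open>P\<close>.\<close>

lemma reg_const_family: "P (\<lambda>i _. c i) \<Longrightarrow> rg k (\<lambda>i _. c i)"
proof (induction k arbitrary: c)
  case (Suc k)
  have "rg k (\<lambda>i. partial_deriv b (\<lambda>_. c i))" for b
    by (rule reg_cong[OF Suc.IH[OF P_const[of 0]]]) (simp add: partial_deriv_def)
  then show ?case using Suc.prems by simp
qed simp

lemma reg_const: "rg k (\<lambda>_ _. c)"
  by (rule reg_const_family[OF P_const])

lemma partial_deriv_add:
  fixes f g :: "'v \<Rightarrow> real"
  assumes "f differentiable (at x)" "g differentiable (at x)"
  shows "partial_deriv b (\<lambda>x. f x + g x) x = partial_deriv b f x + partial_deriv b g x"
proof -
  have "((\<lambda>x. f x + g x) has_derivative
      (\<lambda>h. frechet_derivative f (at x) h + frechet_derivative g (at x) h)) (at x)"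
    using assms frechet_derivative_works by (auto intro!: derivative_intros)
  then show ?thesis by (simp add: partial_deriv_eq) (simp add: partial_deriv_def)
qed

lemma partial_deriv_mult:
  fixes f g :: "'v \<Rightarrow> real"
  assumes "f differentiable (at x)" "g differentiable (at x)"
  shows "partial_deriv b (\<lambda>x. f x * g x) x = f x * partial_deriv b g x + partial_deriv b f x * g x"
proof -
  have "((\<lambda>x. f x * g x) has_derivative
      (\<lambda>h. f x * frechet_derivative g (at x) h + frechet_derivative f (at x) h * g x)) (at x)"
    using assms frechet_derivative_works by (auto intro!: derivative_intros)
  then show ?thesis by (simp add: partial_deriv_eq) (simp add: partial_deriv_def)
qed

lemma reg_add: "rg k F \<Longrightarrow> rg k G \<Longrightarrow> rg k (\<lambda>i x. F i x + G i x)"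
proof (induction k arbitrary: F G)
  case (Suc k)
  have "rg k (\<lambda>i. partial_deriv b (\<lambda>x. F i x + G i x))" if "b \<in> Basis" for b
    by (rule reg_cong[OF Suc.IH[of "\<lambda>i. partial_deriv b (F i)" "\<lambda>i. partial_deriv b (G i)"]])
      (use Suc.prems that in \<open>simp_all add: partial_deriv_add differentiable_on_openD[OF _ open_S]\<close>)
  then show ?case using Suc.prems P_add[of F G] by (simp add: differentiable_on_add)
next
  case 0
  then show ?case using P_add[of F G] by simp
qed

lemma reg_mult: "rg k F \<Longrightarrow> rg k G \<Longrightarrow> rg k (\<lambda>i x. F i x * G i x)"
proof (induction k arbitrary: F G)
  case (Suc k)
  have "rg k (\<lambda>i. partial_deriv b (\<lambda>x. F i x * G i x))" if "b \<in> Basis" for b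
    by (rule reg_cong[OF reg_add[OF Suc.IH[of "F" "\<lambda>i. partial_deriv b (G i)"]
            Suc.IH[of "\<lambda>i. partial_deriv b (F i)" "G"]]])
      (use Suc.prems that reg_pred[OF Suc.prems(1)] reg_pred[OF Suc.prems(2)]
       in \<open>simp_all add: partial_deriv_mult differentiable_on_openD[OF _ open_S]\<close>)
  then show ?case using Suc.prems P_mult[of F G] by (simp add: differentiable_on_mult)
next
  case 0
  then show ?case using P_mult[of F G] by simp
qed

lemma reg_cmult: "rg k F \<Longrightarrow> rg k (\<lambda>i x. c * F i x)"
  using reg_mult[OF reg_const] .

lemma reg_uminus: "rg k F \<Longrightarrow> rg k (\<lambda>i x. - F i x)"
  using reg_cmult[of k F "-1"] by simp

lemma reg_minus: "rg k F \<Longrightarrow> rg k G \<Longrightarrow> rg k (\<lambda>i x. F i x - G i x)"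
  using reg_add[OF _ reg_uminus] by force

lemma reg_sum: "(\<And>j. j \<in> J \<Longrightarrow> rg k (F j)) \<Longrightarrow> rg k (\<lambda>i x. \<Sum>j\<in>J. F j i x)"
  by (induction J rule: infinite_finite_induct) (auto intro: reg_const reg_add)

lemma reg_partial: "rg (Suc k) F \<Longrightarrow> b \<in> Basis \<Longrightarrow> rg k (\<lambda>i. partial_deriv b (F i))"
  by simp

lemma reg_SucI:
  assumes "P F" "\<And>i x. i \<in> I \<Longrightarrow> x \<in> S \<Longrightarrow> F i differentiable (at x)"
    "\<And>b. b \<in> Basis \<Longrightarrow> rg k (G b)"
    "\<And>i x b. i \<in> I \<Longrightarrow> x \<in> S \<Longrightarrow> b \<in> Basis \<Longrightarrow> partial_deriv b (F i) x = G b i x"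
  shows "rg (Suc k) F"
proof -
  have "rg k (\<lambda>i. partial_deriv b (F i))" if "b \<in> Basis" for b
    by (rule reg_cong[OF assms(3)[OF that]]) (use assms(4) that in simp)
  then show ?thesis using assms(1,2)
    by (simp add: differentiable_on_eq_differentiable_at[OF open_S])
qed

text \<open>Both the differentiability of the inverse matrix \<open>B\<close> and the formula for its derivative come
  from \<open>B(x) - B(y) = B(x) (A(y) - A(x)) B(y)\<close>.\<close>

lemma matrix_inverse_difference:
  fixes A B :: "'j \<Rightarrow> 'j \<Rightarrow> 'v \<Rightarrow> real"
  assumes "finite J" "a \<in> J" "b \<in> J"
    and "\<And>a d. a \<in> J \<Longrightarrow> d \<in> J \<Longrightarrow> (\<Sum>c\<in>J. B a c x * A c d x) = (if a = d then 1 else 0)"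
    and "\<And>c b. c \<in> J \<Longrightarrow> b \<in> J \<Longrightarrow> (\<Sum>d\<in>J. A c d y * B d b y) = (if c = b then 1 else 0)"
  shows "B a b x - B a b y = (\<Sum>c\<in>J. \<Sum>d\<in>J. B a c x * (A c d y - A c d x) * B d b y)"
proof -
  have "(\<Sum>c\<in>J. \<Sum>d\<in>J. B a c x * A c d y * B d b y) = (\<Sum>c\<in>J. B a c x * (\<Sum>d\<in>J. A c d y * B d b y))"
    by (simp add: sum_distrib_left mult.assoc)
  also have "\<dots> = (\<Sum>c\<in>J. B a c x * (if c = b then 1 else 0))" using assms(3,5) by simp
  also have "\<dots> = B a b x" using assms(1,3) by (simp add: if_distrib cong: if_cong)
  finally have 1: "(\<Sum>c\<in>J. \<Sum>d\<in>J. B a c x * A c d y * B d b y) = B a b x" .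
  have "(\<Sum>c\<in>J. \<Sum>d\<in>J. B a c x * A c d x * B d b y) = (\<Sum>d\<in>J. (\<Sum>c\<in>J. B a c x * A c d x) * B d b y)"
    by (subst sum.swap) (simp add: sum_distrib_right)
  also have "\<dots> = (\<Sum>d\<in>J. (if a = d then 1 else 0) * B d b y)" using assms(2,4) by simp
  also have "\<dots> = B a b y" using assms(1,2) by (simp add: if_distribR if_distrib cong: if_cong)
  finally show ?thesis using 1 by (simp add: algebra_simps sum_subtractf)
qed

lemma matrix_inverse_has_derivative:
  fixes A B :: "'j \<Rightarrow> 'j \<Rightarrow> 'v \<Rightarrow> real"
  assumes J: "finite J" "a \<in> J" "b \<in> J" and x: "x \<in> S"
    and cont: "\<And>a b. a \<in> J \<Longrightarrow> b \<in> J \<Longrightarrow> continuous_on S (B a b)"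
    and diff: "\<And>a b. a \<in> J \<Longrightarrow> b \<in> J \<Longrightarrow> (A a b has_derivative A' a b) (at x)"
    and BA: "\<And>a d y. y \<in> S \<Longrightarrow> a \<in> J \<Longrightarrow> d \<in> J \<Longrightarrow> (\<Sum>c\<in>J. B a c y * A c d y) = (if a = d then 1 else 0)"
    and AB: "\<And>c b y. y \<in> S \<Longrightarrow> c \<in> J \<Longrightarrow> b \<in> J \<Longrightarrow> (\<Sum>d\<in>J. A c d y * B d b y) = (if c = b then 1 else 0)"
  shows "(B a b has_derivative (\<lambda>h. \<Sum>c\<in>J. \<Sum>d\<in>J. - (B a c x * A' c d h * B d b x))) (at x)"
proof -
  let ?q = "\<lambda>f y h. f / norm (y - x)"
  have "((\<lambda>y. (A c d y - A c d x - A' c d (y - x)) / norm (y - x)) \<longlongrightarrow> 0) (at x)"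
    if "c \<in> J" "d \<in> J" for c d
  proof (rule tendsto_norm_zero_cancel)
    show "((\<lambda>y. norm ((A c d y - A c d x - A' c d (y - x)) / norm (y - x))) \<longlongrightarrow> 0) (at x)"
      using diff[OF that] by (simp add: has_derivative_iff_norm)
  qed
  note lim1 = this
  have lim2: "(B a b \<longlongrightarrow> B a b x) (at x)" if "a \<in> J" "b \<in> J" for a b
    using cont[OF that] x open_S by (simp add: continuous_on_eq_continuous_at continuous_within)
  have bl: "bounded_linear (A' c d)" if "c \<in> J" "d \<in> J" for c d
    using diff[OF that] has_derivative_bounded_linear by blast
  have bdd: "((\<lambda>y. (B d b y - B d b x) * (A' c d (y - x) / norm (y - x))) \<longlongrightarrow> 0) (at x)"
    if cd: "c \<in> J" "d \<in> J" for c d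
  proof -
    obtain K where K: "\<And>h. norm (A' c d h) \<le> norm h * K"
      using bounded_linear.bounded[OF bl[OF cd]] by auto
    show ?thesis
    proof (rule Lim_null_comparison)
      show "\<forall>\<^sub>F y in at x. norm ((B d b y - B d b x) * (A' c d (y - x) / norm (y - x)))
          \<le> \<bar>B d b y - B d b x\<bar> * \<bar>K\<bar>"
      proof (rule always_eventually, rule)
        fix y
        have "\<bar>A' c d (y - x) / norm (y - x)\<bar> \<le> \<bar>K\<bar>"
          using K[of "y - x"] by (cases "y = x") (auto simp: field_simps intro:
            order_trans[OF _ mult_right_mono[OF abs_ge_self]])
        then show "norm ((B d b y - B d b x) * (A' c d (y - x) / norm (y - x))) \<le>
          \<bar>B d b y - B d b x\<bar> * \<bar>K\<bar>"
          unfolding real_norm_def abs_mult by (rule mult_left_mono) simp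
      qed
      have "((\<lambda>y. \<bar>B d b y - B d b x\<bar> * \<bar>K\<bar>) \<longlongrightarrow> \<bar>B d b x - B d b x\<bar> * \<bar>K\<bar>) (at x)"
        using lim2[OF cd(2) J(3)] by (intro tendsto_intros)
      then show "((\<lambda>y. \<bar>B d b y - B d b x\<bar> * \<bar>K\<bar>) \<longlongrightarrow> 0) (at x)" by simp
    qed
  qed
  let ?D = "\<lambda>h. \<Sum>c\<in>J. \<Sum>d\<in>J. - (B a c x * A' c d h * B d b x)"
  have lin: "bounded_linear ?D"
    by (intro bounded_linear_sum bounded_linear_minus bounded_linear_mult_const
        bounded_linear_const_mult bl)
  \<comment> \<open>The difference identity produces a factor \<open>B d b y\<close>, while the
    claimed derivative has \<open>B d b x\<close>. Inserting the linear part of \<open>A\<close>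
    splits each summand into the remainder of \<open>A\<close>, which vanishes to first order, and a
    bounded quotient times \<open>B d b y - B d b x\<close>, which vanishes by continuity of
    \<open>B\<close>.\<close>
  have key: "(B a b y - B a b x - ?D (y - x)) / norm (y - x) =
      - (\<Sum>c\<in>J. \<Sum>d\<in>J. B a c x * (((A c d y - A c d x - A' c d (y - x)) / norm (y - x)) * B d b y
          + (B d b y - B d b x) * (A' c d (y - x) / norm (y - x))))" if "y \<in> S" for y
  proof -
    have "B a b y - B a b x - ?D (y - x) =
        - (\<Sum>c\<in>J. \<Sum>d\<in>J. B a c x * (A c d y - A c d x) * B d b y - B a c x * A' c d (y - x) * B d b x)"
      using matrix_inverse_difference[OF J, of B x A y, OF BA[OF x] AB[OF that]]
      by (simp add: sum_subtractf sum_negf)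
    then have "(B a b y - B a b x - ?D (y - x)) / norm (y - x) = - (\<Sum>c\<in>J. \<Sum>d\<in>J.
        (B a c x * (A c d y - A c d x) * B d b y - B a c x * A' c d (y - x) * B d b x) / norm (y - x))"
      by (simp add: sum_divide_distrib)
    also have "\<dots> = - (\<Sum>c\<in>J. \<Sum>d\<in>J. B a c x *
      (((A c d y - A c d x - A' c d (y - x)) / norm (y - x)) * B d b y
          + (B d b y - B d b x) * (A' c d (y - x) / norm (y - x))))"
      by (intro arg_cong[of _ _ uminus] sum.cong refl) (simp add: divide_inverse algebra_simps)
    finally show ?thesis .
  qed
  have "((\<lambda>y. - (\<Sum>c\<in>J. \<Sum>d\<in>J. B a c x * (((A c d y - A c d x - A' c d (y - x)) / norm (y - x)) * B d b y
          + (B d b y - B d b x) * (A' c d (y - x) / norm (y - x))))) \<longlongrightarrow>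
       - (\<Sum>c\<in>J. \<Sum>d\<in>J. B a c x * (0 * B d b x + 0))) (at x)"
    using J by (intro tendsto_intros lim1 lim2 bdd)
  then have "((\<lambda>y. - (\<Sum>c\<in>J. \<Sum>d\<in>J. B a c x *
    (((A c d y - A c d x - A' c d (y - x)) / norm (y - x)) * B d b y
          + (B d b y - B d b x) * (A' c d (y - x) / norm (y - x))))) \<longlongrightarrow> 0) (at x)" by simp
  then have "((\<lambda>y. (B a b y - B a b x - ?D (y - x)) / norm (y - x)) \<longlongrightarrow> 0) (at x)"
    by (rule tendsto_cong[THEN iffD1, rotated])
      (rule eventually_mono[OF eventually_at_in_open'[OF open_S x]], use key in auto)
  from tendsto_norm[OF this] show ?thesis using lin by (simp add: has_derivative_iff_norm)
qed

text \<open>The derivative of \<open>B\<close> is - B (dA) B, a polynomial in \<open>B\<close>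
  itself and the derivatives of \<open>A\<close>. So control of k derivatives of \<open>B\<close>
  gives control of one more, and at the start only \<open>P\<close> for \<open>B\<close> has to be
  known.\<close>

lemma reg_matrix_inverse:
  fixes A B :: "'j \<Rightarrow> 'j \<Rightarrow> 'i \<Rightarrow> 'v \<Rightarrow> real"
  assumes J: "finite J" "a \<in> J" "b \<in> J"
    and A: "\<And>a b. a \<in> J \<Longrightarrow> b \<in> J \<Longrightarrow> rg k (A a b)"
    and B: "\<And>a b. a \<in> J \<Longrightarrow> b \<in> J \<Longrightarrow> P (B a b)"
    and BA: "\<And>i y a d. i \<in> I \<Longrightarrow> y \<in> S \<Longrightarrow> a \<in> J \<Longrightarrow> d \<in> J \<Longrightarrow>
      (\<Sum>c\<in>J. B a c i y * A c d i y) = (if a = d then 1 else 0)"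
    and AB: "\<And>i y c b. i \<in> I \<Longrightarrow> y \<in> S \<Longrightarrow> c \<in> J \<Longrightarrow> b \<in> J \<Longrightarrow>
      (\<Sum>d\<in>J. A c d i y * B d b i y) = (if c = b then 1 else 0)"
  shows "rg k (B a b)"
  using J(2,3) A
proof (induction k arbitrary: a b)
  case 0
  then show ?case using B by simp
next
  case (Suc k)
  have IH: "rg k (B a b)" if "a \<in> J" "b \<in> J" for a b
    using Suc.IH[OF that] Suc.prems(3) reg_pred by blast
  have der: "(B a b i has_derivative (\<lambda>h. \<Sum>c\<in>J. \<Sum>d\<in>J. - (B a c i x *
    frechet_derivative (A c d i) (at x) h * B d b i x))) (at x)"
    if "i \<in> I" "x \<in> S" for i x
  proof (rule matrix_inverse_has_derivative[OF J(1) Suc.prems(1,2) that(2), of "\<lambda>a b. B a b i"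
    "\<lambda>a b. A a b i"])
    show "(A a b i has_derivative frechet_derivative (A a b i) (at x)) (at x)"
      if "a \<in> J" "b \<in> J" for a b
      using Suc.prems(3)[OF that] \<open>i \<in> I\<close> \<open>x \<in> S\<close> by (intro has_derivative_openD[OF _ open_S]) auto
  qed (use that BA AB P_continuous[OF B] in blast)+
  show ?case
  proof (rule reg_SucI)
    show "P (B a b)" using B Suc.prems by blast
    show "B a b i differentiable at x" if "i \<in> I" "x \<in> S" for i x
      using der[OF that] by (auto simp: differentiable_def)
    show "rg k (\<lambda>i x. \<Sum>c\<in>J. \<Sum>d\<in>J. - (B a c i x * partial_deriv e (A c d i) x * B d b i x))"
      if "e \<in> Basis" for e
      using that Suc.prems by (intro reg_sum reg_uminus reg_mult IH reg_partial) auto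
    show "partial_deriv e (B a b i) x =
      (\<Sum>c\<in>J. \<Sum>d\<in>J. - (B a c i x * partial_deriv e (A c d i) x * B d b i x))"
      if "i \<in> I" "x \<in> S" "e \<in> Basis" for i x e
      using partial_deriv_eq[OF der[OF that(1,2)]] by (simp add: partial_deriv_def)
  qed
qed

text \<open>A nonvanishing function is a one by one invertible matrix, indexed by
  \<open>()\<close>.\<close>

lemma reg_inverse:
  assumes "rg k F" "P (\<lambda>i x. inverse (F i x))" "\<And>i x. i \<in> I \<Longrightarrow> x \<in> S \<Longrightarrow> F i x \<noteq> 0"
  shows "rg k (\<lambda>i x. inverse (F i x))"
  by (rule reg_matrix_inverse[of "{()}" "()" "()" k "\<lambda>_ _. F" "\<lambda>_ _ i x. inverse (F i x)"])
    (use assms in auto)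

end

section \<open>Functions of class \<open>C\<^sup>k\<close>\<close>

lemma regularity_continuous: "open S \<Longrightarrow> regularity (\<lambda>F. \<forall>i\<in>I. continuous_on S (F i)) I S"
proof unfold_locales
  fix F G :: "'b \<Rightarrow> 'a \<Rightarrow> real"
  assume F: "\<forall>i\<in>I. continuous_on S (F i)"
  then show "continuous_on S (F i)" if "i \<in> I" for i using that by blast
  {
    assume "\<And>i x. i \<in> I \<Longrightarrow> x \<in> S \<Longrightarrow> F i x = G i x"
    then have "continuous_on S (F i) \<longleftrightarrow> continuous_on S (G i)" if "i \<in> I" for i
      using that by (intro continuous_on_cong) auto
    then show "\<forall>i\<in>I. continuous_on S (G i)" using F by blast
  next
    assume G: "\<forall>i\<in>I. continuous_on S (G i)"
    show "\<forall>i\<in>I. continuous_on S (\<lambda>x. F i x + G i x)" "\<forall>i\<in>I. continuous_on S (\<lambda>x. F i x * G i x)"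
      using F G by (simp_all add: continuous_on_add continuous_on_mult)
  }
qed auto

lemma Ck_on_iff_reg:
  assumes "open S"
  shows "(\<forall>i\<in>I. Ck_on k S (F i)) \<longleftrightarrow> reg (\<lambda>F. \<forall>i\<in>I. continuous_on S (F i)) I S k F"
proof (induction k arbitrary: F)
  case (Suc k)
  show ?case by (auto simp: Ck_on_Suc Suc[symmetric] differentiable_imp_continuous_on)
qed simp

text \<open>A single function is a family over a one-element index set, so the algebra of the locale
  yields the calculus of \<open>Ck_on\<close>.\<close>

lemma Ck_on_iff_reg_unit:
  "open S \<Longrightarrow> Ck_on k S f \<longleftrightarrow> reg (\<lambda>F. \<forall>i\<in>{()}. continuous_on S (F i)) {()} S k (\<lambda>_. f)"
  using Ck_on_iff_reg[of S "{()}" k "\<lambda>_. f"] by simp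

lemma Ck_on_const: "Ck_on k S (\<lambda>_::'v::euclidean_space. c)"
proof (induction k arbitrary: c)
  case (Suc k)
  have "partial_deriv b (\<lambda>_::'v. c) = (\<lambda>_. 0)" for b by (simp add: partial_deriv_def fun_eq_iff)
  then show ?case using Suc by (simp add: Ck_on_Suc)
qed simp

lemma Ck_on_bounded_linear: "bounded_linear L \<Longrightarrow> Ck_on k S L"
proof (cases k)
  case (Suc j)
  assume L: "bounded_linear L"
  have "partial_deriv b L = (\<lambda>_. L b)" for b
    using partial_deriv_eq[OF bounded_linear_imp_has_derivative[OF L]] by (simp add: fun_eq_iff)
  then show ?thesis using L Suc
    by (simp add: Ck_on_Suc Ck_on_const bounded_linear_imp_differentiable_on)
qed (simp add: linear_continuous_on)

lemma Ck_on_id: "Ck_on k S (\<lambda>x. x)"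
  by (rule Ck_on_bounded_linear) (rule bounded_linear_ident)

lemma Ck_on_mult:
  fixes f g :: "'v::euclidean_space \<Rightarrow> real"
  assumes "open S" "Ck_on k S f" "Ck_on k S g"
  shows "Ck_on k S (\<lambda>x. f x * g x)"
  using assms regularity.reg_mult[OF regularity_continuous[OF assms(1)], of "{()}" k "\<lambda>_. f" "\<lambda>_. g"]
  by (simp add: Ck_on_iff_reg_unit)

lemma Ck_on_sum_real:
  fixes f :: "'j \<Rightarrow> 'v::euclidean_space \<Rightarrow> real"
  assumes "open S" "\<And>j. j \<in> J \<Longrightarrow> Ck_on k S (f j)"
  shows "Ck_on k S (\<lambda>x. \<Sum>j\<in>J. f j x)"
  using assms regularity.reg_sum[OF regularity_continuous[OF assms(1)], of J "{()}" k "\<lambda>j _. f j"]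
  by (simp add: Ck_on_iff_reg_unit)

lemma Ck_on_sum:
  fixes f :: "'j \<Rightarrow> 'v::euclidean_space \<Rightarrow> 'w::euclidean_space"
  assumes "open S" "\<And>j. j \<in> J \<Longrightarrow> Ck_on k S (f j)"
  shows "Ck_on k S (\<lambda>x. \<Sum>j\<in>J. f j x)"
  unfolding Ck_on_componentwise[OF assms(1), of k "\<lambda>x. \<Sum>j\<in>J. f j x"] inner_sum_left
proof (intro ballI Ck_on_sum_real[OF assms(1)])
  show "Ck_on k S (\<lambda>x. f j x \<bullet> a)" if "j \<in> J" "a \<in> Basis" for j a
    using assms(2)[OF that(1)] that(2) Ck_on_componentwise[OF assms(1), of k "f j"] by blast
qed

lemma Ck_on_scaleR:
  fixes f :: "'v::euclidean_space \<Rightarrow> real" and g :: "'v \<Rightarrow> 'w::euclidean_space"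
  assumes "open S" "Ck_on k S f" "Ck_on k S g"
  shows "Ck_on k S (\<lambda>x. f x *\<^sub>R g x)"
  unfolding Ck_on_componentwise[OF assms(1), of k "\<lambda>x. f x *\<^sub>R g x"] inner_scaleR_left
proof (intro ballI Ck_on_mult[OF assms(1,2)])
  show "Ck_on k S (\<lambda>x. g x \<bullet> a)" if "a \<in> Basis" for a
    using assms(3) that Ck_on_componentwise[OF assms(1), of k g] by blast
qed

lemma Ck_on_add:
  fixes f g :: "'v::euclidean_space \<Rightarrow> 'w::euclidean_space"
  assumes "open S" "Ck_on k S f" "Ck_on k S g"
  shows "Ck_on k S (\<lambda>x. f x + g x)"
  using Ck_on_sum[OF assms(1), of "UNIV::bool set" k "\<lambda>b. if b then f else g"] assms
  by (simp add: UNIV_bool add.commute)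

lemma Ck_on_uminus:
  fixes f :: "'v::euclidean_space \<Rightarrow> 'w::euclidean_space"
  assumes "open S" "Ck_on k S f"
  shows "Ck_on k S (\<lambda>x. - f x)"
  using Ck_on_scaleR[OF assms(1) Ck_on_const[of k S "-1"] assms(2)] by simp

lemma Ck_on_diff:
  fixes f g :: "'v::euclidean_space \<Rightarrow> 'w::euclidean_space"
  assumes "open S" "Ck_on k S f" "Ck_on k S g"
  shows "Ck_on k S (\<lambda>x. f x - g x)"
  using Ck_on_add[OF assms(1,2) Ck_on_uminus[OF assms(1,3)]] by simp

lemma Ck_on_inverse:
  fixes f :: "'v::euclidean_space \<Rightarrow> real"
  assumes "open S" "Ck_on k S f" "\<And>x. x \<in> S \<Longrightarrow> f x \<noteq> 0"
  shows "Ck_on k S (\<lambda>x. inverse (f x))"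
  using assms Ck_on_continuous[OF assms(2)]
    regularity.reg_inverse[OF regularity_continuous[OF assms(1)], of "{()}" k "\<lambda>_. f"]
  by (simp add: Ck_on_iff_reg_unit continuous_on_inverse)

lemma Ck_on_matrix_inverse:
  fixes A B :: "'j \<Rightarrow> 'j \<Rightarrow> 'v::euclidean_space \<Rightarrow> real"
  assumes S: "open S" and J: "finite J" "a \<in> J" "b \<in> J"
    and A: "\<And>a b. a \<in> J \<Longrightarrow> b \<in> J \<Longrightarrow> Ck_on k S (A a b)"
    and B: "\<And>a b. a \<in> J \<Longrightarrow> b \<in> J \<Longrightarrow> continuous_on S (B a b)"
    and BA: "\<And>y a d. y \<in> S \<Longrightarrow> a \<in> J \<Longrightarrow> d \<in> J \<Longrightarrow>
      (\<Sum>c\<in>J. B a c y * A c d y) = (if a = d then 1 else 0)"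
    and AB: "\<And>y c b. y \<in> S \<Longrightarrow> c \<in> J \<Longrightarrow> b \<in> J \<Longrightarrow>
      (\<Sum>d\<in>J. A c d y * B d b y) = (if c = b then 1 else 0)"
  shows "Ck_on k S (B a b)"
  unfolding Ck_on_iff_reg_unit[OF S]
  by (rule regularity.reg_matrix_inverse[OF regularity_continuous[OF S] J, where A="\<lambda>a b _. A a b"
    and B="\<lambda>a b _. B a b"])
    (use A B BA AB Ck_on_iff_reg_unit[OF S] in auto)

lemma Ck_on_frechet_derivative:
  fixes f :: "'v::euclidean_space \<Rightarrow> 'w::euclidean_space"
  assumes "open S" "Ck_on (Suc k) S f"
  shows "Ck_on k S (\<lambda>y. frechet_derivative f (at y) v)"
proof -
  have "Ck_on k S (\<lambda>y. \<Sum>b\<in>Basis. (v \<bullet> b) *\<^sub>R partial_deriv b f y)"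
    using assms by (intro Ck_on_sum Ck_on_scaleR Ck_on_const) (auto simp: Ck_on_Suc)
  moreover have "f differentiable (at y)" if "y \<in> S" for y
    using assms that by (auto simp: Ck_on_Suc intro: differentiable_on_openD)
  ultimately show ?thesis by (subst Ck_on_cong[OF assms(1)]) (auto simp: frechet_derivative_eq_sum)
qed

section \<open>The chain rule and compositions\<close>

lemma partial_deriv_compose:
  fixes F :: "'v::euclidean_space \<Rightarrow> 'w::real_normed_vector"
  assumes "\<phi> differentiable (at x)" "F differentiable (at (\<phi> x))"
  shows "partial_deriv b (\<lambda>x. F (\<phi> x)) x =
    (\<Sum>a\<in>Basis. (partial_deriv b \<phi> x \<bullet> a) *\<^sub>R partial_deriv a F (\<phi> x))"
proof -
  have "((\<lambda>x. F (\<phi> x)) has_derivative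
      (\<lambda>h. frechet_derivative F (at (\<phi> x)) (frechet_derivative \<phi> (at x) h))) (at x)"
    using diff_chain_at[OF frechet_derivative_works[THEN iffD1, OF assms(1)]
        frechet_derivative_works[THEN iffD1, OF assms(2)]] by (simp add: o_def)
  from partial_deriv_eq[OF this] show ?thesis
    by (simp add: frechet_derivative_eq_sum[OF assms(2)]) (simp add: partial_deriv_def)
qed

lemma Ck_on_compose:
  fixes F :: "'v::euclidean_space \<Rightarrow> 'w::euclidean_space" and \<phi> :: "'u::euclidean_space \<Rightarrow> 'v"
  assumes "open U" "open V" "Ck_on k U \<phi>" "Ck_on k V F" "\<And>x. x \<in> U \<Longrightarrow> \<phi> x \<in> V"
  shows "Ck_on k U (\<lambda>x. F (\<phi> x))"
  using assms(3,4)
proof (induction k arbitrary: F)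
  case 0
  then show ?case using assms(5)
    by (auto intro!: continuous_on_compose2[of V F U \<phi>])
next
  case (Suc k)
  have \<phi>: "\<phi> differentiable (at x)" if "x \<in> U" for x
    using Suc.prems that assms by (auto simp: Ck_on_Suc intro: differentiable_on_openD)
  have F: "F differentiable (at x)" if "x \<in> V" for x
    using Suc.prems that assms by (auto simp: Ck_on_Suc intro: differentiable_on_openD)
  have "(\<lambda>x. F (\<phi> x)) differentiable (at x)" if "x \<in> U" for x
    using \<phi>[OF that] F[OF assms(5)[OF that]] differentiable_chain_at[of \<phi> x F] by (simp add: o_def)
  moreover have "Ck_on k U (partial_deriv b (\<lambda>x. F (\<phi> x)))" if "b \<in> Basis" for b
  proof -
    have "Ck_on k U (\<lambda>x. \<Sum>a\<in>Basis. (partial_deriv b \<phi> x \<bullet> a) *\<^sub>R partial_deriv a F (\<phi> x))"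
    proof (intro Ck_on_sum Ck_on_scaleR assms(1))
      fix a :: 'v assume a: "a \<in> Basis"
      show "Ck_on k U (\<lambda>x. partial_deriv b \<phi> x \<bullet> a)"
        using Suc.prems(1) that a Ck_on_componentwise[OF assms(1), of k "partial_deriv b \<phi>"]
        by (simp add: Ck_on_Suc)
      show "Ck_on k U (\<lambda>x. partial_deriv a F (\<phi> x))"
        using Suc.prems a Ck_on_mono[OF Suc.prems(1), of k] by (intro Suc.IH) (auto simp: Ck_on_Suc)
    qed
    then show ?thesis
      by (subst Ck_on_cong[OF assms(1)]) (auto simp: partial_deriv_compose \<phi> F assms(5))
  qed
  ultimately show ?case by (simp add: Ck_on_Suc differentiable_on_eq_differentiable_at[OF assms(1)])
qed


subsection \<open>Symmetry of second derivatives\<close>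

lemma has_real_derivative_line:
  fixes f :: "'v::euclidean_space \<Rightarrow> real"
  assumes "f differentiable (at (p + t *\<^sub>R v))"
  shows "((\<lambda>t. f (p + t *\<^sub>R v)) has_real_derivative frechet_derivative f (at (p + t *\<^sub>R v)) v) (at t)"
proof -
  let ?D = "frechet_derivative f (at (p + t *\<^sub>R v))"
  have "((\<lambda>t. p + t *\<^sub>R v) has_derivative (\<lambda>h. h *\<^sub>R v)) (at t)"
    by (auto intro!: derivative_eq_intros)
  from diff_chain_at[OF this] assms have
    "((\<lambda>t. f (p + t *\<^sub>R v)) has_derivative (\<lambda>h. ?D (h *\<^sub>R v))) (at t)"
    using frechet_derivative_works by (auto simp: o_def)
  moreover have "?D (h *\<^sub>R v) = ?D v * h" for h
    using linear_frechet_derivative[OF assms] by (simp add: linear_cmul)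
  ultimately show ?thesis by (simp add: has_field_derivative_def)
qed

text \<open>Two applications of the mean value theorem, along \<open>v\<close> and then along
  \<open>u\<close>, turn the second difference into a mixed second derivative. The second difference
  is unchanged when \<open>u\<close> and \<open>v\<close> are swapped, which is what forces the two
  mixed derivatives to agree.\<close>

lemma second_difference_mean_value:
  fixes f :: "'v::euclidean_space \<Rightarrow> real"
  assumes S: "open S" "Ck_on 2 S f" and s: "0 < s"
    and ball: "ball x d \<subseteq> S" and d: "s * (norm u + norm v) < d"
  obtains y where "y \<in> ball x d"
    "f (x + s *\<^sub>R u + s *\<^sub>R v) - f (x + s *\<^sub>R u) - f (x + s *\<^sub>R v) + f x =
       s * (s * frechet_derivative (\<lambda>y. frechet_derivative f (at y) v) (at y) u)"
proof -
  let ?fv = "\<lambda>y. frechet_derivative f (at y) v"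
  have fv: "?fv differentiable (at y)" if "y \<in> S" for y
    using Ck_on_frechet_derivative[OF S(1), of 1 f v] S that
    by (auto simp: Ck_on_Suc numeral_2_eq_2 intro: differentiable_on_openD)
  have f: "f differentiable (at y)" if "y \<in> S" for y
    using S that by (auto simp: Ck_on_Suc numeral_2_eq_2 intro: differentiable_on_openD)
  have in_ball: "x + a *\<^sub>R u + b *\<^sub>R v \<in> ball x d" if "0 \<le> a" "a \<le> s" "0 \<le> b" "b \<le> s" for a b
  proof -
    have "norm (a *\<^sub>R u + b *\<^sub>R v) \<le> a * norm u + b * norm v"
      using norm_triangle_ineq[of "a *\<^sub>R u" "b *\<^sub>R v"] that by simp
    also have "\<dots> \<le> s * norm u + s * norm v" using that by (intro add_mono mult_right_mono) auto
    finally show ?thesis using d by (simp add: dist_norm norm_minus_commute algebra_simps)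
  qed
  have in_S: "x + a *\<^sub>R u + b *\<^sub>R v \<in> S" if "0 \<le> a" "a \<le> s" "0 \<le> b" "b \<le> s" for a b
    using in_ball[OF that] ball by blast
  define \<phi> where "\<phi> = (\<lambda>t. f ((x + s *\<^sub>R u) + t *\<^sub>R v) - f (x + t *\<^sub>R v))"
  have "\<exists>z>0. z < s \<and> \<phi> s - \<phi> 0 = (s - 0) * (?fv ((x + s *\<^sub>R u) + z *\<^sub>R v) - ?fv (x + z *\<^sub>R v))"
  proof (rule MVT2[OF s])
    fix t :: real assume t: "0 \<le> t" "t \<le> s"
    show "(\<phi> has_real_derivative ?fv (x + s *\<^sub>R u + t *\<^sub>R v) - ?fv (x + t *\<^sub>R v)) (at t)"
      unfolding \<phi>_def using in_S[of 0 t] in_S[of s t] t s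
      by (intro DERIV_diff has_real_derivative_line f) auto
  qed
  then obtain z where z: "0 < z" "z < s"
    "\<phi> s - \<phi> 0 = s * (?fv (x + s *\<^sub>R u + z *\<^sub>R v) - ?fv (x + z *\<^sub>R v))" by auto
  have "\<exists>w>0. w < s \<and> ?fv ((x + z *\<^sub>R v) + s *\<^sub>R u) - ?fv ((x + z *\<^sub>R v) + 0 *\<^sub>R u) =
      (s - 0) * frechet_derivative ?fv (at ((x + z *\<^sub>R v) + w *\<^sub>R u)) u"
  proof (rule MVT2[OF s])
    fix t :: real assume t: "0 \<le> t" "t \<le> s"
    show "((\<lambda>t. ?fv (x + z *\<^sub>R v + t *\<^sub>R u)) has_real_derivative
        frechet_derivative ?fv (at (x + z *\<^sub>R v + t *\<^sub>R u)) u) (at t)"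
      using in_S[of t z] t z by (intro has_real_derivative_line fv) (auto simp: add_ac)
  qed
  then obtain w where w: "0 < w" "w < s"
    "?fv ((x + z *\<^sub>R v) + s *\<^sub>R u) - ?fv (x + z *\<^sub>R v) =
      s * frechet_derivative ?fv (at (x + z *\<^sub>R v + w *\<^sub>R u)) u"
    by auto
  have "x + z *\<^sub>R v + w *\<^sub>R u \<in> ball x d" using in_ball[of w z] z w by (simp add: add_ac)
  moreover have "f (x + s *\<^sub>R u + s *\<^sub>R v) - f (x + s *\<^sub>R u) - f (x + s *\<^sub>R v) + f x = \<phi> s - \<phi> 0"
    by (simp add: \<phi>_def)
  ultimately show ?thesis using that z(3) w(3) by (simp add: add_ac)
qed

lemma second_derivative_symmetric_real:
  fixes f :: "'v::euclidean_space \<Rightarrow> real"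
  assumes S: "open S" "Ck_on 2 S f" "x \<in> S"
  shows "frechet_derivative (\<lambda>y. frechet_derivative f (at y) v) (at x) u =
         frechet_derivative (\<lambda>y. frechet_derivative f (at y) u) (at x) v"
proof (rule ccontr)
  define g where "g = (\<lambda>u v y. frechet_derivative (\<lambda>y. frechet_derivative f (at y) v) (at y) u)"
  assume "\<not> ?thesis"
  then have ne: "g u v x \<noteq> g v u x" by (simp add: g_def)
  \<comment> \<open>Half of the gap: both mixed derivatives at \<open>x\<close> come within less
    than \<open>e\<close> of one and the same number, which the gap rules out.\<close>
  define e where "e = \<bar>g u v x - g v u x\<bar> / 2"
  have e: "e > 0" using ne by (simp add: e_def)
  have cont: "continuous_on S (g u v)" for u v
    using Ck_on_frechet_derivative[OF S(1) Ck_on_frechet_derivative[OF S(1), of "Suc 0"], of f v u] S(2)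
    by (simp add: g_def numeral_2_eq_2)
  have "\<exists>d>0. \<forall>y\<in>S. dist y x < d \<longrightarrow> dist (g u v y) (g u v x) < e" for u v
    using cont[of u v] S(3) e unfolding continuous_on_iff by blast
  from this[of u v] this[of v u] obtain d1 d2 where d: "d1 > 0" "d2 > 0"
    "\<And>y. y \<in> S \<Longrightarrow> dist y x < d1 \<Longrightarrow> dist (g u v y) (g u v x) < e"
    "\<And>y. y \<in> S \<Longrightarrow> dist y x < d2 \<Longrightarrow> dist (g v u y) (g v u x) < e" by blast
  obtain d0 where d0: "d0 > 0" "ball x d0 \<subseteq> S" using S openE by blast
  define d' where "d' = min d0 (min d1 d2)"
  have d': "d' > 0" "ball x d' \<subseteq> S" using d d0 by (auto simp: d'_def)
  \<comment> \<open>With this choice the parallelogram with sides s u and s v lies in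
    \<open>ball x d'\<close>. The summand 1 covers the case that \<open>u\<close> and
    \<open>v\<close> are both 0.\<close>
  define s where "s = d' / (2 * (norm u + norm v + 1))"
  have s: "s > 0" using d' by (simp add: s_def add_nonneg_pos)
  have "s * (norm u + norm v) \<le> s * (norm u + norm v + 1)" using s by simp
  also have "\<dots> = d' / 2"
    unfolding s_def using norm_ge_zero[of u] norm_ge_zero[of v]
      by (simp add: field_simps add_nonneg_eq_0_iff)
  finally have "s * (norm u + norm v) < d'" "s * (norm v + norm u) < d'"
    using d' by (auto simp: add.commute)
  note lt = this
  obtain y where y: "y \<in> ball x d'"
    "f (x + s *\<^sub>R u + s *\<^sub>R v) - f (x + s *\<^sub>R u) - f (x + s *\<^sub>R v) + f x = s * (s * g u v y)"
    using second_difference_mean_value[OF S(1,2) s d'(2) lt(1)] unfolding g_def .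
  obtain y' where y': "y' \<in> ball x d'"
    "f (x + s *\<^sub>R v + s *\<^sub>R u) - f (x + s *\<^sub>R v) - f (x + s *\<^sub>R u) + f x = s * (s * g v u y')"
    using second_difference_mean_value[OF S(1,2) s d'(2) lt(2)] unfolding g_def .
  have "x + s *\<^sub>R v + s *\<^sub>R u = x + s *\<^sub>R u + s *\<^sub>R v" by (simp add: add_ac)
  then have "s * (s * g u v y) = s * (s * g v u y')" using y(2) y'(2) by (simp add: algebra_simps)
  then have "g u v y = g v u y'" using s by simp
  moreover have "y \<in> S" "y' \<in> S" "dist y x < d1" "dist y' x < d2"
    using y(1) y'(1) d'(2) by (auto simp: d'_def dist_commute)
  then have "dist (g u v y) (g u v x) < e" "dist (g v u y') (g v u x) < e"
    using d(3,4) by blast+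
  moreover have "\<bar>g u v x - g v u x\<bar> \<le> \<bar>g u v y - g u v x\<bar> + \<bar>g u v y - g v u x\<bar>" by linarith
  ultimately show False unfolding e_def dist_real_def by simp
qed

lemma frechet_derivative_inner:
  fixes f :: "'v::euclidean_space \<Rightarrow> 'w::real_inner"
  assumes "f differentiable (at x)"
  shows "frechet_derivative (\<lambda>x. f x \<bullet> a) (at x) u = frechet_derivative f (at x) u \<bullet> a"
  using partial_deriv_inner[of f x u a] assms by (simp add: partial_deriv_def)

lemma second_derivative_symmetric:
  fixes f :: "'v::euclidean_space \<Rightarrow> 'w::euclidean_space"
  assumes S: "open S" "Ck_on 2 S f" "x \<in> S"
  shows "frechet_derivative (\<lambda>y. frechet_derivative f (at y) v) (at x) u =
         frechet_derivative (\<lambda>y. frechet_derivative f (at y) u) (at x) v"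
proof (rule euclidean_eqI)
  fix a :: 'w assume a: "a \<in> Basis"
  have f: "f differentiable (at y)" if "y \<in> S" for y
    using S that by (auto simp: Ck_on_Suc numeral_2_eq_2 intro: differentiable_on_openD)
  have fv: "(\<lambda>y. frechet_derivative f (at y) v) differentiable (at y)" if "y \<in> S" for y v
    using Ck_on_frechet_derivative[OF S(1), of 1 f v] S that
    by (auto simp: Ck_on_Suc numeral_2_eq_2 intro: differentiable_on_openD)
  have "frechet_derivative (\<lambda>y. frechet_derivative f (at y) v) (at x) u \<bullet> a =
      frechet_derivative (\<lambda>y. frechet_derivative (\<lambda>y. f y \<bullet> a) (at y) v) (at x) u" for u v
    unfolding frechet_derivative_inner[OF fv[OF S(3)], symmetric]
    by (intro fun_cong[OF frechet_derivative_cong_open[OF S(1,3)]])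
      (simp add: frechet_derivative_inner[OF f])
  moreover have "Ck_on 2 S (\<lambda>y. f y \<bullet> a)" using S a Ck_on_componentwise[of S 2 f] by blast
  ultimately show "frechet_derivative (\<lambda>y. frechet_derivative f (at y) v) (at x) u \<bullet> a =
      frechet_derivative (\<lambda>y. frechet_derivative f (at y) u) (at x) v \<bullet> a"
    using second_derivative_symmetric_real[OF S(1) _ S(3)] by simp
qed


section \<open>Uniform Hoelder bounds\<close>

text \<open>One constant bounds the values and the increments of all members at once. Continuity is
  listed separately, since for \<open>\<alpha>\<close> = 0 the increment condition only bounds the
  oscillation.\<close>

definition hoelder_bound :: "real \<Rightarrow> 'i set \<Rightarrow> 'v::euclidean_space set \<Rightarrow> ('i \<Rightarrow> 'v \<Rightarrow> real) \<Rightarrow> bool" where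
  "hoelder_bound \<alpha> I S F \<longleftrightarrow> (\<exists>C. \<forall>i\<in>I. continuous_on S (F i) \<and> (\<forall>x\<in>S. \<bar>F i x\<bar> \<le> C) \<and>
     (\<forall>x\<in>S. \<forall>y\<in>S. \<bar>F i x - F i y\<bar> \<le> C * dist x y powr \<alpha>))"

lemma hoelder_boundE:
  assumes "hoelder_bound \<alpha> I S F"
  obtains C where "C \<ge> 0" "\<And>i. i \<in> I \<Longrightarrow> continuous_on S (F i)"
    "\<And>i x. i \<in> I \<Longrightarrow> x \<in> S \<Longrightarrow> \<bar>F i x\<bar> \<le> C"
    "\<And>i x y. i \<in> I \<Longrightarrow> x \<in> S \<Longrightarrow> y \<in> S \<Longrightarrow> \<bar>F i x - F i y\<bar> \<le> C * dist x y powr \<alpha>"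
proof -
  obtain C where C: "\<forall>i\<in>I. continuous_on S (F i) \<and> (\<forall>x\<in>S. \<bar>F i x\<bar> \<le> C) \<and>
     (\<forall>x\<in>S. \<forall>y\<in>S. \<bar>F i x - F i y\<bar> \<le> C * dist x y powr \<alpha>)"
    using assms unfolding hoelder_bound_def by blast
  show ?thesis
  proof (rule that[of "max C 0"])
    fix i x y assume i: "i \<in> I" "x \<in> S" "y \<in> S"
    have "C * dist x y powr \<alpha> \<le> max C 0 * dist x y powr \<alpha>"
      by (intro mult_right_mono) auto
    moreover have "\<bar>F i x - F i y\<bar> \<le> C * dist x y powr \<alpha>" using C i by blast
    ultimately show "\<bar>F i x - F i y\<bar> \<le> max C 0 * dist x y powr \<alpha>" by linarith
  qed (use C in \<open>auto simp: max.coboundedI1\<close>)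
qed

lemma hoelder_boundI:
  assumes "\<And>i. i \<in> I \<Longrightarrow> continuous_on S (F i)"
    "\<And>i x. i \<in> I \<Longrightarrow> x \<in> S \<Longrightarrow> \<bar>F i x\<bar> \<le> C1"
    "\<And>i x y. i \<in> I \<Longrightarrow> x \<in> S \<Longrightarrow> y \<in> S \<Longrightarrow> \<bar>F i x - F i y\<bar> \<le> C2 * dist x y powr \<alpha>"
  shows "hoelder_bound \<alpha> I S F"
  unfolding hoelder_bound_def
proof (intro exI[of _ "max C1 C2"] ballI conjI)
  fix i x y assume i: "i \<in> I" "x \<in> S" "y \<in> S"
  have "C2 * dist x y powr \<alpha> \<le> max C1 C2 * dist x y powr \<alpha>" by (intro mult_right_mono) auto
  then show "\<bar>F i x - F i y\<bar> \<le> max C1 C2 * dist x y powr \<alpha>" using assms(3)[OF i] by linarith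
qed (use assms in \<open>auto simp: max.coboundedI1\<close>)

lemma regularity_hoelder:
  assumes "open S"
  shows "regularity (hoelder_bound \<alpha> I S) I S"
proof
  fix F G :: "'b \<Rightarrow> 'a \<Rightarrow> real"
  assume F: "hoelder_bound \<alpha> I S F"
  then obtain C where C: "C \<ge> 0" "\<And>i. i \<in> I \<Longrightarrow> continuous_on S (F i)"
    "\<And>i x. i \<in> I \<Longrightarrow> x \<in> S \<Longrightarrow> \<bar>F i x\<bar> \<le> C"
    "\<And>i x y. i \<in> I \<Longrightarrow> x \<in> S \<Longrightarrow> y \<in> S \<Longrightarrow> \<bar>F i x - F i y\<bar> \<le> C * dist x y powr \<alpha>"
    using hoelder_boundE by blast
  {
    assume "\<And>i x. i \<in> I \<Longrightarrow> x \<in> S \<Longrightarrow> F i x = G i x"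
    then show "hoelder_bound \<alpha> I S G"
      by (intro hoelder_boundI[where ?C1.0=C and ?C2.0=C])
        (use C in \<open>simp_all cong: continuous_on_cong\<close>)
  next
    assume "hoelder_bound \<alpha> I S G"
    then obtain D where D: "D \<ge> 0" "\<And>i. i \<in> I \<Longrightarrow> continuous_on S (G i)"
      "\<And>i x. i \<in> I \<Longrightarrow> x \<in> S \<Longrightarrow> \<bar>G i x\<bar> \<le> D"
      "\<And>i x y. i \<in> I \<Longrightarrow> x \<in> S \<Longrightarrow> y \<in> S \<Longrightarrow> \<bar>G i x - G i y\<bar> \<le> D * dist x y powr \<alpha>"
      using hoelder_boundE by blast
    show "hoelder_bound \<alpha> I S (\<lambda>i x. F i x + G i x)"
    proof (rule hoelder_boundI[where ?C1.0="C + D" and ?C2.0="C + D"])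
      fix i x y assume i: "i \<in> I" "x \<in> S" "y \<in> S"
      show "\<bar>F i x + G i x\<bar> \<le> C + D" using C(3)[OF i(1,2)] D(3)[OF i(1,2)] by linarith
      show "\<bar>F i x + G i x - (F i y + G i y)\<bar> \<le> (C + D) * dist x y powr \<alpha>"
        using C(4)[OF i] D(4)[OF i] by (simp add: algebra_simps)
    qed (use C D in \<open>auto intro: continuous_intros\<close>)
    show "hoelder_bound \<alpha> I S (\<lambda>i x. F i x * G i x)"
    proof (rule hoelder_boundI[where ?C1.0="C * D" and ?C2.0="2 * C * D"])
      fix i x y assume i: "i \<in> I" "x \<in> S" "y \<in> S"
      show "\<bar>F i x * G i x\<bar> \<le> C * D"
        unfolding abs_mult using C(1) C(3)[OF i(1,2)] D(3)[OF i(1,2)] by (intro mult_mono) auto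
      have "F i x * G i x - F i y * G i y = F i x * (G i x - G i y) + (F i x - F i y) * G i y"
        by (simp add: algebra_simps)
      also have "\<bar>\<dots>\<bar> \<le> \<bar>F i x\<bar> * \<bar>G i x - G i y\<bar> + \<bar>F i x - F i y\<bar> * \<bar>G i y\<bar>"
        unfolding abs_mult[symmetric] by (rule abs_triangle_ineq)
      also have "\<dots> \<le> C * (D * dist x y powr \<alpha>) + (C * dist x y powr \<alpha>) * D"
        using C(1) D(1) C(3)[OF i(1,2)] D(3)[OF i(1,3)] C(4)[OF i] D(4)[OF i]
        by (intro add_mono mult_mono) auto
      finally show "\<bar>F i x * G i x - F i y * G i y\<bar> \<le> 2 * C * D * dist x y powr \<alpha>"
        by (simp add: algebra_simps)
    qed (use C D in \<open>auto intro: continuous_intros\<close>)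
  next
    show "continuous_on S (F i)" if "i \<in> I" for i using C that by blast
  }
next
  show "hoelder_bound \<alpha> I S (\<lambda>_ _. c)" for c
    by (rule hoelder_boundI[where ?C1.0="\<bar>c\<bar>" and ?C2.0=0]) auto
qed (rule assms)

lemma hoelder_bound_const_family: "(\<And>i. i \<in> I \<Longrightarrow> \<bar>c i\<bar> \<le> K) \<Longrightarrow> hoelder_bound \<alpha> I S (\<lambda>i _. c i)"
  by (rule hoelder_boundI[where ?C1.0=K and ?C2.0=0]) auto

text \<open>By the identity B(x) - B(y) = B(x) (A(y) - A(x)) B(y), increments of \<open>B\<close>
  are at most K^2 times sums of increments of \<open>A\<close>. Apart from being the inverse of
  \<open>A\<close>, all that has to be known of \<open>B\<close> is therefore the uniform bound
  \<open>K\<close>.\<close>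

lemma hoelder_bound_matrix_inverse:
  fixes A B :: "'j \<Rightarrow> 'j \<Rightarrow> 'i \<Rightarrow> 'v::euclidean_space \<Rightarrow> real"
  assumes S: "open S" and J: "finite J" "a \<in> J" "b \<in> J"
    and A: "\<And>a b. a \<in> J \<Longrightarrow> b \<in> J \<Longrightarrow> hoelder_bound \<alpha> I S (A a b)"
    and B: "\<And>a b i x. a \<in> J \<Longrightarrow> b \<in> J \<Longrightarrow> i \<in> I \<Longrightarrow> x \<in> S \<Longrightarrow> \<bar>B a b i x\<bar> \<le> K"
    and BA: "\<And>i y a d. i \<in> I \<Longrightarrow> y \<in> S \<Longrightarrow> a \<in> J \<Longrightarrow> d \<in> J \<Longrightarrow>
      (\<Sum>c\<in>J. B a c i y * A c d i y) = (if a = d then 1 else 0)"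
    and AB: "\<And>i y c b. i \<in> I \<Longrightarrow> y \<in> S \<Longrightarrow> c \<in> J \<Longrightarrow> b \<in> J \<Longrightarrow>
      (\<Sum>d\<in>J. A c d i y * B d b i y) = (if c = b then 1 else 0)"
  shows "hoelder_bound \<alpha> I S (B a b)"
proof -
  interpret R: regularity "hoelder_bound \<alpha> I S" I S by (rule regularity_hoelder[OF S])
  have "\<exists>C. \<forall>i\<in>I. \<forall>x\<in>S. \<forall>y\<in>S. \<bar>A c d i x - A c d i y\<bar> \<le> C * dist x y powr \<alpha>"
    if "c \<in> J" "d \<in> J" for c d
    using hoelder_boundE[OF A[OF that]] by metis
  then obtain C where C: "\<And>c d i x y. c \<in> J \<Longrightarrow> d \<in> J \<Longrightarrow> i \<in> I \<Longrightarrow> x \<in> S \<Longrightarrow> y \<in> S \<Longrightarrow>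
      \<bar>A c d i x - A c d i y\<bar> \<le> C c d * dist x y powr \<alpha>" by metis
  have le: "\<bar>B a b i x - B a b i y\<bar> \<le> (\<Sum>c\<in>J. \<Sum>d\<in>J. K * \<bar>A c d i y - A c d i x\<bar> * K)"
    if i: "i \<in> I" "x \<in> S" "y \<in> S" for i x y
  proof -
    have K: "K \<ge> 0" using B[OF J(2,3) i(1,2)] by linarith
    have "B a b i x - B a b i y = (\<Sum>c\<in>J. \<Sum>d\<in>J. B a c i x * (A c d i y - A c d i x) * B d b i y)"
      by (rule R.matrix_inverse_difference[OF J, of "\<lambda>a b. B a b i" x "\<lambda>a b. A a b i" y])
        (use BA AB i in auto)
    also have "\<bar>\<dots>\<bar> \<le> (\<Sum>c\<in>J. \<Sum>d\<in>J. \<bar>B a c i x * (A c d i y - A c d i x) * B d b i y\<bar>)"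
      by (intro order_trans[OF sum_abs] sum_mono sum_abs)
    also have "\<dots> \<le> (\<Sum>c\<in>J. \<Sum>d\<in>J. K * \<bar>A c d i y - A c d i x\<bar> * K)"
      unfolding abs_mult using K B i J by (intro sum_mono mult_mono) auto
    finally show ?thesis .
  qed
  show ?thesis
  proof (rule hoelder_boundI)
    fix i assume i: "i \<in> I"
    show "continuous_on S (B a b i)" unfolding continuous_on_def
    proof
      fix x assume x: "x \<in> S"
      have "((\<lambda>y. \<Sum>c\<in>J. \<Sum>d\<in>J. K * \<bar>A c d i y - A c d i x\<bar> * K) \<longlongrightarrow>
          (\<Sum>c\<in>J. \<Sum>d\<in>J. K * \<bar>A c d i x - A c d i x\<bar> * K)) (at x within S)"
      proof (intro tendsto_intros)
        show "((\<lambda>y. A c d i y) \<longlongrightarrow> A c d i x) (at x within S)" if "c \<in> J" "d \<in> J" for c d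
          using R.P_continuous[OF A[OF that] i] x by (simp add: continuous_on_def)
      qed
      then have "((\<lambda>y. \<Sum>c\<in>J. \<Sum>d\<in>J. K * \<bar>A c d i y - A c d i x\<bar> * K) \<longlongrightarrow> 0) (at x within S)" by simp
      then have "((\<lambda>y. B a b i y - B a b i x) \<longlongrightarrow> 0) (at x within S)"
        by (rule Lim_null_comparison[rotated])
          (use le[OF i x] in \<open>auto simp: eventually_at_filter abs_minus_commute[of _ "B a b i x"]\<close>)
      then show "(B a b i \<longlongrightarrow> B a b i x) (at x within S)" by (simp add: LIM_zero_iff)
    qed
    fix x y assume x: "x \<in> S" "y \<in> S"
    show "\<bar>B a b i x\<bar> \<le> K" using B[OF J(2,3) i x(1)] .
    have K: "K \<ge> 0" using B[OF J(2,3) i x(1)] by linarith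
    have "(\<Sum>c\<in>J. \<Sum>d\<in>J. K * \<bar>A c d i y - A c d i x\<bar> * K) \<le>
        (\<Sum>c\<in>J. \<Sum>d\<in>J. K * (C c d * dist x y powr \<alpha>) * K)"
      using C[OF _ _ i x(2) x(1)] K by (intro sum_mono mult_right_mono mult_left_mono)
        (auto simp: dist_commute)
    also have "\<dots> = (\<Sum>c\<in>J. \<Sum>d\<in>J. K * C c d * K) * dist x y powr \<alpha>"
      unfolding sum_distrib_right by (intro sum.cong refl) (simp add: mult_ac)
    finally show "\<bar>B a b i x - B a b i y\<bar> \<le> (\<Sum>c\<in>J. \<Sum>d\<in>J. K * C c d * K) * dist x y powr \<alpha>"
      using le[OF i x] by linarith
  qed
qed

lemma hoelder_bound_inverse:
  assumes "open S" "hoelder_bound \<alpha> I S F" "0 < e" "\<And>i x. i \<in> I \<Longrightarrow> x \<in> S \<Longrightarrow> e \<le> \<bar>F i x\<bar>"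
  shows "hoelder_bound \<alpha> I S (\<lambda>i x. inverse (F i x))"
proof (rule hoelder_bound_matrix_inverse[OF assms(1), of "{()}" "()" "()" _ _ "\<lambda>_ _. F"
  "\<lambda>_ _ i x. inverse (F i x)" "inverse e"])
  fix i x assume "i \<in> I" "x \<in> S"
  from assms(4)[OF this] show "\<bar>inverse (F i x)\<bar> \<le> inverse e"
    using assms(3) le_imp_inverse_le[of e "\<bar>F i x\<bar>"] by (simp add: abs_inverse)
qed (use assms in force)+

section \<open>Hoelder bounds from bounds on first derivatives\<close>

lemma lipschitz_of_partial_bound:
  fixes f :: "'v::euclidean_space \<Rightarrow> real"
  assumes "open S" "convex S" "f differentiable_on S"
    "\<And>b x. b \<in> Basis \<Longrightarrow> x \<in> S \<Longrightarrow> \<bar>partial_deriv b f x\<bar> \<le> C" "x \<in> S" "y \<in> S"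
  shows "\<bar>f x - f y\<bar> \<le> real DIM('v) * C * norm (x - y)"
proof -
  have "norm (f x - f y) \<le> (real DIM('v) * C) * norm (x - y)"
  proof (rule differentiable_bound[OF assms(2) _ _ assms(5,6)])
    fix z assume z: "z \<in> S"
    show "(f has_derivative frechet_derivative f (at z)) (at z within S)"
      using has_derivative_openD[OF assms(3,1) z] has_derivative_at_withinI by blast
    show "onorm (frechet_derivative f (at z)) \<le> real DIM('v) * C"
    proof (rule onorm_le)
      fix h
      have "norm (frechet_derivative f (at z) h) \<le> (\<Sum>b\<in>(Basis::'v set). norm h * C)"
        unfolding frechet_derivative_eq_sum[OF differentiable_on_openD[OF assms(3,1) z]]
      proof (intro order_trans[OF norm_sum] sum_mono)
        fix b :: 'v assume b: "b \<in> Basis"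
        show "norm ((h \<bullet> b) *\<^sub>R partial_deriv b f z) \<le> norm h * C"
          using Basis_le_norm[OF b, of h] assms(4)[OF b z] by (simp add: abs_mult mult_mono)
      qed
      then show "norm (frechet_derivative f (at z) h) \<le> real DIM('v) * C * norm h"
        by (simp add: mult_ac)
    qed
  qed
  then show ?thesis by simp
qed

text \<open>On a bounded convex set a Lipschitz function is Hoelder continuous for every exponent at
  most 1, since |x - y| \<le> diam^(1 - \<alpha>) |x - y|^\<alpha>. This is why the norm may impose
  the Hoelder condition on the derivatives of top order only.\<close>

lemma hoelder_bound_of_partial_bound:
  fixes F :: "'i \<Rightarrow> 'v::euclidean_space \<Rightarrow> real"
  assumes S: "open S" "convex S" "bounded S" and \<alpha>: "0 \<le> \<alpha>" "\<alpha> \<le> 1"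
    and diff: "\<And>i. i \<in> I \<Longrightarrow> F i differentiable_on S"
    and F: "\<And>i x. i \<in> I \<Longrightarrow> x \<in> S \<Longrightarrow> \<bar>F i x\<bar> \<le> C"
    and dF: "\<And>i b x. i \<in> I \<Longrightarrow> b \<in> Basis \<Longrightarrow> x \<in> S \<Longrightarrow> \<bar>partial_deriv b (F i) x\<bar> \<le> C'"
  shows "hoelder_bound \<alpha> I S F"
proof (rule hoelder_boundI[OF differentiable_imp_continuous_on[OF diff] F])
  fix i x y assume i: "i \<in> I" "x \<in> S" "y \<in> S"
  let ?D = "diameter S"
  have C': "C' \<ge> 0" using dF[OF i(1) SOME_Basis i(2)] by linarith
  have xy: "norm (x - y) \<le> ?D"
    using diameter_bounded_bound[OF S(3) i(2,3)] by (simp add: dist_norm)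
  have "norm (x - y) \<le> ?D powr (1 - \<alpha>) * norm (x - y) powr \<alpha>"
  proof (cases "x = y")
    case False
    have "norm (x - y) = norm (x - y) powr (1 - \<alpha>) * norm (x - y) powr \<alpha>"
      using False by (simp flip: powr_add)
    also have "\<dots> \<le> ?D powr (1 - \<alpha>) * norm (x - y) powr \<alpha>"
      using xy \<alpha> by (intro mult_right_mono powr_mono2) auto
    finally show ?thesis .
  qed simp
  then have "real DIM('v) * C' * norm (x - y) \<le> real DIM('v) * C' *
    (?D powr (1 - \<alpha>) * norm (x - y) powr \<alpha>)"
    using C' by (intro mult_left_mono) auto
  then show "\<bar>F i x - F i y\<bar> \<le> (real DIM('v) * C' * ?D powr (1 - \<alpha>)) * dist x y powr \<alpha>"
    using lipschitz_of_partial_bound[OF S(1,2) diff[OF i(1)] dF[OF i(1)] i(2,3)]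
    by (simp add: dist_norm mult_ac)
qed

section \<open>Comparison with the Hoelder norm\<close>

definition Ck_hoelder_le ::
  "real \<Rightarrow> 'i set \<Rightarrow> 'v::euclidean_space set \<Rightarrow> nat \<Rightarrow> real \<Rightarrow> ('i \<Rightarrow> 'v \<Rightarrow> real) \<Rightarrow> bool" where
  "Ck_hoelder_le \<alpha> I S k C F \<longleftrightarrow> (\<forall>i\<in>I. Ck_on k S (F i)) \<and>
     (\<forall>i\<in>I. \<forall>bs. set bs \<subseteq> Basis \<longrightarrow> length bs \<le> k \<longrightarrow> (\<forall>x\<in>S. \<bar>iter_deriv bs (F i) x\<bar> \<le> C)) \<and>
     (\<forall>i\<in>I. \<forall>bs. set bs \<subseteq> Basis \<longrightarrow> length bs = k \<longrightarrow> (\<forall>x\<in>S. \<forall>y\<in>S.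
        \<bar>iter_deriv bs (F i) x - iter_deriv bs (F i) y\<bar> \<le> C * dist x y powr \<alpha>))"

definition Ck_hoelder_bound ::
  "real \<Rightarrow> 'i set \<Rightarrow> 'v::euclidean_space set \<Rightarrow> nat \<Rightarrow> ('i \<Rightarrow> 'v \<Rightarrow> real) \<Rightarrow> bool" where
  "Ck_hoelder_bound \<alpha> I S k F \<longleftrightarrow> (\<exists>C. Ck_hoelder_le \<alpha> I S k C F)"

lemma Ck_hoelder_leD:
  assumes "Ck_hoelder_le \<alpha> I S k C F" "i \<in> I"
  shows "Ck_on k S (F i)"
    "set bs \<subseteq> Basis \<Longrightarrow> length bs \<le> k \<Longrightarrow> x \<in> S \<Longrightarrow> \<bar>iter_deriv bs (F i) x\<bar> \<le> C"
    "set bs \<subseteq> Basis \<Longrightarrow> length bs = k \<Longrightarrow> x \<in> S \<Longrightarrow> y \<in> S \<Longrightarrow>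
      \<bar>iter_deriv bs (F i) x - iter_deriv bs (F i) y\<bar> \<le> C * dist x y powr \<alpha>"
  using assms unfolding Ck_hoelder_le_def by simp_all

lemma Ck_hoelder_leI:
  assumes "\<And>i. i \<in> I \<Longrightarrow> Ck_on k S (F i)"
    "\<And>i bs x. i \<in> I \<Longrightarrow> set bs \<subseteq> Basis \<Longrightarrow> length bs \<le> k \<Longrightarrow> x \<in> S \<Longrightarrow> \<bar>iter_deriv bs (F i) x\<bar> \<le> C"
    "\<And>i bs x y. i \<in> I \<Longrightarrow> set bs \<subseteq> Basis \<Longrightarrow> length bs = k \<Longrightarrow> x \<in> S \<Longrightarrow> y \<in> S \<Longrightarrow>
      \<bar>iter_deriv bs (F i) x - iter_deriv bs (F i) y\<bar> \<le> C * dist x y powr \<alpha>"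
  shows "Ck_hoelder_le \<alpha> I S k C F"
  using assms unfolding Ck_hoelder_le_def by simp

lemma Ck_hoelder_bound_0: "Ck_hoelder_bound \<alpha> I S 0 F \<longleftrightarrow> hoelder_bound \<alpha> I S F"
  unfolding Ck_hoelder_bound_def Ck_hoelder_le_def hoelder_bound_def by (simp add: ball_conj_distrib)

text \<open>From left to right, the Hoelder condition for \<open>F\<close> itself is not part of
  \<open>Ck_hoelder_le\<close> at order \<open>Suc k\<close>; it comes from the bound on the first
  derivatives.\<close>

lemma Ck_hoelder_bound_Suc:
  assumes S: "open S" "convex S" "bounded S" and \<alpha>: "0 \<le> \<alpha>" "\<alpha> \<le> 1"
  shows "Ck_hoelder_bound \<alpha> I S (Suc k) F \<longleftrightarrow> hoelder_bound \<alpha> I S F \<and>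
    (\<forall>i\<in>I. F i differentiable_on S) \<and> (\<forall>b\<in>Basis. Ck_hoelder_bound \<alpha> I S k (\<lambda>i. partial_deriv b (F i)))"
    (is "?L \<longleftrightarrow> ?R")
proof
  assume ?L
  then obtain C where "Ck_hoelder_le \<alpha> I S (Suc k) C F" unfolding Ck_hoelder_bound_def ..
  note C = Ck_hoelder_leD[OF this]
  have diff: "\<And>i. i \<in> I \<Longrightarrow> F i differentiable_on S" using C(1) by (simp add: Ck_on_Suc)
  have "hoelder_bound \<alpha> I S F"
    by (rule hoelder_bound_of_partial_bound[OF S \<alpha> diff, where C=C and C'=C])
      (use C(2)[of _ "[]"] C(2)[of _ "[_]"] in auto)
  moreover have "Ck_hoelder_bound \<alpha> I S k (\<lambda>i. partial_deriv b (F i))" if "b \<in> Basis" for b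
    unfolding Ck_hoelder_bound_def
  proof (intro exI[of _ C] Ck_hoelder_leI)
    show "Ck_on k S (partial_deriv b (F i))" if "i \<in> I" for i using C(1)[OF that] \<open>b \<in> Basis\<close>
      by (simp add: Ck_on_Suc)
  qed (use C(2)[of _ "_ @ [b]"] C(3)[of _ "_ @ [b]"] that in \<open>auto simp: iter_deriv_snoc\<close>)
  ultimately show ?R using diff by blast
next
  assume R: ?R
  from R have "hoelder_bound \<alpha> I S F" by (rule conjunct1)
  then obtain C0 where C0: "C0 \<ge> 0" "\<And>i x. i \<in> I \<Longrightarrow> x \<in> S \<Longrightarrow> \<bar>F i x\<bar> \<le> C0"
    by (rule hoelder_boundE) (rule that; assumption)
  from R have "\<forall>b\<in>Basis. \<exists>C. Ck_hoelder_le \<alpha> I S k C (\<lambda>i. partial_deriv b (F i))"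
    unfolding Ck_hoelder_bound_def by simp
  then obtain C where "\<And>b. b \<in> Basis \<Longrightarrow> Ck_hoelder_le \<alpha> I S k (C b) (\<lambda>i. partial_deriv b (F i))"
    by (auto dest!: bchoice)
  note C = Ck_hoelder_leD[OF this]
  define K where "K = C0 + (\<Sum>b\<in>Basis. \<bar>C b\<bar>)"
  have "C b \<le> K" if "b \<in> Basis" for b
  proof -
    have "\<bar>C b\<bar> \<le> (\<Sum>b\<in>Basis. \<bar>C b\<bar>)" using that by (intro member_le_sum) auto
    then show ?thesis using C0 by (simp add: K_def)
  qed
  note CK = this
  have K0: "C0 \<le> K" by (simp add: K_def sum_nonneg)
  show ?L unfolding Ck_hoelder_bound_def
  proof (intro exI[of _ K] Ck_hoelder_leI)
    fix i assume i: "i \<in> I"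
    show "Ck_on (Suc k) S (F i)" using R C(1)[OF _ i] i by (auto simp: Ck_on_Suc)
    fix bs :: "'a list" and x assume bs: "set bs \<subseteq> Basis" and x: "x \<in> S"
    {
      assume len: "length bs \<le> Suc k"
      show "\<bar>iter_deriv bs (F i) x\<bar> \<le> K"
      proof (cases bs rule: rev_cases)
        case Nil
        then show ?thesis using C0(2)[OF i x] K0 by simp
      next
        case (snoc cs b)
        then show ?thesis using bs len C(2)[OF _ i, of b cs x] x CK[of b] by (simp add: iter_deriv_snoc)
      qed
    next
      fix y assume y: "y \<in> S" and len: "length bs = Suc k"
      then obtain cs b where snoc: "bs = cs @ [b]" by (cases bs rule: rev_cases) auto
      have "C b * dist x y powr \<alpha> \<le> K * dist x y powr \<alpha>"
        using CK[of b] bs snoc by (intro mult_right_mono) auto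
      then show "\<bar>iter_deriv bs (F i) x - iter_deriv bs (F i) y\<bar> \<le> K * dist x y powr \<alpha>"
        using bs len C(3)[OF _ i, of b cs x y] x y snoc by (simp add: iter_deriv_snoc)
    }
  qed
qed

lemma Ck_hoelder_bound_iff_reg:
  assumes S: "open S" "convex S" "bounded S" and \<alpha>: "0 \<le> \<alpha>" "\<alpha> \<le> 1"
  shows "Ck_hoelder_bound \<alpha> I S k F \<longleftrightarrow> reg (hoelder_bound \<alpha> I S) I S k F"
  by (induction k arbitrary: F) (simp_all add: Ck_hoelder_bound_0 Ck_hoelder_bound_Suc[OF S \<alpha>])

lemma hoelder_norm_bounded_iff:
  fixes F :: "'i \<Rightarrow> 'v::euclidean_space \<Rightarrow> real"
  shows "(SUP i\<in>I. hoelder_norm k \<alpha> S (F i)) < top \<longleftrightarrow> Ck_hoelder_bound \<alpha> I S k F" (is "?L \<longleftrightarrow> ?R")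
proof
  assume ?L
  then obtain C where C: "C \<ge> 0" "(SUP i\<in>I. hoelder_norm k \<alpha> S (F i)) = ennreal C"
    by (metis ennreal_cases less_top)
  have le: "hoelder_norm k \<alpha> S (F i) \<le> ennreal C" if "i \<in> I" for i
    unfolding C(2)[symmetric] using that by (rule SUP_upper)
  show ?R unfolding Ck_hoelder_bound_def
  \<comment> \<open>The factor 2 is for \<open>\<alpha>\<close> = 0, where the norm contains no
    seminorm and an increment is bounded by twice the supremum.\<close>
  proof (intro exI[of _ "2 * C"] Ck_hoelder_leI)
    fix i assume i: "i \<in> I"
    show ck: "Ck_on k S (F i)" using le[OF i]
      by (auto simp: hoelder_norm_def top_unique split: if_splits)
    let ?A = "SUP bs\<in>{bs. set bs \<subseteq> Basis \<and> length bs \<le> k}. SUP x\<in>S. ennreal \<bar>iter_deriv bs (F i) x\<bar>"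
    let ?B = "SUP bs\<in>{bs. set bs \<subseteq> Basis \<and> length bs = k}. SUP x\<in>S. SUP y\<in>S - {x}.
             ennreal (\<bar>iter_deriv bs (F i) x - iter_deriv bs (F i) y\<bar> / dist x y powr \<alpha>)"
    have sum: "?A + (if \<alpha> = 0 then 0 else ?B) \<le> ennreal C" using le[OF i] ck
      by (simp add: hoelder_norm_def)
    have "?A \<le> ?A + (if \<alpha> = 0 then 0 else ?B)" by simp
    with sum have A: "?A \<le> ennreal C" by (rule order_trans[rotated])
    have b1: "\<bar>iter_deriv bs (F i) x\<bar> \<le> C" if "set bs \<subseteq> Basis" "length bs \<le> k" "x \<in> S" for bs x
      using A that C(1) by (simp add: SUP_le_iff)
    then show "\<bar>iter_deriv bs (F i) x\<bar> \<le> 2 * C" if "set bs \<subseteq> Basis" "length bs \<le> k" "x \<in> S" for bs x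
      using b1[OF that] C(1) by linarith
    fix bs :: "'v list" and x y assume bs: "set bs \<subseteq> Basis" "length bs = k" and x: "x \<in> S" "y \<in> S"
    show "\<bar>iter_deriv bs (F i) x - iter_deriv bs (F i) y\<bar> \<le> 2 * C * dist x y powr \<alpha>"
    proof (cases "x = y")
      case xy: False
      show ?thesis
      proof (cases "\<alpha> = 0")
        case True
        then show ?thesis using b1[of bs x] b1[of bs y] bs x xy by simp
      next
        case False
        have "?B \<le> ?A + (if \<alpha> = 0 then 0 else ?B)" using False by simp
        with sum have "?B \<le> ennreal C" by (rule order_trans[rotated])
        then have "\<bar>iter_deriv bs (F i) x - iter_deriv bs (F i) y\<bar> / dist x y powr \<alpha> \<le> C"
          using bs x xy C(1) by (simp add: SUP_le_iff)
        then have "\<bar>iter_deriv bs (F i) x - iter_deriv bs (F i) y\<bar> \<le> C * dist x y powr \<alpha>"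
          using xy by (simp add: pos_divide_le_eq)
        also have "\<dots> \<le> 2 * C * dist x y powr \<alpha>" using C(1) by (intro mult_right_mono) auto
        finally show ?thesis .
      qed
    qed simp
  qed
next
  assume ?R
  then obtain C0 where "Ck_hoelder_le \<alpha> I S k C0 F" unfolding Ck_hoelder_bound_def ..
  note C0 = Ck_hoelder_leD[OF this]
  define C where "C = max C0 0"
  have C: "C \<ge> 0" "C0 \<le> C" by (auto simp: C_def)
  have "hoelder_norm k \<alpha> S (F i) \<le> ennreal C + ennreal C" if i: "i \<in> I" for i
  proof -
    have 1: "(SUP bs\<in>{bs. set bs \<subseteq> Basis \<and> length bs \<le> k}. SUP x\<in>S.
      ennreal \<bar>iter_deriv bs (F i) x\<bar>) \<le> ennreal C"
      using C0(2)[OF i] C by (auto intro!: SUP_least ennreal_leI intro: order_trans)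
    have 2: "(SUP bs\<in>{bs. set bs \<subseteq> Basis \<and> length bs = k}. SUP x\<in>S. SUP y\<in>S - {x}.
             ennreal (\<bar>iter_deriv bs (F i) x - iter_deriv bs (F i) y\<bar> / dist x y powr \<alpha>)) \<le> ennreal C"
    proof (intro SUP_least ennreal_leI)
      fix bs x y assume a: "bs \<in> {bs. set bs \<subseteq> (Basis::'v set) \<and> length bs = k}" "x \<in> S" "y \<in> S - {x}"
      then have "\<bar>iter_deriv bs (F i) x - iter_deriv bs (F i) y\<bar> \<le> C0 * dist x y powr \<alpha>"
        using C0(3)[OF i] by auto
      also have "\<dots> \<le> C * dist x y powr \<alpha>" using C by (intro mult_right_mono) auto
      finally show "\<bar>iter_deriv bs (F i) x - iter_deriv bs (F i) y\<bar> / dist x y powr \<alpha> \<le> C"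
        using a by (subst pos_divide_le_eq) auto
    qed
    show ?thesis unfolding hoelder_norm_def using C0(1)[OF i] 1 2
      by (auto intro: add_mono order_trans[OF 1])
  qed
  then have "(SUP i\<in>I. hoelder_norm k \<alpha> S (F i)) \<le> ennreal C + ennreal C" by (rule SUP_least)
  also have "\<dots> < top" by (simp add: ennreal_plus[symmetric] C del: ennreal_plus)
  finally show ?L .
qed

section \<open>Inner products\<close>

definition inner_form :: "('v::euclidean_space \<Rightarrow> 'v \<Rightarrow> real) \<Rightarrow> bool" where
  "inner_form B \<longleftrightarrow> bilinear B \<and> (\<forall>u v. B u v = B v u) \<and> (\<forall>u. u \<noteq> 0 \<longrightarrow> B u u > 0)"

text \<open>For basis vectors these are the entries of the inverse matrix of \<open>B\<close>, that
  is, the metric induced on covectors.\<close>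

definition inv_form :: "('v::euclidean_space \<Rightarrow> 'v \<Rightarrow> real) \<Rightarrow> 'v \<Rightarrow> 'v \<Rightarrow> real" where
  "inv_form B a b = a \<bullet> sharp B (\<lambda>v. b \<bullet> v)"

lemma inner_formD:
  assumes "inner_form B"
  shows "bilinear B" "B u v = B v u" "u \<noteq> 0 \<Longrightarrow> B u u > 0"
  using assms unfolding inner_form_def by auto

lemmas bilinear_simps = bilinear_ladd bilinear_radd bilinear_lmul bilinear_rmul bilinear_lsub
  bilinear_rsub bilinear_lneg bilinear_rneg bilinear_lzero bilinear_rzero

lemma bilinear_left: "bilinear B \<Longrightarrow> linear (\<lambda>u. B u v)"
  and bilinear_right: "bilinear B \<Longrightarrow> linear (B u)"
  unfolding bilinear_def by auto

lemma linear_expand: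
  assumes "linear f"
  shows "f v = (\<Sum>b\<in>Basis. (v \<bullet> b) *\<^sub>R f b)"
proof -
  have "f (\<Sum>b\<in>Basis. (v \<bullet> b) *\<^sub>R b) = (\<Sum>b\<in>Basis. (v \<bullet> b) *\<^sub>R f b)"
    using assms by (simp add: linear_sum linear_cmul)
  then show ?thesis by (simp add: euclidean_representation)
qed

lemma bilinear_expand:
  assumes "bilinear B"
  shows "B u v = (\<Sum>a\<in>Basis. \<Sum>b\<in>Basis. (u \<bullet> a) *\<^sub>R (v \<bullet> b) *\<^sub>R B a b)"
  using linear_expand[OF bilinear_left[OF assms], of u v] linear_expand[OF
    bilinear_right[OF assms], of _ v]
  by (simp add: scaleR_sum_right)

lemma inner_form_eqI:
  assumes "inner_form B" "\<And>v. B w v = B w' v"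
  shows "w = w'"
proof (rule ccontr)
  assume "w \<noteq> w'"
  then have "B (w - w') (w - w') > 0" using inner_formD(3)[OF assms(1), of "w - w'"] by simp
  moreover have "B (w - w') v = 0" for v
    using assms by (simp add: bilinear_lsub[OF inner_formD(1)])
  ultimately show False by simp
qed

lemma sharp_eqI:
  assumes "inner_form B" "\<And>v. B w v = l v"
  shows "sharp B l = w"
  unfolding sharp_def by (rule the_equality) (use assms inner_form_eqI[OF assms(1)] in auto)

text \<open>\<open>sharp\<close> is a definite description, so existence has to be shown: the linear
  map that sends w to the components of B w is injective by positivity, hence onto in finite
  dimension.\<close>

lemma sharp_works:
  assumes B: "inner_form B" and l: "linear l"
  shows "B (sharp B l) v = l v"
proof -
  note bl = inner_formD(1)[OF B]
  define L where "L = (\<lambda>w. \<Sum>b\<in>Basis. B w b *\<^sub>R b)"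
  have L: "linear L" unfolding L_def
    by (rule linearI) (simp_all add: bilinear_simps[OF bl] algebra_simps sum.distrib scaleR_sum_right)
  have Lb: "L w \<bullet> b = B w b" if "b \<in> Basis" for w b
    using that by (simp add: L_def inner_sum_left_Basis)
  have "inj L"
  proof (subst linear_injective_0[OF L], intro allI impI, rule ccontr)
    fix w assume w: "L w = 0" "w \<noteq> 0"
    then have "B w b = 0" if "b \<in> Basis" for b using Lb[OF that] by (metis inner_zero_left)
    then have "B w w = 0" using linear_expand[OF bilinear_right[OF bl], of w w] by simp
    then show False using inner_formD(3)[OF B w(2)] by simp
  qed
  then have "surj L" using linear_injective_imp_surjective[OF L] by blast
  then obtain w where w: "L w = (\<Sum>b\<in>Basis. l b *\<^sub>R b)" by (metis surjD)
  have "B w b = l b" if "b \<in> Basis" for b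
    using Lb[OF that, of w] that by (simp add: w inner_sum_left_Basis)
  then have "B w v = l v" for v
    using linear_expand[OF bilinear_right[OF bl], of w v] linear_expand[OF l, of v] by simp
  then show ?thesis using sharp_eqI[OF B, of w l] by simp
qed

lemma linear_inner_right: "linear (\<lambda>v. c \<bullet> v)"
  by (simp add: linear_iff inner_add_right)

lemma inner_sharp:
  assumes B: "inner_form B" and l: "linear l"
  shows "a \<bullet> sharp B l = (\<Sum>c\<in>Basis. inv_form B a c * l c)"
proof -
  note bl = inner_formD(1)[OF B]
  have "sharp B l = (\<Sum>c\<in>Basis. l c *\<^sub>R sharp B (\<lambda>v. c \<bullet> v))"
  proof (rule sharp_eqI[OF B])
    fix v
    have "B (\<Sum>c\<in>Basis. l c *\<^sub>R sharp B (\<lambda>v. c \<bullet> v)) v = (\<Sum>c\<in>Basis. l c * (c \<bullet> v))"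
      using linear_sum[OF bilinear_left[OF bl], of "\<lambda>c. l c *\<^sub>R sharp B (\<lambda>v. c \<bullet> v)" Basis v]
      by (simp add: bilinear_simps[OF bl] sharp_works[OF B linear_inner_right])
    then show "B (\<Sum>c\<in>Basis. l c *\<^sub>R sharp B (\<lambda>v. c \<bullet> v)) v = l v"
      using linear_expand[OF l, of v] by (simp add: mult.commute inner_commute)
  qed
  then show ?thesis by (simp add: inv_form_def inner_sum_right mult.commute)
qed

lemma inv_form_inverse_left:
  assumes B: "inner_form B" and "a \<in> Basis" "d \<in> Basis"
  shows "(\<Sum>c\<in>Basis. inv_form B a c * B c d) = (if a = d then 1 else 0)"
proof -
  have "sharp B (B d) = d" by (rule sharp_eqI[OF B]) simp
  then have "(\<Sum>c\<in>Basis. inv_form B a c * B d c) = a \<bullet> d"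
    using inner_sharp[OF B bilinear_right[OF inner_formD(1)[OF B]], of a d] by simp
  then show ?thesis using assms inner_formD(2)[OF B, of d] by (simp add: inner_Basis)
qed

lemma inv_form_inverse_right:
  assumes B: "inner_form B" and "c \<in> Basis" "b \<in> Basis"
  shows "(\<Sum>d\<in>Basis. B c d * inv_form B d b) = (if c = b then 1 else 0)"
proof -
  let ?w = "sharp B (\<lambda>v. b \<bullet> v)"
  have "(\<Sum>d\<in>Basis. B c d * inv_form B d b) = B c ?w"
    using linear_expand[OF bilinear_right[OF inner_formD(1)[OF B]], of c ?w]
    by (simp add: inv_form_def inner_commute mult.commute)
  also have "\<dots> = b \<bullet> c"
    using sharp_works[OF B linear_inner_right, of b c] inner_formD(2)[OF B, of c] by simp
  finally show ?thesis using assms by (auto simp: inner_Basis)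
qed

text \<open>The vector w dual to \<open>b\<close> satisfies m |w|^2 \<le> B w w = b . w \<le> |w|,
  so |w| is at most 1/m.\<close>

lemma inv_form_le:
  assumes B: "inner_form B" and m: "m > 0" "\<And>u. m * (norm u)\<^sup>2 \<le> B u u" and ab: "a \<in> Basis" "b \<in> Basis"
  shows "\<bar>inv_form B a b\<bar> \<le> 1 / m"
proof -
  let ?w = "sharp B (\<lambda>v. b \<bullet> v)"
  have "m * (norm ?w)\<^sup>2 \<le> b \<bullet> ?w" using m(2)[of ?w] sharp_works[OF B linear_inner_right, of b ?w]
    by simp
  also have "\<dots> \<le> norm ?w" using norm_cauchy_schwarz[of b ?w] ab by simp
  finally have "m * norm ?w \<le> 1"
    by (cases "?w = 0") (auto simp: power2_eq_square)
  then have "norm ?w \<le> 1 / m" using m(1) by (simp add: field_simps)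
  moreover have "\<bar>a \<bullet> ?w\<bar> \<le> norm ?w" using Cauchy_Schwarz_ineq2[of a ?w] ab by simp
  ultimately show ?thesis unfolding inv_form_def by linarith
qed

text \<open>The minimum of G x u u over the compact product of \<open>K\<close> with the unit sphere
  is positive, and homogeneity extends the bound to all \<open>u\<close>.\<close>

lemma inner_form_uniform:
  fixes G :: "'p::metric_space \<Rightarrow> 'v::euclidean_space \<Rightarrow> 'v \<Rightarrow> real"
  assumes K: "compact K" and G: "\<And>x. x \<in> K \<Longrightarrow> inner_form (G x)"
    and cont: "\<And>a b. a \<in> Basis \<Longrightarrow> b \<in> Basis \<Longrightarrow> continuous_on K (\<lambda>x. G x a b)"
  obtains m where "m > 0" "\<And>x u. x \<in> K \<Longrightarrow> m * (norm u)\<^sup>2 \<le> G x u u"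
proof (cases "K = {}")
  case True
  then show ?thesis using that[of 1] by simp
next
  case False
  let ?f = "\<lambda>(x, u). G x u u"
  have "continuous_on (K \<times> sphere 0 1) (\<lambda>z. \<Sum>a\<in>Basis. \<Sum>b\<in>Basis.
    (snd z \<bullet> a) *\<^sub>R (snd z \<bullet> b) *\<^sub>R G (fst z) a b)"
    by (intro continuous_intros continuous_on_compose2[OF cont continuous_on_fst]) auto
  then have c: "continuous_on (K \<times> sphere 0 1) ?f"
    by (rule continuous_on_eq)
      (use bilinear_expand[OF inner_formD(1)[OF G]] in \<open>auto simp: case_prod_beta\<close>)
  obtain b :: 'v where "b \<in> Basis" using nonempty_Basis by blast
  then have ne: "K \<times> sphere 0 (1::real) \<noteq> ({} :: ('p \<times> 'v) set)" using False norm_Basis by fastforce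
  obtain z where z: "z \<in> K \<times> sphere 0 1" "\<And>y. y \<in> K \<times> sphere 0 1 \<Longrightarrow> ?f z \<le> ?f y"
    using continuous_attains_inf[OF compact_Times[OF K compact_sphere] ne c] by blast
  obtain x0 u0 where z0: "z = (x0, u0)" by (cases z)
  define m where "m = G x0 u0 u0"
  have "u0 \<noteq> 0" using z z0 by auto
  then have m: "m > 0" using G[of x0] z z0 by (auto simp: m_def dest: inner_formD(3))
  show ?thesis
  proof (rule that[OF m])
    fix x u assume x: "x \<in> K"
    show "m * (norm u)\<^sup>2 \<le> G x u u"
    proof (cases "u = 0")
      case False
      define e where "e = u /\<^sub>R norm u"
      have e: "norm e = 1" "u = norm u *\<^sub>R e" using False by (auto simp: e_def)
      have "m \<le> G x e e" using z(2)[of "(x, e)"] x e z0 by (simp add: m_def)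
      then have "m * (norm u)\<^sup>2 \<le> G x e e * (norm u)\<^sup>2" by (intro mult_right_mono) auto
      also have "\<dots> = G x (norm u *\<^sub>R e) (norm u *\<^sub>R e)"
        using bilinear_simps[OF inner_formD(1)[OF G[OF x]]] by (simp add: power2_eq_square mult_ac)
      finally show ?thesis using e by simp
    qed (use bilinear_simps[OF inner_formD(1)[OF G[OF x]]] in simp)
  qed
qed

text \<open>Cyclicity of the trace, tr(QAP) = tr(APQ), together with PQ = 1. The spaces may be
  different types, as they are for coordinate changes.\<close>

lemma trace_conjugate:
  fixes A :: "'w::euclidean_space \<Rightarrow> 'w" and P :: "'v::euclidean_space \<Rightarrow> 'w"
  assumes "linear A" "linear P" "linear Q" "\<And>x. P (Q x) = x"
  shows "(\<Sum>b\<in>Basis. b \<bullet> Q (A (P b))) = (\<Sum>b\<in>Basis. b \<bullet> A b)"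
proof -
  have lin: "linear (\<lambda>x. Q (A x))" using linear_compose[OF assms(1,3)] by (simp add: o_def)
  have "(\<Sum>b\<in>Basis. b \<bullet> Q (A (P b))) = (\<Sum>b\<in>Basis. \<Sum>c\<in>Basis. (P b \<bullet> c) * (b \<bullet> Q (A c)))"
    by (intro sum.cong refl) (subst linear_expand[OF lin], simp add: inner_sum_right)
  also have "\<dots> = (\<Sum>c\<in>Basis. \<Sum>b\<in>Basis. (b \<bullet> Q (A c)) * (P b \<bullet> c))"
    by (subst sum.swap) (simp add: mult.commute)
  also have "\<dots> = (\<Sum>c\<in>Basis. P (Q (A c)) \<bullet> c)"
    by (intro sum.cong refl, subst linear_expand[OF assms(2), of "Q (A _)"])
      (simp add: inner_sum_left inner_sum_right inner_commute)
  finally show ?thesis by (simp add: assms(4) inner_commute)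
qed

lemma trace_rank_one:
  assumes "linear l"
  shows "(\<Sum>b\<in>Basis. b \<bullet> (l b *\<^sub>R v)) = l v"
  using linear_expand[OF assms, of v] by (simp add: mult.commute inner_commute)

section \<open>Algebra and invariance of \<open>sharp\<close> and of metric traces\<close>

lemma sharp_add:
  assumes "inner_form B" "linear l" "linear m"
  shows "sharp B (\<lambda>v. l v + m v) = sharp B l + sharp B m"
  using assms by (intro sharp_eqI) (simp_all add: bilinear_simps[OF inner_formD(1)] sharp_works)

lemma sharp_cmul:
  assumes "inner_form B" "linear l"
  shows "sharp B (\<lambda>v. c * l v) = c *\<^sub>R sharp B l"
  using assms by (intro sharp_eqI) (simp_all add: bilinear_simps[OF inner_formD(1)] sharp_works)

lemma sharp_scaled:
  assumes "inner_form B" "linear l" "c > 0"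
  shows "sharp (\<lambda>u v. c * B u v) l = (1 / c) *\<^sub>R sharp B l"
proof -
  have "inner_form (\<lambda>u v. c * B u v)"
    using assms unfolding inner_form_def bilinear_def linear_iff by (auto simp: algebra_simps)
  then show ?thesis
    using assms by (intro sharp_eqI) (simp_all add: bilinear_simps[OF inner_formD(1)] sharp_works)
qed

lemma metric_trace_add:
  assumes "inner_form B" "\<And>b. linear (h b)" "\<And>b. linear (k b)"
  shows "metric_trace B (\<lambda>u v. h u v + k u v) = metric_trace B h + metric_trace B k"
  unfolding metric_trace_def using assms by (simp add: sharp_add inner_add_right sum.distrib)

lemma metric_trace_cmul:
  assumes "inner_form B" "\<And>b. linear (h b)"
  shows "metric_trace B (\<lambda>u v. c * h u v) = c * metric_trace B h"
  unfolding metric_trace_def using assms by (simp add: sharp_cmul sum_distrib_left)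

lemma metric_trace_scaled:
  assumes "inner_form B" "\<And>b. linear (h b)" "c > 0"
  shows "metric_trace (\<lambda>u v. c * B u v) h = metric_trace B h / c"
  unfolding metric_trace_def using assms by (simp add: sharp_scaled sum_divide_distrib)

lemma metric_trace_eq_trace:
  assumes "inner_form B" "\<And>b v. B (N b) v = h b v"
  shows "metric_trace B h = (\<Sum>b\<in>Basis. b \<bullet> N b)"
  unfolding metric_trace_def using sharp_eqI[OF assms(1)] assms(2) by (intro sum.cong refl) metis

lemma metric_trace_inv_form:
  assumes "inner_form B" "\<And>b. linear (h b)"
  shows "metric_trace B h = (\<Sum>a\<in>Basis. \<Sum>b\<in>Basis. inv_form B a b * h a b)"
  unfolding metric_trace_def using assms by (simp add: inner_sharp)

lemma sharp_pullback:
  assumes "inner_form B" "inner_form B'" "linear l" "linear P" "\<And>x. P (Q x) = x" "\<And>x. Q (P x) = x"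
    "\<And>u v. B u v = B' (P u) (P v)" "\<And>u. l u = l' (P u)" "linear l'"
  shows "P (sharp B l) = sharp B' l'"
proof -
  have "B' (P (sharp B l)) v = l' v" for v
    using assms(5)[of v] assms(7)[of "sharp B l" "Q v"] assms(8)[of "Q v"]
      sharp_works[OF assms(1,3), of "Q v"] by simp
  then show ?thesis using sharp_eqI[OF assms(2)] by metis
qed

text \<open>Raising an index commutes with pullback, so the endomorphism belonging to
  \<open>h\<close> is conjugate under \<open>P\<close> to the one belonging to
  \<open>h'\<close>.\<close>

lemma metric_trace_pullback:
  assumes B: "inner_form B" "inner_form B'" and P: "linear P" "linear Q" "\<And>x. P (Q x) = x"
    "\<And>x. Q (P x) = x"
    and eq: "\<And>u v. B u v = B' (P u) (P v)" and h: "bilinear h'" "\<And>u v. h u v = h' (P u) (P v)"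
  shows "metric_trace B h = metric_trace B' h'"
proof -
  have 1: "sharp B (h b) = Q (sharp B' (h' (P b)))" for b
  proof -
    have "linear (h b)" using linear_compose[OF P(1) bilinear_right[OF h(1), of "P b"]]
      unfolding o_def h(2)[symmetric] .
    from sharp_pullback[OF B this P(1,3,4) eq h(2) bilinear_right[OF h(1)]] show ?thesis using P(4)
      by metis
  qed
  have lin: "linear (\<lambda>u. sharp B' (h' u))"
  proof (rule linearI)
    show "sharp B' (h' (u + v)) = sharp B' (h' u) + sharp B' (h' v)" for u v
    proof -
      have "h' (u + v) = (\<lambda>w. h' u w + h' v w)" using bilinear_ladd[OF h(1)] by (simp add: fun_eq_iff)
      then show ?thesis using sharp_add[OF B(2) bilinear_right[OF h(1)] bilinear_right[OF h(1)]] by simp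
    qed
    show "sharp B' (h' (c *\<^sub>R u)) = c *\<^sub>R sharp B' (h' u)" for c u
    proof -
      have "h' (c *\<^sub>R u) = (\<lambda>v. c * h' u v)" using bilinear_lmul[OF h(1)] by (simp add: fun_eq_iff)
      then show ?thesis using sharp_cmul[OF B(2) bilinear_right[OF h(1)]] by simp
    qed
  qed
  show ?thesis unfolding metric_trace_def 1
    by (rule trace_conjugate[of "\<lambda>u. sharp B' (h' u)" P Q]) (use lin P in auto)
qed

section \<open>Local Riemannian geometry\<close>

definition metric_on :: "nat \<Rightarrow> 'v::euclidean_space set \<Rightarrow> 'v lmetric \<Rightarrow> bool" where
  "metric_on k U G \<longleftrightarrow> open U \<and> (\<forall>x\<in>U. inner_form (G x)) \<and>
     (\<forall>u\<in>Basis. \<forall>v\<in>Basis. Ck_on k U (\<lambda>x. G x u v))"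

lemma metric_onD:
  assumes "metric_on k U G"
  shows "open U" "x \<in> U \<Longrightarrow> inner_form (G x)"
  using assms unfolding metric_on_def by auto

section \<open>Product rules for families of linear and bilinear maps\<close>

lemma Ck_on_bilinear_family:
  fixes B :: "'v::euclidean_space \<Rightarrow> 'u::euclidean_space \<Rightarrow> 'u \<Rightarrow> 'w::euclidean_space"
  assumes "open U" "\<And>x. x \<in> U \<Longrightarrow> bilinear (B x)"
    "\<And>a b. a \<in> Basis \<Longrightarrow> b \<in> Basis \<Longrightarrow> Ck_on k U (\<lambda>x. B x a b)" "Ck_on k U p" "Ck_on k U q"
  shows "Ck_on k U (\<lambda>x. B x (p x) (q x))"
proof -
  have "Ck_on k U (\<lambda>x. \<Sum>a\<in>Basis. \<Sum>b\<in>Basis. (p x \<bullet> a) *\<^sub>R (q x \<bullet> b) *\<^sub>R B x a b)"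
    using assms Ck_on_componentwise[OF assms(1), of k p] Ck_on_componentwise[OF assms(1), of k q]
    by (intro Ck_on_sum Ck_on_scaleR) auto
  then show ?thesis
    by (rule iffD1[OF Ck_on_cong[OF assms(1)], rotated]) (rule bilinear_expand[OF assms(2), symmetric])
qed

text \<open>A product rule that needs no norm on the space of bilinear maps: expand in the basis,
  differentiate the finite sum and recognise the three groups of terms. The inner map \<phi> is
  there for pullbacks.\<close>

lemma has_derivative_bilinear_family:
  fixes B :: "'v::euclidean_space \<Rightarrow> 'u::euclidean_space \<Rightarrow> 'u \<Rightarrow> 'w::euclidean_space"
    and \<phi> :: "'t::euclidean_space \<Rightarrow> 'v"
  assumes V: "open V" "\<phi> x \<in> V" "\<And>y. y \<in> V \<Longrightarrow> bilinear (B y)"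
    and B: "\<And>a b. (\<lambda>y. B y a b) differentiable (at (\<phi> x))"
    and \<phi>: "(\<phi> has_derivative \<phi>') (at x)"
    and p: "(p has_derivative p') (at x)" and q: "(q has_derivative q') (at x)"
  shows "((\<lambda>y. B (\<phi> y) (p y) (q y)) has_derivative
     (\<lambda>h. frechet_derivative (\<lambda>z. B z (p x) (q x)) (at (\<phi> x)) (\<phi>' h) + B (\<phi> x) (p' h) (q x) + B (\<phi>
       x) (p x) (q' h))) (at x)"
proof -
  let ?D = "\<lambda>a b. frechet_derivative (\<lambda>z. B z a b) (at (\<phi> x))"
  note bl = V(3)[OF V(2)]
  have chain: "((\<lambda>y. B (\<phi> y) a b) has_derivative (\<lambda>h. ?D a b (\<phi>' h))) (at x)" for a b
    using diff_chain_at[OF \<phi> frechet_derivative_works[THEN iffD1, OF B]] by (simp add: o_def)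
  have "((\<lambda>y. \<Sum>a\<in>Basis. \<Sum>b\<in>Basis. (p y \<bullet> a) *\<^sub>R (q y \<bullet> b) *\<^sub>R B (\<phi> y) a b) has_derivative
     (\<lambda>h. \<Sum>a\<in>Basis. \<Sum>b\<in>Basis. (p x \<bullet> a) *\<^sub>R ((q x \<bullet> b) *\<^sub>R ?D a b (\<phi>' h) + (q' h \<bullet> b) *\<^sub>R B (\<phi> x) a b)
         + (p' h \<bullet> a) *\<^sub>R (q x \<bullet> b) *\<^sub>R B (\<phi> x) a b)) (at x)"
    by (intro has_derivative_sum has_derivative_scaleR has_derivative_inner_left p q chain)
  also have "(\<lambda>h. \<Sum>a\<in>Basis. \<Sum>b\<in>Basis. (p x \<bullet> a) *\<^sub>R ((q x \<bullet> b) *\<^sub>R ?D a b (\<phi>' h) +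
    (q' h \<bullet> b) *\<^sub>R B (\<phi> x) a b)
         + (p' h \<bullet> a) *\<^sub>R (q x \<bullet> b) *\<^sub>R B (\<phi> x) a b) =
     (\<lambda>h. (\<Sum>a\<in>Basis. \<Sum>b\<in>Basis. (p x \<bullet> a) *\<^sub>R (q x \<bullet> b) *\<^sub>R ?D a b (\<phi>' h)) + B (\<phi> x) (p' h) (q x) +
       B (\<phi> x) (p x) (q' h))"
  proof
    fix h
    show "(\<Sum>a\<in>Basis. \<Sum>b\<in>Basis. (p x \<bullet> a) *\<^sub>R ((q x \<bullet> b) *\<^sub>R ?D a b (\<phi>' h) + (q' h \<bullet> b) *\<^sub>R B (\<phi> x) a b)
         + (p' h \<bullet> a) *\<^sub>R (q x \<bullet> b) *\<^sub>R B (\<phi> x) a b) =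
       (\<Sum>a\<in>Basis. \<Sum>b\<in>Basis. (p x \<bullet> a) *\<^sub>R (q x \<bullet> b) *\<^sub>R ?D a b (\<phi>' h)) + B (\<phi> x) (p' h)
         (q x) + B (\<phi> x) (p x) (q' h)"
      by (subst (1 2) bilinear_expand[OF bl]) (simp add: scaleR_add_right sum.distrib add_ac)
  qed
  also have "(\<lambda>h. \<Sum>a\<in>Basis. \<Sum>b\<in>Basis. (p x \<bullet> a) *\<^sub>R (q x \<bullet> b) *\<^sub>R ?D a b (\<phi>' h)) =
      (\<lambda>h. frechet_derivative (\<lambda>z. B z (p x) (q x)) (at (\<phi> x)) (\<phi>' h))"
  proof -
    have "((\<lambda>z. \<Sum>a\<in>Basis. \<Sum>b\<in>Basis. (p x \<bullet> a) *\<^sub>R (q x \<bullet> b) *\<^sub>R B z a b) has_derivative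
       (\<lambda>h. \<Sum>a\<in>Basis. \<Sum>b\<in>Basis. (p x \<bullet> a) *\<^sub>R (q x \<bullet> b) *\<^sub>R ?D a b h)) (at (\<phi> x))"
      by (intro has_derivative_sum has_derivative_scaleR_right
        frechet_derivative_works[THEN iffD1, OF B])
    then have "((\<lambda>z. B z (p x) (q x)) has_derivative
       (\<lambda>h. \<Sum>a\<in>Basis. \<Sum>b\<in>Basis. (p x \<bullet> a) *\<^sub>R (q x \<bullet> b) *\<^sub>R ?D a b h)) (at (\<phi> x))"
      by (rule has_derivative_transform_within_open[OF _ V(1,2)])
        (rule bilinear_expand[OF V(3), symmetric])
    from frechet_derivative_at[OF this] show ?thesis by (simp add: fun_eq_iff)
  qed
  finally have "((\<lambda>y. \<Sum>a\<in>Basis. \<Sum>b\<in>Basis. (p y \<bullet> a) *\<^sub>R (q y \<bullet> b) *\<^sub>R B (\<phi> y) a b) has_derivative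
     (\<lambda>h. frechet_derivative (\<lambda>z. B z (p x) (q x)) (at (\<phi> x)) (\<phi>' h) + B (\<phi> x) (p' h) (q x) + B (\<phi>
       x) (p x) (q' h))) (at x)" .
  moreover have "\<forall>\<^sub>F y in at x. \<phi> y \<in> V"
    using \<phi> V by (metis eventually_at_topological has_derivative_continuous isCont_def
      topological_tendstoD)
  then have "\<forall>\<^sub>F y in at x. (\<Sum>a\<in>Basis. \<Sum>b\<in>Basis. (p y \<bullet> a) *\<^sub>R (q y \<bullet> b) *\<^sub>R B (\<phi> y) a b) =
    B (\<phi> y) (p y) (q y)"
    by (rule eventually_mono) (rule bilinear_expand[OF V(3), symmetric])
  ultimately show ?thesis
    by (rule has_derivative_transform_eventually) (rule bilinear_expand[OF bl, symmetric], rule UNIV_I)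
qed

lemma has_derivative_linear_family:
  fixes L :: "'v::euclidean_space \<Rightarrow> 'u::euclidean_space \<Rightarrow> 'w::euclidean_space"
    and \<phi> :: "'t::euclidean_space \<Rightarrow> 'v"
  assumes V: "open V" "\<phi> x \<in> V" "\<And>y. y \<in> V \<Longrightarrow> linear (L y)"
    and L: "\<And>a. (\<lambda>y. L y a) differentiable (at (\<phi> x))"
    and \<phi>: "(\<phi> has_derivative \<phi>') (at x)" and q: "(q has_derivative q') (at x)"
  shows "((\<lambda>y. L (\<phi> y) (q y)) has_derivative
     (\<lambda>h. frechet_derivative (\<lambda>z. L z (q x)) (at (\<phi> x)) (\<phi>' h) + L (\<phi> x) (q' h))) (at x)"
proof -
  \<comment> \<open>A linear family becomes bilinear through a dummy first argument, which is then
    set to the constant unit vector \<open>e\<close>.\<close>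
  obtain e :: 'u where e: "e \<in> Basis" using nonempty_Basis by blast
  have bl: "bilinear (\<lambda>u v. (u \<bullet> e) *\<^sub>R L y v)" if "y \<in> V" for y
    using V(3)[OF that] unfolding bilinear_def linear_iff by (simp add: inner_add_left algebra_simps)
  have d: "(\<lambda>y. (a \<bullet> e) *\<^sub>R L y b) differentiable (at (\<phi> x))" for a b
    using L by (intro differentiable_scaleR) auto
  show ?thesis
    using has_derivative_bilinear_family[where B="\<lambda>y u v. (u \<bullet> e) *\<^sub>R L y v" and p="\<lambda>_. e"
      and p'="\<lambda>_. 0",
        OF V(1,2) bl d \<phi> has_derivative_const q] e by simp
qed

section \<open>Regularity of a metric and of its inverse\<close>

lemma metric_on_Ck:
  assumes "metric_on k U G"
  shows "Ck_on k U (\<lambda>x. G x u v)"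
proof (rule Ck_on_bilinear_family[OF metric_onD(1)[OF assms] _ _ Ck_on_const Ck_on_const])
  show "bilinear (G x)" if "x \<in> U" for x by (rule inner_formD(1)[OF metric_onD(2)[OF assms that]])
  show "Ck_on k U (\<lambda>x. G x a b)" if "a \<in> Basis" "b \<in> Basis" for a b
    using assms that unfolding metric_on_def by blast
qed

lemma metric_on_mono: "metric_on k U G \<Longrightarrow> j \<le> k \<Longrightarrow> metric_on j U G"
  unfolding metric_on_def using Ck_on_mono by blast

lemma metric_on_differentiable:
  assumes "metric_on k U G" "0 < k" "x \<in> U"
  shows "(\<lambda>x. G x u v) differentiable (at x)"
  using Ck_on_differentiable[OF metric_on_Ck[OF assms(1)] assms(2)] metric_onD(1)[OF assms(1)] assms(3)
  by (rule differentiable_on_openD)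

lemma hoelder_bound_0I:
  assumes "\<And>i. i \<in> I \<Longrightarrow> continuous_on S (F i)" "\<And>i x. i \<in> I \<Longrightarrow> x \<in> S \<Longrightarrow> \<bar>F i x\<bar> \<le> K"
  shows "hoelder_bound 0 I S F"
proof (rule hoelder_boundI[OF assms])
  fix i x y assume "i \<in> I" "x \<in> S" "y \<in> S"
  then have "\<bar>F i x\<bar> \<le> K" "\<bar>F i y\<bar> \<le> K" using assms(2) by blast+
  then have "\<bar>F i x - F i y\<bar> \<le> 2 * K" by linarith
  \<comment> \<open>\<open>0 powr 0\<close> is 0, so coinciding points are a case of their
    own.\<close>
  then show "\<bar>F i x - F i y\<bar> \<le> (2 * K) * dist x y powr 0" by (cases "x = y") simp_all
qed

text \<open>On a small compact ball positivity is uniform, so \<open>inv_form_le\<close> bounds the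
  inverse. The Hoelder lemma for inverse matrices at exponent 0, where it speaks of bounded
  continuous functions, then yields continuity.\<close>

lemma inv_form_continuous:
  fixes G :: "'v::euclidean_space lmetric"
  assumes U: "open U" and ip: "\<And>x. x \<in> U \<Longrightarrow> inner_form (G x)" and c:
    "\<And>a b. continuous_on U (\<lambda>x. G x a b)"
    and ab: "a \<in> Basis" "b \<in> Basis"
  shows "continuous_on U (\<lambda>x. inv_form (G x) a b)"
proof (rule continuous_at_imp_continuous_on, rule ballI)
  fix x assume "x \<in> U"
  then obtain e where e: "e > 0" "cball x e \<subseteq> U" using U open_contains_cball by blast
  have ip': "inner_form (G y)" if "y \<in> cball x e" for y using ip e(2) that by blast
  have c': "continuous_on (cball x e) (\<lambda>x. G x a b)" for a b
    using c e(2) by (rule continuous_on_subset)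
  obtain m where m: "m > 0" "\<And>x' u. x' \<in> cball x e \<Longrightarrow> m * (norm u)\<^sup>2 \<le> G x' u u"
    using inner_form_uniform[of "cball x e" G, OF compact_cball] ip' c' by blast
  have "hoelder_bound 0 {()} (ball x e) (\<lambda>_ x. inv_form (G x) a b)"
  proof (rule hoelder_bound_matrix_inverse[OF open_ball finite_Basis ab, where A="\<lambda>a b _ x. G x a b"
    and B="\<lambda>a b _ x. inv_form (G x) a b" and K="1/m"])
    fix a b :: 'v assume ab: "a \<in> Basis" "b \<in> Basis"
    have "bounded ((\<lambda>x. G x a b) ` cball x e)"
      using c' by (intro compact_imp_bounded compact_continuous_image compact_cball)
    then have "\<exists>K. \<forall>y\<in>cball x e. \<bar>G y a b\<bar> \<le> K" by (simp add: bounded_iff)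
    then obtain K where K: "\<And>y. y \<in> cball x e \<Longrightarrow> \<bar>G y a b\<bar> \<le> K" by blast
    show "hoelder_bound 0 {()} (ball x e) (\<lambda>_ x. G x a b)"
    proof (rule hoelder_bound_0I)
      show "continuous_on (ball x e) (\<lambda>x. G x a b)" using c' ball_subset_cball
        by (rule continuous_on_subset)
      show "\<bar>G y a b\<bar> \<le> K" if "y \<in> ball x e" for y using K ball_subset_cball that by blast
    qed
    fix y assume y: "y \<in> ball x e"
    then have y': "y \<in> cball x e" using ball_subset_cball by blast
    show "\<bar>inv_form (G y) a b\<bar> \<le> 1 / m" by (rule inv_form_le[OF ip'[OF y'] m(1) m(2)[OF y'] ab])
    show "(\<Sum>c\<in>Basis. inv_form (G y) a c * G y c b) = (if a = b then 1 else 0)"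
      by (rule inv_form_inverse_left[OF ip'[OF y'] ab])
    show "(\<Sum>c\<in>Basis. G y a c * inv_form (G y) c b) = (if a = b then 1 else 0)"
      by (rule inv_form_inverse_right[OF ip'[OF y'] ab])
  qed
  then have "continuous_on (ball x e) (\<lambda>x. inv_form (G x) a b)"
    unfolding hoelder_bound_def by auto
  then show "continuous (at x) (\<lambda>x. inv_form (G x) a b)"
    using e(1) continuous_on_eq_continuous_at[OF open_ball] centre_in_ball by blast
qed

lemma inv_form_Ck:
  fixes G :: "'v::euclidean_space lmetric"
  assumes G: "metric_on k U G" and ab: "a \<in> Basis" "b \<in> Basis"
  shows "Ck_on k U (\<lambda>x. inv_form (G x) a b)"
proof (rule Ck_on_matrix_inverse[OF metric_onD(1)[OF G] finite_Basis ab, where A="\<lambda>a b x. G x a b"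
  and B="\<lambda>a b x. inv_form (G x) a b"])
  fix y and a b :: 'v assume y: "y \<in> U" "a \<in> Basis" "b \<in> Basis"
  show "(\<Sum>c\<in>Basis. inv_form (G y) a c * G y c b) = (if a = b then 1 else 0)"
    by (rule inv_form_inverse_left[OF metric_onD(2)[OF G y(1)] y(2,3)])
  show "(\<Sum>c\<in>Basis. G y a c * inv_form (G y) c b) = (if a = b then 1 else 0)"
    by (rule inv_form_inverse_right[OF metric_onD(2)[OF G y(1)] y(2,3)])
next
  fix a b :: 'v assume ab: "a \<in> Basis" "b \<in> Basis"
  show "continuous_on U (\<lambda>x. inv_form (G x) a b)"
    by (rule inv_form_continuous[OF metric_onD[OF G] Ck_on_continuous[OF metric_on_Ck[OF G]] ab])
  show "Ck_on k U (\<lambda>x. G x a b)" by (rule metric_on_Ck[OF G])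
qed

lemma Ck_on_sharp:
  fixes G :: "'v::euclidean_space lmetric"
  assumes G: "metric_on k U G" and l: "\<And>x. x \<in> U \<Longrightarrow> linear (l x)" "\<And>c. c \<in> Basis \<Longrightarrow> Ck_on k U (\<lambda>x. l x c)"
  shows "Ck_on k U (\<lambda>x. sharp (G x) (l x))"
  unfolding Ck_on_componentwise[OF metric_onD(1)[OF G], of k "\<lambda>x. sharp (G x) (l x)"]
proof
  fix a :: 'v assume a: "a \<in> Basis"
  have "Ck_on k U (\<lambda>x. \<Sum>c\<in>Basis. inv_form (G x) a c * l x c)"
    by (intro Ck_on_sum Ck_on_mult metric_onD(1)[OF G] inv_form_Ck[OF G a] l)
  then show "Ck_on k U (\<lambda>x. sharp (G x) (l x) \<bullet> a)"
    by (rule iffD1[OF Ck_on_cong[OF metric_onD(1)[OF G]], rotated])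
      (simp add: inner_sharp[OF metric_onD(2)[OF G] l(1), symmetric] inner_commute)
qed


subsection \<open>Christoffel symbols\<close>

lemma metric_deriv_linear:
  assumes "metric_on (Suc k) U G" "x \<in> U"
  shows "linear (\<lambda>w. metric_deriv G x w u v)"
  unfolding metric_deriv_def using metric_on_differentiable[OF assms(1) _ assms(2)]
  by (intro linear_frechet_derivative) simp

lemma bilinear_frechet_derivative:
  fixes B :: "'v::euclidean_space \<Rightarrow> 'u::euclidean_space \<Rightarrow> 'u \<Rightarrow> 'w::euclidean_space"
  assumes U: "open U" "x \<in> U" and bl: "\<And>y. y \<in> U \<Longrightarrow> bilinear (B y)"
    and B: "\<And>a b. (\<lambda>y. B y a b) differentiable (at x)"
  shows "bilinear (\<lambda>a b. frechet_derivative (\<lambda>y. B y a b) (at x) w)"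
proof -
  note d = frechet_derivative_works[THEN iffD1, OF B]
  have eqI: "frechet_derivative (\<lambda>y. B y a b) (at x) w = g' w"
    if "(g has_derivative g') (at x)" "\<And>y. y \<in> U \<Longrightarrow> g y = B y a b" for g g' a b
    using frechet_derivative_at[OF has_derivative_transform_within_open[OF that(1) U that(2)]] by simp
  show ?thesis unfolding bilinear_def
  proof (intro conjI allI linearI)
    fix u v v' :: 'u and c
    let ?D = "\<lambda>a b. frechet_derivative (\<lambda>y. B y a b) (at x) w"
    show "?D u (v + v') = ?D u v + ?D u v'"
      by (rule eqI[OF has_derivative_add[OF d d]]) (simp add: bilinear_radd[OF bl])
    show "?D (v + v') u = ?D v u + ?D v' u"
      by (rule eqI[OF has_derivative_add[OF d d]]) (simp add: bilinear_ladd[OF bl])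
    show "?D u (c *\<^sub>R v) = c *\<^sub>R ?D u v"
      by (rule eqI[OF has_derivative_scaleR_right[OF d]]) (simp add: bilinear_rmul[OF bl])
    show "?D (c *\<^sub>R v) u = c *\<^sub>R ?D v u"
      by (rule eqI[OF has_derivative_scaleR_right[OF d]]) (simp add: bilinear_lmul[OF bl])
  qed
qed

lemma metric_deriv_bilinear:
  assumes G: "metric_on (Suc k) U G" "x \<in> U"
  shows "bilinear (metric_deriv G x w)"
  using bilinear_frechet_derivative[of U x G w, OF metric_onD(1)[OF G(1)] G(2)
      inner_formD(1)[OF metric_onD(2)[OF G(1)]] metric_on_differentiable[OF G(1) _ G(2)]]
  by (simp add: metric_deriv_def[abs_def])

lemma metric_deriv_sym:
  assumes "metric_on (Suc k) U G" "x \<in> U"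
  shows "metric_deriv G x w u v = metric_deriv G x w v u"
  unfolding metric_deriv_def
  using inner_formD(2)[OF metric_onD(2)[OF assms(1)]]
  by (intro fun_cong[OF frechet_derivative_cong_open[OF metric_onD(1)[OF assms(1)] assms(2)]])

lemma metric_deriv_Ck:
  assumes "metric_on (Suc k) U G"
  shows "Ck_on k U (\<lambda>x. metric_deriv G x w u v)"
  unfolding metric_deriv_def
  by (rule Ck_on_frechet_derivative[OF metric_onD(1)[OF assms] metric_on_Ck[OF assms]])

text \<open>The Christoffel symbols of the first kind: the one-form whose \<open>sharp\<close> is
  \<open>christoffel\<close>.\<close>

definition christoffel_form :: "('v::euclidean_space) lmetric \<Rightarrow> 'v \<Rightarrow> 'v \<Rightarrow> 'v \<Rightarrow> 'v \<Rightarrow> real" where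
  "christoffel_form G x u v w = (metric_deriv G x u v w + metric_deriv G x v u w -
    metric_deriv G x w u v) / 2"

lemma christoffel_form_linear:
  assumes "metric_on (Suc k) U G" "x \<in> U"
  shows "linear (christoffel_form G x u v)" "linear (\<lambda>u. christoffel_form G x u v w)"
    "linear (\<lambda>v. christoffel_form G x u v w)"
  unfolding linear_iff christoffel_form_def
  using bilinear_simps[OF metric_deriv_bilinear[OF assms]] linear_add[OF metric_deriv_linear[OF assms]]
    linear_cmul[OF metric_deriv_linear[OF assms]]
  by (simp_all add: field_simps)

lemma christoffel_works:
  assumes "metric_on (Suc k) U G" "x \<in> U"
  shows "G x (christoffel G x u v) w = christoffel_form G x u v w"
  using sharp_works[OF metric_onD(2)[OF assms] christoffel_form_linear(1)[OF assms]]
  unfolding christoffel_def christoffel_form_def .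

lemma christoffel_eqI:
  assumes "metric_on (Suc k) U G" "x \<in> U" "\<And>w. G x z w = christoffel_form G x u v w"
  shows "christoffel G x u v = z"
  unfolding christoffel_def
    using sharp_eqI[OF metric_onD(2)[OF assms(1,2)] assms(3)[unfolded christoffel_form_def]] .

lemma christoffel_bilinear:
  assumes "metric_on (Suc k) U G" "x \<in> U"
  shows "bilinear (christoffel G x)"
  unfolding bilinear_def
proof (intro conjI allI linearI)
  note bl = bilinear_simps[OF inner_formD(1)[OF metric_onD(2)[OF assms]]]
  note w = christoffel_works[OF assms]
  note c = christoffel_form_linear[OF assms]
  fix u v v' c
  show "christoffel G x u (v + v') = christoffel G x u v + christoffel G x u v'"
    "christoffel G x (v + v') u = christoffel G x v u + christoffel G x v' u"
    by (rule christoffel_eqI[OF assms], simp add: bl w linear_add[OF c(2)] linear_add[OF c(3)])+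
  show "christoffel G x u (c *\<^sub>R v) = c *\<^sub>R christoffel G x u v"
    "christoffel G x (c *\<^sub>R v) u = c *\<^sub>R christoffel G x v u"
    by (rule christoffel_eqI[OF assms], simp add: bl w linear_cmul[OF c(2)] linear_cmul[OF c(3)])+
qed

lemma christoffel_sym:
  assumes "metric_on (Suc k) U G" "x \<in> U"
  shows "christoffel G x u v = christoffel G x v u"
  by (rule christoffel_eqI[OF assms])
    (simp add: christoffel_works[OF assms] christoffel_form_def metric_deriv_sym[OF assms, of _ u v])

text \<open>The Levi-Civita connection leaves the metric parallel: in the sum of the two Christoffel
  forms the derivatives in directions \<open>v\<close> and \<open>w\<close> cancel, and the one in
  direction \<open>u\<close> occurs twice with weight 1/2.\<close>

lemma christoffel_compatible:
  assumes "metric_on (Suc k) U G" "x \<in> U"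
  shows "metric_deriv G x u v w = G x (christoffel G x u v) w + G x v (christoffel G x u w)"
  using inner_formD(2)[OF metric_onD(2)[OF assms], of v]
  by (simp add: christoffel_works[OF assms] christoffel_form_def field_simps
     metric_deriv_sym[OF assms, of _ w v] metric_deriv_sym[OF assms, of _ u v]
       metric_deriv_sym[OF assms, of _ w u])

lemma christoffel_Ck:
  assumes "metric_on (Suc k) U G"
  shows "Ck_on k U (\<lambda>x. christoffel G x u v)"
  unfolding christoffel_def
proof (rule Ck_on_sharp)
  show "metric_on k U G" using assms by (rule metric_on_mono) simp
  note U = metric_onD(1)[OF assms] and md = metric_deriv_Ck[OF assms]
  show "Ck_on k U (\<lambda>x. (metric_deriv G x u v c + metric_deriv G x v u c -
    metric_deriv G x c u v) / 2)" for c
    using Ck_on_mult[OF U Ck_on_diff[OF U Ck_on_add[OF U md md] md] Ck_on_const[of k U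
      "1/2"], of u v c v u c c u v]
    by simp
qed (rule christoffel_form_linear(1)[OF assms, unfolded christoffel_form_def])

lemma christoffel_differentiable:
  assumes "metric_on (Suc (Suc k)) U G" "x \<in> U"
  shows "(\<lambda>x. christoffel G x u v) differentiable (at x)"
  using Ck_on_differentiable[OF christoffel_Ck[OF assms(1)]] metric_onD(1)[OF assms(1)] assms(2)
  by (intro differentiable_on_openD) auto

subsection \<open>Invariance under changes of coordinates\<close>

lemma curvature_linear:
  assumes G: "metric_on (Suc (Suc 0)) U G" "x \<in> U"
  shows "linear (\<lambda>u. curvature G x u v w)" "linear (\<lambda>v. curvature G x u v w)"
    "linear (curvature G x u v)"
proof -
  note bl = christoffel_bilinear[OF G]
  note d = christoffel_differentiable[OF G]
  have D: "bilinear (\<lambda>a b. frechet_derivative (\<lambda>y. christoffel G y a b) (at x) w)" for w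
    by (rule bilinear_frechet_derivative[OF metric_onD(1)[OF G(1)] G(2)
      christoffel_bilinear[OF G(1)] d])
  note D = bilinear_simps[OF D] linear_add[OF linear_frechet_derivative[OF d]]
    linear_cmul[OF linear_frechet_derivative[OF d]]
  show "linear (\<lambda>u. curvature G x u v w)" "linear (\<lambda>v. curvature G x u v w)"
    "linear (curvature G x u v)"
    unfolding curvature_def by (rule linearI; simp add: bilinear_simps[OF bl] D algebra_simps)+
qed

lemma ricci_bilinear:
  assumes G: "metric_on (Suc (Suc 0)) U G" "x \<in> U"
  shows "bilinear (ricci G x)"
  unfolding ricci_def bilinear_def
  by (auto intro!: linearI simp: linear_add[OF curvature_linear(2)[OF G]] linear_add[OF
    curvature_linear(3)[OF G]]
      linear_cmul[OF curvature_linear(2)[OF G]] linear_cmul[OF curvature_linear(3)[OF G]]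
      inner_add_right sum.distrib sum_distrib_left)

text \<open>\<open>Q\<close> is the inverse of the differential of \<phi>, carried along as data
  because the trace arguments need it. Three derivatives of \<phi> are required because the
  curvature differentiates the second derivatives that appear in the Christoffel symbols.\<close>

locale metric_pullback =
  fixes U :: "'u::euclidean_space set" and V :: "'v::euclidean_space set" and \<phi> :: "'u \<Rightarrow> 'v"
    and G :: "'u lmetric" and H :: "'v lmetric" and Q :: "'u \<Rightarrow> 'v \<Rightarrow> 'u"
  assumes G: "metric_on (Suc (Suc 0)) U G" and H: "metric_on (Suc (Suc 0)) V H"
    and \<phi>_Ck: "Ck_on 3 U \<phi>" and \<phi>_in: "\<And>x. x \<in> U \<Longrightarrow> \<phi> x \<in> V"
    and Q: "\<And>x. x \<in> U \<Longrightarrow> linear (Q x)"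
      "\<And>x v. x \<in> U \<Longrightarrow> frechet_derivative \<phi> (at x) (Q x v) = v"
      "\<And>x v. x \<in> U \<Longrightarrow> Q x (frechet_derivative \<phi> (at x) v) = v"
    and GH: "\<And>x u v. x \<in> U \<Longrightarrow>
      G x u v = H (\<phi> x) (frechet_derivative \<phi> (at x) u) (frechet_derivative \<phi> (at x) v)"
begin

definition "P x = frechet_derivative \<phi> (at x)"
definition "P2 x u v = frechet_derivative (\<lambda>y. P y v) (at x) u"
definition "P3 x u v w = frechet_derivative (\<lambda>y. P2 y v w) (at x) u"

lemma U: "open U" and V: "open V"
  using metric_onD(1)[OF G] metric_onD(1)[OF H] .

lemma P_Ck: "Ck_on 2 U (\<lambda>y. P y v)"
  unfolding P_def using \<phi>_Ck by (intro Ck_on_frechet_derivative[OF U]) (simp add: eval_nat_numeral)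

lemma P2_Ck: "Ck_on 1 U (\<lambda>y. P2 y u v)"
  unfolding P2_def using P_Ck[of v] by (intro Ck_on_frechet_derivative[OF U])
    (simp add: eval_nat_numeral)

lemma \<phi>_deriv: "x \<in> U \<Longrightarrow> (\<phi> has_derivative P x) (at x)"
  using Ck_on_differentiable[OF \<phi>_Ck] unfolding P_def by (intro has_derivative_openD[OF _ U]) auto

lemma P_differentiable: "x \<in> U \<Longrightarrow> (\<lambda>y. P y v) differentiable (at x)"
  using Ck_on_differentiable[OF P_Ck] by (intro differentiable_on_openD[OF _ U]) auto

lemma P_deriv: "x \<in> U \<Longrightarrow> ((\<lambda>y. P y v) has_derivative (\<lambda>u. P2 x u v)) (at x)"
  unfolding P2_def using P_differentiable frechet_derivative_works by blast

lemma P2_deriv: "x \<in> U \<Longrightarrow> ((\<lambda>y. P2 y v w) has_derivative (\<lambda>u. P3 x u v w)) (at x)"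
  unfolding P3_def using Ck_on_differentiable[OF P2_Ck] by (intro has_derivative_openD[OF _ U]) auto

lemma P_linear: "x \<in> U \<Longrightarrow> linear (P x)"
  using \<phi>_deriv has_derivative_linear by blast

lemma P2_sym: "x \<in> U \<Longrightarrow> P2 x u v = P2 x v u"
  unfolding P2_def P_def using Ck_on_mono[OF \<phi>_Ck, of 2]
    by (intro second_derivative_symmetric[OF U]) auto

lemma P3_sym: "x \<in> U \<Longrightarrow> P3 x u v w = P3 x v u w"
  unfolding P3_def P2_def by (rule second_derivative_symmetric[OF U P_Ck])

lemma P_Q: "x \<in> U \<Longrightarrow> P x (Q x v) = v" and Q_P: "x \<in> U \<Longrightarrow> Q x (P x u) = u"
  using Q by (auto simp: P_def)

lemma GH': "x \<in> U \<Longrightarrow> G x u v = H (\<phi> x) (P x u) (P x v)"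
  using GH by (simp add: P_def)

lemma metric_deriv_pullback:
  assumes x: "x \<in> U"
  shows "metric_deriv G x w u v = metric_deriv H (\<phi> x) (P x w) (P x u) (P x v) +
     H (\<phi> x) (P2 x w u) (P x v) + H (\<phi> x) (P x u) (P2 x w v)"
proof -
  have "((\<lambda>y. H (\<phi> y) (P y u) (P y v)) has_derivative (\<lambda>h.
    metric_deriv H (\<phi> x) (P x h) (P x u) (P x v) +
     H (\<phi> x) (P2 x h u) (P x v) + H (\<phi> x) (P x u) (P2 x h v))) (at x)"
    unfolding metric_deriv_def
    using metric_on_differentiable[OF H _ \<phi>_in[OF x]] inner_formD(1)[OF metric_onD(2)[OF H]]
    by (intro has_derivative_bilinear_family[where B=H and V=V] V \<phi>_in \<phi>_deriv P_deriv x) auto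
  then have "((\<lambda>y. G y u v) has_derivative (\<lambda>h. metric_deriv H (\<phi> x) (P x h) (P x u) (P x v) +
     H (\<phi> x) (P2 x h u) (P x v) + H (\<phi> x) (P x u) (P2 x h v))) (at x)"
    by (rule has_derivative_transform_within_open[OF _ U x]) (simp add: GH')
  from frechet_derivative_at[OF this] show ?thesis unfolding metric_deriv_def by (simp add: fun_eq_iff)
qed

text \<open>Differentiating the relation between \<open>G\<close> and \<open>H\<close> produces
  second derivatives of \<phi>. In the combination that forms the Christoffel symbols their symmetry
  cancels all of them except \<open>P2 x u v\<close>.\<close>

lemma christoffel_pullback:
  assumes x: "x \<in> U"
  shows "P x (christoffel G x u v) = christoffel H (\<phi> x) (P x u) (P x v) + P2 x u v"
proof (rule inner_form_eqI[OF metric_onD(2)[OF H \<phi>_in[OF x]]])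
  fix w'
  define w where "w = Q x w'"
  have w: "w' = P x w" using P_Q[OF x] by (simp add: w_def)
  note sym = inner_formD(2)[OF metric_onD(2)[OF H \<phi>_in[OF x]]]
  have "H (\<phi> x) (P x (christoffel G x u v)) w' = christoffel_form G x u v w"
    by (simp add: w GH'[OF x, symmetric] christoffel_works[OF G x])
  also have "\<dots> = christoffel_form H (\<phi> x) (P x u) (P x v) w' + H (\<phi> x) (P2 x u v) w'"
    unfolding christoffel_form_def metric_deriv_pullback[OF x] w
    using P2_sym[OF x, of u v] P2_sym[OF x, of u w] P2_sym[OF x, of v w]
      sym[of "P x v" "P2 x u w"] sym[of "P x u" "P2 x v w"] by (simp add: field_simps)
  finally show "H (\<phi> x) (P x (christoffel G x u v)) w' =
     H (\<phi> x) (christoffel H (\<phi> x) (P x u) (P x v) + P2 x u v) w'"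
    using bilinear_ladd[OF inner_formD(1)[OF metric_onD(2)[OF H \<phi>_in[OF x]]]]
    by (simp add: christoffel_works[OF H \<phi>_in[OF x]])
qed

lemma christoffel_deriv_pullback:
  assumes x: "x \<in> U"
  shows "P2 x u (christoffel G x v w) + P x (frechet_derivative (\<lambda>y. christoffel G y v w) (at x) u) =
     frechet_derivative (\<lambda>y. christoffel H y (P x v) (P x w)) (at (\<phi> x)) (P x u) +
     christoffel H (\<phi> x) (P2 x u v) (P x w) + christoffel H (\<phi> x) (P x v) (P2 x u w) + P3 x u v w"
proof -
  have 1: "((\<lambda>y. P y (christoffel G y v w)) has_derivative (\<lambda>u. P2 x u (christoffel G x v w) +
      P x (frechet_derivative (\<lambda>y. christoffel G y v w) (at x) u))) (at x)"
    using has_derivative_linear_family[of U "\<lambda>y. y" x P "\<lambda>u. u" "\<lambda>y. christoffel G y v w"]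
      U x P_linear P_differentiable frechet_derivative_works[THEN iffD1, OF
        christoffel_differentiable[OF G x]]
    by (simp add: P2_def)
  have 2: "((\<lambda>y. christoffel H (\<phi> y) (P y v) (P y w) + P2 y v w) has_derivative (\<lambda>u.
     frechet_derivative (\<lambda>y. christoffel H y (P x v) (P x w)) (at (\<phi> x)) (P x u) +
     christoffel H (\<phi> x) (P2 x u v) (P x w) + christoffel H (\<phi> x) (P x v)
       (P2 x u w) + P3 x u v w)) (at x)"
    by (intro has_derivative_add P2_deriv x
        has_derivative_bilinear_family[where B="christoffel H"
          and V=V] V \<phi>_in christoffel_bilinear[OF H]
        christoffel_differentiable[OF H] \<phi>_deriv P_deriv)
  have "((\<lambda>y. P y (christoffel G y v w)) has_derivative (\<lambda>u.
     frechet_derivative (\<lambda>y. christoffel H y (P x v) (P x w)) (at (\<phi> x)) (P x u) +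
     christoffel H (\<phi> x) (P2 x u v) (P x w) + christoffel H (\<phi> x) (P x v)
       (P2 x u w) + P3 x u v w)) (at x)"
    by (rule has_derivative_transform_within_open[OF 2 U x]) (simp add: christoffel_pullback)
  from has_derivative_unique[OF 1 this] show ?thesis by (simp add: fun_eq_iff)
qed

lemma curvature_pullback:
  assumes x: "x \<in> U"
  shows "P x (curvature G x u v w) = curvature H (\<phi> x) (P x u) (P x v) (P x w)"
proof -
  let ?D = "\<lambda>u v w. frechet_derivative (\<lambda>y. christoffel G y v w) (at x) u"
  let ?E = "\<lambda>u v w. frechet_derivative (\<lambda>y. christoffel H y v w) (at (\<phi> x)) u"
  let ?c = "christoffel H (\<phi> x)"
  note blH = bilinear_simps[OF christoffel_bilinear[OF H \<phi>_in[OF x]]]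
  \<comment> \<open>The last parenthesis, which collects all second and third derivatives of \<phi>,
    is symmetric in \<open>u\<close> and \<open>v\<close> and so drops out of the curvature.\<close>
  have key: "P x (?D u v w + christoffel G x u (christoffel G x v w)) =
      ?E (P x u) (P x v) (P x w) + ?c (P x u) (?c (P x v) (P x w)) +
      (?c (P2 x u v) (P x w) + ?c (P x v) (P2 x u w) + ?c (P x u) (P2 x v w) + P3 x u v w)" for u v w
  proof -
    have "P x (?D u v w) = ?E (P x u) (P x v) (P x w) + ?c (P2 x u v) (P x w) +
      ?c (P x v) (P2 x u w) + P3 x u v w
        - P2 x u (christoffel G x v w)"
      using christoffel_deriv_pullback[OF x, of u v w] by (simp add: eq_diff_eq add.commute)
    then show ?thesis
      unfolding linear_add[OF P_linear[OF x]] christoffel_pullback[OF x] by (simp add: blH)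
  qed
  have "P x (curvature G x u v w) = P x (?D u v w + christoffel G x u (christoffel G x v w)) -
      P x (?D v u w + christoffel G x v (christoffel G x u w))"
    unfolding curvature_def linear_diff[OF P_linear[OF x], symmetric] by (simp add: algebra_simps)
  also have "\<dots> = curvature H (\<phi> x) (P x u) (P x v) (P x w)"
    unfolding key curvature_def using P2_sym[OF x, of u v] P3_sym[OF x, of u v w] by simp
  finally show ?thesis .
qed

lemma ricci_pullback:
  assumes x: "x \<in> U"
  shows "ricci G x v w = ricci H (\<phi> x) (P x v) (P x w)"
proof -
  have "curvature G x b v w = Q x (curvature H (\<phi> x) (P x b) (P x v) (P x w))" for b
    using Q_P[OF x, of "curvature G x b v w"] by (simp add: curvature_pullback[OF x])
  then show ?thesis unfolding ricci_def
    using trace_conjugate[of "\<lambda>c. curvature H (\<phi> x) c (P x v) (P x w)" "P x" "Q x"]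
      curvature_linear[OF H \<phi>_in[OF x]] P_linear[OF x] Q(1)[OF x] P_Q[OF x] by simp
qed

lemma metric_trace_pullback':
  assumes x: "x \<in> U" and "bilinear h'" "\<And>u v. h u v = h' (P x u) (P x v)"
  shows "metric_trace (G x) h = metric_trace (H (\<phi> x)) h'"
  by (rule metric_trace_pullback[of "G x" "H (\<phi> x)" "P x" "Q x"])
    (use assms metric_onD(2)[OF G x] metric_onD(2)[OF H \<phi>_in[OF x]] P_linear[OF x] Q(1)[OF x]
      P_Q[OF x] Q_P[OF x] GH'[OF x] in auto)

lemma scalar_loc_pullback:
  assumes x: "x \<in> U"
  shows "scalar_loc G x = scalar_loc H (\<phi> x)"
  unfolding scalar_loc_def
  by (rule metric_trace_pullback'[OF x ricci_bilinear[OF H \<phi>_in[OF x]] ricci_pullback[OF x]])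

lemma frechet_derivative_pullback:
  assumes x: "x \<in> U" and F: "F differentiable (at (\<phi> x))" and f: "\<And>y. y \<in> U \<Longrightarrow> f y = F (\<phi> y)"
  shows "frechet_derivative f (at x) v = frechet_derivative F (at (\<phi> x)) (P x v)"
proof -
  have "((\<lambda>y. F (\<phi> y)) has_derivative (\<lambda>v. frechet_derivative F (at (\<phi> x)) (P x v))) (at x)"
    using diff_chain_at[OF \<phi>_deriv[OF x] frechet_derivative_works[THEN iffD1, OF F]]
      by (simp add: o_def)
  then have "(f has_derivative (\<lambda>v. frechet_derivative F (at (\<phi> x)) (P x v))) (at x)"
    by (rule has_derivative_transform_within_open[OF _ U x]) (simp add: f)
  from frechet_derivative_at[OF this] show ?thesis by (simp add: fun_eq_iff)
qed

text \<open>The second derivative of \<phi> enters once through the chain rule and once through the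
  Christoffel symbols, with opposite signs.\<close>

lemma hessian_pullback:
  fixes F :: "'v \<Rightarrow> real"
  assumes x: "x \<in> U" and F: "Ck_on 2 V F" and f: "\<And>y. y \<in> U \<Longrightarrow> f y = F (\<phi> y)"
  shows "hessian G f x u v = hessian H F (\<phi> x) (P x u) (P x v)"
proof -
  let ?DF = "\<lambda>z. frechet_derivative F (at z)"
  have dF: "F differentiable (at z)" if "z \<in> V" for z
    using Ck_on_differentiable[OF F] that by (intro differentiable_on_openD[OF _ V]) auto
  have F2: "Ck_on 1 V (\<lambda>z. ?DF z a)" for a
    using F by (intro Ck_on_frechet_derivative[OF V]) (simp add: eval_nat_numeral)
  have ddF: "(\<lambda>z. ?DF z a) differentiable (at (\<phi> x))" for a
    using Ck_on_differentiable[OF F2] \<phi>_in[OF x] by (intro differentiable_on_openD[OF _ V]) auto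
  have "((\<lambda>y. ?DF (\<phi> y) (P y v)) has_derivative
     (\<lambda>u. frechet_derivative (\<lambda>z. ?DF z (P x v)) (at (\<phi> x)) (P x u) + ?DF (\<phi> x) (P2 x u v))) (at x)"
    by (intro has_derivative_linear_family[where L="?DF" and V=V] V \<phi>_in x ddF \<phi>_deriv P_deriv
        linear_frechet_derivative dF)
  then have "((\<lambda>y. frechet_derivative f (at y) v) has_derivative
     (\<lambda>u. frechet_derivative (\<lambda>z. ?DF z (P x v)) (at (\<phi> x)) (P x u) + ?DF (\<phi> x) (P2 x u v))) (at x)"
    by (rule has_derivative_transform_within_open[OF _ U x])
      (rule frechet_derivative_pullback[OF _ dF f, symmetric]; simp add: \<phi>_in)
  from frechet_derivative_at[OF this]
  have "frechet_derivative (\<lambda>y. frechet_derivative f (at y) v) (at x) u =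
      frechet_derivative (\<lambda>z. ?DF z (P x v)) (at (\<phi> x)) (P x u) + ?DF (\<phi> x) (P2 x u v)"
    by (simp add: fun_eq_iff)
  moreover have "frechet_derivative f (at x) (christoffel G x u v) =
      ?DF (\<phi> x) (christoffel H (\<phi> x) (P x u) (P x v)) + ?DF (\<phi> x) (P2 x u v)"
    using frechet_derivative_pullback[OF x dF[OF \<phi>_in[OF x]] f] christoffel_pullback[OF x]
      linear_add[OF linear_frechet_derivative[OF dF[OF \<phi>_in[OF x]]]] by simp
  ultimately show ?thesis unfolding hessian_def by simp
qed

end

lemma hessian_bilinear:
  assumes H: "metric_on (Suc (Suc 0)) V H" "z \<in> V" and F: "Ck_on 2 V F"
  shows "bilinear (hessian H F z)"
proof -
  note V = metric_onD(1)[OF H(1)]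
  have dF: "F differentiable (at z)" if "z \<in> V" for z
    using Ck_on_differentiable[OF F] that by (intro differentiable_on_openD[OF _ V]) auto
  have F2: "Ck_on 1 V (\<lambda>z. frechet_derivative F (at z) a)" for a
    using F by (intro Ck_on_frechet_derivative[OF V]) (simp add: eval_nat_numeral)
  have ddF: "(\<lambda>z. frechet_derivative F (at z) a) differentiable (at z)" for a
    using Ck_on_differentiable[OF F2] H(2) by (intro differentiable_on_openD[OF _ V]) auto
  note D = linear_add[OF linear_frechet_derivative[OF ddF]]
    linear_cmul[OF linear_frechet_derivative[OF ddF]]
    linear_add[OF linear_frechet_derivative[OF dF[OF H(2)]]]
      linear_cmul[OF linear_frechet_derivative[OF dF[OF H(2)]]]
  have D2: "hessian H F z u v = hessian H F z v u" for u v
    unfolding hessian_def using second_derivative_symmetric[OF V F H(2)] christoffel_sym[OF H] by simp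
  have L: "linear (\<lambda>u. hessian H F z u v)" for v
    unfolding hessian_def
      by (rule linearI) (simp_all add: D bilinear_simps[OF christoffel_bilinear[OF H]] algebra_simps)
  then show ?thesis unfolding bilinear_def using D2 by (metis (no_types, lifting) ext)
qed

context metric_pullback
begin

lemma laplacian_pullback:
  fixes F :: "'v \<Rightarrow> real"
  assumes x: "x \<in> U" and F: "Ck_on 2 V F" and f: "\<And>y. y \<in> U \<Longrightarrow> f y = F (\<phi> y)"
  shows "metric_trace (G x) (hessian G f x) = metric_trace (H (\<phi> x)) (hessian H F (\<phi> x))"
  by (rule metric_trace_pullback'[OF x hessian_bilinear[OF H \<phi>_in[OF x] F] hessian_pullback[OF x F f]])

lemma diff_norm_pullback:
  fixes F :: "'v \<Rightarrow> real"
  assumes x: "x \<in> U" and F: "Ck_on 2 V F" and f: "\<And>y. y \<in> U \<Longrightarrow> f y = F (\<phi> y)"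
  shows "frechet_derivative f (at x) (sharp (G x) (frechet_derivative f (at x))) =
    frechet_derivative F (at (\<phi> x)) (sharp (H (\<phi> x)) (frechet_derivative F (at (\<phi> x))))"
proof -
  have dF: "F differentiable (at (\<phi> x))"
    using Ck_on_differentiable[OF F] \<phi>_in[OF x] by (intro differentiable_on_openD[OF _ V]) auto
  have eq: "frechet_derivative f (at x) v = frechet_derivative F (at (\<phi> x)) (P x v)" for v
    by (rule frechet_derivative_pullback[OF x dF f])
  have "linear (\<lambda>v. frechet_derivative F (at (\<phi> x)) (P x v))"
    using linear_compose[OF P_linear[OF x] linear_frechet_derivative[OF dF]] by (simp add: o_def)
  then have lin: "linear (frechet_derivative f (at x))" unfolding eq[symmetric] .
  have "P x (sharp (G x) (frechet_derivative f (at x))) =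
    sharp (H (\<phi> x)) (frechet_derivative F (at (\<phi> x)))"
    by (rule sharp_pullback[OF metric_onD(2)[OF G x] metric_onD(2)[OF H \<phi>_in[OF x]] lin P_linear[OF x]
      P_Q[OF x] Q_P[OF x] GH'[OF x] eq linear_frechet_derivative[OF dF]])
  then show ?thesis by (simp add: eq)
qed

end

subsection \<open>Conformal change of the scalar curvature\<close>

locale conformal_metric =
  fixes U :: "'v::euclidean_space set" and H :: "'v lmetric" and r :: "'v \<Rightarrow> real" and G :: "'v lmetric"
  assumes H: "metric_on (Suc (Suc 0)) U H" and r_Ck: "Ck_on 2 U r" and r_pos: "\<And>x. x \<in> U \<Longrightarrow> 0 < r x"
    and GH: "\<And>x u v. x \<in> U \<Longrightarrow> G x u v = H x u v / (r x)\<^sup>2"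
begin

text \<open>\<open>\<sigma>\<close> is the one-form d log r and \<open>s\<close> its gradient with
  respect to \<open>H\<close>. The difference of the two connections is algebraic in
  \<open>H\<close>, \<open>\<sigma>\<close> and \<open>s\<close>.\<close>

definition "\<sigma> x u = frechet_derivative r (at x) u / r x"
definition "s x = sharp (H x) (\<sigma> x)"
definition "\<sigma>' x u v = frechet_derivative (\<lambda>y. \<sigma> y v) (at x) u"

lemma U: "open U" using metric_onD(1)[OF H] .

lemma G: "metric_on (Suc (Suc 0)) U G"
  unfolding metric_on_def
proof (intro conjI ballI U)
  fix x assume x: "x \<in> U"
  have "G x = (\<lambda>u v. H x u v / (r x)\<^sup>2)" using GH[OF x] by (simp add: fun_eq_iff)
  then show "inner_form (G x)"
    using metric_onD(2)[OF H x] r_pos[OF x] unfolding inner_form_def bilinear_def linear_iff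
    by (auto simp: add_divide_distrib)
next
  fix u v :: 'v
  have "Ck_on 2 U (\<lambda>x. H x u v * (inverse (r x) * inverse (r x)))"
    using r_pos metric_on_Ck[OF H] by (intro Ck_on_mult Ck_on_inverse U r_Ck)
      (auto simp: numeral_2_eq_2 less_imp_neq[symmetric])
  then show "Ck_on (Suc (Suc 0)) U (\<lambda>x. G x u v)"
    unfolding numeral_2_eq_2
    by (rule iffD1[OF Ck_on_cong[OF U], rotated]) (simp add: GH field_simps power2_eq_square)
qed

lemma r_differentiable: "x \<in> U \<Longrightarrow> r differentiable (at x)"
  using Ck_on_differentiable[OF r_Ck] by (intro differentiable_on_openD[OF _ U]) auto

lemma dr_Ck: "Ck_on 1 U (\<lambda>x. frechet_derivative r (at x) u)"
  using r_Ck by (intro Ck_on_frechet_derivative[OF U]) (simp add: eval_nat_numeral)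

lemma dr_differentiable: "x \<in> U \<Longrightarrow> (\<lambda>y. frechet_derivative r (at y) u) differentiable (at x)"
  using Ck_on_differentiable[OF dr_Ck] by (intro differentiable_on_openD[OF _ U]) auto

lemma \<sigma>_linear: "x \<in> U \<Longrightarrow> linear (\<sigma> x)"
  using linear_frechet_derivative[OF r_differentiable, of x]
  unfolding \<sigma>_def linear_iff by (simp add: add_divide_distrib)

lemma \<sigma>_Ck: "Ck_on 1 U (\<lambda>x. \<sigma> x u)"
  unfolding \<sigma>_def divide_inverse
  using dr_Ck Ck_on_mono[OF r_Ck, of 1] r_pos by (intro Ck_on_mult Ck_on_inverse U)
    (auto simp: less_imp_neq[symmetric])

lemma \<sigma>_deriv: "x \<in> U \<Longrightarrow> ((\<lambda>y. \<sigma> y v) has_derivative (\<lambda>u. \<sigma>' x u v)) (at x)"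
  unfolding \<sigma>'_def using Ck_on_differentiable[OF \<sigma>_Ck] by (intro has_derivative_openD[OF _ U]) auto

lemma \<sigma>'_eq:
  assumes x: "x \<in> U"
  shows "\<sigma>' x u v = frechet_derivative (\<lambda>y. frechet_derivative r (at y) v) (at x) u / r x -
    \<sigma> x u * \<sigma> x v"
proof -
  have "((\<lambda>y. \<sigma> y v) has_derivative (\<lambda>u. frechet_derivative (\<lambda>y.
    frechet_derivative r (at y) v) (at x) u / r x
      - \<sigma> x u * \<sigma> x v)) (at x)"
    unfolding \<sigma>_def
    using r_pos[OF x] frechet_derivative_works[THEN iffD1, OF dr_differentiable[OF x]]
      frechet_derivative_works[THEN iffD1, OF r_differentiable[OF x]]
    by (auto intro!: derivative_eq_intros simp: field_simps)
  from has_derivative_unique[OF \<sigma>_deriv[OF x] this] show ?thesis by (simp add: fun_eq_iff)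
qed

lemma \<sigma>'_sym: "x \<in> U \<Longrightarrow> \<sigma>' x u v = \<sigma>' x v u"
  unfolding \<sigma>'_eq using second_derivative_symmetric_real[OF U r_Ck, of x v u]
    by (simp add: mult.commute)

lemma H_s: "x \<in> U \<Longrightarrow> H x (s x) v = \<sigma> x v"
  unfolding s_def by (rule sharp_works[OF metric_onD(2)[OF H] \<sigma>_linear])

lemma s_differentiable: "x \<in> U \<Longrightarrow> s differentiable (at x)"
proof -
  have "Ck_on 1 U s" unfolding s_def
    by (rule Ck_on_sharp[OF metric_on_mono[OF H] \<sigma>_linear \<sigma>_Ck]) auto
  then show "x \<in> U \<Longrightarrow> s differentiable (at x)"
    using Ck_on_differentiable by (intro differentiable_on_openD[OF _ U]) auto
qed

lemma metric_deriv_conformal: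
  assumes x: "x \<in> U"
  shows "metric_deriv G x w u v = (metric_deriv H x w u v - 2 * \<sigma> x w * H x u v) / (r x)\<^sup>2"
proof -
  have "((\<lambda>y. H y u v / (r y)\<^sup>2) has_derivative
     (\<lambda>w. (metric_deriv H x w u v - 2 * \<sigma> x w * H x u v) / (r x)\<^sup>2)) (at x)"
    unfolding \<sigma>_def metric_deriv_def
    using r_pos[OF x] frechet_derivative_works[THEN iffD1, OF
      metric_on_differentiable[OF H _ x, of u v]]
      frechet_derivative_works[THEN iffD1, OF r_differentiable[OF x]]
    by (auto intro!: derivative_eq_intros simp: field_simps power2_eq_square)
  then have "((\<lambda>y. G y u v) has_derivative
     (\<lambda>w. (metric_deriv H x w u v - 2 * \<sigma> x w * H x u v) / (r x)\<^sup>2)) (at x)"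
    by (rule has_derivative_transform_within_open[OF _ U x]) (simp add: GH)
  from frechet_derivative_at[OF this] show ?thesis unfolding metric_deriv_def by (simp add: fun_eq_iff)
qed

lemma christoffel_conformal:
  assumes x: "x \<in> U"
  shows "christoffel G x u v = christoffel H x u v - \<sigma> x u *\<^sub>R v - \<sigma> x v *\<^sub>R u + H x u v *\<^sub>R s x"
proof (rule christoffel_eqI[OF G x])
  fix w
  note bl = bilinear_simps[OF inner_formD(1)[OF metric_onD(2)[OF H x]]]
  have "christoffel_form G x u v w = (christoffel_form H x u v w - \<sigma> x u * H x v w - \<sigma> x v *
    H x u w + \<sigma> x w * H x u v) / (r x)\<^sup>2"
    unfolding christoffel_form_def metric_deriv_conformal[OF x]
      by (simp add: add_divide_distrib diff_divide_distrib)
  then show "G x (christoffel H x u v - \<sigma> x u *\<^sub>R v - \<sigma> x v *\<^sub>R u + H x u v *\<^sub>R s x) w =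
    christoffel_form G x u v w"
    by (simp add: GH[OF x] bl christoffel_works[OF H x] H_s[OF x])
qed

lemma christoffel_deriv_conformal:
  assumes x: "x \<in> U"
  shows "frechet_derivative (\<lambda>y. christoffel G y v w) (at x) u =
    frechet_derivative (\<lambda>y. christoffel H y v w) (at x) u - \<sigma>' x u v *\<^sub>R w - \<sigma>' x u w *\<^sub>R v +
    metric_deriv H x u v w *\<^sub>R s x + H x v w *\<^sub>R frechet_derivative s (at x) u"
proof -
  have "((\<lambda>y. christoffel H y v w - \<sigma> y v *\<^sub>R w - \<sigma> y w *\<^sub>R v + H y v w *\<^sub>R s y) has_derivative
     (\<lambda>u. frechet_derivative (\<lambda>y. christoffel H y v w) (at x) u - \<sigma>' x u v *\<^sub>R w - \<sigma>' x u w *\<^sub>R v +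
      (H x v w *\<^sub>R frechet_derivative s (at x) u + metric_deriv H x u v w *\<^sub>R s x))) (at x)"
    unfolding metric_deriv_def
    by (intro has_derivative_add has_derivative_diff has_derivative_scaleR
      has_derivative_scaleR_left \<sigma>_deriv[OF x]
        frechet_derivative_works[THEN iffD1] christoffel_differentiable[OF H x] s_differentiable[OF x]
        metric_on_differentiable[OF H _ x]) simp
  then have "((\<lambda>y. christoffel G y v w) has_derivative
     (\<lambda>u. frechet_derivative (\<lambda>y. christoffel H y v w) (at x) u - \<sigma>' x u v *\<^sub>R w - \<sigma>' x u w *\<^sub>R v +
      (H x v w *\<^sub>R frechet_derivative s (at x) u + metric_deriv H x u v w *\<^sub>R s x))) (at x)"
    by (rule has_derivative_transform_within_open[OF _ U x]) (simp add: christoffel_conformal)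
  from fun_cong[OF frechet_derivative_at[OF this], of u] show ?thesis by (simp add: algebra_simps)
qed

text \<open>The covariant derivatives of the one-form \<open>d log r\<close> and of the vector field dual to it.\<close>

definition "T x u v = \<sigma>' x u v - \<sigma> x (christoffel H x u v)"
definition "N x u = frechet_derivative s (at x) u + christoffel H x u (s x)"

lemma T_eq: "x \<in> U \<Longrightarrow> T x u v = hessian H r x u v / r x - \<sigma> x u * \<sigma> x v"
  unfolding T_def \<sigma>'_eq hessian_def by (simp add: \<sigma>_def diff_divide_distrib)

lemma T_sym: "x \<in> U \<Longrightarrow> T x u v = T x v u"
  unfolding T_def using \<sigma>'_sym christoffel_sym[OF H] by simp

lemma T_linear: assumes x: "x \<in> U" shows "linear (T x u)"
  using bilinear_right[OF hessian_bilinear[OF H x r_Ck]] \<sigma>_linear[OF x]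
  unfolding linear_iff T_eq[OF x] by (simp add: add_divide_distrib algebra_simps)

lemma H_N:
  assumes x: "x \<in> U"
  shows "H x (N x u) w = T x u w"
proof -
  have d: "(\<lambda>y. H y a b) differentiable (at x)" for a b
    by (rule metric_on_differentiable[OF H _ x]) simp
  have "((\<lambda>y. H y (s y) w) has_derivative
     (\<lambda>u. metric_deriv H x u (s x) w + H x (frechet_derivative s (at x) u) w + H x (s x) 0)) (at x)"
    unfolding metric_deriv_def
    using has_derivative_bilinear_family[of U "\<lambda>y. y" x H "\<lambda>y. y" s "frechet_derivative s (at x)"
      "\<lambda>_. w" "\<lambda>_. 0"]
      U x inner_formD(1)[OF metric_onD(2)[OF H]] d frechet_derivative_works[THEN iffD1, OF
        s_differentiable[OF x]] by auto
  then have "((\<lambda>y. \<sigma> y w) has_derivative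
     (\<lambda>u. metric_deriv H x u (s x) w + H x (frechet_derivative s (at x) u) w + H x (s x) 0)) (at x)"
    by (rule has_derivative_transform_within_open[OF _ U x]) (simp add: H_s)
  from has_derivative_unique[OF \<sigma>_deriv[OF x] this]
  have "\<sigma>' x u w = metric_deriv H x u (s x) w + H x (frechet_derivative s (at x) u) w"
    using bilinear_rzero[OF inner_formD(1)[OF metric_onD(2)[OF H x]]] by (simp add: fun_eq_iff)
  then show ?thesis
    unfolding N_def T_def christoffel_compatible[OF H x] H_s[OF x]
    using bilinear_ladd[OF inner_formD(1)[OF metric_onD(2)[OF H x]]] by simp
qed

lemma curvature_conformal:
  assumes x: "x \<in> U"
  shows "curvature G x u v w = curvature H x u v w
     - T x u w *\<^sub>R v + T x v w *\<^sub>R u + H x v w *\<^sub>R N x u - H x u w *\<^sub>R N x v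
     + (\<sigma> x v * \<sigma> x w) *\<^sub>R u - (\<sigma> x u * \<sigma> x w) *\<^sub>R v
     - \<sigma> x (s x) *\<^sub>R (H x v w *\<^sub>R u - H x u w *\<^sub>R v)
     - (\<sigma> x v * H x u w - \<sigma> x u * H x v w) *\<^sub>R s x"
proof -
  let ?c = "christoffel H x"
  note bl = bilinear_simps[OF inner_formD(1)[OF metric_onD(2)[OF H x]]]
  note blc = bilinear_simps[OF christoffel_bilinear[OF H x]]
  note lin = linear_add[OF \<sigma>_linear[OF x]] linear_diff[OF \<sigma>_linear[OF x]] linear_cmul[OF \<sigma>_linear[OF x]]
  have Hs: "H x a (s x) = \<sigma> x a" for a
    using inner_formD(2)[OF metric_onD(2)[OF H x], of a "s x"] H_s[OF x] by simp
  \<comment> \<open>The group that starts with \<open>H x (?c u v) w\<close> gathers all terms that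
    are not tensors. It is symmetric in \<open>u\<close> and \<open>v\<close>, hence disappears in
    the difference that forms the curvature.\<close>
  have key: "frechet_derivative (\<lambda>y. christoffel G y v w) (at x) u +
    christoffel G x u (christoffel G x v w) =
     (frechet_derivative (\<lambda>y. christoffel H y v w) (at x) u + ?c u (?c v w)) +
     (H x v w *\<^sub>R N x u - T x u w *\<^sub>R v + ((\<sigma> x v * \<sigma> x w) *\<^sub>R u + (\<sigma> x v * \<sigma> x w) *\<^sub>R u) +
       (\<sigma> x u * \<sigma> x w) *\<^sub>R v
      - (\<sigma> x (s x) * H x v w) *\<^sub>R u - (\<sigma> x v * H x u w) *\<^sub>R s x)
     + (H x (?c u v) w *\<^sub>R s x + (H x v (?c u w) + H x u (?c v w)) *\<^sub>R s x
      - (\<sigma> x v *\<^sub>R ?c u w + \<sigma> x u *\<^sub>R ?c v w) - \<sigma> x w *\<^sub>R ?c u v - \<sigma>' x u v *\<^sub>R w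
      + (\<sigma> x u * \<sigma> x v) *\<^sub>R w - (\<sigma> x w * H x u v) *\<^sub>R s x - \<sigma> x (?c u w) *\<^sub>R v - \<sigma> x
        (?c v w) *\<^sub>R u)" for u v w
    unfolding christoffel_deriv_conformal[OF x] christoffel_conformal[OF x]
      christoffel_compatible[OF H x] N_def T_def
    by (simp add: bl blc lin Hs H_s[OF x] algebra_simps) (simp flip: scaleR_add_left)
  have split: "curvature G x u v w =
    (frechet_derivative (\<lambda>y. christoffel G y v w) (at x) u + christoffel G x u (christoffel G x v w)) -
    (frechet_derivative (\<lambda>y. christoffel G y u w) (at x) v + christoffel G x v (christoffel G x u w))"
    "curvature H x u v w =
    (frechet_derivative (\<lambda>y. christoffel H y v w) (at x) u + ?c u (?c v w)) -
    (frechet_derivative (\<lambda>y. christoffel H y u w) (at x) v + ?c v (?c u w))"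
    unfolding curvature_def by simp_all
  show ?thesis
    unfolding split key using christoffel_sym[OF H x, of u v] \<sigma>'_sym[OF x, of u v]
      inner_formD(2)[OF metric_onD(2)[OF H x], of u v]
    by (simp add: algebra_simps)
qed

lemma s_linear_simps: "x \<in> U \<Longrightarrow> linear (\<lambda>b. H x b w)"
  using bilinear_left[OF inner_formD(1)[OF metric_onD(2)[OF H]]] .

lemma ricci_conformal:
  assumes x: "x \<in> U"
  defines "m \<equiv> real DIM('v)"
  shows "ricci G x v w = ricci H x v w + (m - 2) * T x v w + (\<Sum>b\<in>Basis. b \<bullet> N x b) * H x v w
     + (m - 2) * (\<sigma> x v * \<sigma> x w) - (m - 2) * (\<sigma> x (s x) * H x v w)"
proof -
  have 1: "(\<Sum>b\<in>Basis. T x b w * (b \<bullet> v)) = T x v w"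
    using linear_expand[OF T_linear[OF x, of w], of v] T_sym[OF x, of w]
      by (simp add: mult.commute inner_commute)
  \<comment> \<open>\<open>N\<close> is \<open>T\<close> with an index raised, so contracting it
    with \<open>H\<close> gives \<open>T\<close> back.\<close>
  have 2: "(\<Sum>b\<in>Basis. H x b w * (b \<bullet> N x v)) = T x v w"
    using linear_expand[OF s_linear_simps[OF x, of w], of "N x v"] H_N[OF x, of v w]
    by (simp add: mult.commute inner_commute)
  have 3: "(\<Sum>b\<in>Basis. \<sigma> x b * (b \<bullet> a)) = \<sigma> x a" for a
    using linear_expand[OF \<sigma>_linear[OF x], of a] by (simp add: mult.commute inner_commute)
  have 4: "(\<Sum>b\<in>Basis. H x b w * (b \<bullet> a)) = H x a w" for a
    using linear_expand[OF s_linear_simps[OF x, of w], of a] by (simp add: mult.commute inner_commute)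
  have "ricci G x v w = (\<Sum>b\<in>Basis. b \<bullet> curvature H x b v w - T x b w * (b \<bullet> v) + T x v w
      + H x v w * (b \<bullet> N x b) - H x b w * (b \<bullet> N x v) + \<sigma> x v * \<sigma> x w - \<sigma> x w * (\<sigma> x b * (b \<bullet> v))
      - \<sigma> x (s x) * H x v w + \<sigma> x (s x) * (H x b w * (b \<bullet> v))
      - \<sigma> x v * (H x b w * (b \<bullet> s x)) + H x v w * (\<sigma> x b * (b \<bullet> s x)))"
    unfolding ricci_def
  proof (intro sum.cong refl)
    fix b :: 'v assume "b \<in> Basis"
    then have "b \<bullet> b = 1" by simp
    then show "b \<bullet> curvature G x b v w = b \<bullet> curvature H x b v w - T x b w * (b \<bullet> v) + T x v w
      + H x v w * (b \<bullet> N x b) - H x b w * (b \<bullet> N x v) + \<sigma> x v * \<sigma> x w - \<sigma> x w * (\<sigma> x b * (b \<bullet> v))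
      - \<sigma> x (s x) * H x v w + \<sigma> x (s x) * (H x b w * (b \<bullet> v))
      - \<sigma> x v * (H x b w * (b \<bullet> s x)) + H x v w * (\<sigma> x b * (b \<bullet> s x))"
      unfolding curvature_conformal[OF x] by (simp add: inner_add_right inner_diff_right algebra_simps)
  qed
  also have "\<dots> = ricci H x v w - T x v w + m * T x v w + H x v w * (\<Sum>b\<in>Basis. b \<bullet> N x b) - T x v w
      + m * (\<sigma> x v * \<sigma> x w) - \<sigma> x w * \<sigma> x v - m * (\<sigma> x (s x) * H x v w) + \<sigma> x (s x) * H x v w
      - \<sigma> x v * \<sigma> x w + H x v w * \<sigma> x (s x)"
    unfolding ricci_def
    by (simp add: sum.distrib sum_subtractf sum_distrib_left[symmetric] 1 2 3 4 H_s[OF x] m_def)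
  finally show ?thesis by (simp add: algebra_simps)
qed

text \<open>The Laplacian of r enters through the trace of \<open>T\<close>, which is (lap r) / r -
  |d log r|^2; tracing with \<open>G\<close> instead of \<open>H\<close> contributes the factor
  r^2.\<close>

lemma scalar_conformal:
  assumes x: "x \<in> U"
  defines "m \<equiv> real DIM('v)"
  shows "scalar_loc G x = (r x)\<^sup>2 * scalar_loc H x + 2 * (m - 1) *
    (r x * metric_trace (H x) (hessian H r x))
     - m * (m - 1) * frechet_derivative r (at x) (sharp (H x) (frechet_derivative r (at x)))"
proof -
  note ip = metric_onD(2)[OF H x]
  let ?tr = "metric_trace (H x)" and ?t = "\<Sum>b\<in>Basis. b \<bullet> N x b" and ?c = "\<sigma> x (s x)"
  have linH: "linear (H x b)" for b by (rule bilinear_right[OF inner_formD(1)[OF ip]])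
  have lin\<sigma>: "linear (\<lambda>v. \<sigma> x b * \<sigma> x v)" for b using \<sigma>_linear[OF x]
    by (simp add: linear_iff algebra_simps)
  have linh: "linear (hessian H r x b)" for b by (rule bilinear_right[OF hessian_bilinear[OF H x r_Ck]])
  have linR: "linear (ricci H x b)" for b by (rule bilinear_right[OF ricci_bilinear[OF H x]])
  have lins: "linear (\<lambda>v. k * f v)" if "linear f" for f :: "'v \<Rightarrow> real" and k
    using that by (simp add: linear_iff algebra_simps)
  have trT: "?tr (T x) = ?t" by (rule metric_trace_eq_trace[OF ip]) (rule H_N[OF x])
  have trH: "?tr (H x) = m" using metric_trace_eq_trace[OF ip, of "\<lambda>u. u" "H x"] by (simp add: m_def)
  have tr\<sigma>: "?tr (\<lambda>u v. \<sigma> x u * \<sigma> x v) = ?c"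
  proof -
    have "?tr (\<lambda>u v. \<sigma> x u * \<sigma> x v) = (\<Sum>b\<in>Basis. b \<bullet> (\<sigma> x b *\<^sub>R s x))"
      by (rule metric_trace_eq_trace[OF ip])
        (simp add: bilinear_lmul[OF inner_formD(1)[OF ip]] H_s[OF x])
    then show ?thesis using trace_rank_one[OF \<sigma>_linear[OF x]] by simp
  qed
  have Geq: "G x = (\<lambda>u v. (1 / (r x)\<^sup>2) * H x u v)" using GH[OF x] by (simp add: fun_eq_iff)
  have "metric_trace (G x) (ricci G x) = (r x)\<^sup>2 * ?tr (ricci G x)"
    unfolding Geq using metric_trace_scaled[OF ip bilinear_right[OF ricci_bilinear[OF G x]], of
      "1 / (r x)\<^sup>2"] r_pos[OF x]
    by (simp add: Geq)
  moreover have "ricci G x = (\<lambda>v w. ((ricci H x v w + (m - 2) * T x v w) + ?t * H x v w)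
     + ((m - 2) * (\<sigma> x v * \<sigma> x w) + (- (m - 2) * ?c) * H x v w))"
    unfolding ricci_conformal[OF x, folded m_def, abs_def] by (simp add: fun_eq_iff algebra_simps)
  then have "?tr (ricci G x) = ((?tr (ricci H x) + (m - 2) * ?t) + ?t * m) +
    ((m - 2) * ?c + (- (m - 2) * ?c) * m)"
    by (simp only:) (simp add: metric_trace_add[OF ip] metric_trace_cmul[OF ip] linear_compose_add
      linR lins T_linear[OF x] linH lin\<sigma>
        trT trH tr\<sigma>)
  moreover have "?t = ?tr (hessian H r x) / r x - ?c"
  proof -
    have "T x = (\<lambda>u v. (1 / r x) * hessian H r x u v + (-1) * (\<sigma> x u * \<sigma> x v))"
      by (simp add: fun_eq_iff T_eq[OF x])
    then have "?tr (T x) = (1 / r x) * ?tr (hessian H r x) + (-1) * ?c"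
      by (simp only:) (simp only: metric_trace_add[OF ip lins[OF linh] lins[OF lin\<sigma>]]
        metric_trace_cmul[OF ip linh]
          metric_trace_cmul[OF ip lin\<sigma>] tr\<sigma>)
    then show ?thesis using trT by simp
  qed
  moreover have "frechet_derivative r (at x) (sharp (H x) (frechet_derivative r (at x))) = (r x)\<^sup>2 * ?c"
  proof -
    have lr: "linear (frechet_derivative r (at x))"
      by (rule linear_frechet_derivative[OF r_differentiable[OF x]])
    have "\<sigma> x = (\<lambda>v. (1 / r x) * frechet_derivative r (at x) v)" by (simp add: fun_eq_iff \<sigma>_def)
    then have "s x = (1 / r x) *\<^sub>R sharp (H x) (frechet_derivative r (at x))"
      unfolding s_def by (simp only: sharp_cmul[OF ip lr])
    then show ?thesis using linear_cmul[OF lr] r_pos[OF x] by (simp add: \<sigma>_def power2_eq_square)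
  qed
  \<comment> \<open>With this quotient as a variable, the remaining identity is free of divisions by
    r.\<close>
  moreover define q where "q = ?tr (hessian H r x) / r x"
  then have "?tr (hessian H r x) = r x * q" using r_pos[OF x] by simp
  ultimately show ?thesis unfolding scalar_loc_def using r_pos[OF x]
    by (simp add: algebra_simps power2_eq_square)
qed

end

section \<open>Smooth bump functions\<close>

abbreviation Cinf_on :: "'v::euclidean_space set \<Rightarrow> ('v \<Rightarrow> 'w::real_normed_vector) \<Rightarrow> bool" where
  "Cinf_on S f \<equiv> \<forall>k. Ck_on k S f"

text \<open>The powers of t in the denominator make the functions closed under differentiation up to
  linear combinations, so one induction over all \<open>n\<close> gives smoothness of exp(-1/t)
  extended by 0.\<close>

definition flat :: "nat \<Rightarrow> real \<Rightarrow> real" where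
  "flat n t = (if t > 0 then exp (- 1 / t) / t ^ n else 0)"

lemma power_le_fact_exp:
  assumes "0 \<le> (x::real)"
  shows "x ^ m \<le> fact m * exp x"
proof -
  have "(\<Sum>i\<in>{m}. x ^ i /\<^sub>R fact i) \<le> (\<Sum>i. x ^ i /\<^sub>R fact i)"
    using assms summable_exp_generic[of x] by (intro sum_le_suminf) auto
  then show ?thesis by (simp add: exp_def field_simps)
qed

text \<open>A bound of order t^2 makes the difference quotient at 0 tend to 0. It comes from x^m
  \<le> m! exp x with x = 1/t and m = n + 2.\<close>

lemma flat_le: "\<bar>flat n t\<bar> \<le> fact (n + 2) * t\<^sup>2"
proof (cases "t > 0")
  case True
  have "(1 / t) ^ (n + 2) \<le> fact (n + 2) * exp (1 / t)" using True by (intro power_le_fact_exp) simp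
  then have "exp (- 1 / t) * (1 / t) ^ (n + 2) \<le> exp (- 1 / t) * (fact (n + 2) * exp (1 / t))"
    by (rule mult_left_mono) simp
  also have "exp (- 1 / t) * (fact (n + 2) * exp (1 / t)) = fact (n + 2) * exp (- 1 / t + 1 / t)"
    unfolding exp_add by (simp only: mult_ac)
  finally have "exp (- 1 / t) * (1 / t) ^ (n + 2) \<le> fact (n + 2)" by simp
  then have "exp (- 1 / t) * (1 / t) ^ (n + 2) * t\<^sup>2 \<le> fact (n + 2) * t\<^sup>2"
    by (rule mult_right_mono) simp
  moreover have "(1 / t) ^ (n + 2) * t\<^sup>2 = 1 / t ^ n" using True
    by (simp add: power_add power_one_over power2_eq_square field_simps)
  then have "exp (- 1 / t) * (1 / t) ^ (n + 2) * t\<^sup>2 = exp (- 1 / t) / t ^ n"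
    by (simp only: mult.assoc) simp
  ultimately show ?thesis using True by (simp only: flat_def) simp
qed (simp add: flat_def)

lemma flat_deriv: "(flat n has_real_derivative flat (n + 2) t - n * flat (n + 1) t) (at t)"
proof -
  consider "t > 0" | "t < 0" | "t = 0" by linarith
  then show ?thesis
  proof cases
    case 1
    have e: "((\<lambda>t. exp (- 1 / t)) has_real_derivative exp (- 1 / t) * (1 / t\<^sup>2)) (at t)"
      using 1 by (auto intro!: derivative_eq_intros simp: power2_eq_square)
    have p: "((\<lambda>t. t ^ n) has_real_derivative real n * t ^ (n - Suc 0)) (at t)"
      by (auto intro!: derivative_eq_intros)
    have gen: "(a * (1 / t\<^sup>2) * (t * b) - a * (c * b)) / ((t * b) * (t * b)) =
      a / (t * (t * (t * b))) - c * (a / (t * (t * b)))"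
      if "b \<noteq> 0" for a b c :: real
      using 1 that by (simp add: field_simps power2_eq_square)
    have "(exp (- 1 / t) * (1 / t\<^sup>2) * t ^ n - exp (- 1 / t) *
      (real n * t ^ (n - Suc 0))) / (t ^ n * t ^ n) =
        flat (n + 2) t - n * flat (n + 1) t"
    proof (cases n)
      case 0
      then show ?thesis using 1 by (simp add: flat_def power2_eq_square)
    next
      case (Suc m)
      then show ?thesis using 1 gen[of "t ^ m" "exp (- 1 / t)" "real n"] by (simp add: flat_def)
    qed
    then have "((\<lambda>t. exp (- 1 / t) / t ^ n) has_real_derivative flat (n + 2) t - n *
      flat (n + 1) t) (at t)"
      using DERIV_divide[OF e p] 1 by simp
    then show ?thesis
      by (rule has_field_derivative_transform_within_open[of _ _ _
        "{0<..}"]) (use 1 in \<open>auto simp: flat_def\<close>)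
  next
    case 2
    have "((\<lambda>_. 0) has_real_derivative flat (n + 2) t - n * flat (n + 1) t) (at t)"
      using 2 by (auto intro!: derivative_eq_intros simp: flat_def)
    then show ?thesis
      by (rule has_field_derivative_transform_within_open[of _ _ _
        "{..<0}"]) (use 2 in \<open>auto simp: flat_def\<close>)
  next
    case 3
    have "(\<lambda>h. flat n h / h) \<midarrow>0\<rightarrow> 0"
    proof (rule Lim_null_comparison)
      show "\<forall>\<^sub>F h in at 0. norm (flat n h / h) \<le> fact (n + 2) * \<bar>h\<bar>"
      proof (rule always_eventually, rule)
        fix h show "norm (flat n h / h) \<le> fact (n + 2) * \<bar>h\<bar>"
          using flat_le[of n h]
            by (cases "h = 0") (simp_all add: divide_le_eq power2_eq_square mult.assoc)
      qed
      show "(\<lambda>h::real. fact (n + 2) * \<bar>h\<bar>) \<midarrow>0\<rightarrow> 0"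
        by (intro tendsto_mult_right_zero tendsto_rabs_zero tendsto_ident_at)
    qed
    then show ?thesis using 3 by (simp add: DERIV_def flat_def)
  qed
qed

lemma flat_Ck: "Ck_on k S (flat n)"
proof -
  have "Ck_on k UNIV (flat n)"
  proof (induction k arbitrary: n)
    case 0
    show ?case by (simp add: continuous_at_imp_continuous_on DERIV_isCont[OF flat_deriv])
  next
    case (Suc k)
    have "partial_deriv 1 (flat n) = (\<lambda>t. flat (n + 2) t - n * flat (n + 1) t)"
      using partial_deriv_eq[OF flat_deriv[unfolded has_field_derivative_def]] by (simp add: fun_eq_iff)
    moreover have "flat n differentiable_on UNIV"
      using flat_deriv by (auto simp: differentiable_on_def differentiable_def has_field_derivative_def)
    ultimately show ?case
      using Ck_on_diff[OF open_UNIV Suc Ck_on_mult[OF open_UNIV Ck_on_const Suc]]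
        by (simp add: Ck_on_Suc)
  qed
  then show ?thesis by (rule Ck_on_subset) simp
qed

text \<open>The inner argument is at most 0 from t = 1 on, where the outer \<open>flat 0\<close>
  vanishes, and it is constant for t \<le> 0, where the normalisation makes the quotient 1.\<close>

definition smooth_step :: "real \<Rightarrow> real" where
  "smooth_step t = flat 0 (flat 0 1 - flat 0 t) / flat 0 (flat 0 1)"

lemma smooth_step_Ck: "Ck_on k UNIV smooth_step"
  unfolding smooth_step_def[abs_def] divide_inverse
  by (intro Ck_on_mult Ck_on_const Ck_on_compose[OF open_UNIV open_UNIV _ flat_Ck] Ck_on_diff
    flat_Ck open_UNIV UNIV_I)

lemma smooth_step_eq_1: "t \<le> 0 \<Longrightarrow> smooth_step t = 1"
  by (simp add: smooth_step_def flat_def)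

lemma smooth_step_eq_0:
  assumes "t \<ge> 1" shows "smooth_step t = 0"
proof -
  have "flat 0 1 \<le> flat 0 t" using assms by (simp add: flat_def divide_le_eq)
  then show ?thesis by (simp add: smooth_step_def flat_def)
qed

lemma Ck_on_norm_squared:
  fixes a :: "'v::euclidean_space"
  shows "Ck_on k UNIV (\<lambda>x. (norm (x - a))\<^sup>2)"
proof -
  have "Ck_on k UNIV (\<lambda>x. \<Sum>b\<in>Basis. ((x - a) \<bullet> b) * ((x - a) \<bullet> b))"
  proof (intro Ck_on_sum Ck_on_mult open_UNIV)
    show "Ck_on k UNIV (\<lambda>x. (x - a) \<bullet> b)" for b
      unfolding inner_diff_left
      by (intro Ck_on_diff Ck_on_const open_UNIV Ck_on_bounded_linear bounded_linear_inner_left)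
    then show "Ck_on k UNIV (\<lambda>x. (x - a) \<bullet> b)" for b .
  qed
  moreover have "(norm (x - a))\<^sup>2 = (\<Sum>b\<in>Basis. ((x - a) \<bullet> b) * ((x - a) \<bullet> b))" for x
    unfolding power2_norm_eq_inner by (rule euclidean_inner)
  ultimately show ?thesis by simp
qed

lemma Ck_on_prod:
  fixes f :: "'j \<Rightarrow> 'v::euclidean_space \<Rightarrow> real"
  assumes "open S" "\<And>j. j \<in> J \<Longrightarrow> Ck_on k S (f j)"
  shows "Ck_on k S (\<lambda>x. \<Prod>j\<in>J. f j x)"
  using assms(2) by (induction J rule: infinite_finite_induct)
    (simp_all add: Ck_on_const Ck_on_mult[OF assms(1)])

lemma smooth_bump:
  fixes K :: "'v::euclidean_space set"
  assumes "compact K" "open W" "K \<subseteq> W"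
  obtains \<eta> :: "'v \<Rightarrow> real" and L where "Cinf_on UNIV \<eta>" "\<And>x. x \<in> K \<Longrightarrow> \<eta> x = 1" "compact L" "L \<subseteq> W"
    "\<And>x. x \<notin> L \<Longrightarrow> \<eta> x = 0"
proof -
  have "\<exists>r>0. cball x (2 * r) \<subseteq> W" if "x \<in> K" for x
  proof -
    have "x \<in> W" using assms(3) that by blast
    from iffD1[OF open_contains_cball_eq[OF assms(2), rule_format] this] obtain e
      where "e > 0" "cball x e \<subseteq> W" by blast
    then show ?thesis by (intro exI[of _ "e / 2"]) auto
  qed
  then obtain r where r: "\<And>x. x \<in> K \<Longrightarrow> r x > 0" "\<And>x. x \<in> K \<Longrightarrow> cball x (2 * r x) \<subseteq> W" by metis
  obtain F where F: "F \<subseteq> K" "finite F" "K \<subseteq> (\<Union>x\<in>F. ball x (r x))"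
    by (rule compactE_image[OF assms(1), of K "\<lambda>x. ball x (r x)"]) (use r(1) in auto)
  \<comment> \<open>Equal to 1 on the ball of radius \<open>r a\<close> and to 0 outside the ball of
    radius \<open>2 * r a\<close>. The squared norm is used because it is smooth at the
    centre.\<close>
  define \<beta> where "\<beta> = (\<lambda>a x. smooth_step (((norm (x - a))\<^sup>2) * (1 / (r a)\<^sup>2) - 1))"
  \<comment> \<open>The complementary product makes \<open>\<eta>\<close> equal to 1 as soon as one
    bump is 1, and 0 where all of them vanish.\<close>
  define \<eta> where "\<eta> = (\<lambda>x. 1 - (\<Prod>a\<in>F. 1 - \<beta> a x))"
  show ?thesis
  proof (rule that)
    have "Ck_on k UNIV (\<beta> a)" for k a unfolding \<beta>_def
      by (rule Ck_on_compose[OF open_UNIV open_UNIV _ smooth_step_Ck])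
        (intro Ck_on_diff Ck_on_mult Ck_on_const Ck_on_norm_squared open_UNIV, simp)
    then show "Cinf_on UNIV \<eta>" unfolding \<eta>_def
      by (intro allI Ck_on_diff Ck_on_prod Ck_on_const open_UNIV)
    show "\<eta> x = 1" if xK: "x \<in> K" for x
    proof -
      obtain a where a: "a \<in> F" "x \<in> ball a (r a)" using F(3) xK by blast
      then have "(norm (x - a))\<^sup>2 \<le> (r a)\<^sup>2"
        by (intro power_mono) (auto simp: dist_norm norm_minus_commute)
      moreover have "r a > 0" using r(1) a(1) F(1) by blast
      ultimately have "\<beta> a x = 1" unfolding \<beta>_def by (intro smooth_step_eq_1) (simp add: field_simps)
      then have "(\<Prod>a\<in>F. 1 - \<beta> a x) = 0" using a(1) F(2) by (intro prod_zero) auto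
      then show ?thesis by (simp add: \<eta>_def)
    qed
    show "compact (\<Union>a\<in>F. cball a (2 * r a))" using F(2) by (intro compact_UN) auto
    show "(\<Union>a\<in>F. cball a (2 * r a)) \<subseteq> W" using r(2) F(1) by blast
    show "\<eta> x = 0" if "x \<notin> (\<Union>a\<in>F. cball a (2 * r a))" for x
    proof -
      have "\<beta> a x = 0" if "a \<in> F" for a
      proof -
        have ra: "r a > 0" using r(1) that F(1) by blast
        have "2 * r a \<le> norm (x - a)" using \<open>x \<notin> _\<close> that by (force simp: dist_norm norm_minus_commute)
        then have "(2 * r a)\<^sup>2 \<le> (norm (x - a))\<^sup>2" using ra by (intro power_mono) auto
        then have "1 + 1 \<le> (norm (x - a))\<^sup>2 * (1 / (r a)\<^sup>2)" using ra
          by (simp add: field_simps power_mult_distrib)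
          (smt (verit) zero_le_power2)
        then show ?thesis unfolding \<beta>_def by (intro smooth_step_eq_0) linarith
      qed
      then show ?thesis by (simp add: \<eta>_def)
    qed
  qed
qed

section \<open>Smoothness on subsets of the half-space\<close>

lemma halfspace_pos_open: "open {z :: 'e::euclidean_space \<times> real. snd z > 0}"
  by (intro open_Collect_less continuous_intros)

lemma openin_halfspace_pos:
  assumes "openin (top_of_set halfspace) S" "S \<subseteq> {z :: 'e::euclidean_space \<times> real. snd z > 0}"
  shows "open S"
proof -
  obtain W where W: "open W" "S = halfspace \<inter> W" using assms(1) by (auto simp: openin_open)
  then have "S = W \<inter> {z. snd z > 0}" using assms(2) by (auto simp: halfspace_def)
  then show ?thesis using W(1) halfspace_pos_open open_Int by metis
qed

text \<open>Also at boundary points derivatives within \<open>S\<close> are unique, because every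
  basis vector has nonnegative last coordinate: small positive multiples of it stay in the
  half-space.\<close>

lemma has_derivative_within_halfspace_unique:
  fixes x :: "'e::euclidean_space \<times> real"
  assumes S: "openin (top_of_set halfspace) S" "x \<in> S"
    and "(f has_derivative f') (at x within S)" "(f has_derivative f'') (at x within S)"
  shows "f' = f''"
proof (rule frechet_derivative_unique_within[OF assms(3,4)])
  fix i :: "'e \<times> real" and e :: real assume i: "i \<in> Basis" "0 < e"
  obtain W where W: "open W" "S = halfspace \<inter> W" using S(1) by (auto simp: openin_open)
  then obtain r where r: "r > 0" "ball x r \<subseteq> W" using S(2) openE by blast
  define d where "d = min (e / 2) (r / 2)"
  have d: "0 < d" "d < e" "d < r" using i r by (auto simp: d_def)
  have "snd i \<ge> 0" using i(1) by (auto simp: Basis_prod_def)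
  then have "x + d *\<^sub>R i \<in> halfspace" using S(2) W(2) d by (auto simp: halfspace_def)
  moreover have "x + d *\<^sub>R i \<in> ball x r" using d i(1) by (simp add: dist_norm)
  ultimately have "x + d *\<^sub>R i \<in> S" using W r by blast
  then show "\<exists>d. 0 < \<bar>d\<bar> \<and> \<bar>d\<bar> < e \<and> x + d *\<^sub>R i \<in> S" using d by (intro exI[of _ d]) auto
qed

lemma Ck_on_local:
  fixes f :: "'v::euclidean_space \<Rightarrow> 'w::real_normed_vector"
  assumes "\<And>x. x \<in> S \<Longrightarrow> \<exists>W. open W \<and> x \<in> W \<and> Ck_on k W f" "open S"
  shows "Ck_on k S f"
  using assms(1)
proof (induction k arbitrary: f)
  case 0
  show ?case
    unfolding Ck_on_0
  proof (rule continuous_at_imp_continuous_on, rule ballI)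
    fix x assume "x \<in> S"
    from 0[OF this] obtain W where "open W" "x \<in> W" "continuous_on W f" by auto
    then show "isCont f x" by (simp add: continuous_on_eq_continuous_at)
  qed
next
  case (Suc k)
  have "f differentiable (at x)" if "x \<in> S" for x
  proof -
    from Suc.prems[OF that] obtain W where "open W" "x \<in> W" "f differentiable_on W"
      by (auto simp: Ck_on_Suc)
    then show ?thesis by (intro differentiable_on_openD)
  qed
  moreover have "Ck_on k S (partial_deriv b f)" if "b \<in> Basis" for b
  proof (rule Suc.IH)
    fix x assume "x \<in> S"
    from Suc.prems[OF this] that show "\<exists>W. open W \<and> x \<in> W \<and> Ck_on k W (partial_deriv b f)"
      by (auto simp: Ck_on_Suc)
  qed
  ultimately show ?case by (simp add: Ck_on_Suc differentiable_on_eq_differentiable_at[OF assms(2)])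
qed

lemma smooth_onE:
  assumes "smooth_on S f" "x \<in> S"
  obtains W F where "open W" "x \<in> W" "Cinf_on W F" "\<And>y. y \<in> W \<Longrightarrow> y \<in> S \<Longrightarrow> F y = f y"
  using assms unfolding smooth_on_def by (metis IntI)

lemma smooth_onI:
  assumes "\<And>x. x \<in> S \<Longrightarrow> \<exists>W F. open W \<and> x \<in> W \<and> Cinf_on W F \<and> (\<forall>y\<in>W \<inter> S. F y = f y)"
  shows "smooth_on S f"
  using assms unfolding smooth_on_def by blast

lemma smooth_on_subset:
  assumes "smooth_on S f" "R \<subseteq> S"
  shows "smooth_on R f"
proof (rule smooth_onI)
  fix x assume "x \<in> R"
  then have "x \<in> S" using assms(2) by blast
  from smooth_onE[OF assms(1) this] show "\<exists>W F. open W \<and> x \<in> W \<and> Cinf_on W F \<and> (\<forall>y\<in>W \<inter> R. F y = f y)"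
    using assms(2) by (metis IntE subsetD)
qed

lemma smooth_on_cong:
  assumes "smooth_on S f" "\<And>x. x \<in> S \<Longrightarrow> f x = g x"
  shows "smooth_on S g"
  using assms unfolding smooth_on_def by (metis IntE)

lemma smooth_on_of_Cinf: "Cinf_on UNIV f \<Longrightarrow> smooth_on S f"
  unfolding smooth_on_def by blast

lemma smooth_on_openD:
  assumes "smooth_on S f" "open R" "R \<subseteq> S"
  shows "Ck_on k R f"
proof (rule Ck_on_local[OF _ assms(2)])
  fix x assume x: "x \<in> R"
  then have "x \<in> S" using assms by blast
  from smooth_onE[OF assms(1) this] obtain W F where W: "open W" "x \<in> W" "Cinf_on W F"
    "\<And>y. y \<in> W \<Longrightarrow> y \<in> S \<Longrightarrow> F y = f y" by blast
  have "Ck_on k (W \<inter> R) F" using W(3) Ck_on_subset by blast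
  then have "Ck_on k (W \<inter> R) f"
    by (rule iffD1[OF Ck_on_cong, rotated 2]) (use W assms in auto)
  then show "\<exists>W. open W \<and> x \<in> W \<and> Ck_on k W f" using W x assms(2) by (intro exI[of _ "W \<inter> R"]) auto
qed

lemma smooth_on_compose:
  fixes f :: "'u::euclidean_space \<Rightarrow> 'v::euclidean_space" and g :: "'v \<Rightarrow> 'w::euclidean_space"
  assumes "smooth_on S f" "smooth_on R g" "\<And>x. x \<in> S \<Longrightarrow> f x \<in> R"
  shows "smooth_on S (\<lambda>x. g (f x))"
proof (rule smooth_onI)
  fix x assume x: "x \<in> S"
  from smooth_onE[OF assms(1) this] obtain W F where W: "open W" "x \<in> W" "Cinf_on W F"
    "\<And>y. y \<in> W \<Longrightarrow> y \<in> S \<Longrightarrow> F y = f y" by blast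
  from smooth_onE[OF assms(2) assms(3)[OF x]] obtain W' F'
    where W': "open W'" "f x \<in> W'" "Cinf_on W' F'" "\<And>y. y \<in> W' \<Longrightarrow> y \<in> R \<Longrightarrow> F' y = g y" by blast
  define V where "V = W \<inter> F -` W'"
  have "continuous_on W F" using W(3) Ck_on_0 by blast
  then have V: "open V" unfolding V_def using W(1) W'(1) by (rule continuous_open_preimage)
  have "Ck_on k V (\<lambda>x. F' (F x))" for k
  proof (rule Ck_on_compose[OF V W'(1)])
    show "Ck_on k V F" using W(3) Ck_on_subset[of k W F V] by (simp add: V_def)
  qed (use W'(3) in \<open>auto simp: V_def\<close>)
  moreover have "x \<in> V" using W W' x by (simp add: V_def)
  moreover have "F' (F y) = g (f y)" if "y \<in> V \<inter> S" for y using that W(4) W'(4) assms(3)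
    by (auto simp: V_def)
  ultimately show "\<exists>W F. open W \<and> x \<in> W \<and> Cinf_on W F \<and> (\<forall>y\<in>W \<inter> S. F y = g (f y))"
    using V by (intro exI[of _ V] exI[of _ "\<lambda>x. F' (F x)"]) auto
qed

lemma smooth_on_continuous:
  fixes f :: "'u::euclidean_space \<Rightarrow> 'w::real_normed_vector"
  assumes "smooth_on S f"
  shows "continuous_on S f"
  unfolding continuous_on_eq_continuous_within
proof
  fix x assume x: "x \<in> S"
  from smooth_onE[OF assms this] obtain W F where W: "open W" "x \<in> W" "Cinf_on W F"
    "\<And>y. y \<in> W \<Longrightarrow> y \<in> S \<Longrightarrow> F y = f y" by blast
  have "continuous_on W F" using W(3) Ck_on_0 by blast
  then have "continuous_on (W \<inter> S) F" by (rule continuous_on_subset) simp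
  then have "continuous_on (W \<inter> S) f" by (rule continuous_on_eq) (use W(4) in auto)
  then have "continuous (at x within W \<inter> S) f" using x W(2)
    by (simp add: continuous_on_eq_continuous_within)
  moreover have "at x within W \<inter> S = at x within S"
    by (rule at_within_nhd[OF W(2,1)]) auto
  ultimately show "continuous (at x within S) f" by simp
qed

lemma smooth_on_has_derivative_within:
  fixes f :: "'u::euclidean_space \<Rightarrow> 'w::real_normed_vector"
  assumes W: "open W" "x \<in> W" "Ck_on (Suc k) W F" and eq: "\<And>y. y \<in> W \<Longrightarrow> y \<in> S \<Longrightarrow> F y = f y" and x: "x \<in> S"
  shows "(f has_derivative frechet_derivative F (at x)) (at x within S)"
proof -
  have "(F has_derivative frechet_derivative F (at x)) (at x)"
    using W by (intro has_derivative_openD[of F W]) (auto simp: Ck_on_Suc)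
  then have "(F has_derivative frechet_derivative F (at x)) (at x within W \<inter> S)"
    by (rule has_derivative_at_withinI)
  then have "(f has_derivative frechet_derivative F (at x)) (at x within W \<inter> S)"
    using eq x W(2) by (metis (no_types, lifting) IntE IntI has_derivative_transform)
  moreover have "at x within W \<inter> S = at x within S"
    by (rule at_within_nhd[OF W(2,1)]) auto
  ultimately show ?thesis by simp
qed

section \<open>Charts of a manifold with boundary\<close>

locale manifold_with_boundary =
  fixes T :: "'m topology" and \<A> :: "('m, 'e::euclidean_space \<times> real) chart set" and \<rho> :: "'m \<Rightarrow> real"
  assumes smooth: "smooth_structure T halfspace \<A>" and defining: "defining_function T \<A> \<rho>"
begin

abbreviation "M \<equiv> minterior T \<A>"

lemma chartD:
  assumes "c \<in> \<A>"
  shows "openin T (fst c)" "openin (top_of_set halfspace) (chart_image c)"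
    "homeomorphic_map (subtopology T (fst c)) (top_of_set (chart_image c)) (snd c)"
    "fst c \<subseteq> topspace T" "inj_on (snd c) (fst c)"
proof -
  have c: "is_chart T halfspace c" using smooth assms unfolding smooth_structure_def by blast
  then show 1: "openin T (fst c)" "openin (top_of_set halfspace) (chart_image c)"
    "homeomorphic_map (subtopology T (fst c)) (top_of_set (chart_image c)) (snd c)"
    unfolding is_chart_def by auto
  show 2: "fst c \<subseteq> topspace T" using 1(1) by (rule openin_subset)
  have "topspace (subtopology T (fst c)) = fst c" using 2 by auto
  then show "inj_on (snd c) (fst c)" using homeomorphic_imp_injective_map[OF 1(3)] by metis
qed

lemma chart_exists: "p \<in> topspace T \<Longrightarrow> \<exists>c\<in>\<A>. p \<in> fst c"
  using smooth unfolding smooth_structure_def by (metis UN_iff)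

lemma chart_at: "p \<in> topspace T \<Longrightarrow> chart_at \<A> p \<in> \<A>" "p \<in> topspace T \<Longrightarrow> p \<in> fst (chart_at \<A> p)"
  using someI_ex[OF chart_exists[unfolded Bex_def], of p] unfolding chart_at_def by blast+

lemma chart_inv:
  assumes "c \<in> \<A>"
  shows "p \<in> fst c \<Longrightarrow> chart_inv c (snd c p) = p" "x \<in> chart_image c \<Longrightarrow> snd c (chart_inv c x) = x"
    "x \<in> chart_image c \<Longrightarrow> chart_inv c x \<in> fst c" "p \<in> fst c \<Longrightarrow> snd c p \<in> chart_image c"
  using chartD(5)[OF assms] unfolding chart_inv_def chart_image_def
  by (auto simp: f_inv_into_f inv_into_into)

lemma chart_image_halfspace: "c \<in> \<A> \<Longrightarrow> chart_image c \<subseteq> halfspace"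
  using chartD(2) openin_imp_subset by blast

lemma chart_open_image:
  assumes "c \<in> \<A>" "openin T W" "W \<subseteq> fst c"
  shows "openin (top_of_set halfspace) (snd c ` W)"
proof -
  have "openin (subtopology T (fst c)) W" using assms by (simp add: openin_open_subtopology chartD)
  then have "openin (top_of_set (chart_image c)) (snd c ` W)"
    using homeomorphic_imp_open_map[OF chartD(3)[OF assms(1)]] by (simp add: open_map_def)
  then show ?thesis using chartD(2)[OF assms(1)] openin_trans by blast
qed

lemma chart_open_vimage:
  assumes "c \<in> \<A>" "openin (top_of_set halfspace) Y"
  shows "openin T {p \<in> fst c. snd c p \<in> Y}"
proof -
  have "openin (top_of_set (chart_image c)) (chart_image c \<inter> Y)"
    using assms chart_image_halfspace[OF assms(1)] openin_subset_trans[of halfspace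
      "chart_image c \<inter> Y" "chart_image c"]
      openin_Int[OF chartD(2)[OF assms(1)] assms(2)] by (metis Int_lower1)
  then have "openin (subtopology T (fst c)) {p \<in> topspace (subtopology T (fst c)).
    snd c p \<in> chart_image c \<inter> Y}"
    using homeomorphic_imp_continuous_map[OF chartD(3)[OF assms(1)]] openin_continuous_map_preimage
      by blast
  moreover have "{p \<in> topspace (subtopology T (fst c)). snd c p \<in> chart_image c \<inter> Y} =
    {p \<in> fst c. snd c p \<in> Y}"
    using chartD(4)[OF assms(1)] chart_inv(4)[OF assms(1)] by auto
  ultimately show ?thesis using openin_trans_full[OF _ chartD(1)[OF assms(1)]] by metis
qed

lemma rho_smooth: "c \<in> \<A> \<Longrightarrow> smooth_on (chart_image c) (\<lambda>x. \<rho> (chart_inv c x))"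
  using defining unfolding defining_function_def o_def by blast

lemma minterior_iff: "p \<in> M \<longleftrightarrow> p \<in> topspace T \<and> \<rho> p > 0"
proof -
  have 1: "bdry \<A> = {p\<in>topspace T. \<rho> p = 0}" and 2: "p \<in> topspace T \<Longrightarrow> \<rho> p \<ge> 0"
    using defining unfolding defining_function_def by auto
  show ?thesis unfolding minterior_def 1 using 2 by auto
qed

lemma openin_minterior: "openin T M"
proof (subst openin_subopen, intro ballI)
  fix p assume p: "p \<in> M"
  then obtain c where c: "c \<in> \<A>" "p \<in> fst c" using chart_exists minterior_iff by blast
  define Y where "Y = {x \<in> chart_image c. \<rho> (chart_inv c x) > 0}"
  have "openin (top_of_set (chart_image c)) (chart_image c \<inter> (\<lambda>x. \<rho> (chart_inv c x)) -` {0<..})"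
    by (rule continuous_openin_preimage_gen[OF smooth_on_continuous[OF rho_smooth[OF c(1)]]]) simp
  moreover have "chart_image c \<inter> (\<lambda>x. \<rho> (chart_inv c x)) -` {0<..} = Y" by (auto simp: Y_def)
  ultimately have "openin (top_of_set halfspace) Y" using openin_trans[OF _ chartD(2)[OF c(1)]] by metis
  from chart_open_vimage[OF c(1) this]
  show "\<exists>W. openin T W \<and> p \<in> W \<and> W \<subseteq> M"
    using c p chart_inv[OF c(1)] chartD(4)[OF c(1)]
    by (intro exI[of _ "{p \<in> fst c. snd c p \<in> Y}"]) (auto simp: Y_def minterior_iff)
qed

text \<open>\<open>bdry\<close> asks for one chart with vanishing last coordinate, so an interior
  point has nonvanishing last coordinate in every chart.\<close>

lemma snd_chart_pos:
  assumes "c \<in> \<A>" "p \<in> fst c" "p \<in> M"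
  shows "snd (snd c p) > 0"
proof -
  have "snd (snd c p) \<noteq> 0" using assms unfolding minterior_def bdry_def by blast
  moreover have "snd (snd c p) \<ge> 0" using chart_image_halfspace[OF assms(1)] chart_inv(4)[OF assms(1,2)]
    by (auto simp: halfspace_def)
  ultimately show ?thesis by linarith
qed

lemma open_image_interior:
  assumes "c \<in> \<A>" "openin T W"
  shows "open (snd c ` (W \<inter> fst c \<inter> M))"
proof (rule openin_halfspace_pos)
  show "openin (top_of_set halfspace) (snd c ` (W \<inter> fst c \<inter> M))"
    using chartD(1)[OF assms(1)] openin_minterior assms by (intro chart_open_image openin_Int) auto
  show "snd c ` (W \<inter> fst c \<inter> M) \<subseteq> {z. snd z > 0}" using snd_chart_pos[OF assms(1)] by auto
qed

lemma compatibleD: "c \<in> \<A> \<Longrightarrow> d \<in> \<A> \<Longrightarrow> smooth_on (overlap c d) (transition c d)"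
  using smooth unfolding smooth_structure_def compatible_def by blast

lemma overlap_openin: "c \<in> \<A> \<Longrightarrow> d \<in> \<A> \<Longrightarrow> openin (top_of_set halfspace) (overlap c d)"
  unfolding overlap_def using chartD(1) by (intro chart_open_image openin_Int) auto

lemma transition_eq: "c \<in> \<A> \<Longrightarrow> p \<in> fst c \<Longrightarrow> transition c d (snd c p) = snd d p"
  by (simp add: transition_def chart_inv)

lemma transition_has_derivative:
  assumes "c \<in> \<A>" "d \<in> \<A>" "p \<in> fst c" "p \<in> fst d"
  shows "(transition c d has_derivative transition_deriv c d p) (at (snd c p) within overlap c d)"
proof -
  have x: "snd c p \<in> overlap c d" using assms by (auto simp: overlap_def)
  from smooth_onE[OF compatibleD[OF assms(1,2)] x] obtain W F where W: "open W" "snd c p \<in> W"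
    "Cinf_on W F" "\<And>y. y \<in> W \<Longrightarrow> y \<in> overlap c d \<Longrightarrow> F y = transition c d y" by blast
  have "Ck_on (Suc 0) W F" using W(3) by blast
  from smooth_on_has_derivative_within[OF W(1,2) this W(4) x] show ?thesis
    unfolding transition_deriv_def by (metis differentiableI frechet_derivative_works)
qed

text \<open>\<open>transition_deriv\<close> is a derivative within a subset of the half-space.
  Uniqueness there identifies it with the derivative of any smooth extension, which lives on an open
  set and can be differentiated further at boundary points.\<close>

lemma transition_deriv_eq_extension:
  assumes "c \<in> \<A>" "d \<in> \<A>" "p \<in> fst c" "p \<in> fst d"
    and W: "open W" "snd c p \<in> W" "Cinf_on W F" "\<And>y. y \<in> W \<Longrightarrow> y \<in> overlap c d \<Longrightarrow> F y = transition c d y"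
  shows "transition_deriv c d p = frechet_derivative F (at (snd c p))"
proof -
  have x: "snd c p \<in> overlap c d" using assms by (auto simp: overlap_def)
  have "Ck_on (Suc 0) W F" using W(3) by blast
  from smooth_on_has_derivative_within[OF W(1,2) this W(4) x]
  show ?thesis
    by (rule has_derivative_within_halfspace_unique[OF overlap_openin[OF assms(1,2)] x
      transition_has_derivative[OF assms(1-4)]])
qed

lemma transition_deriv_linear:
  "c \<in> \<A> \<Longrightarrow> d \<in> \<A> \<Longrightarrow> p \<in> fst c \<Longrightarrow> p \<in> fst d \<Longrightarrow> linear (transition_deriv c d p)"
  using transition_has_derivative has_derivative_linear by blast

lemma transition_deriv_chain:
  assumes "c \<in> \<A>" "d \<in> \<A>" "e \<in> \<A>" "p \<in> fst c" "p \<in> fst d" "p \<in> fst e"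
  shows "transition_deriv c e p v = transition_deriv d e p (transition_deriv c d p v)"
proof -
  define S where "S = snd c ` (fst c \<inter> fst d \<inter> fst e)"
  have S: "openin (top_of_set halfspace) S" "snd c p \<in> S"
    unfolding S_def using assms
      by (auto intro!: chart_open_image openin_Int chartD(1)[of c] chartD(1)[of d] chartD(1)[of e]
      simp del: split_paired_All)
  have "(transition c d has_derivative transition_deriv c d p) (at (snd c p) within S)"
    by (rule has_derivative_subset[OF transition_has_derivative])
      (use assms in \<open>auto simp: S_def overlap_def\<close>)
  moreover have "(transition d e has_derivative transition_deriv d e p)
    (at (transition c d (snd c p)) within transition c d ` S)"
    unfolding transition_eq[OF assms(1,4)]
    by (rule has_derivative_subset[OF transition_has_derivative])
      (use assms in \<open>auto simp: S_def overlap_def image_image transition_eq[OF assms(1)]\<close>)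
  ultimately have
    "(transition d e \<circ> transition c d has_derivative transition_deriv d e p \<circ> transition_deriv c d
    p) (at (snd c p) within S)"
    by (rule diff_chain_within)
  then have "(transition c e has_derivative transition_deriv d e p \<circ> transition_deriv c d p)
    (at (snd c p) within S)"
    by (rule has_derivative_transform[rotated 2], intro S(2))
      (unfold S_def, elim imageE, simp add: transition_eq[OF assms(1)] transition_eq[OF assms(2)])
  moreover have "(transition c e has_derivative transition_deriv c e p) (at (snd c p) within S)"
    by (rule has_derivative_subset[OF transition_has_derivative])
      (use assms in \<open>auto simp: S_def overlap_def\<close>)
  ultimately show ?thesis using has_derivative_within_halfspace_unique[OF S] by (metis comp_apply)
qed

lemma transition_deriv_refl:
  assumes "c \<in> \<A>" "p \<in> fst c"
  shows "transition_deriv c c p v = v"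
proof -
  have x: "snd c p \<in> overlap c c" using assms by (auto simp: overlap_def)
  have "((\<lambda>x. x) has_derivative (\<lambda>x. x)) (at (snd c p) within overlap c c)"
    by (rule has_derivative_ident)
  then have "(transition c c has_derivative (\<lambda>x. x)) (at (snd c p) within overlap c c)"
    by (rule has_derivative_transform[rotated 2], intro x)
      (unfold overlap_def, elim imageE, simp add: transition_eq[OF assms(1)])
  from has_derivative_within_halfspace_unique[OF overlap_openin[OF assms(1,1)] x this
    transition_has_derivative] assms
  show ?thesis by (metis)
qed

lemma transition_deriv_inverse:
  assumes "c \<in> \<A>" "d \<in> \<A>" "p \<in> fst c" "p \<in> fst d"
  shows "transition_deriv d c p (transition_deriv c d p v) = v"
  using transition_deriv_chain[OF assms(1,2,1,3,4,3), of v] transition_deriv_refl[OF assms(1,3)] by simp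

end

section \<open>Rescaled charts and cut-off coordinate fields\<close>

lemma homeomorphic_map_rescale:
  fixes a :: "'v::real_normed_vector"
  assumes "t \<noteq> 0"
  shows "homeomorphic_map (top_of_set X) (top_of_set ((\<lambda>z. (1 / t) *\<^sub>R (z - a)) ` X)) (\<lambda>z.
    (1 / t) *\<^sub>R (z - a))"
  unfolding homeomorphic_map_maps
  by (rule exI[of _ "\<lambda>z. t *\<^sub>R z + a"])
    (use assms in \<open>auto simp: homeomorphic_maps_def intro!: continuous_intros\<close>)

context manifold_with_boundary
begin

text \<open>The atlas is maximal, and restricting a chart and composing it with a dilation and a
  translation along the boundary preserves both the half-space and smooth compatibility. The
  inverses of Moebius parametrizations arise in this way from a background chart, so tensor fields
  have components in them.\<close>

lemma rescaled_chart:
  assumes c: "c \<in> \<A>" and U: "openin T U" "U \<subseteq> fst c" and t: "0 < t"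
    and \<theta>: "\<And>p. p \<in> U \<Longrightarrow> \<theta> p = (1 / t) *\<^sub>R (snd c p - (a, 0))"
  shows "(U, \<theta>) \<in> \<A>"
proof -
  define L where "L = (\<lambda>z. (1 / t) *\<^sub>R (z - (a, 0 :: real)))"
  define K where "K = (\<lambda>z. t *\<^sub>R z + (a, 0 :: real))"
  have KL: "K (L z) = z" "L (K z) = z" for z using t by (simp_all add: K_def L_def)
  have \<theta>L: "\<theta> p = L (snd c p)" if "p \<in> U" for p using \<theta>[OF that] by (simp add: L_def)
  have inj: "inj_on \<theta> U"
    using chartD(5)[OF c] U(2) KL(1) \<theta>L unfolding inj_on_def by (metis subsetD)
  have img: "chart_image (U, \<theta>) = L ` (snd c ` U)" unfolding chart_image_def using \<theta>L
    by (auto simp: image_image)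
  have Ck: "Cinf_on UNIV L" "Cinf_on UNIV K" unfolding L_def K_def
    by (intro allI Ck_on_scaleR Ck_on_add Ck_on_diff Ck_on_const Ck_on_id open_UNIV)+
  have chart: "is_chart T halfspace (U, \<theta>)"
    unfolding is_chart_def fst_conv snd_conv
  proof (intro conjI U(1))
    obtain W where W: "open W" "snd c ` U = halfspace \<inter> W"
      using chart_open_image[OF c U] by (auto simp: openin_open)
    have cK: "continuous_on UNIV K" using Ck(2) Ck_on_0 by blast
    have "L ` (snd c ` U) = halfspace \<inter> K -` W"
    proof (intro equalityI subsetI)
      fix z assume "z \<in> L ` (snd c ` U)"
      then obtain w where w: "w \<in> halfspace" "w \<in> W" "z = L w" using W(2) by blast
      then show "z \<in> halfspace \<inter> K -` W" using KL t by (auto simp: halfspace_def L_def)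
    next
      fix z assume z: "z \<in> halfspace \<inter> K -` W"
      then have "K z \<in> snd c ` U" unfolding W(2) using t by (auto simp: halfspace_def K_def)
      then show "z \<in> L ` (snd c ` U)" using KL(2) by (metis imageI)
    qed
    moreover have "open (K -` W)" using open_vimage[OF W(1) cK] .
    ultimately show "openin (top_of_set halfspace) (chart_image (U, \<theta>))" unfolding img
      by (simp add: openin_open_Int)
    have "homeomorphic_map (subtopology (subtopology T (fst c)) U)
      (subtopology (top_of_set (chart_image c)) (snd c ` U)) (snd c)"
      by (rule homeomorphic_map_subtopologies[OF chartD(3)[OF c]])
        (use U(2) chartD(4,5)[OF c] in \<open>auto simp: chart_image_def inj_on_def\<close>)
    moreover have "subtopology (subtopology T (fst c)) U = subtopology T U"
      using U(2) by (simp add: subtopology_subtopology Int_absorb1)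
    moreover have "subtopology (top_of_set (chart_image c)) (snd c ` U) = top_of_set (snd c ` U)"
      using U(2) by (auto simp: subtopology_subtopology chart_image_def intro!:
        arg_cong[of _ _ top_of_set])
    ultimately have "homeomorphic_map (subtopology T U) (top_of_set (snd c ` U)) (snd c)" by simp
    from homeomorphic_map_compose[OF this homeomorphic_map_rescale[of t "snd c ` U" "(a, 0)"]] t
    have "homeomorphic_map (subtopology T U) (top_of_set (chart_image (U, \<theta>))) (L \<circ> snd c)"
      unfolding img by (simp add: L_def)
    then show "homeomorphic_map (subtopology T U) (top_of_set (chart_image (U, \<theta>))) \<theta>"
      by (rule homeomorphic_map_eq) (use \<theta>L in auto)
  qed
  moreover have "compatible (U, \<theta>) d" if d: "d \<in> \<A>" for d
    unfolding compatible_def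
  proof
    have ci: "chart_inv (U, \<theta>) (\<theta> p) = p" if "p \<in> U" for p
      using inj that by (simp add: chart_inv_def)
    have "smooth_on (overlap (U, \<theta>) d) (\<lambda>x. transition c d (K x))"
    proof (rule smooth_on_compose[OF smooth_on_of_Cinf[OF Ck(2)] compatibleD[OF c d]])
      fix x assume "x \<in> overlap (U, \<theta>) d"
      then obtain p where "p \<in> U" "p \<in> fst d" "x = L (snd c p)" unfolding overlap_def using \<theta>L by auto
      then show "K x \<in> overlap c d" using U(2) by (auto simp: KL overlap_def)
    qed
    then show "smooth_on (overlap (U, \<theta>) d) (transition (U, \<theta>) d)"
    proof (rule smooth_on_cong)
      fix x assume "x \<in> overlap (U, \<theta>) d"
      then obtain p where p: "p \<in> U" "p \<in> fst d" "x = \<theta> p" unfolding overlap_def by auto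
      then show "transition c d (K x) = transition (U, \<theta>) d x"
        using U(2) transition_eq[OF c, of p d]
          by (auto simp: \<theta>L KL transition_def ci[unfolded \<theta>L[OF p(1)]] ci[OF p(1),
          unfolded \<theta>L[OF p(1)]])
    qed
    have "smooth_on (overlap d (U, \<theta>)) (\<lambda>x. L (transition d c x))"
      by (rule smooth_on_compose[OF _ smooth_on_of_Cinf[OF Ck(1), of UNIV]])
        (use smooth_on_subset[OF compatibleD[OF d c], of
          "overlap d (U, \<theta>)"] U(2) in \<open>auto simp: overlap_def\<close>)
    then show "smooth_on (overlap d (U, \<theta>)) (transition d (U, \<theta>))"
    proof (rule smooth_on_cong)
      fix x assume "x \<in> overlap d (U, \<theta>)"
      then obtain p where p: "p \<in> U" "p \<in> fst d" "x = snd d p" unfolding overlap_def by auto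
      then show "L (transition d c x) = transition d (U, \<theta>) x"
        using transition_eq[OF d p(2)] \<theta>L[OF p(1)] by simp
    qed
  qed
  ultimately show ?thesis using smooth unfolding smooth_structure_def by blast
qed

text \<open>The constant field \<open>v\<close> of the chart \<open>d\<close>, multiplied by a
  cut-off and extended by 0. Only the part of \<open>L\<close> in the half-space has to lie in the
  chart image, because bump functions live on the whole coordinate space.\<close>

lemma smooth_vfield_extension:
  assumes T: "Hausdorff_space T" and d: "d \<in> \<A>" and \<eta>: "Cinf_on UNIV \<eta>"
    and L: "compact L" "\<And>x. x \<notin> L \<Longrightarrow> \<eta> x = 0" "L \<inter> halfspace \<subseteq> chart_image d"
  shows "smooth_vfield \<A> (\<lambda>c p. if p \<in> fst d then \<eta> (snd d p) *\<^sub>R transition_deriv d c p v else 0)"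
    (is "smooth_vfield \<A> ?X")
  unfolding smooth_vfield_def
proof (intro conjI ballI)
  fix c c' p assume c: "c \<in> \<A>" "c' \<in> \<A>" "p \<in> fst c \<inter> fst c'"
  show "?X c' p = transition_deriv c c' p (?X c p)"
    using linear_0[OF transition_deriv_linear[of c c' p]] linear_cmul[OF
      transition_deriv_linear[of c c' p]] c
      transition_deriv_chain[of d c c' p v] d by auto
next
  fix c assume c: "c \<in> \<A>"
  show "smooth_on (chart_image c) (\<lambda>x. ?X c (chart_inv c x))"
  proof (rule smooth_onI)
    fix x assume x: "x \<in> chart_image c"
    define p where "p = chart_inv c x"
    have p: "p \<in> fst c" "snd c p = x" using chart_inv[OF c] x by (auto simp: p_def)
    show "\<exists>W F. open W \<and> x \<in> W \<and> Cinf_on W F \<and> (\<forall>y\<in>W \<inter> chart_image c. F y = ?X c (chart_inv c y))"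
    proof (cases "p \<in> fst d")
      case True
      have xo: "x \<in> overlap c d" "snd d p \<in> overlap d c" using p True by (auto simp: overlap_def)
      obtain W F where W: "open W" "x \<in> W" "Cinf_on W F" "\<And>y. y \<in> W \<Longrightarrow> y \<in> overlap c d \<Longrightarrow>
        F y = transition c d y"
        using smooth_onE[OF compatibleD[OF c d] xo(1)] by blast
      obtain W' F' where W': "open W'" "snd d p \<in> W'" "Cinf_on W' F'"
        "\<And>y. y \<in> W' \<Longrightarrow> y \<in> overlap d c \<Longrightarrow> F' y = transition d c y"
        using smooth_onE[OF compatibleD[OF d c] xo(2)] by blast
      obtain W0 where W0: "open W0" "overlap c d = halfspace \<inter> W0"
        using overlap_openin[OF c d] by (auto simp: openin_open)
      define V where "V = W \<inter> F -` W' \<inter> W0"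
      have "continuous_on W F" using W(3) Ck_on_0 by blast
      then have V: "open V" unfolding V_def using W(1) W'(1) W0(1)
        by (intro open_Int continuous_open_preimage)
      have Fx: "F x = snd d p" using W(4)[OF W(2) xo(1)] transition_eq[OF c p(1)] p(2) by simp
      then have xV: "x \<in> V" using W(2) W'(2) xo(1) W0(2) by (auto simp: V_def)
      let ?g = "\<lambda>z. \<eta> z *\<^sub>R frechet_derivative F' (at z) v"
      have g: "Ck_on k W' ?g" for k
      proof (rule Ck_on_scaleR[OF W'(1)])
        show "Ck_on k W' \<eta>" using \<eta> Ck_on_subset[of k UNIV \<eta> W'] by simp
        show "Ck_on k W' (\<lambda>z. frechet_derivative F' (at z) v)"
          by (rule Ck_on_frechet_derivative[OF W'(1)]) (use W'(3) in blast)
      qed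
      have f: "Ck_on k V F" for k using W(3) Ck_on_subset[of k W F V] by (auto simp: V_def)
      have "Ck_on k V (\<lambda>y. ?g (F y))" for k
        by (rule Ck_on_compose[OF V W'(1) f g]) (auto simp: V_def)
      moreover have "?g (F y) = ?X c (chart_inv c y)" if y: "y \<in> V \<inter> chart_image c" for y
      proof -
        have "y \<in> overlap c d" using y chart_image_halfspace[OF c] W0(2) by (auto simp: V_def)
        then obtain q where q: "q \<in> fst c" "q \<in> fst d" "y = snd c q" unfolding overlap_def by blast
        have Fy: "F y = snd d q" using W(4)[OF _ \<open>y \<in> overlap c d\<close>] y q transition_eq[OF c q(1)]
          by (auto simp: V_def)
        then have "snd d q \<in> W'" using y by (auto simp: V_def)
        from transition_deriv_eq_extension[OF d c q(2,1) W'(1) this W'(3,4)]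
        show ?thesis using q Fy chart_inv(1)[OF c q(1)] by simp
      qed
      ultimately show ?thesis using V xV by (intro exI[of _ V] exI[of _ "\<lambda>y. ?g (F y)"]) auto
    next
      case False
      \<comment> \<open>\<open>Z\<close> contains the support of the field. It is compact as a
        continuous image, hence closed because the space is Hausdorff, so the field vanishes near
        any point outside.\<close>
      define Z where "Z = chart_inv d ` (L \<inter> halfspace)"
      obtain h where h:
        "homeomorphic_maps (subtopology T (fst d)) (top_of_set (chart_image d)) (snd d) h"
        using chartD(3)[OF d] unfolding homeomorphic_map_maps by blast
      have top: "topspace (subtopology T (fst d)) = fst d" using chartD(4)[OF d] by auto
      have hd: "h x = chart_inv d x" if "x \<in> chart_image d" for x
        using h chart_inv(2,3)[OF d that] top unfolding homeomorphic_maps_def by metis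
      have "continuous_map (top_of_set (chart_image d)) (subtopology T (fst d)) h"
        using h unfolding homeomorphic_maps_def by blast
      then have "continuous_map (top_of_set (chart_image d)) (subtopology T (fst d)) (chart_inv d)"
        by (rule continuous_map_eq) (simp add: hd)
      then have cm: "continuous_map (top_of_set (chart_image d)) T (chart_inv d)"
        using continuous_map_into_fulltopology by blast
      have "closed (halfspace :: ('e \<times> real) set)" unfolding halfspace_def
        by (intro closed_Collect_le continuous_intros)
      then have "compactin (top_of_set (chart_image d)) (L \<inter> halfspace)"
        using L(1,3) by (simp add: compactin_subtopology compact_Int_closed)
      from image_compactin[OF this cm] have "closedin T Z"
        unfolding Z_def using T compactin_imp_closedin by blast
      moreover have Zd: "Z \<subseteq> fst d" unfolding Z_def using chart_inv(3)[OF d] L(3) by blast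
      ultimately have N: "openin T (fst c - Z)" using chartD(1)[OF c] by (simp add: openin_diff)
      obtain W where W: "open W" "snd c ` (fst c - Z) = halfspace \<inter> W"
        using chart_open_image[OF c N] by (auto simp: openin_open)
      have "x \<in> snd c ` (fst c - Z)" using p False Zd by blast
      then have "x \<in> W" using W(2) by blast
      moreover have "0 = ?X c (chart_inv c y)" if y: "y \<in> W \<inter> chart_image c" for y
      proof -
        have "y \<in> snd c ` (fst c - Z)" using y chart_image_halfspace[OF c] W(2) by blast
        then obtain q where q: "q \<in> fst c" "q \<notin> Z" "y = snd c q" by blast
        have "\<eta> (snd d q) = 0" if "q \<in> fst d"
        proof (rule L(2), rule notI)
          assume "snd d q \<in> L"
          then have "q \<in> Z" unfolding Z_def using chart_inv[OF d] that chart_image_halfspace[OF d]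
            by (metis IntI imageI subsetD)
          then show False using q(2) by simp
        qed
        then show ?thesis using q chart_inv(1)[OF c q(1)] by auto
      qed
      ultimately show ?thesis using W(1)
        by (intro exI[of _ W] exI[of _ "\<lambda>_. 0"]) (auto simp: Ck_on_const)
    qed
  qed
qed

end

section \<open>Families with rescaled derivatives\<close>

text \<open>Each of the first \<open>j\<close> derivatives may be divided by the scale
  \<open>t i\<close>, and what is left after \<open>j\<close> such steps still has regularity of
  order \<open>\<kappa>\<close>. The undivided family has order \<open>\<kappa> + j\<close>, so a
  derivative lowers the order and the number of available divisions together.\<close>

primrec wreg ::
  "(('i \<Rightarrow> 'v::euclidean_space \<Rightarrow> real) \<Rightarrow> bool) \<Rightarrow> 'i set \<Rightarrow> 'v set \<Rightarrow> ('i \<Rightarrow> real) \<Rightarrow> nat \<Rightarrow> nat \<Rightarrow>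
    ('i \<Rightarrow> 'v \<Rightarrow> real) \<Rightarrow> bool" where
  "wreg P I S t \<kappa> 0 F \<longleftrightarrow> reg P I S \<kappa> F"
| "wreg P I S t \<kappa> (Suc j) F \<longleftrightarrow> reg P I S (\<kappa> + Suc j) F \<and>
     (\<forall>b\<in>Basis. wreg P I S t \<kappa> j (\<lambda>i x. partial_deriv b (F i) x / t i))"

context regularity
begin

lemma wreg_reg: "wreg P I S t \<kappa> j F \<Longrightarrow> rg (\<kappa> + j) F"
  by (cases j) auto

lemma wreg_pred: "wreg P I S t \<kappa> (Suc j) F \<Longrightarrow> wreg P I S t \<kappa> j F"
proof (induction j arbitrary: F)
  case 0
  then show ?case using reg_mono[of "\<kappa> + Suc 0" F \<kappa>] by simp
next
  case (Suc j)
  have "wreg P I S t \<kappa> j (\<lambda>i x. partial_deriv b (F i) x / t i)" if "b \<in> Basis" for b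
    using Suc.prems that by (intro Suc.IH) simp
  then show ?case using Suc.prems reg_mono[of "\<kappa> + Suc (Suc j)" F "\<kappa> + Suc j"] by simp
qed

lemma wreg_differentiable: "wreg P I S t \<kappa> (Suc j) F \<Longrightarrow> i \<in> I \<Longrightarrow> x \<in> S \<Longrightarrow> F i differentiable (at x)"
  using reg_differentiable[OF wreg_reg[of t \<kappa> "Suc j" F]] by (simp del: wreg.simps)

lemma wreg_partial: "wreg P I S t \<kappa> (Suc j) F \<Longrightarrow> b \<in> Basis \<Longrightarrow>
  wreg P I S t \<kappa> j (\<lambda>i x. partial_deriv b (F i) x / t i)"
  by simp

lemma wreg_cong:
  assumes "wreg P I S t \<kappa> j F" "\<And>i x. i \<in> I \<Longrightarrow> x \<in> S \<Longrightarrow> F i x = G i x"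
  shows "wreg P I S t \<kappa> j G"
  using assms
proof (induction j arbitrary: F G)
  case 0
  then show ?case using reg_cong[of \<kappa> F G] by simp
next
  case (Suc j)
  have "wreg P I S t \<kappa> j (\<lambda>i x. partial_deriv b (G i) x / t i)" if "b \<in> Basis" for b
  proof (rule Suc.IH)
    show "wreg P I S t \<kappa> j (\<lambda>i x. partial_deriv b (F i) x / t i)" using Suc.prems(1) that by simp
    show "partial_deriv b (F i) x / t i = partial_deriv b (G i) x / t i" if "i \<in> I" "x \<in> S" for i x
      using partial_deriv_cong_open[OF open_S that(2) Suc.prems(2)[OF that(1)]] by simp
  qed
  moreover have "rg (\<kappa> + Suc j) G" using reg_cong[OF wreg_reg[OF Suc.prems(1)] Suc.prems(2)] .
  ultimately show ?case by simp
qed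

lemma wreg_SucI:
  assumes "rg (\<kappa> + Suc j) F" "\<And>b. b \<in> Basis \<Longrightarrow> wreg P I S t \<kappa> j (G b)"
    "\<And>i x b. i \<in> I \<Longrightarrow> x \<in> S \<Longrightarrow> b \<in> Basis \<Longrightarrow> G b i x = partial_deriv b (F i) x / t i"
  shows "wreg P I S t \<kappa> (Suc j) F"
proof -
  have "wreg P I S t \<kappa> j (\<lambda>i x. partial_deriv b (F i) x / t i)" if "b \<in> Basis" for b
    by (rule wreg_cong[OF assms(2)[OF that]]) (use assms(3) that in simp)
  then show ?thesis using assms(1) by simp
qed

lemma wreg_const: "wreg P I S t \<kappa> j (\<lambda>_ _. c)"
proof (induction j arbitrary: c)
  case (Suc j)
  show ?case
  proof (rule wreg_SucI[where G="\<lambda>_ _ _. 0"])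
    show "rg (\<kappa> + Suc j) (\<lambda>_ _. c)" by (rule reg_const)
  qed (simp_all add: Suc partial_deriv_def)
qed (simp add: reg_const)

lemma wreg_add: "wreg P I S t \<kappa> j F \<Longrightarrow> wreg P I S t \<kappa> j G \<Longrightarrow> wreg P I S t \<kappa> j (\<lambda>i x. F i x + G i x)"
proof (induction j arbitrary: F G)
  case (Suc j)
  show ?case
  proof (rule wreg_SucI[where G="\<lambda>b i x. partial_deriv b (F i) x / t i +
    partial_deriv b (G i) x / t i"])
    show "rg (\<kappa> + Suc j) (\<lambda>i x. F i x + G i x)" by (rule reg_add[OF Suc.prems[THEN wreg_reg]])
    show "wreg P I S t \<kappa> j (\<lambda>i x. partial_deriv b (F i) x / t i + partial_deriv b (G i) x / t i)"
      if "b \<in> Basis" for b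
      by (rule Suc.IH[OF Suc.prems[THEN wreg_partial, OF that]])
  qed (simp add: partial_deriv_add Suc.prems[THEN wreg_differentiable] add_divide_distrib)
qed (simp add: reg_add)

lemma wreg_mult: "wreg P I S t \<kappa> j F \<Longrightarrow> wreg P I S t \<kappa> j G \<Longrightarrow> wreg P I S t \<kappa> j (\<lambda>i x. F i x * G i x)"
proof (induction j arbitrary: F G)
  case (Suc j)
  show ?case
  proof (rule wreg_SucI[where G="\<lambda>b i x. F i x * (partial_deriv b (G i) x / t i) +
    (partial_deriv b (F i) x / t i) * G i x"])
    show "rg (\<kappa> + Suc j) (\<lambda>i x. F i x * G i x)" by (rule reg_mult[OF Suc.prems[THEN wreg_reg]])
    show "wreg P I S t \<kappa> j (\<lambda>i x. F i x * (partial_deriv b (G i) x / t i) +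
      (partial_deriv b (F i) x / t i) * G i x)"
      if "b \<in> Basis" for b
      by (rule wreg_add[OF Suc.IH[OF wreg_pred[OF Suc.prems(1)] wreg_partial[OF Suc.prems(2) that]]
            Suc.IH[OF wreg_partial[OF Suc.prems(1) that] wreg_pred[OF Suc.prems(2)]]])
  qed (simp add: partial_deriv_mult Suc.prems[THEN wreg_differentiable] add_divide_distrib)
qed (simp add: reg_mult)

lemma wreg_cmult: "wreg P I S t \<kappa> j F \<Longrightarrow> wreg P I S t \<kappa> j (\<lambda>i x. c * F i x)"
  using wreg_mult[OF wreg_const] .

lemma wreg_minus: "wreg P I S t \<kappa> j F \<Longrightarrow> wreg P I S t \<kappa> j G \<Longrightarrow> wreg P I S t \<kappa> j (\<lambda>i x. F i x - G i x)"
  using wreg_add[OF _ wreg_cmult[of t \<kappa> j G "-1"], of F] by simp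

lemma wreg_sum: "(\<And>a. a \<in> J \<Longrightarrow> wreg P I S t \<kappa> j (F a)) \<Longrightarrow> wreg P I S t \<kappa> j (\<lambda>i x. \<Sum>a\<in>J. F a i x)"
  by (induction J rule: infinite_finite_induct) (auto intro: wreg_const wreg_add)

text \<open>The case of the interior parametrizations, where nothing shrinks.\<close>

lemma wreg_of_reg:
  assumes "\<And>i. i \<in> I \<Longrightarrow> t i = 1"
  shows "rg (\<kappa> + j) F \<Longrightarrow> wreg P I S t \<kappa> j F"
proof (induction j arbitrary: F)
  case (Suc j)
  show ?case
    by (rule wreg_SucI[where G="\<lambda>b i. partial_deriv b (F i)"]) (use Suc assms in auto)
qed simp

text \<open>As for \<open>reg\<close>, the derivative is - B (dA) B; the division by
  \<open>t i\<close> is absorbed by the single factor dA.\<close>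

lemma wreg_matrix_inverse:
  fixes A B :: "'j \<Rightarrow> 'j \<Rightarrow> 'i \<Rightarrow> 'v \<Rightarrow> real"
  assumes J: "finite J" "a \<in> J" "b \<in> J"
    and A: "\<And>a b. a \<in> J \<Longrightarrow> b \<in> J \<Longrightarrow> wreg P I S t \<kappa> j (A a b)"
    and B: "\<And>a b. a \<in> J \<Longrightarrow> b \<in> J \<Longrightarrow> P (B a b)"
    and BA: "\<And>i y a d. i \<in> I \<Longrightarrow> y \<in> S \<Longrightarrow> a \<in> J \<Longrightarrow> d \<in> J \<Longrightarrow>
      (\<Sum>c\<in>J. B a c i y * A c d i y) = (if a = d then 1 else 0)"
    and AB: "\<And>i y c b. i \<in> I \<Longrightarrow> y \<in> S \<Longrightarrow> c \<in> J \<Longrightarrow> b \<in> J \<Longrightarrow>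
      (\<Sum>d\<in>J. A c d i y * B d b i y) = (if c = b then 1 else 0)"
  shows "wreg P I S t \<kappa> j (B a b)"
  using J(2,3) A
proof (induction j arbitrary: a b)
  case 0
  show ?case using reg_matrix_inverse[OF J(1) 0(1,2), of \<kappa> A B] 0(3) B BA AB by simp
next
  case (Suc j)
  have IH: "wreg P I S t \<kappa> j (B a b)" if "a \<in> J" "b \<in> J" for a b
    using Suc.IH[OF that] Suc.prems(3) wreg_pred by blast
  show ?case
  proof (rule wreg_SucI[where G="\<lambda>e i x. - 1 * (\<Sum>c\<in>J. \<Sum>d\<in>J. B a c i x *
    (partial_deriv e (A c d i) x / t i) * B d b i x)"])
    show "rg (\<kappa> + Suc j) (B a b)"
      using reg_matrix_inverse[OF J(1) Suc.prems(1,2), of "\<kappa> +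
        Suc j" A B] Suc.prems(3)[THEN wreg_reg] B BA AB by blast
    show "wreg P I S t \<kappa> j (\<lambda>i x. - 1 * (\<Sum>c\<in>J. \<Sum>d\<in>J. B a c i x *
      (partial_deriv e (A c d i) x / t i) * B d b i x))"
      if e: "e \<in> Basis" for e
    proof (rule wreg_cmult, rule wreg_sum, rule wreg_sum)
      fix c d assume cd: "c \<in> J" "d \<in> J"
      show "wreg P I S t \<kappa> j (\<lambda>i x. B a c i x * (partial_deriv e (A c d i) x / t i) * B d b i x)"
        by (rule wreg_mult[OF wreg_mult[OF IH[OF Suc.prems(1) cd(1)] wreg_partial[OF
          Suc.prems(3)[OF cd] e]]
            IH[OF cd(2) Suc.prems(2)]])
    qed
    fix i x and e :: 'v assume i: "i \<in> I" "x \<in> S" and e: "e \<in> Basis"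
    have "(B a b i has_derivative (\<lambda>h. \<Sum>c\<in>J. \<Sum>d\<in>J. - (B a c i x *
      frechet_derivative (A c d i) (at x) h * B d b i x))) (at x)"
    proof (rule matrix_inverse_has_derivative[OF J(1) Suc.prems(1,2) i(2), of "\<lambda>a b. B a b i"
      "\<lambda>a b. A a b i"])
      show "(A a b i has_derivative frechet_derivative (A a b i) (at x)) (at x)"
        if "a \<in> J" "b \<in> J" for a b
        by (rule frechet_derivative_works[THEN iffD1, OF wreg_differentiable[OF
          Suc.prems(3)[OF that] i]])
    qed (use i(1) BA AB P_continuous[OF B] in blast)+
    from partial_deriv_eq[OF this]
    show "- 1 * (\<Sum>c\<in>J. \<Sum>d\<in>J. B a c i x * (partial_deriv e (A c d i) x / t i) * B d b i x) =
      partial_deriv e (B a b i) x / t i"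
      by (simp add: partial_deriv_def sum_negf sum_divide_distrib)
  qed
qed

end


text \<open>On a segment of length \<delta> the mean value theorem finds a point where the
  derivative of \<open>F i\<close> is at most 2 C0 / \<delta>, hence \<open>G i\<close> at most 2 C0
  / \<delta> + C1. The derivative bound for \<open>G i\<close> carries this to all of
  \<open>S\<close>. The segment is the same for all indices, so the constant does not depend on
  \<open>i\<close>.\<close>

lemma derivative_splitting_bound:
  fixes F G H :: "'i \<Rightarrow> 'v::euclidean_space \<Rightarrow> real"
  assumes S: "open S" "convex S" "bounded S" "S \<noteq> {}" and b: "b \<in> Basis"
    and F: "\<And>i x. i \<in> I \<Longrightarrow> x \<in> S \<Longrightarrow> F i differentiable (at x)" "\<And>i x. i \<in> I \<Longrightarrow> x \<in> S \<Longrightarrow> \<bar>F i x\<bar> \<le> C0"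
    and split: "\<And>i x. i \<in> I \<Longrightarrow> x \<in> S \<Longrightarrow> partial_deriv b (F i) x = G i x + H i x"
    and H: "\<And>i x. i \<in> I \<Longrightarrow> x \<in> S \<Longrightarrow> \<bar>H i x\<bar> \<le> C1"
    and G: "\<And>i. i \<in> I \<Longrightarrow> G i differentiable_on S"
      "\<And>i x e. i \<in> I \<Longrightarrow> x \<in> S \<Longrightarrow> e \<in> Basis \<Longrightarrow> \<bar>partial_deriv e (G i) x\<bar> \<le> C2"
  shows "\<exists>C. \<forall>i\<in>I. \<forall>x\<in>S. \<bar>G i x\<bar> \<le> C"
proof -
  obtain z where z: "z \<in> S" using S(4) by blast
  obtain e where e: "e > 0" "ball z e \<subseteq> S" using S(1) z openE by blast
  define \<delta> where "\<delta> = e / 2"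
  have \<delta>: "\<delta> > 0" using e by (simp add: \<delta>_def)
  have line: "z + s *\<^sub>R b \<in> S" if "0 \<le> s" "s \<le> \<delta>" for s
    using e that b by (intro subsetD[OF e(2)]) (auto simp: dist_norm \<delta>_def)
  have "\<bar>G i x\<bar> \<le> 2 * C0 / \<delta> + C1 + real DIM('v) * C2 * diameter S" if i: "i \<in> I" and x: "x \<in> S" for i x
  proof -
    have "\<exists>s>0. s < \<delta> \<and> F i (z + \<delta> *\<^sub>R b) - F i (z + 0 *\<^sub>R b) = (\<delta> - 0) *
      frechet_derivative (F i) (at (z + s *\<^sub>R b)) b"
      using F(1)[OF i line] by (intro MVT2[OF \<delta>] has_real_derivative_line) auto
    then obtain s where s: "0 < s" "s < \<delta>"
      "F i (z + \<delta> *\<^sub>R b) - F i z = \<delta> * partial_deriv b (F i) (z + s *\<^sub>R b)"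
        by (auto simp: partial_deriv_def)
    define y where "y = z + s *\<^sub>R b"
    have y: "y \<in> S" using line s by (simp add: y_def)
    have "\<delta> * \<bar>partial_deriv b (F i) y\<bar> = \<bar>F i (z + \<delta> *\<^sub>R b) - F i z\<bar>"
      using s(3) \<delta> by (simp add: abs_mult y_def)
    also have "\<dots> \<le> 2 * C0" using F(2)[OF i line[of \<delta>]] F(2)[OF i z] \<delta> by linarith
    finally have "\<bar>partial_deriv b (F i) y\<bar> \<le> 2 * C0 / \<delta>" using \<delta> by (simp add: field_simps)
    then have Gy: "\<bar>G i y\<bar> \<le> 2 * C0 / \<delta> + C1" using split[OF i y] H[OF i y] by linarith
    have C2: "C2 \<ge> 0" using G(2)[OF i x b] by linarith
    have "\<bar>G i x - G i y\<bar> \<le> real DIM('v) * C2 * norm (x - y)"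
      by (rule lipschitz_of_partial_bound[OF S(1,2) G(1)[OF i] G(2)[OF i] x y])
    also have "\<dots> \<le> real DIM('v) * C2 * diameter S"
      using diameter_bounded_bound[OF S(3) x y] C2 by (intro mult_left_mono) (auto simp: dist_norm)
    finally show ?thesis using Gy by linarith
  qed
  then show ?thesis by blast
qed

section \<open>Bounds for the curvature and the defect in rescaled balls\<close>

lemma metric_deriv_partial: "metric_deriv G x b u v = partial_deriv b (\<lambda>y. G y u v) x"
  by (simp add: metric_deriv_def partial_deriv_def)

lemma inner_christoffel:
  fixes G :: "'v::euclidean_space lmetric"
  assumes "metric_on (Suc k) U G" "x \<in> U"
  shows "c \<bullet> christoffel G x a b = (\<Sum>d\<in>Basis. inv_form (G x) c d *
    (1/2 * ((partial_deriv a (\<lambda>y. G y b d) x + partial_deriv b (\<lambda>y. G y a d) x) - partial_deriv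
      d (\<lambda>y. G y a b) x)))"
proof -
  have "c \<bullet> christoffel G x a b = (\<Sum>d\<in>Basis. inv_form (G x) c d * christoffel_form G x a b d)"
    unfolding christoffel_def
    using inner_sharp[OF metric_onD(2)[OF assms] christoffel_form_linear(1)[OF assms], of c a b]
    by (simp add: christoffel_form_def[abs_def])
  then show ?thesis by (simp add: christoffel_form_def metric_deriv_partial)
qed

text \<open>In a Moebius ball of radius \<open>t\<close>, \<open>G\<close> stands for the rescaled metric \<open>t\<^sup>-\<^sup>2 \<Phi>\<^sup>* gbar\<close>, and
  \<open>r\<close> for \<open>\<rho> / t\<close>.\<close>

locale scaled_family =
  fixes \<alpha> :: real and I :: "'i set" and S :: "'v::euclidean_space set" and t :: "'i \<Rightarrow> real" and \<kappa> :: nat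
    and G :: "'i \<Rightarrow> 'v lmetric" and r :: "'i \<Rightarrow> 'v \<Rightarrow> real" and m \<epsilon> T0 :: real
  assumes S: "open S" "convex S" "bounded S" "S \<noteq> {}" and \<alpha>: "0 \<le> \<alpha>" "\<alpha> \<le> 1"
    and t: "\<And>i. i \<in> I \<Longrightarrow> 0 < t i" "\<And>i. i \<in> I \<Longrightarrow> t i \<le> T0"
    and G_metric: "\<And>i. i \<in> I \<Longrightarrow> metric_on (Suc (Suc 0)) S (G i)"
    and G_wreg: "\<And>a b. a \<in> Basis \<Longrightarrow> b \<in> Basis \<Longrightarrow>
      wreg (hoelder_bound \<alpha> I S) I S t \<kappa> (Suc (Suc 0)) (\<lambda>i x. G i x a b)"
    and G_pos: "0 < m" "\<And>i x u. i \<in> I \<Longrightarrow> x \<in> S \<Longrightarrow> m * (norm u)\<^sup>2 \<le> G i x u u"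
    and r_reg: "reg (hoelder_bound \<alpha> I S) I S (\<kappa> + Suc (Suc 0)) r"
    and r_wreg: "\<And>a. a \<in> Basis \<Longrightarrow> wreg (hoelder_bound \<alpha> I S) I S t \<kappa> (Suc (Suc 0)) (\<lambda>i.
      partial_deriv a (r i))"
    and r_pos: "0 < \<epsilon>" "\<And>i x. i \<in> I \<Longrightarrow> x \<in> S \<Longrightarrow> \<epsilon> \<le> r i x"
begin

sublocale regularity "hoelder_bound \<alpha> I S" I S
  by (rule regularity_hoelder[OF S(1)])

abbreviation "wr \<equiv> wreg (hoelder_bound \<alpha> I S) I S t \<kappa>"

lemma wreg_inv_form:
  assumes "a \<in> Basis" "b \<in> Basis"
  shows "wr (Suc (Suc 0)) (\<lambda>i x. inv_form (G i x) a b)"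
proof -
  note left = inv_form_inverse_left[OF metric_onD(2)[OF G_metric]]
  note right = inv_form_inverse_right[OF metric_onD(2)[OF G_metric]]
  have bd: "hoelder_bound \<alpha> I S (\<lambda>i x. inv_form (G i x) a b)" if "a \<in> Basis" "b \<in> Basis" for a b
  proof (rule hoelder_bound_matrix_inverse[OF S(1) finite_Basis that, where A="\<lambda>a b i x. G i x a b"
    and B="\<lambda>a b i x. inv_form (G i x) a b"])
    show "hoelder_bound \<alpha> I S (\<lambda>i x. G i x a b)" if "a \<in> Basis" "b \<in> Basis" for a b
      using reg_P[OF wreg_reg[OF G_wreg[OF that]]] .
    show "\<bar>inv_form (G i x) a b\<bar> \<le> 1 / m" if "a \<in> Basis" "b \<in> Basis" "i \<in> I" "x \<in> S" for a b i x
      by (rule inv_form_le[OF metric_onD(2)[OF G_metric[OF that(3)] that(4)] G_pos(1) G_pos(2)[OF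
        that(3,4)] that(1,2)])
  qed (use left right in blast)+
  show ?thesis
    by (rule wreg_matrix_inverse[OF finite_Basis assms, where A="\<lambda>a b i x. G i x a b"
      and B="\<lambda>a b i x. inv_form (G i x) a b"])
      (use G_wreg bd left right in blast)+
qed

text \<open>Every summand contains exactly one derivative of the metric, so one factor
  \<open>t i\<close> can be divided out and one further rescaled derivative remains.\<close>

lemma wreg_christoffel:
  assumes "a \<in> Basis" "b \<in> Basis" "c \<in> Basis"
  shows "wr (Suc 0) (\<lambda>i x. (c \<bullet> christoffel (G i) x a b) / t i)"
proof -
  have "wr (Suc 0) (\<lambda>i x. \<Sum>d\<in>Basis. inv_form (G i x) c d * (1/2 *
     ((partial_deriv a (\<lambda>y. G i y b d) x / t i + partial_deriv b (\<lambda>y. G i y a d) x / t i) -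
       partial_deriv d (\<lambda>y. G i y a b) x / t i)))"
    by (rule wreg_sum, rule wreg_mult[OF wreg_pred[OF wreg_inv_form[OF assms(3)]]], assumption,
        rule wreg_cmult, rule wreg_minus, rule wreg_add)
      (rule wreg_partial[OF G_wreg]; (rule assms | assumption))+
  then show ?thesis
  proof (rule wreg_cong)
    fix i x assume i: "i \<in> I" "x \<in> S"
    show "(\<Sum>d\<in>Basis. inv_form (G i x) c d * (1/2 * ((partial_deriv a (\<lambda>y. G i y b d) x / t i +
        partial_deriv b (\<lambda>y. G i y a d) x / t i) - partial_deriv d (\<lambda>y. G i y a b) x / t i))) =
      (c \<bullet> christoffel (G i) x a b) / t i"
      unfolding inner_christoffel[OF G_metric[OF i(1)] i(2)] sum_divide_distrib
      by (intro sum.cong refl)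
        (simp only: add_divide_distrib[symmetric] diff_divide_distrib[symmetric] times_divide_eq_right)
  qed
qed

lemma inner_frechet_christoffel:
  assumes "i \<in> I" "x \<in> S"
  shows "d \<bullet> frechet_derivative (\<lambda>y. christoffel (G i) y a b) (at x) c =
    partial_deriv c (\<lambda>y. d \<bullet> christoffel (G i) y a b) x"
  using frechet_derivative_inner[OF christoffel_differentiable[OF G_metric[OF assms(1)]
    assms(2)], of a b d c]
  by (simp add: partial_deriv_def inner_commute)

text \<open>Each term carries two derivatives of the metric, either as a second derivative or as a
  product of two Christoffel symbols; hence the square of \<open>t i\<close>.\<close>

lemma reg_curvature:
  assumes "a \<in> Basis" "b \<in> Basis" "c \<in> Basis" "d \<in> Basis"
  shows "rg \<kappa> (\<lambda>i x. (d \<bullet> curvature (G i) x a b c) / (t i)\<^sup>2)"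
proof -
  let ?g = "\<lambda>d a b i x. (d \<bullet> christoffel (G i) x a b) / t i"
  have g: "rg (Suc \<kappa>) (?g d a b)" "rg \<kappa> (?g d a b)"
    "rg \<kappa> (\<lambda>i x. partial_deriv c (?g d a b i) x / t i)"
    if "a \<in> Basis" "b \<in> Basis" "d \<in> Basis" "c \<in> Basis" for a b c d
    using wreg_reg[OF wreg_christoffel[OF that(1,2,3)]] wreg_christoffel[OF that(1,2,3)] that(4)
      reg_pred[of \<kappa>] by auto
  have "rg \<kappa> (\<lambda>i x. (partial_deriv a (?g d b c i) x / t i - partial_deriv b (?g d a c i) x / t i) +
     ((\<Sum>e\<in>Basis. ?g e b c i x * ?g d a e i x) - (\<Sum>e\<in>Basis. ?g e a c i x * ?g d b e i x)))"
    by (rule reg_add[OF reg_minus[OF g(3)[OF assms(2,3,4,1)] g(3)[OF assms(1,3,4,2)]]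
        reg_minus[OF reg_sum[OF reg_mult[OF g(2)[OF assms(2,3) _ assms(1)] g(2)[OF
          assms(1) _ assms(4,1)]]]
          reg_sum[OF reg_mult[OF g(2)[OF assms(1,3) _ assms(1)] g(2)[OF assms(2) _ assms(4,1)]]]]])
  then show ?thesis
  proof (rule reg_cong)
    fix i x assume i: "i \<in> I" "x \<in> S"
    have t0: "t i \<noteq> 0" using t(1)[OF i(1)] by simp
    have gd: "partial_deriv a (?g d b c i) x = partial_deriv a (\<lambda>y.
      d \<bullet> christoffel (G i) y b c) x / t i" for a b c d
    proof -
      have "(\<lambda>y. d \<bullet> christoffel (G i) y b c) differentiable (at x)"
        using christoffel_differentiable[OF G_metric[OF i(1)] i(2)]
          by (auto intro: differentiable_inner)
      from frechet_derivative_works[THEN iffD1, OF this]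
      have "((\<lambda>y. d \<bullet> christoffel (G i) y b c) has_derivative
          frechet_derivative (\<lambda>y. d \<bullet> christoffel (G i) y b c) (at x)) (at x)" .
      from has_derivative_scaleR_right[OF this, of "1 / t i"]
      have "(?g d b c i has_derivative (\<lambda>h. frechet_derivative (\<lambda>y.
        d \<bullet> christoffel (G i) y b c) (at x) h / t i)) (at x)"
        by simp
      from partial_deriv_eq[OF this] show ?thesis by (simp add: partial_deriv_def)
    qed
    have ch: "d \<bullet> christoffel (G i) x a z = (\<Sum>e\<in>Basis. (e \<bullet> z) * (d \<bullet> christoffel (G i) x a e))"
      for a d z
      using linear_expand[OF bilinear_right[OF christoffel_bilinear[OF G_metric[OF i(1)] i(2)]], of a z]
      by (simp add: inner_sum_right inner_commute)
    show "(partial_deriv a (?g d b c i) x / t i - partial_deriv b (?g d a c i) x / t i) +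
     ((\<Sum>e\<in>Basis. ?g e b c i x * ?g d a e i x) - (\<Sum>e\<in>Basis. ?g e a c i x * ?g d b e i x)) =
     (d \<bullet> curvature (G i) x a b c) / (t i)\<^sup>2"
      unfolding curvature_def inner_add_right inner_diff_right inner_frechet_christoffel[OF i] gd
        ch[of d a "christoffel (G i) x b c"] ch[of d b "christoffel (G i) x a c"]
      by (simp add: power2_eq_square add_divide_distrib diff_divide_distrib sum_divide_distrib)
  qed
qed

lemma reg_scalar: "rg \<kappa> (\<lambda>i x. scalar_loc (G i) x / (t i)\<^sup>2)"
proof -
  have inv: "rg \<kappa> (\<lambda>i x. inv_form (G i x) a b)" if "a \<in> Basis" "b \<in> Basis" for a b
    using reg_mono[OF wreg_reg[OF wreg_inv_form[OF that]]] by simp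
  have "rg \<kappa> (\<lambda>i x. \<Sum>a\<in>Basis. \<Sum>b\<in>Basis. inv_form (G i x) a b *
    (\<Sum>c\<in>Basis. (c \<bullet> curvature (G i) x c a b) / (t i)\<^sup>2))"
    by (rule reg_sum, rule reg_sum, rule reg_mult, rule inv, assumption, assumption, rule
      reg_sum, rule reg_curvature)
  then show ?thesis
  proof (rule reg_cong)
    fix i x assume i: "i \<in> I" "x \<in> S"
    have "scalar_loc (G i) x = (\<Sum>a\<in>Basis. \<Sum>b\<in>Basis. inv_form (G i x) a b * ricci (G i) x a b)"
      unfolding scalar_loc_def
      by (rule metric_trace_inv_form[OF metric_onD(2)[OF G_metric[OF i(1)] i(2)]])
        (rule bilinear_right[OF ricci_bilinear[OF G_metric[OF i(1)] i(2)]])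
    then show "(\<Sum>a\<in>Basis. \<Sum>b\<in>Basis. inv_form (G i x) a b *
      (\<Sum>c\<in>Basis. (c \<bullet> curvature (G i) x c a b) / (t i)\<^sup>2))
        = scalar_loc (G i) x / (t i)\<^sup>2"
      by (simp add: ricci_def flip: sum_divide_distrib)
  qed
qed

text \<open>In terms of gbar and rho, with the metric rescaled by t^-2 and r = rho / t,
  \<open>dnorm\<close> is |d rho|^2 and \<open>lap\<close> is t times the Laplacian of rho.\<close>

definition "dnorm i x =
  frechet_derivative (r i) (at x) (sharp (G i x) (frechet_derivative (r i) (at x)))"
definition "lap i x = metric_trace (G i x) (hessian (G i) (r i) x)"

lemma r_differentiable: "i \<in> I \<Longrightarrow> x \<in> S \<Longrightarrow> r i differentiable (at x)"
  using reg_differentiable[OF r_reg] by simp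

lemma r_Ck: "i \<in> I \<Longrightarrow> Ck_on 2 S (r i)"
proof -
  assume i: "i \<in> I"
  have "Ck_hoelder_bound \<alpha> I S (\<kappa> + Suc (Suc 0)) r"
    using r_reg by (simp add: Ck_hoelder_bound_iff_reg[OF S(1-3) \<alpha>])
  then show ?thesis using i Ck_on_mono[of "\<kappa> + Suc (Suc 0)" S "r i" 2]
    unfolding Ck_hoelder_bound_def Ck_hoelder_le_def by auto
qed

lemma wreg_dnorm: "wr (Suc (Suc 0)) dnorm"
proof -
  have "wr (Suc (Suc 0)) (\<lambda>i x. \<Sum>a\<in>Basis. (\<Sum>b\<in>Basis. inv_form (G i x) a b *
    partial_deriv b (r i) x) * partial_deriv a (r i) x)"
    by (rule wreg_sum, rule wreg_mult[OF wreg_sum[OF wreg_mult[OF wreg_inv_form r_wreg]] r_wreg])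
  then show ?thesis
  proof (rule wreg_cong)
    fix i x assume i: "i \<in> I" "x \<in> S"
    note rd = r_differentiable[OF i]
    show "(\<Sum>a\<in>Basis. (\<Sum>b\<in>Basis. inv_form (G i x) a b * partial_deriv b (r i) x) *
      partial_deriv a (r i) x) = dnorm i x"
      unfolding dnorm_def
        using frechet_derivative_eq_sum[OF rd, of "sharp (G i x) (frechet_derivative (r i) (at x))"]
        inner_sharp[OF metric_onD(2)[OF G_metric[OF i(1)] i(2)] linear_frechet_derivative[OF rd]]
      by (simp add: partial_deriv_def inner_commute)
  qed
qed

text \<open>Second derivatives of \<open>r\<close> and Christoffel symbols both gain a factor
  \<open>t i\<close>. Dividing it out uses up one of the two rescaled derivatives, which leaves the
  Laplacian one behind \<open>dnorm\<close>.\<close>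

lemma wreg_lap: "wr (Suc 0) (\<lambda>i x. lap i x / t i)"
proof -
  have "wr (Suc 0) (\<lambda>i x. \<Sum>a\<in>Basis. \<Sum>b\<in>Basis. inv_form (G i x) a b *
     (partial_deriv a (partial_deriv b (r i)) x / t i - (\<Sum>c\<in>Basis. (c \<bullet> christoffel (G i) x a b) / t
       i * partial_deriv c (r i) x)))"
    by (rule wreg_sum, rule wreg_sum, rule wreg_mult[OF wreg_pred[OF wreg_inv_form]],
      assumption, assumption,
      rule wreg_minus[OF wreg_partial[OF r_wreg] wreg_sum[OF wreg_mult[OF wreg_christoffel
        wreg_pred[OF r_wreg]]]])
  then show ?thesis
  proof (rule wreg_cong)
    fix i x assume i: "i \<in> I" "x \<in> S"
    note rd = r_differentiable[OF i]
    have h: "hessian (G i) (r i) x a b = partial_deriv a (partial_deriv b (r i)) x -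
       (\<Sum>c\<in>Basis. (c \<bullet> christoffel (G i) x a b) * partial_deriv c (r i) x)" for a b
      unfolding hessian_def frechet_derivative_eq_sum[OF rd, of "christoffel (G i) x a b"]
      by (simp add: partial_deriv_def[abs_def] inner_commute)
    have "lap i x = (\<Sum>a\<in>Basis. \<Sum>b\<in>Basis. inv_form (G i x) a b * hessian (G i) (r i) x a b)"
      unfolding lap_def
      by (rule metric_trace_inv_form[OF metric_onD(2)[OF G_metric[OF i(1)] i(2)]])
        (rule bilinear_right[OF hessian_bilinear[OF G_metric[OF i(1)] i(2) r_Ck[OF i(1)]]])
    then show "(\<Sum>a\<in>Basis. \<Sum>b\<in>Basis. inv_form (G i x) a b *
       (partial_deriv a (partial_deriv b (r i)) x / t i - (\<Sum>c\<in>Basis. (c \<bullet> christoffel (G i) x a b) /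
         t i * partial_deriv c (r i) x)))
       = lap i x / t i"
      unfolding h by (simp flip: sum_divide_distrib diff_divide_distrib)
  qed
qed

definition "defect c i x = dnorm i x - 1 - c * r i x * lap i x"

text \<open>Turns a bound for \<open>lap\<close> divided by t back into one for \<open>lap\<close>;
  the upper bound \<open>T0\<close> on the scales makes them a regular family.\<close>

lemma const_t: "rg j (\<lambda>i _. t i)"
  by (rule reg_const_family, rule hoelder_bound_const_family[where K=T0])
    (use t in \<open>auto simp: less_imp_le\<close>)

lemma reg_lap: "rg (Suc \<kappa>) lap"
proof -
  have "rg (Suc \<kappa>) (\<lambda>i x. t i * (lap i x / t i))"
    using reg_mult[OF const_t wreg_reg[OF wreg_lap]] by simp
  then show ?thesis by (rule reg_cong) (use t in \<open>auto simp: less_imp_neq[symmetric]\<close>)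
qed

lemma reg_defect: "rg (Suc \<kappa>) (defect c)"
proof -
  have "rg (Suc \<kappa>) dnorm" "rg (Suc \<kappa>) r"
    using reg_mono[OF wreg_reg[OF wreg_dnorm]] reg_mono[OF r_reg] by (simp_all del: reg.simps(2))
  then show ?thesis unfolding defect_def[abs_def]
    by (intro reg_minus reg_mult reg_const reg_lap)
qed

lemma reg_inverse_r: "j \<le> \<kappa> + Suc (Suc 0) \<Longrightarrow> rg j (\<lambda>i x. inverse (r i x))"
proof (rule reg_inverse)
  show "j \<le> \<kappa> + Suc (Suc 0) \<Longrightarrow> rg j r" by (rule reg_mono[OF r_reg])
  show "hoelder_bound \<alpha> I S (\<lambda>i x. inverse (r i x))"
    by (rule hoelder_bound_inverse[OF S(1) reg_P[OF r_reg] r_pos(1)]) (use r_pos in force)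
qed (use r_pos in force)

text \<open>The derivative of \<open>defect / t\<^sup>2\<close> is the sum of a function with bounded derivative and a
  bounded function, so that a bound of \<open>defect / t\<^sup>2\<close> itself bounds its derivative.\<close>

lemma reg_defect_scaled:
  assumes bd: "\<And>i x. i \<in> I \<Longrightarrow> x \<in> S \<Longrightarrow> \<bar>defect c i x\<bar> \<le> C * (t i)\<^sup>2"
  shows "rg (Suc \<kappa>) (\<lambda>i x. defect c i x / (t i)\<^sup>2)"
proof -
  have diff: "dnorm i differentiable (at x)"
    "(\<lambda>y. partial_deriv b (dnorm i) y / t i) differentiable (at x)"
    "lap i differentiable (at x)" "partial_deriv b (r i) differentiable (at x)"
    if "i \<in> I" "x \<in> S" "b \<in> Basis" for i x b
    using wreg_differentiable[OF wreg_dnorm that(1,2)] reg_differentiable[OF reg_lap _ that(1,2)]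
      wreg_differentiable[OF r_wreg[OF that(3)] that(1,2)]
      wreg_differentiable[OF wreg_partial[OF wreg_dnorm that(3)] that(1,2)] by auto
  \<comment> \<open>In \<open>B\<close> the Laplacian has been differentiated and is of order t^2,
    so \<open>B\<close> is bounded. The terms of \<open>A\<close> are only of order t / t^2, but one
    more derivative brings them to order t^2 / t^2.\<close>
  define A where "A = (\<lambda>b i x. partial_deriv b (dnorm i) x / (t i)\<^sup>2 - c *
    (partial_deriv b (r i) x * (lap i x / (t i)\<^sup>2)))"
  define B where "B = (\<lambda>b i x. - c * (r i x * (partial_deriv b (lap i) x / (t i)\<^sup>2)))"
  have scale: "partial_deriv b (\<lambda>y. f y / s) x = partial_deriv b f x / s"
    if "f differentiable (at x)" for f :: "'v \<Rightarrow> real" and s b x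
  proof -
    have "((\<lambda>y. f y / s) has_derivative (\<lambda>h. frechet_derivative f (at x) h / s)) (at x)"
      using has_derivative_scaleR_right[OF frechet_derivative_works[THEN iffD1, OF
        that], of "1 / s"] by simp
    from partial_deriv_eq[OF this] show ?thesis by (simp add: partial_deriv_def)
  qed
  have t0: "t i \<noteq> 0" if "i \<in> I" for i using t(1)[OF that] by simp
  have lapB: "rg \<kappa> (\<lambda>i x. partial_deriv b (lap i) x / (t i)\<^sup>2)" if "b \<in> Basis" for b
  proof -
    have "rg \<kappa> (\<lambda>i x. partial_deriv b (\<lambda>x. lap i x / t i) x / t i)" using wreg_lap that by simp
    then show ?thesis by (rule reg_cong) (use diff(3) that in \<open>simp add: scale power2_eq_square\<close>)
  qed
  have rB: "rg \<kappa> r" and rB': "b \<in> Basis \<Longrightarrow> rg \<kappa> (\<lambda>i. partial_deriv b (r i))" for b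
    using reg_mono[OF r_reg] reg_mono[OF wreg_reg[OF r_wreg]] by simp_all
  have B: "rg \<kappa> (B b)" if "b \<in> Basis" for b unfolding B_def
    by (intro reg_mult reg_const rB lapB that)
  have A_diff: "(\<lambda>x. A b i x) differentiable (at x)" if "i \<in> I" "x \<in> S" "b \<in> Basis" for b i x
  proof -
    have "(\<lambda>x. (partial_deriv b (dnorm i) x / t i) * (1 / t i) - c *
      (partial_deriv b (r i) x * (lap i x * (1 / (t i)\<^sup>2)))) differentiable (at x)"
      using diff[OF that] by (intro differentiable_diff differentiable_mult differentiable_const) auto
    moreover have "(\<lambda>x. A b i x) = (\<lambda>x. (partial_deriv b (dnorm i) x / t i) * (1 / t i) - c *
      (partial_deriv b (r i) x * (lap i x * (1 / (t i)\<^sup>2))))"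
      by (simp add: A_def fun_eq_iff power2_eq_square)
    ultimately show ?thesis by simp
  qed
  have A': "rg \<kappa> (\<lambda>i. partial_deriv e (A b i))" if b: "b \<in> Basis" and e: "e \<in> Basis" for b e
  proof -
    have 1: "rg \<kappa> (\<lambda>i x. partial_deriv e (\<lambda>x. partial_deriv b (dnorm i) x / t i) x / t i)"
      using wreg_dnorm b e by simp
    have 2: "rg \<kappa> (\<lambda>i x. partial_deriv e (partial_deriv b (r i)) x / t i)"
      using reg_mono[OF wreg_reg[OF wreg_partial[OF r_wreg[OF b] e]], of \<kappa>] by simp
    have 3: "rg \<kappa> (\<lambda>i x. lap i x / t i)" using reg_mono[OF wreg_reg[OF wreg_lap], of \<kappa>] by simp
    have "rg \<kappa> (\<lambda>i x. partial_deriv e (\<lambda>x. partial_deriv b (dnorm i) x / t i) x / t i -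
        c * (partial_deriv b (r i) x * (partial_deriv e (lap i) x / (t i)\<^sup>2) + (partial_deriv e
          (partial_deriv b (r i)) x / t i) * (lap i x / t i)))"
      by (intro reg_minus reg_mult reg_const reg_add 1 2 3 rB' lapB b e)
    then show ?thesis
    proof (rule reg_cong)
      fix i x assume i: "i \<in> I" "x \<in> S"
      note d = diff[OF i b]
      have d1: "((\<lambda>x. partial_deriv b (dnorm i) x / t i) has_derivative (frechet_derivative (\<lambda>x.
        partial_deriv b (dnorm i) x / t i) (at x))) (at x)"
        by (rule frechet_derivative_works[THEN iffD1, OF d(2)])
      have d2: "((\<lambda>x. (partial_deriv b (dnorm i) x / t i) * (1 / t i) - c *
        (partial_deriv b (r i) x * (lap i x * (1 / (t i)\<^sup>2)))) has_derivative
         (\<lambda>h. frechet_derivative (\<lambda>x. partial_deriv b (dnorm i) x / t i) (at x) h * (1 / t i) -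
           c * (partial_deriv b (r i) x * (frechet_derivative (lap i) (at x) h * (1 / (t i)\<^sup>2)) +
           frechet_derivative (partial_deriv b (r i)) (at x) h * (lap i x * (1 / (t i)\<^sup>2))))) (at x)"
        using frechet_derivative_works[THEN iffD1, OF d(3)]
          frechet_derivative_works[THEN iffD1, OF d(4)]
        by (intro has_derivative_diff has_derivative_mult_left has_derivative_mult_right
          has_derivative_mult d1)
      have "A b i = (\<lambda>x. (partial_deriv b (dnorm i) x / t i) * (1 / t i) - c *
        (partial_deriv b (r i) x * (lap i x * (1 / (t i)\<^sup>2))))"
        by (simp add: A_def fun_eq_iff power2_eq_square)
      from partial_deriv_eq[OF d2[folded this], of e]
      show "partial_deriv e (\<lambda>x. partial_deriv b (dnorm i) x / t i) x / t i -
        c * (partial_deriv b (r i) x * (partial_deriv e (lap i) x / (t i)\<^sup>2) + (partial_deriv e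
          (partial_deriv b (r i)) x / t i) * (lap i x / t i))
        = partial_deriv e (A b i) x"
        by (simp add: partial_deriv_def power2_eq_square)
    qed
  qed
  let ?F = "\<lambda>i x. defect c i x / (t i)\<^sup>2"
  have F_diff: "?F i differentiable (at x)" if "i \<in> I" "x \<in> S" for i x
    using reg_differentiable[OF reg_defect _ that] by (simp add: divide_inverse)
  have F': "partial_deriv b (?F i) x = A b i x + B b i x" if "i \<in> I" "x \<in> S" "b \<in> Basis" for b i x
  proof -
    note d = diff[OF that] and rd = r_differentiable[OF that(1,2)]
    have "(?F i has_derivative (\<lambda>h. (frechet_derivative (dnorm i) (at x) h - 0 -
        c * (r i x * frechet_derivative (lap i) (at x) h + frechet_derivative (r i) (at x) h * lap i
          x)) / (t i)\<^sup>2)) (at x)"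
      unfolding defect_def mult.assoc divide_inverse
      using frechet_derivative_works[THEN iffD1, OF d(3)] frechet_derivative_works[THEN iffD1, OF d(1)]
        frechet_derivative_works[THEN iffD1, OF rd]
      by (intro has_derivative_diff has_derivative_mult_left has_derivative_mult_right
        has_derivative_mult has_derivative_const)
    from partial_deriv_eq[OF this, of b] show ?thesis
      by (simp add: A_def B_def partial_deriv_def add_divide_distrib diff_divide_distrib distrib_left)
  qed
  have F_bd: "\<bar>?F i x\<bar> \<le> C" if "i \<in> I" "x \<in> S" for i x
    using bd[OF that] t(1)[OF that(1)] by (simp add: pos_divide_le_eq)
  have A: "rg (Suc \<kappa>) (A b)" if b: "b \<in> Basis" for b
  proof -
    have "\<exists>C. \<forall>i\<in>I. \<forall>x\<in>S. \<bar>F i x\<bar> \<le> C" if "rg \<kappa> F" for F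
      using reg_P[OF that] unfolding hoelder_bound_def by blast
    note bound = this
    have "\<forall>e\<in>Basis. \<exists>C. \<forall>i\<in>I. \<forall>x\<in>S. \<bar>partial_deriv e (A b i) x\<bar> \<le> C" using bound[OF A'[OF b]] by blast
    then obtain C2 where C2: "\<And>e i x. e \<in> Basis \<Longrightarrow> i \<in> I \<Longrightarrow> x \<in> S \<Longrightarrow> \<bar>partial_deriv e (A b i) x\<bar> \<le> C2 e"
      by (auto dest!: bchoice)
    have C2': "\<bar>partial_deriv e (A b i) x\<bar> \<le> (\<Sum>e\<in>Basis. \<bar>C2 e\<bar>)" if "i \<in> I" "x \<in> S" "e \<in> Basis"
      for e i x
      using C2[OF that(3,1,2)] member_le_sum[OF that(3), of "\<lambda>e. \<bar>C2 e\<bar>"] by force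
    obtain C1 where C1: "\<And>i x. i \<in> I \<Longrightarrow> x \<in> S \<Longrightarrow> \<bar>B b i x\<bar> \<le> C1" using bound[OF B[OF b]] by blast
    have A_on: "A b i differentiable_on S" if "i \<in> I" for i
      using A_diff[OF that _ b] by (simp add: differentiable_on_eq_differentiable_at[OF S(1)])
    \<comment> \<open>Here the assumed bound on the defect makes up for the factor t that is missing
      in \<open>A\<close>.\<close>
    obtain C0 where C0: "\<And>i x. i \<in> I \<Longrightarrow> x \<in> S \<Longrightarrow> \<bar>A b i x\<bar> \<le> C0"
      using derivative_splitting_bound[of S b I ?F C "A b" "B b" C1 "\<Sum>e\<in>Basis. \<bar>C2 e\<bar>",
          OF S b F_diff F_bd F'[OF _ _ b] C1 A_on C2'] by auto
    have "hoelder_bound \<alpha> I S (A b)"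
      by (rule hoelder_bound_of_partial_bound[OF S(1-3) \<alpha> A_on C0 C2'])
    then show ?thesis using A_on A'[OF b] by simp
  qed
  have F'': "rg \<kappa> (\<lambda>i x. A b i x + B b i x)" if "b \<in> Basis" for b
    using reg_add[OF reg_pred[OF A[OF that]] B[OF that]] .
  have "rg \<kappa> (\<lambda>i. partial_deriv b (?F i))" if "b \<in> Basis" for b
    by (rule reg_cong[OF F''[OF that]]) (use F' that in simp)
  note dF = this
  have F_on: "?F i differentiable_on S" if "i \<in> I" for i
    using F_diff[OF that] by (simp add: differentiable_on_eq_differentiable_at[OF S(1)])
  have "\<forall>e\<in>Basis. \<exists>C. \<forall>i\<in>I. \<forall>x\<in>S. \<bar>partial_deriv e (?F i) x\<bar> \<le> C"
    using reg_P[OF dF] unfolding hoelder_bound_def by blast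
  then obtain C2 where C2: "\<And>e i x. e \<in> Basis \<Longrightarrow> i \<in> I \<Longrightarrow> x \<in> S \<Longrightarrow> \<bar>partial_deriv e (?F i) x\<bar> \<le> C2 e"
    by (auto dest!: bchoice)
  have C2': "\<bar>partial_deriv e (?F i) x\<bar> \<le> (\<Sum>e\<in>Basis. \<bar>C2 e\<bar>)" if "i \<in> I" "e \<in> Basis" "x \<in> S" for e i x
    using C2[OF that(2,1,3)] member_le_sum[OF that(2), of "\<lambda>e. \<bar>C2 e\<bar>"] by force
  have "hoelder_bound \<alpha> I S ?F"
    by (rule hoelder_bound_of_partial_bound[OF S(1-3) \<alpha> F_on F_bd C2'])
  then show ?thesis using F_on dF by simp
qed

text \<open>The weight of the function spaces is rho = t r rather than t. Since \<open>r\<close> is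
  regular and bounded below, the two weights differ by a regular factor.\<close>

lemma reg_defect_weighted:
  assumes "\<And>i x. i \<in> I \<Longrightarrow> x \<in> S \<Longrightarrow> \<bar>defect c i x\<bar> \<le> C * (t i)\<^sup>2"
  shows "rg (Suc \<kappa>) (\<lambda>i x. defect c i x / (t i * r i x)\<^sup>2)"
proof -
  have "rg (Suc \<kappa>) (\<lambda>i x. defect c i x / (t i)\<^sup>2 * (inverse (r i x) * inverse (r i x)))"
    by (intro reg_mult reg_defect_scaled reg_inverse_r) (use assms in auto)
  then show ?thesis by (rule reg_cong) (simp add: field_simps power2_eq_square)
qed

end

section \<open>Scaling by constants\<close>

lemma metric_on_scale:
  assumes G: "metric_on k U G" and c: "0 < c"
  shows "metric_on k U (\<lambda>x u v. c * G x u v)"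
  unfolding metric_on_def
proof (intro conjI ballI metric_onD(1)[OF G])
  show "inner_form (\<lambda>u v. c * G x u v)" if "x \<in> U" for x
    using metric_onD(2)[OF G that] c unfolding inner_form_def bilinear_def linear_iff
      by (auto simp: algebra_simps)
  show "Ck_on k U (\<lambda>x. c * G x u v)" for u v
    by (rule Ck_on_mult[OF metric_onD(1)[OF G] Ck_on_const metric_on_Ck[OF G]])
qed

lemma christoffel_scale:
  assumes G: "metric_on (Suc k) U G" "x \<in> U" and c: "0 < c"
  shows "christoffel (\<lambda>x u v. c * G x u v) x u v = christoffel G x u v"
proof (rule christoffel_eqI[OF metric_on_scale[OF G(1) c] G(2)])
  have "metric_deriv (\<lambda>x u v. c * G x u v) x w u v = c * metric_deriv G x w u v" for w u v
  proof -
    have "((\<lambda>y. c * G y u v) has_derivative (\<lambda>w. c * metric_deriv G x w u v)) (at x)"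
      unfolding metric_deriv_def
      by (intro has_derivative_mult_right frechet_derivative_works[THEN iffD1]
        metric_on_differentiable[OF G(1) _ G(2)]) simp
    from frechet_derivative_at[OF this] show ?thesis by (simp add: metric_deriv_def fun_eq_iff)
  qed
  then show "c * G x (christoffel G x u v) w = christoffel_form (\<lambda>x u v. c * G x u v) x u v w" for w
    by (simp add: christoffel_works[OF G] christoffel_form_def algebra_simps)
qed

lemma scalar_loc_scale:
  fixes G :: "'v::euclidean_space lmetric"
  assumes G: "metric_on (Suc (Suc 0)) U G" "x \<in> U" and c: "0 < c"
  shows "scalar_loc (\<lambda>x u v. c * G x u v) x = scalar_loc G x / c"
proof -
  note ch = christoffel_scale[OF G(1) _ c]
  have "frechet_derivative (\<lambda>y. christoffel (\<lambda>x u v. c * G x u v) y v w) (at x) =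
    frechet_derivative (\<lambda>y. christoffel G y v w) (at x)" for v w
    by (rule frechet_derivative_cong_open[OF metric_onD(1)[OF G(1)] G(2)]) (simp add: ch)
  then have "ricci (\<lambda>x u v. c * G x u v) x = ricci G x"
    by (simp add: fun_eq_iff ricci_def curvature_def ch[OF G(2)])
  then show ?thesis unfolding scalar_loc_def
    using metric_trace_scaled[OF metric_onD(2)[OF G] bilinear_right[OF ricci_bilinear[OF G]] c] by simp
qed

lemma frechet_derivative_cmult:
  fixes f :: "'v::real_normed_vector \<Rightarrow> real"
  assumes "f differentiable (at x)"
  shows "frechet_derivative (\<lambda>x. s * f x) (at x) v = s * frechet_derivative f (at x) v"
  using frechet_derivative_at[OF has_derivative_mult_right[OF frechet_derivative_works[THEN
    iffD1, OF assms], of s]]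
  by (simp add: fun_eq_iff)

lemma laplacian_scale:
  fixes G :: "'v::euclidean_space lmetric"
  assumes G: "metric_on (Suc (Suc 0)) U G" "x \<in> U" and c: "0 < c" and f: "Ck_on 2 U f"
  shows "metric_trace (\<lambda>u v. c * G x u v) (hessian (\<lambda>x u v. c * G x u v) (\<lambda>x. s * f x) x) =
    s / c * metric_trace (G x) (hessian G f x)"
proof -
  note U = metric_onD(1)[OF G(1)]
  have df: "f differentiable (at z)" if "z \<in> U" for z
    using Ck_on_differentiable[OF f] that by (intro differentiable_on_openD[OF _ U]) auto
  have f2: "Ck_on 1 U (\<lambda>z. frechet_derivative f (at z) a)" for a
    using f by (intro Ck_on_frechet_derivative[OF U]) (simp add: eval_nat_numeral)
  have ddf: "(\<lambda>z. frechet_derivative f (at z) a) differentiable (at x)" for a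
    using Ck_on_differentiable[OF f2] G(2) by (intro differentiable_on_openD[OF _ U]) auto
  have "frechet_derivative (\<lambda>y. frechet_derivative (\<lambda>x. s * f x) (at y) v) (at x) u =
      s * frechet_derivative (\<lambda>y. frechet_derivative f (at y) v) (at x) u" for u v
    unfolding frechet_derivative_cmult[OF ddf, symmetric]
    by (rule fun_cong[OF frechet_derivative_cong_open[OF U G(2)]])
      (rule frechet_derivative_cmult[OF df])
  then have "hessian (\<lambda>x u v. c * G x u v) (\<lambda>x. s * f x) x = (\<lambda>u v. s * hessian G f x u v)"
    by (simp add: fun_eq_iff hessian_def christoffel_scale[OF G c] frechet_derivative_cmult[OF df[OF
      G(2)]] algebra_simps)
  moreover have "linear (\<lambda>v. s * hessian G f x b v)" for b
    using bilinear_right[OF hessian_bilinear[OF G f], of b] by (simp add: linear_iff algebra_simps)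
  ultimately show ?thesis
    using metric_trace_scaled[OF metric_onD(2)[OF G] _ c]
      metric_trace_cmul[OF metric_onD(2)[OF G] bilinear_right[OF hessian_bilinear[OF G f]]] by simp
qed

lemma diff_norm_scale:
  fixes f :: "'v::euclidean_space \<Rightarrow> real" and s :: real
  assumes B: "inner_form B" and c: "0 < c" and f: "f differentiable (at x)"
  defines "df \<equiv> frechet_derivative (\<lambda>x. s * f x) (at x)"
  shows "df (sharp (\<lambda>u v. c * B u v) df) = s\<^sup>2 / c *
    frechet_derivative f (at x) (sharp B (frechet_derivative f (at x)))"
proof -
  note lin = linear_frechet_derivative[OF f]
  have df: "df = (\<lambda>v. s * frechet_derivative f (at x) v)"
    unfolding df_def using frechet_derivative_cmult[OF f] by (simp add: fun_eq_iff)
  then have lin': "linear df" using lin by (simp add: linear_iff algebra_simps)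
  have "sharp (\<lambda>u v. c * B u v) df = (1 / c) *\<^sub>R (s *\<^sub>R sharp B (frechet_derivative f (at x)))"
    unfolding sharp_scaled[OF B lin' c] unfolding df sharp_cmul[OF B lin] by simp
  then show ?thesis by (simp add: df linear_cmul[OF lin] power2_eq_square)
qed


section \<open>Hyperbolic balls\<close>

text \<open>Both conditions reduce to |x|^2 + (y - 1)^2 < 2 y (cosh r - 1). The Euclidean
  description supplies the convexity that the mean value arguments need.\<close>

lemma hyp_ball_eq:
  assumes "0 < r"
  shows "hyp_ball r = (ball (0, cosh r) (sinh r) :: ('e::euclidean_space \<times> real) set)"
proof (intro set_eqI, clarify)
  fix x :: 'e and y :: real
  have cs: "(cosh r)\<^sup>2 = (sinh r)\<^sup>2 + 1" for r :: real by (rule cosh_square_eq)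
  have sr: "sinh r > 0" "cosh r > 0" using assms by (simp_all add: sinh_real_pos_iff cosh_real_pos)
  have "dist (0, cosh r) (x, y) = sqrt ((norm x)\<^sup>2 + (y - cosh r)\<^sup>2)"
    by (simp add: dist_Pair_Pair dist_real_def power2_commute)
  then have "dist (0, cosh r) (x, y) < sinh r \<longleftrightarrow> sqrt ((norm x)\<^sup>2 + (y - cosh r)\<^sup>2) < sqrt ((sinh r)\<^sup>2)"
    using sr by simp
  also have "\<dots> \<longleftrightarrow> (norm x)\<^sup>2 + (y - cosh r)\<^sup>2 < (sinh r)\<^sup>2" by (rule real_sqrt_less_iff)
  also have "\<dots> \<longleftrightarrow> (norm x)\<^sup>2 + (y - 1)\<^sup>2 < 2 * y * (cosh r - 1)"
    using cs[of r] by (simp add: power2_eq_square algebra_simps)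
  finally have ball: "dist (0, cosh r) (x, y) < sinh r \<longleftrightarrow> (norm x)\<^sup>2 + (y - 1)\<^sup>2 <
    2 * y * (cosh r - 1)" .
  have "cosh r > 1" using assms cs[of r] sr by (metis cosh_real_strict_mono cosh_0 order_refl)
  then have pos: "y > 0" if "(norm x)\<^sup>2 + (y - 1)\<^sup>2 < 2 * y * (cosh r - 1)"
  proof -
    have "0 \<le> (norm x)\<^sup>2 + (y - 1)\<^sup>2" by simp
    with that have "0 < 2 * y * (cosh r - 1)" by linarith
    then have "0 < y * (2 * (cosh r - 1))" by (simp add: mult_ac)
    then show ?thesis using \<open>cosh r > 1\<close> by (simp add: zero_less_mult_iff)
  qed
  have "arcosh (1 + ((norm x)\<^sup>2 + (y - 1)\<^sup>2) / (2 * y)) < r \<longleftrightarrow> (norm x)\<^sup>2 + (y - 1)\<^sup>2 <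
    2 * y * (cosh r - 1)"
    if y: "y > 0"
  proof -
    let ?w = "1 + ((norm x)\<^sup>2 + (y - 1)\<^sup>2) / (2 * y)"
    have w: "?w \<ge> 1" using y by simp
    have "arcosh ?w < r \<longleftrightarrow> cosh (arcosh ?w) < cosh r"
      using assms arcosh_nonneg_real[OF w] by (simp add: cosh_real_nonneg_less_iff)
    also have "\<dots> \<longleftrightarrow> ?w < cosh r" using cosh_arcosh_real[OF w] by simp
    also have "\<dots> \<longleftrightarrow> (norm x)\<^sup>2 + (y - 1)\<^sup>2 < 2 * y * (cosh r - 1)"
      using y by (simp add: field_simps)
    finally show ?thesis .
  qed
  then show "(x, y) \<in> hyp_ball r \<longleftrightarrow> (x, y) \<in> ball (0, cosh r) (sinh r)"
    using ball pos by (auto simp: hyp_ball_def)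
qed

text \<open>The number exp (-2) = cosh 2 - sinh 2 is the height of the lowest point of the closed
  ball; the lower bound for rho / t in Moebius balls rests on it.\<close>

lemma hyp_ball_2:
  defines "S \<equiv> hyp_ball 2 :: ('e::euclidean_space \<times> real) set"
  shows "open S" "convex S" "bounded S" "S \<noteq> {}" "compact (closure S)"
    "z \<in> closure S \<Longrightarrow> exp (- 2) \<le> snd z"
    "hyp_ball 1 \<subseteq> S"
proof -
  have eq: "S = ball (0, cosh 2) (sinh 2)" unfolding S_def by (rule hyp_ball_eq) simp
  have s2: "sinh 2 > (0::real)" by (simp add: sinh_real_pos_iff)
  show "open S" "convex S" "bounded S" "compact (closure S)" by (simp_all add: eq)
  show "S \<noteq> {}" using s2 by (simp add: eq)
  show "hyp_ball 1 \<subseteq> S" by (auto simp: S_def hyp_ball_def)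
  have "S \<subseteq> {z. exp (- 2) \<le> snd z}"
  proof
    fix z assume "z \<in> S"
    then have "dist (0, cosh 2) z < sinh 2" by (simp add: eq)
    moreover have "\<bar>cosh 2 - snd z\<bar> \<le> dist (0, cosh 2) z"
      using dist_snd_le[of "(0, cosh 2)" z] by (simp add: dist_real_def)
    ultimately have "snd z \<ge> cosh 2 - sinh 2" by linarith
    also have "cosh 2 - sinh 2 = exp (- 2 :: real)" by (rule cosh_minus_sinh)
    finally show "z \<in> {z. exp (- 2) \<le> snd z}" by simp
  qed
  moreover have "closed {z :: 'e \<times> real. exp (- 2) \<le> snd z}"
    by (intro closed_Collect_le continuous_intros)
  ultimately have "closure S \<subseteq> {z. exp (- 2) \<le> snd z}" by (rule closure_minimal)
  then show "z \<in> closure S \<Longrightarrow> exp (- 2) \<le> snd z" by blast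
qed


section \<open>Invariance on the manifold\<close>

context manifold_with_boundary
begin

definition "int_image c = snd c ` (fst c \<inter> M)"

lemma open_int_image: "c \<in> \<A> \<Longrightarrow> open (int_image c)"
  using open_image_interior[of c "topspace T"] chartD(4)[of c] unfolding int_image_def
  by (simp add: Int_absorb1)

lemma chart_inv_int_image:
  assumes "c \<in> \<A>" "x \<in> int_image c"
  shows "chart_inv c x \<in> fst c" "chart_inv c x \<in> M" "snd c (chart_inv c x) = x"
  using assms chart_inv(1)[OF assms(1)] unfolding int_image_def by auto

lemma transition_Ck:
  assumes "c \<in> \<A>" "d \<in> \<A>"
  shows "Ck_on k (snd c ` (fst d \<inter> fst c \<inter> M)) (transition c d)"
  by (rule smooth_on_openD[OF compatibleD[OF assms] open_image_interior[OF assms(1)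
    chartD(1)[OF assms(2)]]])
    (auto simp: overlap_def)

lemma transition_deriv_interior:
  assumes "c \<in> \<A>" "d \<in> \<A>" "p \<in> fst c" "p \<in> fst d" "p \<in> M"
  shows "transition_deriv c d p = frechet_derivative (transition c d) (at (snd c p))"
  by (rule transition_deriv_eq_extension[OF assms(1-4) open_image_interior[OF assms(1)
    chartD(1)[OF assms(2)]]])
    (use transition_Ck[OF assms(1,2)] assms in auto)

lemma in_coords_transform:
  assumes h: "tensor2_field \<A> M h" and cd: "c \<in> \<A>" "d \<in> \<A>" and x: "x \<in> snd c ` (fst d \<inter> fst c \<inter> M)"
  shows "in_coords c h x u v = in_coords d h (transition c d x)
    (frechet_derivative (transition c d) (at x) u) (frechet_derivative (transition c d) (at x) v)"
proof -
  obtain p where p: "p \<in> fst c" "p \<in> fst d" "p \<in> M" "x = snd c p" using x by blast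
  have "h c p u v = h d p (transition_deriv c d p u) (transition_deriv c d p v)"
    using h cd p unfolding tensor2_field_def by blast
  then show ?thesis
    unfolding in_coords_def p(4) transition_eq[OF cd(1) p(1)] chart_inv(1)[OF cd(1) p(1)]
      chart_inv(1)[OF cd(2) p(2)]
      transition_deriv_interior[OF cd p(1,2,3)] .
qed

end

section \<open>Independence of the chart\<close>

locale manifold_metric = manifold_with_boundary T \<A> \<rho>
  for T :: "'m topology" and \<A> :: "('m, 'e::euclidean_space \<times> real) chart set" and \<rho> :: "'m \<Rightarrow> real" +
  fixes h :: "('m, 'e \<times> real) tensor2"
  assumes h_tensor: "tensor2_field \<A> M h"
    and h_metric: "\<And>c. c \<in> \<A> \<Longrightarrow> metric_on (Suc (Suc 0)) (int_image c) (in_coords c h)"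
begin

abbreviation "rho c \<equiv> \<rho> \<circ> chart_inv c"
text \<open>The chart is a parameter here, whereas the global definitions evaluate in the
  unspecified chart \<open>chart_at\<close>. The estimates need the freedom to use the charts of the
  parametrizations.\<close>

definition "scal c p = scalar_loc (in_coords c h) (snd c p)"
definition "dn c p = (let df = frechet_derivative (rho c) (at (snd c p)) in df (sharp (h c p) df))"
definition "lp c p = metric_trace (h c p) (hessian (in_coords c h) (rho c) (snd c p))"

lemma rho_Ck:
  assumes "c \<in> \<A>"
  shows "Ck_on k (int_image c) (rho c)"
  unfolding o_def
  by (rule smooth_on_openD[OF rho_smooth[OF assms] open_int_image[OF assms]])
    (use chart_inv(4)[OF assms] in \<open>auto simp: int_image_def\<close>)

lemma metric_on_subset: "metric_on k U G \<Longrightarrow> open V \<Longrightarrow> V \<subseteq> U \<Longrightarrow> metric_on k V G"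
  unfolding metric_on_def using Ck_on_subset by blast

text \<open>The transition map is an isometry between the two coordinate metrics on the overlap,
  with the differential of the reverse transition as \<open>Q\<close>.\<close>

lemma invariants:
  assumes c: "c \<in> \<A>" and d: "d \<in> \<A>" and p: "p \<in> fst c" "p \<in> fst d" "p \<in> M"
  shows "scal c p = scal d p" "lp c p = lp d p" "dn c p = dn d p"
proof -
  let ?U = "snd c ` (fst d \<inter> fst c \<inter> M)" and ?V = "snd d ` (fst c \<inter> fst d \<inter> M)"
  note U = open_image_interior[OF c chartD(1)[OF d]] and V = open_image_interior[OF d chartD(1)[OF c]]
  have sub: "?U \<subseteq> int_image c" "?V \<subseteq> int_image d" unfolding int_image_def by auto
  let ?Q = "\<lambda>x. frechet_derivative (transition d c) (at (transition c d x))"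
  have inv: "linear (?Q x)" "frechet_derivative (transition c d) (at x) (?Q x v) = v"
    "?Q x (frechet_derivative (transition c d) (at x) v) = v" if "x \<in> ?U" for x v
  proof -
    obtain q where q: "q \<in> fst c" "q \<in> fst d" "q \<in> M" "x = snd c q" using \<open>x \<in> ?U\<close> by blast
    have Q: "?Q x = transition_deriv d c q" "frechet_derivative (transition c d) (at x) =
      transition_deriv c d q"
      using transition_deriv_interior[OF c d q(1,2,3)] transition_deriv_interior[OF d c q(2,1,3)]
      by (simp_all add: q(4) transition_eq[OF c q(1)])
    show "linear (?Q x)" "frechet_derivative (transition c d) (at x) (?Q x v) = v"
      "?Q x (frechet_derivative (transition c d) (at x) v) = v"
      unfolding Q using transition_deriv_linear[OF d c q(2,1)] transition_deriv_inverse[OF c d q(1,2)]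
        transition_deriv_inverse[OF d c q(2,1)] by auto
  qed
  interpret metric_pullback ?U ?V "transition c d" "in_coords c h" "in_coords d h" ?Q
  proof (rule metric_pullback.intro)
    show "metric_on (Suc (Suc 0)) ?U (in_coords c h)"
      by (rule metric_on_subset[OF h_metric[OF c] U sub(1)])
    show "metric_on (Suc (Suc 0)) ?V (in_coords d h)"
      by (rule metric_on_subset[OF h_metric[OF d] V sub(2)])
    show "Ck_on 3 ?U (transition c d)" by (rule transition_Ck[OF c d])
    show "transition c d x \<in> ?V" if "x \<in> ?U" for x
    proof -
      obtain q where q: "q \<in> fst c" "q \<in> fst d" "q \<in> M" "x = snd c q" using \<open>x \<in> ?U\<close> by blast
      then have "transition c d x = snd d q" using transition_eq[OF c q(1), of d] by simp
      then show ?thesis using q by blast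
    qed
    show "linear (?Q x)" if "x \<in> ?U" for x by (rule inv(1)[OF that])
    show "frechet_derivative (transition c d) (at x) (?Q x v) = v" if "x \<in> ?U" for x v
      by (rule inv(2)[OF that])
    show "?Q x (frechet_derivative (transition c d) (at x) v) = v" if "x \<in> ?U" for x v
      using inv(3)[OF that] .
    show "in_coords c h x u v = in_coords d h (transition c d x)
      (frechet_derivative (transition c d) (at x) u)
        (frechet_derivative (transition c d) (at x) v)" if "x \<in> ?U" for x u v
      by (rule in_coords_transform[OF h_tensor c d that])
  qed
  have x: "snd c p \<in> ?U" using p by blast
  have eq: "transition c d (snd c p) = snd d p" by (rule transition_eq[OF c p(1)])
  have hc: "in_coords c h (snd c p) = h c p" "in_coords d h (snd d p) = h d p"
    unfolding in_coords_def using chart_inv(1)[OF c p(1)] chart_inv(1)[OF d p(2)] by auto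
  have F: "Ck_on 2 ?V (rho d)" using Ck_on_subset[OF rho_Ck[OF d] sub(2)] .
  have f: "rho c y = rho d (transition c d y)" if "y \<in> ?U" for y
  proof -
    obtain q where q: "q \<in> fst c" "q \<in> fst d" "y = snd c q" using \<open>y \<in> ?U\<close> by blast
    then show ?thesis by (simp add: transition_eq[OF c] chart_inv(1)[OF c] chart_inv(1)[OF d])
  qed
  show "scal c p = scal d p" using scalar_loc_pullback[OF x] unfolding scal_def eq .
  show "lp c p = lp d p" using laplacian_pullback[OF x F f] unfolding lp_def eq hc .
  show "dn c p = dn d p" using diff_norm_pullback[OF x F f] unfolding dn_def Let_def eq hc .
qed

lemma chart_values:
  assumes c: "c \<in> \<A>" and p: "p \<in> fst c" "p \<in> M"
  shows "laplacian \<A> h \<rho> p = lp c p" "diff_norm_sq \<A> h \<rho> p = dn c p"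
proof -
  have "p \<in> topspace T" using p chartD(4)[OF c] by blast
  note c0 = chart_at[OF this]
  show "laplacian \<A> h \<rho> p = lp c p" "diff_norm_sq \<A> h \<rho> p = dn c p"
    unfolding invariants(2)[OF c c0(1) p(1) c0(2) p(2)] invariants(3)[OF c c0(1) p(1) c0(2) p(2)]
    by (simp_all add: laplacian_def diff_norm_sq_def lp_def dn_def Let_def)
qed

lemma scalar_curvature_conformal:
  assumes g: "\<And>c p u v. c \<in> \<A> \<Longrightarrow> p \<in> fst c \<Longrightarrow> p \<in> M \<Longrightarrow> h c p u v = (\<rho> p)\<^sup>2 * g c p u v"
    and c: "c \<in> \<A>" and p: "p \<in> fst c" "p \<in> M"
  defines "m \<equiv> real DIM('e \<times> real)"
  shows "scalar_curvature \<A> g p = (\<rho> p)\<^sup>2 * scal c p + 2 * (m - 1) * (\<rho> p * lp c p) -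
    m * (m - 1) * dn c p"
proof -
  have "p \<in> topspace T" using p chartD(4)[OF c] by blast
  note d = chart_at[OF this]
  let ?d = "chart_at \<A> p"
  have pos: "\<rho> (chart_inv ?d x) > 0" if "x \<in> int_image ?d" for x
    using chart_inv_int_image[OF d(1) that] minterior_iff by blast
  interpret conformal_metric "int_image ?d" "in_coords ?d h" "rho ?d" "in_coords ?d g"
  proof
    show "in_coords ?d g x u v = in_coords ?d h x u v / ((rho ?d) x)\<^sup>2" if "x \<in> int_image ?d" for x u v
      using g[OF d(1) chart_inv_int_image(1,2)[OF d(1) that]] pos[OF that] by (simp add: in_coords_def)
  qed (use h_metric[OF d(1)] rho_Ck[OF d(1)] pos in auto)
  have x: "snd ?d p \<in> int_image ?d" using d p by (auto simp: int_image_def)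
  have hd: "in_coords ?d h (snd ?d p) = h ?d p" "rho ?d (snd ?d p) = \<rho> p"
    unfolding in_coords_def using chart_inv(1)[OF d] by auto
  have "scalar_curvature \<A> g p = scalar_loc (in_coords ?d g) (snd ?d p)"
    by (simp add: scalar_curvature_def Let_def)
  also have "\<dots> = (\<rho> p)\<^sup>2 * scal ?d p + 2 * (m - 1) * (\<rho> p * lp ?d p) - m * (m - 1) * dn ?d p"
    using scalar_conformal[OF x] unfolding hd scal_def lp_def dn_def Let_def m_def .
  finally show ?thesis using invariants[OF c d(1) p(1) d(2) p(2)] by simp
qed

end

section \<open>Moebius parametrizations\<close>

lemma reg_hoelder_subset:
  assumes "reg (hoelder_bound \<alpha> I S) I S k F" "J \<subseteq> I"
  shows "reg (hoelder_bound \<alpha> J S) J S k F"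
proof -
  have hb: "hoelder_bound \<alpha> J S F" if "hoelder_bound \<alpha> I S F" for F
    using that assms(2) unfolding hoelder_bound_def by blast
  show ?thesis using assms(1)
  proof (induction k arbitrary: F)
    case (Suc k)
    have "reg (hoelder_bound \<alpha> J S) J S k (\<lambda>i. partial_deriv b (F i))" if "b \<in> Basis" for b
      using Suc.prems that by (intro Suc.IH) simp
    moreover have "hoelder_bound \<alpha> J S F" using Suc.prems hb by simp
    moreover have "\<forall>i\<in>J. F i differentiable_on S" using Suc.prems assms(2) by auto
    ultimately show ?case by simp
  qed (use hb in simp)
qed

text \<open>Adding up finitely many constants gives a common one; this is what allows each boundary
  chart to have its own.\<close>

lemma reg_hoelder_UN:
  assumes "finite X" "\<And>x. x \<in> X \<Longrightarrow> reg (hoelder_bound \<alpha> (J x) S) (J x) S k F"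
  shows "reg (hoelder_bound \<alpha> (\<Union>x\<in>X. J x) S) (\<Union>x\<in>X. J x) S k F"
proof -
  have hb: "hoelder_bound \<alpha> (\<Union>x\<in>X. J x) S F" if "\<And>x. x \<in> X \<Longrightarrow> hoelder_bound \<alpha> (J x) S F" for F
  proof -
    have "\<forall>x\<in>X. \<exists>C\<ge>0. \<forall>i\<in>J x. continuous_on S (F i) \<and> (\<forall>z\<in>S. \<bar>F i z\<bar> \<le> C) \<and>
        (\<forall>z\<in>S. \<forall>y\<in>S. \<bar>F i z - F i y\<bar> \<le> C * dist z y powr \<alpha>)"
    proof
      fix x assume "x \<in> X"
      from hoelder_boundE[OF that[OF this]] obtain C
        where C: "C \<ge> 0" "\<And>i. i \<in> J x \<Longrightarrow> continuous_on S (F i)"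
        "\<And>i z. i \<in> J x \<Longrightarrow> z \<in> S \<Longrightarrow> \<bar>F i z\<bar> \<le> C"
        "\<And>i z y. i \<in> J x \<Longrightarrow> z \<in> S \<Longrightarrow> y \<in> S \<Longrightarrow> \<bar>F i z - F i y\<bar> \<le> C * dist z y powr \<alpha>" by blast
      then show "\<exists>C\<ge>0. \<forall>i\<in>J x. continuous_on S (F i) \<and> (\<forall>z\<in>S. \<bar>F i z\<bar> \<le> C) \<and>
        (\<forall>z\<in>S. \<forall>y\<in>S. \<bar>F i z - F i y\<bar> \<le> C * dist z y powr \<alpha>)" by (intro exI[of _ C]) simp
    qed
    from bchoice[OF this] obtain C where C': "\<forall>x\<in>X. C x \<ge> 0 \<and>
      (\<forall>i\<in>J x. continuous_on S (F i) \<and> (\<forall>z\<in>S. \<bar>F i z\<bar> \<le> C x) \<and>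
        (\<forall>z\<in>S. \<forall>y\<in>S. \<bar>F i z - F i y\<bar> \<le> C x * dist z y powr \<alpha>))" ..
    have C: "\<And>x. x \<in> X \<Longrightarrow> C x \<ge> 0" "\<And>x i. x \<in> X \<Longrightarrow> i \<in> J x \<Longrightarrow> continuous_on S (F i)"
      "\<And>x i z. x \<in> X \<Longrightarrow> i \<in> J x \<Longrightarrow> z \<in> S \<Longrightarrow> \<bar>F i z\<bar> \<le> C x"
      "\<And>x i z y. x \<in> X \<Longrightarrow> i \<in> J x \<Longrightarrow> z \<in> S \<Longrightarrow> y \<in> S \<Longrightarrow> \<bar>F i z - F i y\<bar> \<le> C x * dist z y powr \<alpha>"
      using C' by simp_all
    have le: "C x \<le> (\<Sum>x\<in>X. C x)" if "x \<in> X" for x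
      using C(1) assms(1) that by (intro member_le_sum) auto
    show ?thesis
    proof (rule hoelder_boundI[where ?C1.0="\<Sum>x\<in>X. C x" and ?C2.0="\<Sum>x\<in>X. C x"])
      fix i assume "i \<in> (\<Union>x\<in>X. J x)"
      then obtain x where x: "x \<in> X" "i \<in> J x" by blast
      show "continuous_on S (F i)" by (rule C(2)[OF x])
      show "\<bar>F i z\<bar> \<le> (\<Sum>x\<in>X. C x)" if "z \<in> S" for z using C(3)[OF x that] le[OF x(1)] by linarith
      show "\<bar>F i z - F i y\<bar> \<le> (\<Sum>x\<in>X. C x) * dist z y powr \<alpha>" if "z \<in> S" "y \<in> S" for z y
        using C(4)[OF x that] mult_right_mono[OF le[OF x(1)], of "dist z y powr \<alpha>"] by simp
    qed
  qed
  show ?thesis using assms(2)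
  proof (induction k arbitrary: F)
    case (Suc k)
    have "reg (hoelder_bound \<alpha> (\<Union>x\<in>X. J x) S) (\<Union>x\<in>X. J x) S k (\<lambda>i. partial_deriv b (F i))"
      if "b \<in> Basis" for b
      using Suc.prems that by (intro Suc.IH) simp
    moreover have "hoelder_bound \<alpha> (\<Union>x\<in>X. J x) S F" using Suc.prems hb by simp
    moreover have "\<forall>i\<in>(\<Union>x\<in>X. J x). F i differentiable_on S" using Suc.prems by auto
    ultimately show ?case by simp
  qed (use hb in simp)
qed

text \<open>Every derivative of a function that is smooth near the compact closure is bounded. This
  serves for the height function of the half-space and for rho in an interior chart.\<close>

lemma reg_hoelder_smooth:
  fixes F :: "'v::euclidean_space \<Rightarrow> real"
  assumes S: "open S" "convex S" "bounded S" and \<alpha>: "0 \<le> \<alpha>" "\<alpha> \<le> 1" and W: "open W" "closure S \<subseteq> W"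
    and F: "Cinf_on W F"
  shows "reg (hoelder_bound \<alpha> I S) I S k (\<lambda>_. F)"
proof -
  have hb: "hoelder_bound \<alpha> I S (\<lambda>_. F)" if F: "Cinf_on W F" for F
  proof -
    have cpt: "compact (closure S)" using S(3) by simp
    have bd: "\<exists>C. \<forall>x\<in>S. \<bar>f x\<bar> \<le> C" if "continuous_on W f" for f :: "'v \<Rightarrow> real"
    proof -
      have "compact (f ` closure S)"
        by (rule compact_continuous_image[OF continuous_on_subset[OF that W(2)] cpt])
      from compact_imp_bounded[OF this] show ?thesis using closure_subset[of S]
        by (auto simp: bounded_iff)
    qed
    have d: "F differentiable_on W" "\<And>b. b \<in> Basis \<Longrightarrow> continuous_on W (partial_deriv b F)"
      using F[rule_format, of "Suc 0"] by (auto simp: Ck_on_Suc)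
    obtain C where C: "\<And>x. x \<in> S \<Longrightarrow> \<bar>F x\<bar> \<le> C" using bd[of F] F[rule_format, of 0] by auto
    have "\<forall>b\<in>Basis. \<exists>C. \<forall>x\<in>S. \<bar>partial_deriv b F x\<bar> \<le> C" using bd[OF d(2)] by simp
    then obtain C' where C': "\<And>b x. b \<in> Basis \<Longrightarrow> x \<in> S \<Longrightarrow> \<bar>partial_deriv b F x\<bar> \<le> C' b"
      by (auto dest!: bchoice)
    have "\<bar>partial_deriv b F x\<bar> \<le> (\<Sum>b\<in>Basis. \<bar>C' b\<bar>)" if "b \<in> Basis" "x \<in> S" for b x
      using C'[OF that] member_le_sum[OF that(1), of "\<lambda>b. \<bar>C' b\<bar>"] by force
    moreover have "F differentiable_on S"
      by (rule differentiable_on_subset[OF d(1) subset_trans[OF closure_subset W(2)]])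
    ultimately show ?thesis using C by (intro hoelder_bound_of_partial_bound[OF S \<alpha>]) auto
  qed
  show ?thesis using F
  proof (induction k arbitrary: F)
    case 0
    then show ?case using hb by simp
  next
    case (Suc k)
    have "Cinf_on W (partial_deriv b F)" if "b \<in> Basis" for b
      using Suc.prems that by (metis Ck_on_Suc)
    moreover have "F differentiable_on W"
      using Suc.prems[rule_format, of "Suc 0"] by (simp add: Ck_on_Suc)
    then have "F differentiable_on S" by (rule differentiable_on_subset)
      (rule subset_trans[OF closure_subset W(2)])
    ultimately show ?case using Suc.IH hb[OF Suc.prems] by simp
  qed
qed

context manifold_with_boundary
begin

text \<open>The function spaces control the metric only in the charts given by the parametrizations.
  Near each point any other chart is related to one of these by a smooth transition, so two
  derivatives carry over.\<close>

lemma metric_on_all_charts: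
  assumes h: "tensor2_field \<A> M h" and ip: "\<And>c p. c \<in> \<A> \<Longrightarrow> p \<in> fst c \<Longrightarrow> p \<in> M \<Longrightarrow> inner_form (h c p)"
    and cover: "\<And>p. p \<in> M \<Longrightarrow> \<exists>d\<in>\<A>. p \<in> fst d \<and> metric_on (Suc (Suc 0)) (int_image d) (in_coords d h)"
    and c: "c \<in> \<A>"
  shows "metric_on (Suc (Suc 0)) (int_image c) (in_coords c h)"
  unfolding metric_on_def
proof (intro conjI ballI open_int_image[OF c])
  show "inner_form (in_coords c h x)" if "x \<in> int_image c" for x
    unfolding in_coords_def using ip[OF c] chart_inv_int_image[OF c that] by simp
  fix u v :: "'e \<times> real"
  show "Ck_on (Suc (Suc 0)) (int_image c) (\<lambda>x. in_coords c h x u v)"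
  proof (rule Ck_on_local[OF _ open_int_image[OF c]])
    fix x assume x: "x \<in> int_image c"
    define p where "p = chart_inv c x"
    have p: "p \<in> fst c" "p \<in> M" "snd c p = x" using chart_inv_int_image[OF c x] by (auto simp: p_def)
    obtain d where d: "d \<in> \<A>" "p \<in> fst d" "metric_on (Suc (Suc 0)) (int_image d) (in_coords d h)"
      using cover[OF p(2)] by blast
    let ?W = "snd c ` (fst d \<inter> fst c \<inter> M)"
    have W: "open ?W" "x \<in> ?W" using open_image_interior[OF c chartD(1)[OF d(1)]] p d(2) by auto
    have im: "transition c d y \<in> int_image d" if "y \<in> ?W" for y
    proof -
      obtain q where q: "q \<in> fst d" "q \<in> fst c" "q \<in> M" "y = snd c q" using \<open>y \<in> ?W\<close> by blast
      then show ?thesis using transition_eq[OF c q(2), of d] by (auto simp: int_image_def)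
    qed
    have "Ck_on (Suc (Suc 0)) ?W (\<lambda>y. in_coords d h (transition c d y)
        (frechet_derivative (transition c d) (at y) u) (frechet_derivative (transition c d) (at y) v))"
    proof (rule Ck_on_bilinear_family[where B="\<lambda>y. in_coords d h (transition c d y)" and
          p="\<lambda>y. frechet_derivative (transition c d) (at y) u"
            and q="\<lambda>y. frechet_derivative (transition c d) (at y) v", OF W(1)])
      show "bilinear (in_coords d h (transition c d y))" if "y \<in> ?W" for y
        using inner_formD(1)[OF metric_onD(2)[OF d(3) im[OF that]]] .
      show "Ck_on (Suc (Suc 0)) ?W (\<lambda>y. in_coords d h (transition c d y) a b)" for a b
        by (rule Ck_on_compose[OF W(1) metric_onD(1)[OF d(3)] transition_Ck[OF c d(1)]
          metric_on_Ck[OF d(3)] im])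
      show "Ck_on (Suc (Suc 0)) ?W (\<lambda>y. frechet_derivative (transition c d) (at y) u)"
        "Ck_on (Suc (Suc 0)) ?W (\<lambda>y. frechet_derivative (transition c d) (at y) v)"
        by (rule Ck_on_frechet_derivative[OF W(1) transition_Ck[OF c d(1)]])+
    qed
    then have "Ck_on (Suc (Suc 0)) ?W (\<lambda>y. in_coords c h y u v)"
      by (rule iffD1[OF Ck_on_cong[OF W(1)], rotated])
        (rule in_coords_transform[OF h c d(1), symmetric])
    then show "\<exists>W. open W \<and> x \<in> W \<and> Ck_on (Suc (Suc 0)) W (\<lambda>x. in_coords c h x u v)" using W by blast
  qed
qed

end

text \<open>\<open>\<kappa>\<close> stands for k - 2, which avoids truncated subtraction, and
  \<open>h\<close> is gbar.\<close>

locale weakly_hyperbolic = manifold_with_boundary T \<A> \<rho>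
  for T :: "'m topology" and \<A> :: "('m, 'e::euclidean_space \<times> real) chart set" and \<rho> :: "'m \<Rightarrow> real" +
  fixes I :: "nat set" and \<Phi> :: "nat \<Rightarrow> 'e \<times> real \<Rightarrow> 'm" and \<kappa> :: nat and \<alpha> :: real
    and g h :: "('m, 'e \<times> real) tensor2"
  assumes \<alpha>: "0 \<le> \<alpha>" "\<alpha> < 1"
    and g_weak: "g \<in> M_weak2 T \<A> \<rho> I \<Phi> (Suc (Suc \<kappa>)) \<alpha>"
    and h_def: "h = scale_tensor2 (\<lambda>p. (\<rho> p)\<^sup>2) g"
begin

abbreviation "S \<equiv> hyp_ball 2 :: ('e \<times> real) set"
abbreviation "rgh J \<equiv> reg (hoelder_bound \<alpha> J S) J S"
definition "pchart i = (\<Phi> i ` S, inv_into S (\<Phi> i))"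

lemma \<alpha>': "\<alpha> \<le> 1" using \<alpha> by simp

lemma h_eq: "h c p u v = (\<rho> p)\<^sup>2 * g c p u v"
  by (simp add: h_def scale_tensor2_def)

lemma g_metric: "riemannian_metric \<A> M g"
  using g_weak by (simp add: M_weak2_def Let_def)

lemma h_tensor: "tensor2_field \<A> M h"
proof -
  have g: "tensor2_field \<A> M g" using g_metric by (simp add: riemannian_metric_def)
  have "bilinear (h c p)" if "c \<in> \<A>" "p \<in> fst c \<inter> M" for c p
  proof -
    have "bilinear (g c p)" using g that unfolding tensor2_field_def by blast
    then show ?thesis unfolding h_eq[abs_def] bilinear_def linear_iff by (simp add: algebra_simps)
  qed
  moreover have "h c p u v = h d p (transition_deriv c d p u) (transition_deriv c d p v)"
    if "c \<in> \<A>" "d \<in> \<A>" "p \<in> fst c \<inter> fst d \<inter> M" for c d p u v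
  proof -
    have "g c p u v = g d p (transition_deriv c d p u) (transition_deriv c d p v)"
      using g that unfolding tensor2_field_def by blast
    then show ?thesis by (simp add: h_eq)
  qed
  ultimately show ?thesis unfolding tensor2_field_def by blast
qed

lemma h_inner:
  assumes "c \<in> \<A>" "p \<in> fst c" "p \<in> M"
  shows "inner_form (h c p)"
proof -
  have bl: "bilinear (h c p)" using h_tensor assms unfolding tensor2_field_def by blast
  have "g c p u v = g c p v u" "u \<noteq> 0 \<Longrightarrow> g c p u u > 0" for u v
    using g_metric assms unfolding riemannian_metric_def by blast+
  moreover have "\<rho> p > 0" using assms(3) minterior_iff by blast
  ultimately show ?thesis using bl unfolding inner_form_def h_eq by simp
qed

lemma tensor_reg:
  assumes "w \<in> hoelder_tensors2 \<rho> I \<Phi> k \<alpha> 2" "u \<in> Basis" "v \<in> Basis"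
  shows "rgh I k (\<lambda>i z. \<rho> (\<Phi> i z) powr - 2 * w (pchart i) (\<Phi> i z) u v)"
proof -
  let ?n = "\<lambda>i u v. hoelder_norm k \<alpha> S (\<lambda>z. pullback2 (\<Phi> i) (scale_tensor2 (\<lambda>p. \<rho> p powr - 2) w) z u v)"
  have "(SUP i\<in>I. ?n i u v) \<le> (SUP i\<in>I. SUP u\<in>Basis. SUP v\<in>Basis. ?n i u v)"
    using assms(2,3) by (intro SUP_mono) (meson SUP_upper SUP_upper2)
  also have "\<dots> < top" using assms(1) by (simp add: hoelder_tensors2_def tensor2_norm_def)
  finally have "Ck_hoelder_bound \<alpha> I S k (\<lambda>i z.
    pullback2 (\<Phi> i) (scale_tensor2 (\<lambda>p. \<rho> p powr - 2) w) z u v)"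
    by (simp add: hoelder_norm_bounded_iff)
  then show ?thesis
    by (simp add: Ck_hoelder_bound_iff_reg[OF hyp_ball_2(1-3) \<alpha>(1) \<alpha>'] pullback2_def
      scale_tensor2_def pchart_def)
qed

lemma h_weak:
  shows "h \<in> hoelder_tensors2 \<rho> I \<Phi> (Suc (Suc \<kappa>)) \<alpha> 2"
    "smooth_vfield \<A> X \<Longrightarrow> lie_deriv X h \<in> hoelder_tensors2 \<rho> I \<Phi> (Suc \<kappa>) \<alpha> 2"
    "smooth_vfield \<A> X \<Longrightarrow> smooth_vfield \<A> Y \<Longrightarrow> lie_deriv X (lie_deriv Y h) \<in> hoelder_tensors2 \<rho> I \<Phi> \<kappa> \<alpha> 2"
  using g_weak unfolding M_weak2_def mem_Collect_eq Let_def h_def[symmetric] by auto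

lemma h_extension:
  obtains ghat where "riemannian_metric \<A> (topspace T) ghat" "continuous_tensor2 \<A> ghat"
    "\<And>c p. c \<in> \<A> \<Longrightarrow> p \<in> fst c \<Longrightarrow> p \<in> M \<Longrightarrow> ghat c p = h c p"
  using g_weak unfolding M_weak2_def mem_Collect_eq Let_def h_def[symmetric] by blast

text \<open>The set \<open>K\<close> may touch the boundary, so compactness is applied to the
  continuous extension of \<open>h\<close>, which is positive definite there as well.\<close>

lemma h_uniform:
  assumes d: "d \<in> \<A>" and K: "compact K" "K \<subseteq> chart_image d"
  obtains m where "m > 0" "\<And>p u. p \<in> fst d \<Longrightarrow> p \<in> M \<Longrightarrow> snd d p \<in> K \<Longrightarrow> m * (norm u)\<^sup>2 \<le> h d p u u"
proof -
  obtain ghat where gh: "riemannian_metric \<A> (topspace T) ghat" "continuous_tensor2 \<A> ghat"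
    "\<And>c p. c \<in> \<A> \<Longrightarrow> p \<in> fst c \<Longrightarrow> p \<in> M \<Longrightarrow> ghat c p = h c p" using h_extension by blast
  have ip: "inner_form (ghat d (chart_inv d x))" if "x \<in> K" for x
  proof -
    have "chart_inv d x \<in> fst d \<inter> topspace T" using chart_inv(3)[OF d] chartD(4)[OF d] K(2) that
      by blast
    then show ?thesis using gh(1) d unfolding riemannian_metric_def tensor2_field_def inner_form_def
      by blast
  qed
  have cont: "continuous_on K (\<lambda>x. ghat d (chart_inv d x) a b)" for a b
    using gh(2) d K(2) continuous_on_subset unfolding continuous_tensor2_def by blast
  obtain m where m: "m > 0" "\<And>x u. x \<in> K \<Longrightarrow> m * (norm u)\<^sup>2 \<le> ghat d (chart_inv d x) u u"
    using inner_form_uniform[of K "\<lambda>x. ghat d (chart_inv d x)", OF K(1) ip cont] by blast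
  show ?thesis
  proof (rule that[OF m(1)])
    fix p u assume p: "p \<in> fst d" "p \<in> M" "snd d p \<in> K"
    show "m * (norm u)\<^sup>2 \<le> h d p u u" using m(2)[OF p(3), of u]
      by (simp add: chart_inv(1)[OF d p(1)] gh(3)[OF d p(1,2)])
  qed
qed

end

text \<open>In one chart \<open>d\<close> every parametrization of the family is the dilation by
  \<open>t i\<close> followed by a translation along the boundary. Moebius maps have this form in a
  background chart, and an interior parametrization has it with t = 1 in its own chart. The compact
  set \<open>K\<close> provides one lower bound of the metric for the whole family.\<close>

locale param_family = weakly_hyperbolic T \<A> \<rho> I \<Phi> \<kappa> \<alpha> g h
  for T :: "'m topology" and \<A> :: "('m, 'e::euclidean_space \<times> real) chart set" and \<rho> I \<Phi> \<kappa> \<alpha> g h +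
  fixes J :: "nat set" and d :: "('m, 'e \<times> real) chart" and t :: "nat \<Rightarrow> real" and a :: "nat \<Rightarrow> 'e"
    and K T0
  assumes J: "J \<subseteq> I" and d: "d \<in> \<A>" and t: "\<And>i. i \<in> J \<Longrightarrow> 0 < t i" "\<And>i. i \<in> J \<Longrightarrow> t i \<le> T0"
    and K: "compact K" "K \<subseteq> chart_image d"
    and \<Phi>: "\<And>i z. i \<in> J \<Longrightarrow> z \<in> S \<Longrightarrow> \<Phi> i z \<in> fst d" "\<And>i z. i \<in> J \<Longrightarrow> z \<in> S \<Longrightarrow> \<Phi> i z \<in> M"
      "\<And>i z. i \<in> J \<Longrightarrow> z \<in> S \<Longrightarrow> snd d (\<Phi> i z) = t i *\<^sub>R z + (a i, 0)"
      "\<And>i z. i \<in> J \<Longrightarrow> z \<in> S \<Longrightarrow> snd d (\<Phi> i z) \<in> K"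
begin

lemma recover: "i \<in> J \<Longrightarrow> z \<in> S \<Longrightarrow> (1 / t i) *\<^sub>R (snd d (\<Phi> i z) - (a i, 0)) = z"
  using t(1)[of i] \<Phi>(3)[of i z] by simp

lemma \<Phi>_inj: "i \<in> J \<Longrightarrow> inj_on (\<Phi> i) S"
  by (rule inj_onI) (metis recover)

lemma snd_pchart: "i \<in> J \<Longrightarrow> z \<in> S \<Longrightarrow> snd (pchart i) (\<Phi> i z) = z"
  using \<Phi>_inj by (simp add: pchart_def)

lemma fst_pchart: "i \<in> J \<Longrightarrow> z \<in> S \<Longrightarrow> \<Phi> i z \<in> fst (pchart i)"
  by (simp add: pchart_def)

lemma pchart_in:
  assumes i: "i \<in> J"
  shows "pchart i \<in> \<A>"
  unfolding pchart_def
proof (rule rescaled_chart[OF d])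
  let ?Y = "(\<lambda>w. (1 / t i) *\<^sub>R (w - (a i, 0))) -` S"
  have "open ?Y" using hyp_ball_2(1) by (intro open_vimage continuous_intros)
  then have "openin (top_of_set halfspace) (halfspace \<inter> ?Y)" by (rule openin_open_Int)
  from chart_open_vimage[OF d this]
  have "openin T {p \<in> fst d. snd d p \<in> halfspace \<inter> ?Y}" .
  moreover have "{p \<in> fst d. snd d p \<in> halfspace \<inter> ?Y} = \<Phi> i ` S"
  proof (intro equalityI subsetI)
    fix p assume p: "p \<in> {p \<in> fst d. snd d p \<in> halfspace \<inter> ?Y}"
    define z where "z = (1 / t i) *\<^sub>R (snd d p - (a i, 0))"
    have z: "z \<in> S" using p by (simp add: z_def)
    have "snd d (\<Phi> i z) = snd d p" using \<Phi>(3)[OF i z] t(1)[OF i] by (simp add: z_def)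
    then have "\<Phi> i z = p" using chartD(5)[OF d] \<Phi>(1)[OF i z] p by (auto dest: inj_onD)
    then show "p \<in> \<Phi> i ` S" using z by blast
  next
    fix p assume "p \<in> \<Phi> i ` S"
    then obtain z where z: "z \<in> S" "p = \<Phi> i z" by blast
    then show "p \<in> {p \<in> fst d. snd d p \<in> halfspace \<inter> ?Y}"
      using \<Phi>(1)[OF i z(1)] recover[OF i z(1)] chart_inv(4)[OF d \<Phi>(1)[OF i z(1)]]
        chart_image_halfspace[OF d] by auto
  qed
  ultimately show "openin T (\<Phi> i ` S)" by simp
  show "\<Phi> i ` S \<subseteq> fst d" using \<Phi>(1)[OF i] by blast
  show "0 < t i" by (rule t(1)[OF i])
  show "inv_into S (\<Phi> i) p = (1 / t i) *\<^sub>R (snd d p - (a i, 0))" if "p \<in> \<Phi> i ` S" for p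
    using that recover[OF i] \<Phi>_inj[OF i] by auto
qed

lemma chart_inv_pchart: "i \<in> J \<Longrightarrow> z \<in> S \<Longrightarrow> chart_inv (pchart i) z = \<Phi> i z"
  using chart_inv(1)[OF pchart_in fst_pchart] snd_pchart by metis

lemma int_image_pchart:
  assumes i: "i \<in> J"
  shows "int_image (pchart i) = S"
proof -
  have "fst (pchart i) \<inter> M = \<Phi> i ` S" using \<Phi>(2)[OF i] by (auto simp: pchart_def)
  then show ?thesis using snd_pchart[OF i] by (force simp: int_image_def)
qed

lemma transition_deriv_from:
  assumes i: "i \<in> J" and z: "z \<in> S"
  shows "transition_deriv d (pchart i) (\<Phi> i z) v = (1 / t i) *\<^sub>R v"
proof -
  let ?F = "\<lambda>w. (1 / t i) *\<^sub>R (w - (a i, 0))"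
  have F: "Ck_on k UNIV ?F" for k
    by (intro Ck_on_scaleR Ck_on_diff Ck_on_const Ck_on_id open_UNIV)
  have eq: "?F y = transition d (pchart i) y" if "y \<in> overlap d (pchart i)" for y
  proof -
    obtain p where p: "p \<in> fst d" "p \<in> fst (pchart i)" "y = snd d p" using \<open>y \<in> _\<close>
      by (auto simp: overlap_def)
    then obtain z where z: "z \<in> S" "p = \<Phi> i z" by (auto simp: pchart_def)
    show ?thesis using transition_eq[OF d p(1)] snd_pchart[OF i z(1)] recover[OF i z(1)]
      by (simp add: p(3) z(2))
  qed
  have "(?F has_derivative (\<lambda>v. (1 / t i) *\<^sub>R v)) (at (snd d (\<Phi> i z)))"
    by (auto intro!: derivative_eq_intros)
  from fun_cong[OF frechet_derivative_at[OF this], of v]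
  have "frechet_derivative ?F (at (snd d (\<Phi> i z))) v = (1 / t i) *\<^sub>R v" by simp
  then show ?thesis
    using transition_deriv_eq_extension[OF d pchart_in[OF i] \<Phi>(1)[OF i z] fst_pchart[OF i z]
      open_UNIV UNIV_I allI[OF F] eq] by simp
qed

lemma transition_deriv_to:
  assumes i: "i \<in> J" and z: "z \<in> S"
  shows "transition_deriv (pchart i) d (\<Phi> i z) v = t i *\<^sub>R v"
  using transition_deriv_inverse[OF d pchart_in[OF i] \<Phi>(1)[OF i z] fst_pchart[OF i z], of "t i *\<^sub>R v"]
    transition_deriv_from[OF i z] t(1)[OF i] by simp

lemma h_pchart:
  assumes i: "i \<in> J" and z: "z \<in> S"
  shows "in_coords (pchart i) h z u v = (t i)\<^sup>2 * h d (\<Phi> i z) u v"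
proof -
  have "in_coords (pchart i) h z u v = h (pchart i) (\<Phi> i z) u v"
    by (simp add: in_coords_def chart_inv_pchart[OF i z])
  also have "\<dots> = h d (\<Phi> i z) (t i *\<^sub>R u) (t i *\<^sub>R v)"
    using h_tensor pchart_in[OF i] d fst_pchart[OF i z] \<Phi>(1,2)[OF i z]
    unfolding tensor2_field_def transition_deriv_to[OF i z, symmetric] by blast
  also have "\<dots> = (t i)\<^sup>2 * h d (\<Phi> i z) u v"
    using bilinear_simps[OF inner_formD(1)[OF h_inner[OF d \<Phi>(1,2)[OF i z]]]]
      by (simp add: power2_eq_square)
  finally show ?thesis .
qed

definition "G i = (\<lambda>x u v. (1 / (t i)\<^sup>2) * in_coords (pchart i) h x u v)"
definition "r i = (\<lambda>x. \<rho> (\<Phi> i x) / t i)"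

lemma rho_r: "i \<in> J \<Longrightarrow> \<rho> (\<Phi> i x) = t i * r i x"
  using t(1)[of i] by (simp add: r_def)

lemma rho_pos: "i \<in> J \<Longrightarrow> z \<in> S \<Longrightarrow> \<rho> (\<Phi> i z) > 0"
  using \<Phi>(2) minterior_iff by blast

lemma R: "regularity (hoelder_bound \<alpha> J S) J S"
  by (rule regularity_hoelder[OF hyp_ball_2(1)])

text \<open>Multiplication by r^2 replaces the weight rho^-2 of the norms by t^-2, which is constant
  on each ball.\<close>

lemma weight_cancel:
  assumes "i \<in> J" "z \<in> S"
  shows "r i z * r i z * (\<rho> (\<Phi> i z) powr - 2 * x) = x / (t i)\<^sup>2"
  using rho_pos[OF assms] t(1)[OF assms(1)]
    by (simp add: r_def powr_minus powr_numeral field_simps power2_eq_square)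

lemma reg_weight:
  assumes "rgh I k (\<lambda>i z. \<rho> (\<Phi> i z) powr - 2 * w i z)" "rgh J k r"
    "\<And>i z. i \<in> J \<Longrightarrow> z \<in> S \<Longrightarrow> w i z / (t i)\<^sup>2 = y i z"
  shows "rgh J k y"
  by (rule regularity.reg_cong[OF R regularity.reg_mult[OF R regularity.reg_mult[OF R assms(2,2)]
    reg_hoelder_subset[OF assms(1) J]]])
    (use assms(3) weight_cancel in simp)

lemma G_reg:
  assumes "rgh J (Suc (Suc \<kappa>)) r" "u \<in> Basis" "v \<in> Basis"
  shows "rgh J (Suc (Suc \<kappa>)) (\<lambda>i x. G i x u v)"
  by (rule reg_weight[OF tensor_reg[OF h_weak(1) assms(2,3)] assms(1)])
    (simp add: G_def in_coords_def chart_inv_pchart)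

lemma G_metric:
  assumes r: "rgh J (Suc (Suc \<kappa>)) r" and i: "i \<in> J"
  shows "metric_on (Suc (Suc 0)) S (G i)" "metric_on (Suc (Suc 0)) S (in_coords (pchart i) h)"
proof -
  have Ck: "Ck_on (Suc (Suc 0)) S (\<lambda>x. G i x u v)" if "u \<in> Basis" "v \<in> Basis" for u v
  proof -
    have "Ck_hoelder_bound \<alpha> J S (Suc (Suc \<kappa>)) (\<lambda>i x. G i x u v)"
      using G_reg[OF r that] by (simp add: Ck_hoelder_bound_iff_reg[OF hyp_ball_2(1-3) \<alpha>(1) \<alpha>'])
    then have "Ck_on (Suc (Suc \<kappa>)) S (\<lambda>x. G i x u v)" using i
      unfolding Ck_hoelder_bound_def Ck_hoelder_le_def by blast
    then show ?thesis by (rule Ck_on_mono) simp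
  qed
  have t0: "t i > 0" by (rule t(1)[OF i])
  have ip: "inner_form (in_coords (pchart i) h z)" if "z \<in> S" for z
    unfolding in_coords_def chart_inv_pchart[OF i that]
      by (rule h_inner[OF pchart_in[OF i] fst_pchart[OF i that] \<Phi>(2)[OF i that]])
  have eq: "in_coords (pchart i) h z u v = (t i)\<^sup>2 * G i z u v" for z u v using t0 by (simp add: G_def)
  have "Ck_on (Suc (Suc 0)) S (\<lambda>x. in_coords (pchart i) h x u v)" if "u \<in> Basis" "v \<in> Basis" for u v
    unfolding eq by (rule Ck_on_mult[OF hyp_ball_2(1) Ck_on_const Ck[OF that]])
  then show 1: "metric_on (Suc (Suc 0)) S (in_coords (pchart i) h)"
    unfolding metric_on_def using ip hyp_ball_2(1) by blast
  show "metric_on (Suc (Suc 0)) S (G i)"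
    unfolding G_def by (rule metric_on_scale[OF 1]) (use t0 in simp)
qed

lemma family_results:
  assumes r_reg: "rgh J (Suc (Suc \<kappa>)) r"
    and r_wreg: "\<And>b. b \<in> Basis \<Longrightarrow> wreg (hoelder_bound \<alpha> J S) J S t \<kappa> (Suc (Suc 0)) (\<lambda>i.
      partial_deriv b (r i))"
    and r_pos: "0 < \<epsilon>" "\<And>i x. i \<in> J \<Longrightarrow> x \<in> S \<Longrightarrow> \<epsilon> \<le> r i x"
    and G_wreg: "\<And>u v. u \<in> Basis \<Longrightarrow> v \<in> Basis \<Longrightarrow>
      wreg (hoelder_bound \<alpha> J S) J S t \<kappa> (Suc (Suc 0)) (\<lambda>i x. G i x u v)"
    and mm: "manifold_metric T \<A> \<rho> h"
  defines "f \<equiv> (\<lambda>c p. diff_norm_sq \<A> h \<rho> p - 1 - c * \<rho> p * laplacian \<A> h \<rho> p)"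
  shows "rgh J \<kappa> (\<lambda>i z. manifold_metric.scal h (pchart i) (\<Phi> i z))"
    "rgh J (Suc \<kappa>) (\<lambda>i z. f c (\<Phi> i z))"
    "(\<And>i z. i \<in> J \<Longrightarrow> z \<in> S \<Longrightarrow> \<bar>f c (\<Phi> i z)\<bar> \<le> C * (\<rho> (\<Phi> i z))\<^sup>2) \<Longrightarrow>
      rgh J (Suc \<kappa>) (\<lambda>i z. f c (\<Phi> i z) / (\<rho> (\<Phi> i z))\<^sup>2)"
proof -
  interpret mm: manifold_metric T \<A> \<rho> h by (rule mm)
  obtain m where m: "m > 0" "\<And>p u. p \<in> fst d \<Longrightarrow> p \<in> M \<Longrightarrow> snd d p \<in> K \<Longrightarrow> m * (norm u)\<^sup>2 \<le> h d p u u"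
    using h_uniform[OF d K] by blast
  have t0: "t i > 0" if "i \<in> J" for i by (rule t(1)[OF that])
  interpret sf: scaled_family \<alpha> J S t \<kappa> G r m \<epsilon> T0
  proof (rule scaled_family.intro)
    show "m * (norm u)\<^sup>2 \<le> G i z u u" if "i \<in> J" "z \<in> S" for i z u
      using m(2)[OF \<Phi>(1,2,4)[OF that], of u] t0[OF that(1)] by (simp add: G_def h_pchart[OF that])
    show "metric_on (Suc (Suc 0)) S (G i)" if "i \<in> J" for i by (rule G_metric(1)[OF r_reg that])
    show "rgh J (\<kappa> + Suc (Suc 0)) r" using r_reg by (simp del: reg.simps)
  qed (use hyp_ball_2(1-4) \<alpha> \<alpha>' t m r_wreg r_pos G_wreg in \<open>auto simp del: reg.simps wreg.simps\<close>)
  have sc: "mm.scal (pchart i) (\<Phi> i z) = scalar_loc (G i) z / (t i)\<^sup>2" if iz: "i \<in> J" "z \<in> S" for i z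
    unfolding mm.scal_def snd_pchart[OF iz] G_def
    using scalar_loc_scale[OF G_metric(2)[OF r_reg iz(1)] iz(2), of "1 / (t i)\<^sup>2"] t0[OF iz(1)] by simp
  show "rgh J \<kappa> (\<lambda>i z. mm.scal (pchart i) (\<Phi> i z))"
    by (rule sf.reg_cong[OF sf.reg_scalar]) (simp add: sc)
  \<comment> \<open>Scaling the metric by t^-2 and the function by 1/t leaves |d rho|^2 and rho
    times the Laplacian of rho unchanged.\<close>
  have f: "f c (\<Phi> i z) = sf.defect c i z" if iz: "i \<in> J" "z \<in> S" for i z
  proof -
    let ?c = "pchart i"
    note c = pchart_in[OF iz(1)] and p = fst_pchart[OF iz] \<Phi>(2)[OF iz]
    have rho: "mm.rho ?c y = t i * r i y" if "y \<in> S" for y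
      using chart_inv_pchart[OF iz(1) that] rho_r[OF iz(1)] by simp
    have rho_Ck: "Ck_on 2 S (mm.rho ?c)" using mm.rho_Ck[OF c] by (simp add: int_image_pchart[OF iz(1)])
    have rdiff: "mm.rho ?c differentiable (at z)"
      using Ck_on_differentiable[OF rho_Ck] iz(2) hyp_ball_2(1) by (intro differentiable_on_openD) auto
    have hz: "h ?c (\<Phi> i z) = in_coords ?c h z" by (simp add: in_coords_def chart_inv_pchart[OF iz])
    have r_eq: "r i y = (1 / t i) * mm.rho ?c y" if "y \<in> S" for y using rho[OF that] t0[OF iz(1)]
      by simp
    have fd: "frechet_derivative (r i) (at y) = frechet_derivative (\<lambda>y. (1 / t i) *
      mm.rho ?c y) (at y)" if "y \<in> S" for y
      by (rule frechet_derivative_cong_open[OF hyp_ball_2(1) that r_eq])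
    have fd2: "frechet_derivative (\<lambda>y. frechet_derivative (r i) (at y) v) (at z) =
        frechet_derivative (\<lambda>y. frechet_derivative (\<lambda>y. (1 / t i) * mm.rho ?c y) (at y) v) (at z)" for v
      by (rule frechet_derivative_cong_open[OF hyp_ball_2(1) iz(2)]) (simp add: fd)
    have ti: "1 / (t i)\<^sup>2 > 0" using t0[OF iz(1)] by simp
    have dn: "sf.dnorm i z = mm.dn ?c (\<Phi> i z)"
      unfolding sf.dnorm_def mm.dn_def Let_def snd_pchart[OF iz] hz fd[OF iz(2)] G_def
      using diff_norm_scale[OF metric_onD(2)[OF G_metric(2)[OF r_reg iz(1)] iz(2)] ti rdiff, of
        "1 / t i"] t0[OF iz(1)]
      by (simp add: power_one_over)
    have "hessian (G i) (r i) z = hessian (G i) (\<lambda>y. (1 / t i) * mm.rho ?c y) z"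
      by (simp add: fun_eq_iff hessian_def fd2 fd[OF iz(2)])
    then have lp: "sf.lap i z = t i * mm.lp ?c (\<Phi> i z)"
      unfolding sf.lap_def mm.lp_def snd_pchart[OF iz] hz G_def
      using laplacian_scale[OF G_metric(2)[OF r_reg iz(1)] iz(2) ti rho_Ck, of "1 / t i"] t0[OF iz(1)]
      by (simp add: power2_eq_square)
    show ?thesis
      unfolding f_def mm.chart_values[OF c p] sf.defect_def dn lp rho_r[OF iz(1)] by simp
  qed
  show "rgh J (Suc \<kappa>) (\<lambda>i z. f c (\<Phi> i z))"
    by (rule sf.reg_cong[OF sf.reg_defect[of c]]) (simp add: f)
  show "rgh J (Suc \<kappa>) (\<lambda>i z. f c (\<Phi> i z) / (\<rho> (\<Phi> i z))\<^sup>2)"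
    if bd: "\<And>i z. i \<in> J \<Longrightarrow> z \<in> S \<Longrightarrow> \<bar>f c (\<Phi> i z)\<bar> \<le> C * (\<rho> (\<Phi> i z))\<^sup>2"
  proof -
    have "hoelder_bound \<alpha> J S r" using sf.reg_P[OF r_reg] .
    then obtain R0 where R0: "R0 \<ge> 0" "\<And>i z. i \<in> J \<Longrightarrow> z \<in> S \<Longrightarrow> \<bar>r i z\<bar> \<le> R0"
      by (rule hoelder_boundE) (rule that; assumption)
    \<comment> \<open>\<open>C\<close> may be negative, hence its absolute value; \<open>R0\<close>
      bounds \<open>r\<close> and so trades rho = t r for t.\<close>
    have "\<bar>sf.defect c i z\<bar> \<le> (\<bar>C\<bar> * R0\<^sup>2) * (t i)\<^sup>2" if iz: "i \<in> J" "z \<in> S" for i z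
    proof -
      have "\<bar>sf.defect c i z\<bar> \<le> C * (t i * r i z)\<^sup>2" using bd[OF iz] f[OF iz] rho_r[OF iz(1)] by simp
      also have "\<dots> \<le> \<bar>C\<bar> * (t i * r i z)\<^sup>2" by (intro mult_right_mono) auto
      also have "(t i * r i z)\<^sup>2 \<le> (t i)\<^sup>2 * R0\<^sup>2"
        unfolding power_mult_distrib using R0(2)[OF iz]
          by (intro mult_left_mono) (auto simp: abs_le_square_iff[symmetric] R0(1))
      then have "\<bar>C\<bar> * (t i * r i z)\<^sup>2 \<le> \<bar>C\<bar> * ((t i)\<^sup>2 * R0\<^sup>2)" by (intro mult_left_mono) auto
      finally show ?thesis by (simp add: mult_ac)
    qed
    from sf.reg_defect_weighted[OF this] show ?thesis
    proof (rule sf.reg_cong)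
      show "sf.defect c i z / (t i * r i z)\<^sup>2 = f c (\<Phi> i z) / (\<rho> (\<Phi> i z))\<^sup>2" if "i \<in> J" "z \<in> S" for i z
        by (simp only: f[OF that] rho_r[OF that(1)])
    qed
  qed
qed

end

section \<open>Regular families of parametrizations\<close>

lemma partial_deriv_cmult:
  fixes f :: "'v::euclidean_space \<Rightarrow> real"
  assumes "f differentiable (at x)"
  shows "partial_deriv b (\<lambda>x. s * f x) x = s * partial_deriv b f x"
  using frechet_derivative_cmult[OF assms] by (simp add: partial_deriv_def)

context weakly_hyperbolic
begin

definition "defect_fun c p = diff_norm_sq \<A> h \<rho> p - 1 - c * \<rho> p * laplacian \<A> h \<rho> p"

text \<open>The estimates are conditional because \<open>manifold_metric\<close> concerns all charts
  and is known only after every point has been covered. The first conjunct, collected over all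
  families, is what establishes it.\<close>

definition regular_family :: "nat set \<Rightarrow> bool" where
  "regular_family J \<longleftrightarrow>
     (\<forall>i\<in>J. pchart i \<in> \<A> \<and> (\<forall>z\<in>S. \<Phi> i z \<in> fst (pchart i) \<and> \<Phi> i z \<in> M) \<and>
        metric_on (Suc (Suc 0)) (int_image (pchart i)) (in_coords (pchart i) h)) \<and>
     (manifold_metric T \<A> \<rho> h \<longrightarrow>
        rgh J \<kappa> (\<lambda>i z. manifold_metric.scal h (pchart i) (\<Phi> i z)) \<and>
        (\<forall>c. rgh J (Suc \<kappa>) (\<lambda>i z. defect_fun c (\<Phi> i z))) \<and>
        (\<forall>c C. (\<forall>i\<in>J. \<forall>z\<in>S. \<bar>defect_fun c (\<Phi> i z)\<bar> \<le> C * (\<rho> (\<Phi> i z))\<^sup>2) \<longrightarrow>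
          rgh J (Suc \<kappa>) (\<lambda>i z. defect_fun c (\<Phi> i z) / (\<rho> (\<Phi> i z))\<^sup>2)))"

end

context param_family
begin

lemma regular_familyI:
  assumes "rgh J (Suc (Suc \<kappa>)) r"
    and "\<And>b. b \<in> Basis \<Longrightarrow> wreg (hoelder_bound \<alpha> J S) J S t \<kappa> (Suc (Suc 0)) (\<lambda>i. partial_deriv b (r i))"
    and "0 < \<epsilon>" "\<And>i x. i \<in> J \<Longrightarrow> x \<in> S \<Longrightarrow> \<epsilon> \<le> r i x"
    and "\<And>u v. u \<in> Basis \<Longrightarrow> v \<in> Basis \<Longrightarrow>
      wreg (hoelder_bound \<alpha> J S) J S t \<kappa> (Suc (Suc 0)) (\<lambda>i x. G i x u v)"
  shows "regular_family J"
  unfolding regular_family_def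
proof (intro conjI ballI impI allI)
  fix i assume i: "i \<in> J"
  show "pchart i \<in> \<A>" by (rule pchart_in[OF i])
  show "\<Phi> i z \<in> fst (pchart i)" "\<Phi> i z \<in> M" if "z \<in> S" for z
    using fst_pchart[OF i that] \<Phi>(2)[OF i that] .
  show "metric_on (Suc (Suc 0)) (int_image (pchart i)) (in_coords (pchart i) h)"
    unfolding int_image_pchart[OF i] by (rule G_metric(2)[OF assms(1) i])
next
  assume mm: "manifold_metric T \<A> \<rho> h"
  note res = family_results[OF assms mm]
  show "rgh J \<kappa> (\<lambda>i z. manifold_metric.scal h (pchart i) (\<Phi> i z))" by (rule res(1))
  show "rgh J (Suc \<kappa>) (\<lambda>i z. defect_fun c (\<Phi> i z))" for c unfolding defect_fun_def by (rule res(2))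
  show "rgh J (Suc \<kappa>) (\<lambda>i z. defect_fun c (\<Phi> i z) / (\<rho> (\<Phi> i z))\<^sup>2)"
    if bd: "\<forall>i\<in>J. \<forall>z\<in>S. \<bar>defect_fun c (\<Phi> i z)\<bar> \<le> C * (\<rho> (\<Phi> i z))\<^sup>2" for c C
  proof -
    have "\<bar>diff_norm_sq \<A> h \<rho> (\<Phi> i z) - 1 - c * \<rho> (\<Phi> i z) * laplacian \<A> h \<rho> (\<Phi> i z)\<bar> \<le>
      C * (\<rho> (\<Phi> i z))\<^sup>2"
      if "i \<in> J" "z \<in> S" for i z
      using bd that unfolding defect_fun_def by blast
    then show ?thesis unfolding defect_fun_def by (intro res(3)[of c C])
  qed
qed

text \<open>In the charts of the family the fields \<open>X e\<close> are constant, so that the Lie derivatives are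
  partial derivatives divided by \<open>t\<close>.\<close>

lemma G_wreg_of_vfields:
  assumes r: "rgh J (Suc (Suc \<kappa>)) r"
    and X: "\<And>e. e \<in> Basis \<Longrightarrow> smooth_vfield \<A> (X e)"
      "\<And>e i z. e \<in> Basis \<Longrightarrow> i \<in> J \<Longrightarrow> z \<in> S \<Longrightarrow> X e (pchart i) (\<Phi> i z) = (1 / t i) *\<^sub>R e"
    and uv: "u \<in> Basis" "v \<in> Basis"
  shows "wreg (hoelder_bound \<alpha> J S) J S t \<kappa> (Suc (Suc 0)) (\<lambda>i x. G i x u v)"
proof -
  interpret R: regularity "hoelder_bound \<alpha> J S" J S by (rule R)
  let ?F = "\<lambda>i u v x. in_coords (pchart i) h x u v"
  \<comment> \<open>As the field is constant, the terms with its derivative become \<open>w\<close>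
    with one argument 0. Their vanishing is an assumption because this is applied also to the first
    Lie derivative of \<open>h\<close>, whose value at 0 is computed separately rather than taken
    from bilinearity.\<close>
  have lie: "lie_deriv (X e) w (pchart i) (\<Phi> i z) u v = (1 / t i) *
    partial_deriv e (\<lambda>x. in_coords (pchart i) w x u v) z"
    if e: "e \<in> Basis" and i: "i \<in> J" and z: "z \<in> S" and diff:
      "(\<lambda>x. in_coords (pchart i) w x u v) differentiable (at z)"
      and zero: "w (pchart i) (\<Phi> i z) 0 v = 0" "w (pchart i) (\<Phi> i z) u 0 = 0" for e i z w u v
  proof -
    have "frechet_derivative (\<lambda>x. X e (pchart i) (chart_inv (pchart i) x)) (at z) =
      frechet_derivative (\<lambda>x. (1 / t i) *\<^sub>R e) (at z)"
      by (rule frechet_derivative_cong_open[OF hyp_ball_2(1) z])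
        (simp add: chart_inv_pchart[OF i] X(2)[OF e i])
    then have DX: "frechet_derivative (\<lambda>x. X e (pchart i) (chart_inv (pchart i) x)) (at z) =
      (\<lambda>_. 0)" by simp
    show ?thesis
      unfolding lie_deriv_def Let_def snd_pchart[OF i z] DX zero X(2)[OF e i z]
      using linear_cmul[OF linear_frechet_derivative[OF diff], of "1 / t i" e] by (simp
        add: partial_deriv_def)
  qed
  have F_Ck: "Ck_on 2 S (?F i u v)" if "i \<in> J" for i u v
    using metric_on_Ck[OF G_metric(2)[OF r that]] by (simp add: numeral_2_eq_2)
  have F_diff: "?F i u v differentiable (at z)" if "i \<in> J" "z \<in> S" for i u v z
    using Ck_on_differentiable[OF F_Ck[OF that(1)]] that(2) hyp_ball_2(1)
      by (intro differentiable_on_openD) auto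
  have dF_diff: "partial_deriv e (?F i u v) differentiable (at z)" if "i \<in> J" "z \<in> S" "e \<in> Basis"
    for i u v z e
  proof -
    have "Ck_on 1 S (partial_deriv e (?F i u v))" using F_Ck[OF that(1), of u v] that(3)
      by (simp add: numeral_2_eq_2 Ck_on_Suc)
    then show ?thesis using Ck_on_differentiable that(2) hyp_ball_2(1)
      by (intro differentiable_on_openD) auto
  qed
  have bl: "bilinear (h (pchart i) (\<Phi> i z))" if "i \<in> J" "z \<in> S" for i z
    by (rule inner_formD(1)[OF h_inner[OF pchart_in[OF that(1)] fst_pchart[OF that] \<Phi>(2)[OF that]]])
  have lie1: "lie_deriv (X e) h (pchart i) (\<Phi> i z) u v = (1 / t i) * partial_deriv e (?F i u v) z"
    if "e \<in> Basis" "i \<in> J" "z \<in> S" for e i z u v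
    by (rule lie[OF that F_diff[OF that(2,3)]])
      (simp_all add: bilinear_lzero[OF bl[OF that(2,3)]] bilinear_rzero[OF bl[OF that(2,3)]])
  have F0: "?F i 0 v x = 0" "?F i u 0 x = 0" if "i \<in> J" "x \<in> S" for i u v x
    by (simp_all add: in_coords_def chart_inv_pchart[OF that] bilinear_lzero[OF bl[OF that]]
      bilinear_rzero[OF bl[OF that]])
  have dF0: "partial_deriv e (?F i 0 v) z = 0" "partial_deriv e (?F i u 0) z = 0" if "i \<in> J" "z \<in> S"
    for e i u v z
    using partial_deriv_cong_open[OF hyp_ball_2(1) that(2), of "?F i 0 v" "\<lambda>_. 0" e]
      partial_deriv_cong_open[OF hyp_ball_2(1) that(2), of "?F i u 0" "\<lambda>_. 0" e] F0[OF that(1)]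
    by (simp_all add: partial_deriv_def)
  have in1: "in_coords (pchart i) (lie_deriv (X e) h) x u v = (1 / t i) * partial_deriv e (?F i u v) x"
    if "e \<in> Basis" "i \<in> J" "x \<in> S" for e i x u v
    unfolding in_coords_def[of _ "lie_deriv (X e) h"] chart_inv_pchart[OF
      that(2,3)] by (rule lie1[OF that])
  have lie2: "lie_deriv (X e') (lie_deriv (X e) h) (pchart i) (\<Phi> i z) u v =
      (1 / t i) * ((1 / t i) * partial_deriv e' (partial_deriv e (?F i u v)) z)"
    if "e \<in> Basis" "e' \<in> Basis" "i \<in> J" "z \<in> S" for e e' i z u v
  proof -
    have d: "((\<lambda>x. (1 / t i) * partial_deriv e (?F i u v) x) has_derivative
       (\<lambda>h. (1 / t i) * frechet_derivative (partial_deriv e (?F i u v)) (at z) h)) (at z)"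
      by (intro has_derivative_mult_right frechet_derivative_works[THEN iffD1] dF_diff that)
    then have d': "((\<lambda>x. in_coords (pchart i) (lie_deriv (X e) h) x u v) has_derivative
       (\<lambda>h. (1 / t i) * frechet_derivative (partial_deriv e (?F i u v)) (at z) h)) (at z)"
      by (rule has_derivative_transform_within_open[OF _ hyp_ball_2(1) that(4)])
        (simp add: in1[OF that(1,3)])
    have "lie_deriv (X e') (lie_deriv (X e) h) (pchart i) (\<Phi> i z) u v =
      (1 / t i) * partial_deriv e' (\<lambda>x. in_coords (pchart i) (lie_deriv (X e) h) x u v) z"
      by (rule lie[OF that(2,3,4) differentiableI[OF d']])
        (simp_all add: lie1[OF that(1,3,4)] dF0[OF that(3,4)])
    also have "partial_deriv e' (\<lambda>x. in_coords (pchart i) (lie_deriv (X e) h) x u v) z =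
      (1 / t i) * partial_deriv e' (partial_deriv e (?F i u v)) z"
      using partial_deriv_eq[OF d', of e'] by (simp add: partial_deriv_def)
    finally show ?thesis .
  qed
  have dG: "partial_deriv e (\<lambda>x. G i x u v) z = (1 / (t i)\<^sup>2) * partial_deriv e (?F i u v) z"
    if "i \<in> J" "z \<in> S" for e i z
    unfolding G_def by (rule partial_deriv_cmult[OF F_diff[OF that]])
  have r': "rgh J (Suc \<kappa>) r" "rgh J \<kappa> r" using R.reg_mono[OF r] by (simp_all del: reg.simps)
  have ddG: "partial_deriv e' (\<lambda>x. partial_deriv e (\<lambda>x. G i x u v) x / t i) z =
      (1 / (t i)\<^sup>2 / t i) * partial_deriv e' (partial_deriv e (?F i u v)) z" if "i \<in> J" "z \<in> S" "e
        \<in> Basis" for e e' i z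
  proof -
    have "partial_deriv e' (\<lambda>x. partial_deriv e (\<lambda>x. G i x u v) x / t i) z =
        partial_deriv e' (\<lambda>x. (1 / (t i)\<^sup>2 / t i) * partial_deriv e (?F i u v) x) z"
      by (rule partial_deriv_cong_open[OF hyp_ball_2(1) that(2)]) (simp add: dG[OF that(1)])
    also have "\<dots> = (1 / (t i)\<^sup>2 / t i) * partial_deriv e' (partial_deriv e (?F i u v)) z"
      by (rule partial_deriv_cmult[OF dF_diff[OF that]])
    finally show ?thesis .
  qed
  have 1: "rgh J (Suc \<kappa>) (\<lambda>i x. partial_deriv e (\<lambda>x. G i x u v) x / t i)" if "e \<in> Basis" for e
    by (rule reg_weight[OF tensor_reg[OF h_weak(2)[OF X(1)[OF that]] uv] r'(1)])
      (simp add: lie1[OF that] dG)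
  have 2: "rgh J \<kappa> (\<lambda>i x. partial_deriv e' (\<lambda>x. partial_deriv e (\<lambda>x. G i x u v) x / t i) x / t i)"
    if "e \<in> Basis" "e' \<in> Basis" for e e'
    by (rule reg_weight[OF tensor_reg[OF h_weak(3)[OF X(1)[OF that(2)] X(1)[OF that(1)]] uv] r'(2)])
      (simp add: lie2[OF that] ddG[OF _ _ that(1)])
  have 0: "rgh J (Suc (Suc \<kappa>)) (\<lambda>i x. G i x u v)" by (rule G_reg[OF r uv])
  show ?thesis using 0 1 2 by (simp del: reg.simps)
qed

end

text \<open>The gap between \<open>\<rho>s\<close> and \<open>s\<close> keeps the heights of points
  in Moebius balls in the compact interval \<open>{0..\<rho>s}\<close> inside the collar.\<close>

locale moebius_hyperbolic = weakly_hyperbolic T \<A> \<rho> I \<Phi> \<kappa> \<alpha> g h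
  for T :: "'m topology" and \<A> :: "('m, 'e::euclidean_space \<times> real) chart set" and \<rho> I \<Phi> \<kappa> \<alpha> g h +
  fixes \<psi> :: "'m \<Rightarrow> real \<Rightarrow> 'm" and s \<rho>s :: real and \<B> :: "('m, 'e) chart set"
  assumes compact: "compact_space T" and Hausdorff: "Hausdorff_space T"
    and collar: "collar T \<A> \<rho> \<psi> s" and \<rho>s: "0 < \<rho>s" "\<rho>s < s"
    and background: "background_cover T \<A> \<B>" and moebius: "moebius_cover T \<A> \<psi> \<rho>s \<B> I \<Phi>"
begin

lemma regular_family_interior:
  assumes j: "j \<in> I" "interior_param T \<A> (\<Phi> j)"
  shows "regular_family {j}"
proof -
  obtain W \<Psi> where W: "open W" "closure S \<subseteq> W" "W \<subseteq> {z. snd z > 0}" "inj_on \<Psi> W" "\<Psi> ` W \<subseteq> M"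
    "(\<Psi> ` W, inv_into W \<Psi>) \<in> \<A>" "\<And>z. z \<in> S \<Longrightarrow> \<Phi> j z = \<Psi> z"
    using j(2) unfolding interior_param_def by blast
  let ?d = "(\<Psi> ` W, inv_into W \<Psi>)"
  have SW: "S \<subseteq> W" using W(2) closure_subset by blast
  have im: "chart_image ?d = W" using W(4) by (simp add: chart_image_def image_image)
  have ci: "chart_inv ?d z = \<Psi> z" if "z \<in> W" for z
    using chart_inv(1)[OF W(6), of "\<Psi> z"] that W(4) by simp
  define F where "F = (\<lambda>z. \<rho> (\<Psi> z))"
  have F: "Cinf_on W F"
  proof
    fix k
    have "Ck_on k W (\<lambda>x. \<rho> (chart_inv ?d x))"
      by (rule smooth_on_openD[OF rho_smooth[OF W(6)] W(1)]) (simp add: im)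
    then show "Ck_on k W F" by (rule iffD1[OF Ck_on_cong[OF W(1)], rotated]) (simp add: ci F_def)
  qed
  have cS: "compact (closure S)" by (rule hyp_ball_2(5))
  have \<Phi>j: "\<Phi> j z \<in> fst ?d" "\<Phi> j z \<in> M" "snd ?d (\<Phi> j z) = z" if "z \<in> S" for z
  proof -
    have z: "z \<in> W" using SW that by blast
    then show "\<Phi> j z \<in> fst ?d" "\<Phi> j z \<in> M" using W(5) by (auto simp: W(7)[OF that])
    show "snd ?d (\<Phi> j z) = z" using inv_into_f_f[OF W(4) z] by (simp add: W(7)[OF that])
  qed
  \<comment> \<open>A singleton family with scale 1 and no translation; the chart is the inverse of
    the extended parametrization \<open>\<Psi>\<close>.\<close>
  interpret param_family T \<A> \<rho> I \<Phi> \<kappa> \<alpha> g h "{j}" ?d "\<lambda>_. 1" "\<lambda>_. 0" "closure S" 1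
  proof (intro param_family.intro param_family_axioms.intro)
    show "weakly_hyperbolic T \<A> \<rho> I \<Phi> \<kappa> \<alpha> g h" by (rule weakly_hyperbolic_axioms)
    show "closure S \<subseteq> chart_image ?d" unfolding im by (rule W(2))
    show "snd ?d (\<Phi> i z) = 1 *\<^sub>R z + (0, 0)" "snd ?d (\<Phi> i z) \<in> closure S" "\<Phi> i z \<in> fst ?d" "\<Phi> i z \<in> M"
      if "i \<in> {j}" "z \<in> S" for i z
      using that \<Phi>j[OF that(2)] closure_subset[of S]
        by (auto simp del: fst_conv snd_conv simp flip: zero_prod_def)
  qed (use j(1) W(6) cS in auto)
  have r: "r i x = F x" if "i \<in> {j}" "x \<in> S" for i x using that W(7) by (simp add: r_def F_def)
  have reg: "rgh {j} k r" for k
    by (rule regularity.reg_cong[OF R reg_hoelder_smooth[OF hyp_ball_2(1-3) \<alpha>(1) \<alpha>' W(1,2) F]])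
      (simp add: r)
  have "continuous_on (closure S) F" using F[rule_format, of 0] W(2) continuous_on_subset by auto
  moreover have "closure S \<noteq> {}" using hyp_ball_2(4) by simp
  \<comment> \<open>The minimum of rho over the compact closure of the ball serves as the lower
    bound for \<open>r\<close>.\<close>
  ultimately obtain z where z: "z \<in> closure S" "\<And>y. y \<in> closure S \<Longrightarrow> F z \<le> F y"
    using continuous_attains_inf[OF cS, of F] by blast
  show ?thesis
  proof (rule regular_familyI[OF reg])
    show "F z > 0" unfolding F_def using z(1) W(2,5) minterior_iff by blast
    show "F z \<le> r i x" if "i \<in> {j}" "x \<in> S" for i x
      using r[OF that] z(2)[OF subsetD[OF closure_subset that(2)]] by simp
    show "wreg (hoelder_bound \<alpha> {j} S) {j} S (\<lambda>_. 1) \<kappa> (Suc (Suc 0)) (\<lambda>i. partial_deriv b (r i))"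
      if "b \<in> Basis" for b
      by (rule regularity.wreg_of_reg[OF R refl regularity.reg_partial[OF R reg that]])
    show "wreg (hoelder_bound \<alpha> {j} S) {j} S (\<lambda>_. 1) \<kappa> (Suc (Suc 0)) (\<lambda>i x. G i x u v)"
      if "u \<in> Basis" "v \<in> Basis" for u v
      by (rule regularity.wreg_of_reg[OF R refl]) (use G_reg[OF reg that] in \<open>simp del: reg.simps\<close>)
  qed
qed

section \<open>Moebius parametrizations in background charts\<close>

lemma bdry_chartD:
  assumes "b \<in> bdry_charts T \<A>"
  shows "fst b \<subseteq> bdry \<A>" "inj_on (snd b) (fst b)" "open (chart_image b)"
    "continuous_map (subtopology T (fst b)) euclidean (snd b)" "background_chart \<A> \<rho> \<psi> s b \<in> \<A>"
proof -
  have b: "is_chart (subtopology T (bdry \<A>)) UNIV b" using assms unfolding bdry_charts_def by blast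
  have o: "openin (subtopology T (bdry \<A>)) (fst b)" using b unfolding is_chart_def by blast
  then show 1: "fst b \<subseteq> bdry \<A>" using openin_subset by fastforce
  have hm: "homeomorphic_map (subtopology T (fst b)) (top_of_set (chart_image b)) (snd b)"
    using b 1 unfolding is_chart_def by (simp add: subtopology_subtopology Int_absorb1)
  have "fst b \<subseteq> topspace T" using openin_subset[OF o] by simp
  then show "inj_on (snd b) (fst b)" using homeomorphic_imp_injective_map[OF hm]
    by (simp add: Int_absorb1)
  show "open (chart_image b)" using b unfolding is_chart_def by (simp add: subtopology_UNIV)
  show "continuous_map (subtopology T (fst b)) euclidean (snd b)"
    using homeomorphic_imp_continuous_map[OF hm] continuous_map_into_fulltopology by blast
  show "background_chart \<A> \<rho> \<psi> s b \<in> \<A>" using collar assms unfolding collar_def by blast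
qed

lemma background_chart:
  assumes b: "b \<in> bdry_charts T \<A>" and q: "q \<in> fst b" and t: "0 \<le> t" "t < s"
  defines "d \<equiv> background_chart \<A> \<rho> \<psi> s b"
  shows "\<psi> q t \<in> fst d" "snd d (\<psi> q t) = (snd b q, t)" "\<rho> (\<psi> q t) = t" "\<psi> q t \<in> topspace T"
proof -
  have qb: "q \<in> bdry \<A>" using bdry_chartD(1)[OF b] q by blast
  show 1: "\<rho> (\<psi> q t) = t" "\<psi> q t \<in> topspace T" using collar qb t unfolding collar_def by auto
  show "\<psi> q t \<in> fst d" unfolding d_def background_chart_def using q t by force
  have "inj_on (\<lambda>(q, t). \<psi> q t) (bdry \<A> \<times> {0..<s})" using collar unfolding collar_def by blast
  from inv_into_f_f[OF this, of "(q, t)"] have "inv_into (bdry \<A> \<times> {0..<s}) (\<lambda>(q, t).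
    \<psi> q t) (\<psi> q t) = (q, t)"
    using qb t by simp
  then show "snd d (\<psi> q t) = (snd b q, t)" using 1 by (simp add: d_def background_chart_def)
qed

lemma background_chart_image:
  assumes b: "b \<in> bdry_charts T \<A>"
  shows "chart_image (background_chart \<A> \<rho> \<psi> s b) = chart_image b \<times> {0..<s}"
proof -
  let ?d = "background_chart \<A> \<rho> \<psi> s b"
  have "chart_image ?d = (\<lambda>(q, t). snd ?d (\<psi> q t)) ` (fst b \<times> {0..<s})"
    unfolding chart_image_def by (simp add: background_chart_def image_image case_prod_beta)
  also have "\<dots> = (\<lambda>(q, t). (snd b q, t)) ` (fst b \<times> {0..<s})"
    by (rule image_cong) (auto simp: background_chart(2)[OF b])
  also have "\<dots> = chart_image b \<times> {0..<s}" unfolding chart_image_def by force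
  finally show ?thesis .
qed

text \<open>This sorts the indices by boundary chart, spelling out \<open>moebius_param\<close> for
  a single \<open>b\<close>; an index may occur for several charts.\<close>

definition "moebius_index b = {i \<in> I. \<exists>q\<in>fst b. \<exists>t. 0 < t \<and> t < \<rho>s \<and>
     (\<forall>(x, y)\<in>S. snd b q + t *\<^sub>R x \<in> chart_image b \<and> t * y < \<rho>s \<and>
        \<Phi> i (x, y) = \<psi> (chart_inv b (snd b q + t *\<^sub>R x)) (t * y))}"

lemma regular_family_moebius:
  assumes b: "b \<in> \<B>"
  shows "regular_family (moebius_index b)"
proof -
  have bc: "b \<in> bdry_charts T \<A>" using b background unfolding background_cover_def by blast
  \<comment> \<open>The larger chart makes the closure of \<open>fst b\<close> a compact subset of a
    chart domain. The common chart of the family is therefore the background chart of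
    \<open>b'\<close> and not that of \<open>b\<close>.\<close>
  have "\<exists>b'\<in>bdry_charts T \<A>. T closure_of (fst b) \<subseteq> fst b' \<and> (\<forall>q\<in>fst b. snd b' q = snd b q)"
    using background b unfolding background_cover_def by (elim conjE) (erule (1) bspec)
  then obtain b' where b': "b' \<in> bdry_charts T \<A>" "T closure_of (fst b) \<subseteq> fst b'"
    "\<And>q. q \<in> fst b \<Longrightarrow> snd b' q = snd b q"
    by (elim bexE conjE) (rule that, assumption+, erule bspec)
  let ?d = "background_chart \<A> \<rho> \<psi> s b'" and ?J = "moebius_index b"
  have d: "?d \<in> \<A>" by (rule bdry_chartD(5)[OF b'(1)])
  have bT: "fst b \<subseteq> topspace T"
  proof
    fix p assume "p \<in> fst b"
    then have "p \<in> bdry \<A>" using bdry_chartD(1)[OF bc] by blast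
    then obtain c where "c \<in> \<A>" "p \<in> fst c" unfolding bdry_def by blast
    then show "p \<in> topspace T" using chartD(4) by blast
  qed
  have cl: "fst b \<subseteq> T closure_of (fst b)" by (rule closure_of_subset[OF bT])
  have "\<forall>i\<in>?J. \<exists>q t. q \<in> fst b \<and> 0 < t \<and> t < \<rho>s \<and>
    (\<forall>(x, y)\<in>S. snd b q + t *\<^sub>R x \<in> chart_image b \<and> t * y < \<rho>s \<and>
        \<Phi> i (x, y) = \<psi> (chart_inv b (snd b q + t *\<^sub>R x)) (t * y))"
    unfolding moebius_index_def by blast
  from bchoice[OF this] obtain q where "\<forall>i\<in>?J. \<exists>t. q i \<in> fst b \<and> 0 < t \<and> t < \<rho>s \<and>
    (\<forall>(x, y)\<in>S. snd b (q i) + t *\<^sub>R x \<in> chart_image b \<and> t * y < \<rho>s \<and>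
        \<Phi> i (x, y) = \<psi> (chart_inv b (snd b (q i) + t *\<^sub>R x)) (t * y))" ..
  from bchoice[OF this] obtain t where qt: "\<forall>i\<in>?J. q i \<in> fst b \<and> 0 < t i \<and> t i < \<rho>s \<and>
    (\<forall>(x, y)\<in>S. snd b (q i) + t i *\<^sub>R x \<in> chart_image b \<and> t i * y < \<rho>s \<and>
        \<Phi> i (x, y) = \<psi> (chart_inv b (snd b (q i) + t i *\<^sub>R x)) (t i * y))" ..
  \<comment> \<open>Compact and reaching down to height 0, this set contains the images of all balls
    of the family, however small.\<close>
  define K where "K = snd b' ` (T closure_of (fst b)) \<times> {0..\<rho>s}"
  have "compactin T (T closure_of (fst b))"
    by (intro closedin_compact_space compact closedin_closure_of)
  then have "compactin (subtopology T (fst b')) (T closure_of (fst b))" using b'(2)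
    by (simp add: compactin_subtopology)
  from image_compactin[OF this bdry_chartD(4)[OF b'(1)]] have cK0:
    "compact (snd b' ` (T closure_of (fst b)))" by simp
  then have K: "compact K" unfolding K_def by (intro compact_Times) auto
  have K0: "snd b' ` (T closure_of (fst b)) \<subseteq> chart_image b'" using b'(2)
    by (auto simp: chart_image_def)
  have Kd: "K \<subseteq> chart_image ?d" unfolding background_chart_image[OF b'(1)] K_def using K0 \<rho>s by auto
  have pt: "0 < t i" "t i < \<rho>s" "\<Phi> i z \<in> fst ?d" "\<Phi> i z \<in> M"
    "snd ?d (\<Phi> i z) = t i *\<^sub>R z + (snd b (q i), 0)"
     "snd ?d (\<Phi> i z) \<in> K" "\<rho> (\<Phi> i z) = t i * snd z"
    if i: "i \<in> ?J" and z: "z \<in> S" for i z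
  proof -
    obtain x y where xy: "z = (x, y)" by (cases z)
    let ?\<theta> = "snd b (q i) + t i *\<^sub>R x"
    from qt i z xy have \<Phi>: "?\<theta> \<in> chart_image b" "t i * y < \<rho>s"
      "\<Phi> i z = \<psi> (chart_inv b ?\<theta>) (t i * y)" and ti: "0 < t i" "t i < \<rho>s"
      by auto
    show "0 < t i" "t i < \<rho>s" by (rule ti)+
    have "y \<ge> exp (-2)" using hyp_ball_2(6)[of z] closure_subset z xy by (metis snd_conv subsetD)
    then have y: "y > 0" using exp_gt_zero[of "-2::real"] by linarith
    then have ty: "0 < t i * y" "t i * y < s" using ti \<Phi>(2) \<rho>s(2) by auto
    let ?q = "chart_inv b ?\<theta>"
    have q: "?q \<in> fst b" "snd b ?q = ?\<theta>" using \<Phi>(1) unfolding chart_inv_def chart_image_def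
      by (auto intro: inv_into_into f_inv_into_f)
    have q': "?q \<in> fst b'" "snd b' ?q = ?\<theta>" using q b'(2,3) cl by auto
    note bg = background_chart[OF b'(1) q'(1) less_imp_le[OF ty(1)] ty(2)]
    show "\<Phi> i z \<in> fst ?d" "\<rho> (\<Phi> i z) = t i * snd z" using bg \<Phi>(3) xy by simp_all
    show "\<Phi> i z \<in> M" unfolding minterior_iff using bg(3,4) ty(1) \<Phi>(3) by simp
    have sd: "snd ?d (\<Phi> i z) = (?\<theta>, t i * y)" using bg(2) \<Phi>(3) q'(2) by simp
    then show "snd ?d (\<Phi> i z) = t i *\<^sub>R z + (snd b (q i), 0)" by (simp add: xy add.commute)
    have "?\<theta> \<in> snd b' ` (T closure_of (fst b))" using q'(2) q(1) cl by (metis imageI subsetD)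
    then show "snd ?d (\<Phi> i z) \<in> K" unfolding sd K_def using ty \<Phi>(2) by auto
  qed
  obtain z0 where z0: "z0 \<in> S" using hyp_ball_2(4) by blast
  interpret param_family T \<A> \<rho> I \<Phi> \<kappa> \<alpha> g h ?J ?d t "\<lambda>i. snd b (q i)" K \<rho>s
  proof (intro param_family.intro param_family_axioms.intro)
    show "weakly_hyperbolic T \<A> \<rho> I \<Phi> \<kappa> \<alpha> g h" by (rule weakly_hyperbolic_axioms)
    show "t i \<le> \<rho>s" "0 < t i" if "i \<in> ?J" for i using pt(1,2)[OF that z0] by auto
    show "?J \<subseteq> I" by (auto simp: moebius_index_def)
  qed (use d K Kd pt in auto)
  \<comment> \<open>The last background coordinate is rho, so \<open>r\<close> is one linear
    function for all indices, and its second derivatives vanish.\<close>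
  have r: "r i z = snd z" if "i \<in> ?J" "z \<in> S" for i z using pt(1,7)[OF that] by (simp add: r_def)
  have snd_Ck: "Cinf_on UNIV (snd :: 'e \<times> real \<Rightarrow> real)"
    by (intro allI Ck_on_bounded_linear bounded_linear_snd)
  have reg: "rgh ?J k r" for k
    by (rule regularity.reg_cong[OF R reg_hoelder_smooth[OF hyp_ball_2(1-3) \<alpha>(1) \<alpha>' open_UNIV
      subset_UNIV snd_Ck]]) (simp add: r)
  have dr: "partial_deriv e (r i) z = snd e" if "i \<in> ?J" "z \<in> S" for i z e
  proof -
    have "partial_deriv e (r i) z = partial_deriv e snd z"
      by (rule partial_deriv_cong_open[OF hyp_ball_2(1) that(2) r[OF that(1)]])
    also have "\<dots> = snd e" by (rule partial_deriv_eq)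
      (rule bounded_linear_imp_has_derivative[OF bounded_linear_snd])
    finally show ?thesis .
  qed
  \<comment> \<open>\<open>K\<close> contains points of height 0, and the bump function lives on the
    full coordinate space, so the neighbourhood has to extend below the boundary.\<close>
  have O: "open (chart_image b' \<times> {-1<..<s})" by (intro open_Times bdry_chartD(3)[OF b'(1)]) auto
  have KO: "K \<subseteq> chart_image b' \<times> {-1<..<s}" using K0 \<rho>s by (auto simp: K_def)
  obtain \<eta> :: "'e \<times> real \<Rightarrow> real" and L where \<eta>: "Cinf_on UNIV \<eta>" "\<And>x. x \<in> K \<Longrightarrow> \<eta> x = 1" "compact L"
    "L \<subseteq> chart_image b' \<times> {-1<..<s}"
    "\<And>x. x \<notin> L \<Longrightarrow> \<eta> x = 0" by (rule smooth_bump[OF K(1) O KO])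
      (rule that, assumption, simp, assumption, assumption, simp)
  have Ld: "L \<inter> halfspace \<subseteq> chart_image ?d"
    unfolding background_chart_image[OF b'(1)] using \<eta>(4) by (auto simp: halfspace_def)
  define X where "X = (\<lambda>e c p. if p \<in> fst ?d then \<eta> (snd ?d p) *\<^sub>R transition_deriv ?d c p e else 0)"
  have X: "smooth_vfield \<A> (X e)" for e
    unfolding X_def by (rule smooth_vfield_extension[OF Hausdorff d \<eta>(1,3,5) Ld])
  have Xe: "X e (pchart i) (\<Phi> i z) = (1 / t i) *\<^sub>R e" if "i \<in> ?J" "z \<in> S" for e i z
    using pt(3,6)[OF that] by (simp add: X_def \<eta>(2) transition_deriv_from[OF that])
  show ?thesis
  proof (rule regular_familyI[OF reg])
    show "exp (- 2) > (0 :: real)" by simp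
    show "exp (- 2) \<le> r i x" if "i \<in> ?J" "x \<in> S" for i x
      using r[OF that] hyp_ball_2(6)[of x] closure_subset that(2) by auto
    show "wreg (hoelder_bound \<alpha> ?J S) ?J S t \<kappa> (Suc (Suc 0)) (\<lambda>i. partial_deriv e (r i))"
      if "e \<in> Basis" for e
      by (rule regularity.wreg_cong[OF R regularity.wreg_const[OF R, of _ _ _ "snd e"]]) (simp add: dr)
    show "wreg (hoelder_bound \<alpha> ?J S) ?J S t \<kappa> (Suc (Suc 0)) (\<lambda>i x. G i x u v)"
      if "u \<in> Basis" "v \<in> Basis" for u v
      by (rule G_wreg_of_vfields[OF reg X Xe that])
  qed
qed

text \<open>There are finitely many interior parametrizations, and the remaining indices are
  distributed over the finitely many charts of the background cover.\<close>

lemma regular_cover: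
  obtains \<J> where "finite \<J>" "(\<Union>J\<in>\<J>. J) = I" "\<And>J. J \<in> \<J> \<Longrightarrow> regular_family J"
proof -
  obtain J0 where J0: "J0 \<subseteq> I" "finite J0" "\<And>i. i \<in> I - J0 \<Longrightarrow> moebius_param \<psi> \<rho>s \<B> (\<Phi> i)"
    "\<And>i. i \<in> J0 \<Longrightarrow> interior_param T \<A> (\<Phi> i)"
  proof -
    have "\<exists>J\<subseteq>I. finite J \<and> (\<forall>i\<in>I - J. moebius_param \<psi> \<rho>s \<B> (\<Phi> i)) \<and> (\<forall>i\<in>J. interior_param T \<A> (\<Phi> i))"
      using moebius unfolding moebius_cover_def by (elim conjE)
    then show ?thesis by (elim exE conjE) (rule that, assumption+, erule (1) bspec, erule (1) bspec)
  qed
  show ?thesis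
  proof (rule that[of "(\<lambda>j. {j}) ` J0 \<union> moebius_index ` \<B>"])
    show "finite ((\<lambda>j. {j}) ` J0 \<union> moebius_index ` \<B>)" using J0(2) background
      by (simp add: background_cover_def)
    show "regular_family J" if "J \<in> (\<lambda>j. {j}) ` J0 \<union> moebius_index ` \<B>" for J
      using that regular_family_interior regular_family_moebius J0(1,4) by auto
    have "\<exists>b\<in>\<B>. i \<in> moebius_index b" if "i \<in> I" "i \<notin> J0" for i
    proof -
      have "i \<in> I - J0" using that by blast
      from J0(3)[OF this] obtain b where "b \<in> \<B>" and q: "\<exists>q\<in>fst b. \<exists>t. 0 < t \<and> t < \<rho>s \<and>
         (\<forall>(x, y)\<in>S. snd b q + t *\<^sub>R x \<in> chart_image b \<and> t * y < \<rho>s \<and>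
          \<Phi> i (x, y) = \<psi> (chart_inv b (snd b q + t *\<^sub>R x)) (t * y))"
        unfolding moebius_param_def by (elim bexE) (rule that; assumption | blast)
      then show ?thesis using that(1) unfolding moebius_index_def by (intro bexI[of _ b] CollectI conjI)
    qed
    then have "I \<subseteq> J0 \<union> (\<Union>b\<in>\<B>. moebius_index b)" by blast
    moreover have "moebius_index b \<subseteq> I" for b unfolding moebius_index_def by blast
    then have "(\<Union>b\<in>\<B>. moebius_index b) \<subseteq> I" by (rule UN_least)
    ultimately have "J0 \<union> (\<Union>b\<in>\<B>. moebius_index b) = I" using J0(1) by blast
    then show "(\<Union>J\<in>(\<lambda>j. {j}) ` J0 \<union> moebius_index ` \<B>. J) = I" by (simp add: image_Un)
  qed
qed

section \<open>From the families to the whole manifold\<close>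

lemma cover_M:
  assumes "p \<in> M"
  obtains i z where "i \<in> I" "z \<in> S" "p = \<Phi> i z"
proof -
  have "(\<Union>i\<in>I. \<Phi> i ` hyp_ball 1) = M" using moebius unfolding moebius_cover_def by blast
  then show ?thesis using assms hyp_ball_2(7) that by blast
qed

lemma pchart_facts:
  assumes "i \<in> I"
  shows "pchart i \<in> \<A>" "z \<in> S \<Longrightarrow> \<Phi> i z \<in> fst (pchart i)" "z \<in> S \<Longrightarrow> \<Phi> i z \<in> M"
    "metric_on (Suc (Suc 0)) (int_image (pchart i)) (in_coords (pchart i) h)"
proof -
  obtain \<J> where \<J>: "finite \<J>" "(\<Union>J\<in>\<J>. J) = I" "\<And>J. J \<in> \<J> \<Longrightarrow> regular_family J" using regular_cover
    by blast
  then obtain J where "i \<in> J" "regular_family J" using assms by blast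
  then show "pchart i \<in> \<A>" "z \<in> S \<Longrightarrow> \<Phi> i z \<in> fst (pchart i)" "z \<in> S \<Longrightarrow> \<Phi> i z \<in> M"
    "metric_on (Suc (Suc 0)) (int_image (pchart i)) (in_coords (pchart i) h)"
    unfolding regular_family_def by blast+
qed

lemma manifold_metric_h: "manifold_metric T \<A> \<rho> h"
proof (intro manifold_metric.intro manifold_metric_axioms.intro)
  show "manifold_with_boundary T \<A> \<rho>" by (rule manifold_with_boundary_axioms)
  show "tensor2_field \<A> M h" by (rule h_tensor)
  fix c assume c: "c \<in> \<A>"
  show "metric_on (Suc (Suc 0)) (int_image c) (in_coords c h)"
  proof (rule metric_on_all_charts[OF h_tensor h_inner _ c])
    fix p assume "p \<in> M"
    then obtain i z where i: "i \<in> I" "z \<in> S" "p = \<Phi> i z" by (rule cover_M)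
    then show "\<exists>d\<in>\<A>. p \<in> fst d \<and> metric_on (Suc (Suc 0)) (int_image d) (in_coords d h)"
      using pchart_facts(1,2,4)[OF i(1)] by blast
  qed
qed

sublocale mm: manifold_metric T \<A> \<rho> h
  by (rule manifold_metric_h)

lemma global_results:
  shows "rgh I \<kappa> (\<lambda>i z. mm.scal (pchart i) (\<Phi> i z))"
    "rgh I (Suc \<kappa>) (\<lambda>i z. defect_fun c (\<Phi> i z))"
    "(\<And>p. p \<in> M \<Longrightarrow> \<bar>defect_fun c p\<bar> \<le> C * (\<rho> p)\<^sup>2) \<Longrightarrow>
      rgh I (Suc \<kappa>) (\<lambda>i z. defect_fun c (\<Phi> i z) / (\<rho> (\<Phi> i z))\<^sup>2)"
proof -
  obtain \<J> where \<J>: "finite \<J>" "(\<Union>J\<in>\<J>. J) = I" "\<And>J. J \<in> \<J> \<Longrightarrow> regular_family J" using regular_cover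
    by blast
  have un: "rgh I k F" if "\<And>J. J \<in> \<J> \<Longrightarrow> rgh J k F" for k F
    using reg_hoelder_UN[OF \<J>(1), of \<alpha> "\<lambda>J. J" S k F] that unfolding \<J>(2) by blast
  have res: "rgh J \<kappa> (\<lambda>i z. mm.scal (pchart i) (\<Phi> i z))" "rgh J (Suc \<kappa>) (\<lambda>i z. defect_fun c (\<Phi> i z))"
    "\<forall>i\<in>J. \<forall>z\<in>S. \<bar>defect_fun c (\<Phi> i z)\<bar> \<le> C * (\<rho> (\<Phi> i z))\<^sup>2 \<Longrightarrow>
          rgh J (Suc \<kappa>) (\<lambda>i z. defect_fun c (\<Phi> i z) / (\<rho> (\<Phi> i z))\<^sup>2)" if "J \<in> \<J>" for J
    using \<J>(3)[OF that] manifold_metric_h unfolding regular_family_def by blast+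
  show "rgh I \<kappa> (\<lambda>i z. mm.scal (pchart i) (\<Phi> i z))" "rgh I (Suc \<kappa>) (\<lambda>i z. defect_fun c (\<Phi> i z))"
    by (rule un, rule res, assumption)+
  assume bd: "\<And>p. p \<in> M \<Longrightarrow> \<bar>defect_fun c p\<bar> \<le> C * (\<rho> p)\<^sup>2"
  show "rgh I (Suc \<kappa>) (\<lambda>i z. defect_fun c (\<Phi> i z) / (\<rho> (\<Phi> i z))\<^sup>2)"
  proof (rule un, rule res(3))
    fix J assume J: "J \<in> \<J>"
    then have "J \<subseteq> I" using \<J>(2) by blast
    then show "\<forall>i\<in>J. \<forall>z\<in>S. \<bar>defect_fun c (\<Phi> i z)\<bar> \<le> C * (\<rho> (\<Phi> i z))\<^sup>2"
      using bd pchart_facts(3) by blast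
  qed
qed

section \<open>Function spaces, bounds on the whole interior and the big-O conditions\<close>

lemma hoelder_functions_iff:
  "u \<in> hoelder_functions \<rho> I \<Phi> k \<alpha> 2 \<longleftrightarrow> rgh I k (\<lambda>i z. u (\<Phi> i z) / (\<rho> (\<Phi> i z))\<^sup>2)"
proof -
  let ?u = "\<lambda>i z. \<rho> (\<Phi> i z) powr - 2 * u (\<Phi> i z)"
  have "u \<in> hoelder_functions \<rho> I \<Phi> k \<alpha> 2 \<longleftrightarrow> Ck_hoelder_bound \<alpha> I S k (\<lambda>i.
    (\<lambda>p. \<rho> p powr - 2 * u p) \<circ> \<Phi> i)"
    unfolding hoelder_functions_def function_norm_def mem_Collect_eq by (rule hoelder_norm_bounded_iff)
  also have "\<dots> \<longleftrightarrow> rgh I k ?u"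
    unfolding Ck_hoelder_bound_iff_reg[OF hyp_ball_2(1-3) \<alpha>(1) \<alpha>'] o_def ..
  also have "\<dots> \<longleftrightarrow> rgh I k (\<lambda>i z. u (\<Phi> i z) / (\<rho> (\<Phi> i z))\<^sup>2)"
  proof -
    have eq: "?u i z = u (\<Phi> i z) / (\<rho> (\<Phi> i z))\<^sup>2" if "i \<in> I" "z \<in> S" for i z
      using pchart_facts(3)[OF that] minterior_iff by (simp add: powr_minus powr_numeral field_simps)
    note cong = regularity.reg_cong[OF regularity_hoelder[OF hyp_ball_2(1)]]
    show ?thesis
    proof
      assume "rgh I k ?u"
      then show "rgh I k (\<lambda>i z. u (\<Phi> i z) / (\<rho> (\<Phi> i z))\<^sup>2)" by (rule cong) (rule eq)
    next
      assume "rgh I k (\<lambda>i z. u (\<Phi> i z) / (\<rho> (\<Phi> i z))\<^sup>2)"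
      then show "rgh I k ?u" by (rule cong) (rule eq[symmetric])
    qed
  qed
  finally show ?thesis .
qed

lemma rgh_bounded:
  assumes "rgh I k (\<lambda>i z. u (\<Phi> i z))"
  obtains C where "\<And>p. p \<in> M \<Longrightarrow> \<bar>u p\<bar> \<le> C"
proof -
  have "hoelder_bound \<alpha> I S (\<lambda>i z. u (\<Phi> i z))"
    by (rule regularity.reg_P[OF regularity_hoelder[OF hyp_ball_2(1)] assms])
  then obtain C where C: "\<And>i z. i \<in> I \<Longrightarrow> z \<in> S \<Longrightarrow> \<bar>u (\<Phi> i z)\<bar> \<le> C"
    by (rule hoelder_boundE) (rule that; assumption)
  show ?thesis by (rule that[of C]) (metis C cover_M)
qed

text \<open>The bound is required on all of the interior and not only near the boundary, which makes
  it comparable with the norms.\<close>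

definition "quadratic u \<longleftrightarrow> (\<exists>C. \<forall>p\<in>M. \<bar>u p\<bar> \<le> C * (\<rho> p)\<^sup>2)"

lemma hoelder_quadratic:
  assumes "u \<in> hoelder_functions \<rho> I \<Phi> k \<alpha> 2"
  shows "quadratic u"
proof -
  have "rgh I k (\<lambda>i z. u (\<Phi> i z) / (\<rho> (\<Phi> i z))\<^sup>2)" using assms by (simp add: hoelder_functions_iff)
  from rgh_bounded[of k "\<lambda>p. u p / (\<rho> p)\<^sup>2", OF this] obtain C where C: "\<And>p. p \<in> M \<Longrightarrow>
    \<bar>u p / (\<rho> p)\<^sup>2\<bar> \<le> C" by blast
  have "\<bar>u p\<bar> \<le> C * (\<rho> p)\<^sup>2" if "p \<in> M" for p
    using C[OF that] that minterior_iff by (simp add: pos_divide_le_eq)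
  then show ?thesis unfolding quadratic_def by blast
qed

lemma quadratic_bigo:
  assumes "quadratic u"
  shows "u \<in> O[bdry_filter T \<A> \<rho>](\<lambda>p. (\<rho> p)\<^sup>2)"
proof -
  obtain C where C: "\<And>p. p \<in> M \<Longrightarrow> \<bar>u p\<bar> \<le> C * (\<rho> p)\<^sup>2" using assms unfolding quadratic_def by blast
  show ?thesis
    by (rule bigoI[of _ C]) (use C in \<open>simp add: bdry_filter_def eventually_inf_principal\<close>)
qed

text \<open>Where rho is at least \<open>e\<close>, a function bounded by \<open>C0\<close> is
  bounded by C0 / e^2 times rho^2.\<close>

lemma bigo_iff_quadratic:
  assumes bd: "\<And>p. p \<in> M \<Longrightarrow> \<bar>u p\<bar> \<le> C0"
  shows "u \<in> O[bdry_filter T \<A> \<rho>](\<lambda>p. (\<rho> p)\<^sup>2) \<longleftrightarrow> quadratic u"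
proof
  assume "u \<in> O[bdry_filter T \<A> \<rho>](\<lambda>p. (\<rho> p)\<^sup>2)"
  then obtain c where c: "c > 0" "\<forall>\<^sub>F p in bdry_filter T \<A> \<rho>. norm (u p) \<le> c * norm ((\<rho> p)\<^sup>2)"
    by (elim landau_o.bigE)
  then have "\<forall>\<^sub>F p in filtercomap \<rho> (nhds 0). p \<in> M \<longrightarrow> \<bar>u p\<bar> \<le> c * (\<rho> p)\<^sup>2"
    by (simp add: bdry_filter_def eventually_inf_principal)
  then obtain Q where Q: "eventually Q (nhds 0)" "\<And>p. Q (\<rho> p) \<Longrightarrow> p \<in> M \<Longrightarrow> \<bar>u p\<bar> \<le> c * (\<rho> p)\<^sup>2"
    unfolding eventually_filtercomap by blast
  from Q(1) obtain e where e: "e > 0" "\<And>x. dist x 0 < e \<Longrightarrow> Q x" unfolding eventually_nhds_metric by blast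
  have "\<bar>u p\<bar> \<le> (c + \<bar>C0\<bar> / e\<^sup>2) * (\<rho> p)\<^sup>2" if p: "p \<in> M" for p
  proof (cases "\<rho> p < e")
    case True
    have "\<rho> p > 0" using p minterior_iff by blast
    then have "\<bar>u p\<bar> \<le> c * (\<rho> p)\<^sup>2" using Q(2)[OF e(2) p] True by simp
    also have "\<dots> \<le> (c + \<bar>C0\<bar> / e\<^sup>2) * (\<rho> p)\<^sup>2" by (intro mult_right_mono) auto
    finally show ?thesis .
  next
    case False
    then have "e\<^sup>2 \<le> (\<rho> p)\<^sup>2" using e(1) by (intro power_mono) auto
    then have "\<bar>C0\<bar> \<le> \<bar>C0\<bar> / e\<^sup>2 * (\<rho> p)\<^sup>2" using e(1) by (simp add: field_simps mult_left_mono)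
    also have "\<dots> \<le> (c + \<bar>C0\<bar> / e\<^sup>2) * (\<rho> p)\<^sup>2" using c(1) by (intro mult_right_mono) auto
    finally show ?thesis using bd[OF p] by linarith
  qed
  then show "quadratic u" unfolding quadratic_def by blast
next
  assume "quadratic u"
  then show "u \<in> O[bdry_filter T \<A> \<rho>](\<lambda>p. (\<rho> p)\<^sup>2)" by (rule quadratic_bigo)
qed

text \<open>In dimension n + 1 the conformal law contains 2 n rho (lap rho) - n (n + 1) |d rho|^2.
  Factoring out - n (n + 1) leaves the coefficient 2 / (n + 1) in front of the Laplacian, and the
  constant n (n + 1) supplies the - 1 of the defect.\<close>

lemma scalar_curvature_defect:
  assumes i: "i \<in> I" "z \<in> S"
  defines "n \<equiv> real DIM('e)"
  shows "scalar_curvature \<A> g (\<Phi> i z) + n * (n + 1) =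
     (\<rho> (\<Phi> i z))\<^sup>2 * mm.scal (pchart i) (\<Phi> i z) - n * (n + 1) * defect_fun (2 / (n + 1)) (\<Phi> i z)"
proof -
  note c = pchart_facts(1)[OF i(1)] and p = pchart_facts(2,3)[OF i]
  have n: "n + 1 > 0" by (simp add: n_def add_nonneg_pos)
  have m: "real DIM('e \<times> real) = n + 1" by (simp add: n_def)
  show ?thesis
    unfolding mm.scalar_curvature_conformal[OF h_eq c p] defect_fun_def mm.chart_values[OF c p] m
    using n by (simp add: field_simps)
qed

theorem equivalences:
  defines "n \<equiv> real DIM('e)"
  defines "f \<equiv> defect_fun (2 / (n + 1))" and "R \<equiv> (\<lambda>p. scalar_curvature \<A> g p + n * (n + 1))"
  shows "f \<in> hoelder_functions \<rho> I \<Phi> (Suc \<kappa>) \<alpha> 2 \<longleftrightarrow> f \<in> O[bdry_filter T \<A> \<rho>](\<lambda>p. (\<rho> p)\<^sup>2)"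
    "f \<in> O[bdry_filter T \<A> \<rho>](\<lambda>p. (\<rho> p)\<^sup>2) \<longleftrightarrow> R \<in> hoelder_functions \<rho> I \<Phi> \<kappa> \<alpha> 2"
    "R \<in> hoelder_functions \<rho> I \<Phi> \<kappa> \<alpha> 2 \<longleftrightarrow> R \<in> O[bdry_filter T \<A> \<rho>](\<lambda>p. (\<rho> p)\<^sup>2)"
proof -
  interpret reg: regularity "hoelder_bound \<alpha> I S" I S by (rule regularity_hoelder[OF hyp_ball_2(1)])
  have n: "n * (n + 1) > 0" by (simp add: n_def)
  have R: "R (\<Phi> i z) = (\<rho> (\<Phi> i z))\<^sup>2 * mm.scal (pchart i) (\<Phi> i z) - n * (n + 1) * f (\<Phi> i z)"
    if "i \<in> I" "z \<in> S" for i z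
    unfolding R_def f_def n_def by (rule scalar_curvature_defect[OF that])
  have "hoelder_bound \<alpha> I S (\<lambda>i z. mm.scal (pchart i) (\<Phi> i z))"
    by (rule reg.reg_P[OF global_results(1)])
  then obtain Cs where Cs: "\<And>i z. i \<in> I \<Longrightarrow> z \<in> S \<Longrightarrow> \<bar>mm.scal (pchart i) (\<Phi> i z)\<bar> \<le> Cs"
    by (rule hoelder_boundE) (rule that; assumption)
  have bound: "\<bar>R p + n * (n + 1) * f p\<bar> \<le> Cs * (\<rho> p)\<^sup>2" if p: "p \<in> M" for p
  proof -
    obtain i z where i: "i \<in> I" "z \<in> S" "p = \<Phi> i z" using cover_M[OF p] by blast
    show ?thesis using mult_right_mono[OF Cs[OF i(1,2)], of "(\<rho> p)\<^sup>2"] by (simp add: i(3)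
      R[OF i(1,2)] abs_mult mult.commute)
  qed
  obtain C0 where C0: "\<And>p. p \<in> M \<Longrightarrow> \<bar>f p\<bar> \<le> C0"
    using rgh_bounded[OF global_results(2)[of "2 / (n + 1)"]] unfolding f_def by blast
  have quadratic_iff: "quadratic f \<longleftrightarrow> quadratic R"
  proof
    assume "quadratic f"
    then obtain C where C: "\<And>p. p \<in> M \<Longrightarrow> \<bar>f p\<bar> \<le> C * (\<rho> p)\<^sup>2" unfolding quadratic_def by blast
    have "\<bar>R p\<bar> \<le> (Cs + n * (n + 1) * C) * (\<rho> p)\<^sup>2" if p: "p \<in> M" for p
    proof -
      have "\<bar>n * (n + 1) * f p\<bar> \<le> n * (n + 1) * (C * (\<rho> p)\<^sup>2)"
        using mult_left_mono[OF C[OF p], of "n * (n + 1)"] n by (simp only: abs_mult[of "n *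
          (n + 1)"] abs_of_pos[OF n] less_imp_le)
      then show ?thesis using bound[OF p] by (simp add: distrib_right)
    qed
    then show "quadratic R" unfolding quadratic_def by blast
  next
    assume "quadratic R"
    then obtain C where C: "\<And>p. p \<in> M \<Longrightarrow> \<bar>R p\<bar> \<le> C * (\<rho> p)\<^sup>2" unfolding quadratic_def by blast
    have "\<bar>f p\<bar> \<le> (Cs + C) / (n * (n + 1)) * (\<rho> p)\<^sup>2" if p: "p \<in> M" for p
    proof -
      have "\<bar>n * (n + 1) * f p\<bar> \<le> (Cs + C) * (\<rho> p)\<^sup>2"
        using bound[OF p] C[OF p] by (simp add: distrib_right)
      then have "n * (n + 1) * \<bar>f p\<bar> \<le> (Cs + C) * (\<rho> p)\<^sup>2"
        by (simp only: abs_mult[of "n * (n + 1)"] abs_of_pos[OF n])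
      then show ?thesis using n by (simp add: pos_le_divide_eq mult.commute)
    qed
    then show "quadratic f" unfolding quadratic_def by blast
  qed
  have bigo_f: "f \<in> O[bdry_filter T \<A> \<rho>](\<lambda>p. (\<rho> p)\<^sup>2) \<longleftrightarrow> quadratic f"
    by (rule bigo_iff_quadratic) (rule C0)
  \<comment> \<open>The condition on \<open>R\<close> is moved to \<open>f\<close>, for which the
    global bound \<open>C0\<close> has been obtained, and then back.\<close>
  have bigo_R: "R \<in> O[bdry_filter T \<A> \<rho>](\<lambda>p. (\<rho> p)\<^sup>2) \<longleftrightarrow> quadratic R"
  proof
    assume R: "R \<in> O[bdry_filter T \<A> \<rho>](\<lambda>p. (\<rho> p)\<^sup>2)"
    have "(\<lambda>p. R p + n * (n + 1) * f p) \<in> O[bdry_filter T \<A> \<rho>](\<lambda>p. (\<rho> p)\<^sup>2)"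
      by (rule bigoI[of _ Cs]) (use bound in \<open>simp add: bdry_filter_def eventually_inf_principal\<close>)
    from sum_in_bigo(2)[OF this R] have
      "(\<lambda>p. n * (n + 1) * f p) \<in> O[bdry_filter T \<A> \<rho>](\<lambda>p. (\<rho> p)\<^sup>2)" by simp
    then have "f \<in> O[bdry_filter T \<A> \<rho>](\<lambda>p. (\<rho> p)\<^sup>2)" using n
      by (subst (asm) landau_o.big.cmult_in_iff) auto
    then show "quadratic R" using bigo_f quadratic_iff by blast
  next
    assume "quadratic R"
    then show "R \<in> O[bdry_filter T \<A> \<rho>](\<lambda>p. (\<rho> p)\<^sup>2)" by (rule quadratic_bigo)
  qed
  have f_hoelder: "f \<in> hoelder_functions \<rho> I \<Phi> (Suc \<kappa>) \<alpha> 2 \<longleftrightarrow> quadratic f"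
  proof
    assume "f \<in> hoelder_functions \<rho> I \<Phi> (Suc \<kappa>) \<alpha> 2"
    then show "quadratic f" by (rule hoelder_quadratic)
  next
    assume "quadratic f"
    then obtain C where "\<And>p. p \<in> M \<Longrightarrow> \<bar>f p\<bar> \<le> C * (\<rho> p)\<^sup>2" unfolding quadratic_def by blast
    then show "f \<in> hoelder_functions \<rho> I \<Phi> (Suc \<kappa>) \<alpha> 2"
      unfolding hoelder_functions_iff f_def by (rule global_results(3))
  qed
  have R_hoelder: "R \<in> hoelder_functions \<rho> I \<Phi> \<kappa> \<alpha> 2 \<longleftrightarrow> quadratic R"
  proof
    assume "R \<in> hoelder_functions \<rho> I \<Phi> \<kappa> \<alpha> 2"
    then show "quadratic R" by (rule hoelder_quadratic)
  next
    assume "quadratic R"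
    then have "rgh I (Suc \<kappa>) (\<lambda>i z. f (\<Phi> i z) / (\<rho> (\<Phi> i z))\<^sup>2)"
      using quadratic_iff f_hoelder hoelder_functions_iff by blast
    \<comment> \<open>The defect is controlled with one derivative more than the curvature
      needs.\<close>
    then have "rgh I \<kappa> (\<lambda>i z. f (\<Phi> i z) / (\<rho> (\<Phi> i z))\<^sup>2)" by (rule reg.reg_mono) simp
    from reg.reg_minus[OF global_results(1) reg.reg_cmult[OF this, of "n * (n + 1)"]]
    have "rgh I \<kappa> (\<lambda>i z. R (\<Phi> i z) / (\<rho> (\<Phi> i z))\<^sup>2)"
    proof (rule reg.reg_cong)
      fix i z assume iz: "i \<in> I" "z \<in> S"
      have "\<rho> (\<Phi> i z) > 0" using pchart_facts(3)[OF iz] minterior_iff by blast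
      then show "mm.scal (pchart i) (\<Phi> i z) - n * (n + 1) * (f (\<Phi> i z) / (\<rho> (\<Phi> i z))\<^sup>2) =
        R (\<Phi> i z) / (\<rho> (\<Phi> i z))\<^sup>2"
        unfolding R[OF iz] by (simp add: field_simps)
    qed
    then show "R \<in> hoelder_functions \<rho> I \<Phi> \<kappa> \<alpha> 2" unfolding hoelder_functions_iff .
  qed
  show "f \<in> hoelder_functions \<rho> I \<Phi> (Suc \<kappa>) \<alpha> 2 \<longleftrightarrow> f \<in> O[bdry_filter T \<A> \<rho>](\<lambda>p. (\<rho> p)\<^sup>2)"
    "f \<in> O[bdry_filter T \<A> \<rho>](\<lambda>p. (\<rho> p)\<^sup>2) \<longleftrightarrow> R \<in> hoelder_functions \<rho> I \<Phi> \<kappa> \<alpha> 2"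
    "R \<in> hoelder_functions \<rho> I \<Phi> \<kappa> \<alpha> 2 \<longleftrightarrow> R \<in> O[bdry_filter T \<A> \<rho>](\<lambda>p. (\<rho> p)\<^sup>2)"
    unfolding bigo_f bigo_R f_hoelder R_hoelder using quadratic_iff by blast+
qed

end

theorem theorem1p3:
  fixes T :: "'m topology"
    and \<A> :: "('m, (real ^ 'n) \<times> real) chart set"
    and \<rho> :: "'m \<Rightarrow> real"
    and \<psi> :: "'m \<Rightarrow> real \<Rightarrow> 'm"
    and \<rho>s s :: real
    and \<B> :: "('m, real ^ 'n) chart set"
    and I :: "nat set"
    and \<Phi> :: "nat \<Rightarrow> (real ^ 'n) \<times> real \<Rightarrow> 'm"
    and k :: nat and \<alpha> :: real
    and g gbar :: "('m, (real ^ 'n) \<times> real) tensor2"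
    and f S :: "'m \<Rightarrow> real"
  assumes "compact_space T" and "Hausdorff_space T"
    and "smooth_structure T halfspace \<A>"
    and "defining_function T \<A> \<rho>"
    and "collar T \<A> \<rho> \<psi> s" and "0 < \<rho>s" and "\<rho>s < s"
    and "background_cover T \<A> \<B>"
    and "moebius_cover T \<A> \<psi> \<rho>s \<B> I \<Phi>"
    and "k \<ge> 2" and "0 \<le> \<alpha>" and "\<alpha> < 1"
    and "g \<in> M_weak2 T \<A> \<rho> I \<Phi> k \<alpha>"
  defines "gbar \<equiv> scale_tensor2 (\<lambda>p. (\<rho> p)\<^sup>2) g"
    and "f \<equiv> (\<lambda>p. diff_norm_sq \<A> gbar \<rho> p - 1
                  - 2 / (real CARD('n) + 1) * \<rho> p * laplacian \<A> gbar \<rho> p)"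
    and "S \<equiv> (\<lambda>p. scalar_curvature \<A> g p + real CARD('n) * (real CARD('n) + 1))"
  shows "(f \<in> hoelder_functions \<rho> I \<Phi> (k - 1) \<alpha> 2 \<longleftrightarrow> f \<in> O[bdry_filter T \<A> \<rho>](\<lambda>p. (\<rho> p)\<^sup>2)) \<and>
         (f \<in> O[bdry_filter T \<A> \<rho>](\<lambda>p. (\<rho> p)\<^sup>2) \<longleftrightarrow> S \<in> hoelder_functions \<rho> I \<Phi> (k - 2) \<alpha> 2) \<and>
         (S \<in> hoelder_functions \<rho> I \<Phi> (k - 2) \<alpha> 2 \<longleftrightarrow> S \<in> O[bdry_filter T \<A> \<rho>](\<lambda>p. (\<rho> p)\<^sup>2))"
proof -
  obtain \<kappa> where k: "k = Suc (Suc \<kappa>)" using \<open>k \<ge> 2\<close> by (metis Suc_le_D numeral_2_eq_2 Suc_le_mono)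
  interpret moebius_hyperbolic T \<A> \<rho> I \<Phi> \<kappa> \<alpha> g gbar \<psi> s \<rho>s \<B>
    by (intro moebius_hyperbolic.intro weakly_hyperbolic.intro manifold_with_boundary.intro
        weakly_hyperbolic_axioms.intro moebius_hyperbolic_axioms.intro)
      (use assms in \<open>simp_all add: k\<close>)
  have f: "f = defect_fun (2 / (real DIM(real ^ 'n) + 1))"
    unfolding f_def by (simp add: defect_fun_def fun_eq_iff)
  have S: "S = (\<lambda>p. scalar_curvature \<A> g p + real DIM(real ^ 'n) * (real DIM(real ^ 'n) + 1))"
    unfolding S_def by simp
  have k': "k - 1 = Suc \<kappa>" "k - 2 = \<kappa>" by (simp_all add: k)
  show ?thesis unfolding k' f S using equivalences by blast
qed

end
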